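(* Let $M$ be a smooth manifold of dimension $n>2$, let $a=a_{ij}\,\mathrm dx^i\mathrm dx^j$ be a (pseudo-)Riemannian metric on $M$, let $b=b_i\,\mathrm dx^i$ be a nowhere vanishing 1-form on $M$ that is closed ($\mathrm db=0$) and null with respect to $a$ ($b^2=a_{ij}b^ib^j=0$), and let $m$ be a real parameter. Put $\alpha=\sqrt{a_{ij}(x)y^iy^j}$, $\beta=b_i(x)y^i$, and let $F=\alpha^{1+m}\beta^{-m}$ be the corresponding $m$-Kropina metric. Then $F$ is Berwald if and only if around each $p\in M$ there exist local coordinates $(u,v,x^3,\dots,x^n)$ such that $$a=-2\,\mathrm du\,\mathrm dv+H(u,v,x)\,\mathrm du^2+W_a(u,x)\,\mathrm du\,\mathrm dx^a+h_{ab}(u,x)\,\mathrm dx^a\mathrm dx^b,\qquad b=\mathrm du,$$ with $h$ some (pseudo-)Riemannian metric. In this case the metric satisfies the Berwald condition $$\nabla_jb_i=c\left[m\,b^2a_{ij}+(1-m)b_ib_j\right]$$ with $$c=-\frac{\partial_vH}{2(1-m)},$$ where $\nabla$ is the Levi-Civita connection of $a$.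
   Context: Indices $i,j,k,l$ run from $1$ to $n$; indices $a,b$ on $W_a$, $h_{ab}$, $x^a$ run from $3$ to $n$; repeated indices are summed; indices are raised and lowered with $a_{ij}$. Here $x=(x^3,\dots,x^n)$, and $H,W_a,h_{ab}$ are functions of the indicated variables. Products of 1-forms are symmetrized tensor products: $\mathrm du\,\mathrm dv=\tfrac12(\mathrm du\otimes\mathrm dv+\mathrm dv\otimes\mathrm du)$, etc. Local coordinates $x^i$ on $M$ induce coordinates $(x^i,y^i)$ on $TM$; write $\partial_i=\partial/\partial x^i$, $\bar\partial_i=\partial/\partial y^i$. A conic subbundle is a non-empty open set $\mathcal A\subset TM\setminus\{0\}$ such that $(x,\lambda y)\in\mathcal A$ for all $(x,y)\in\mathcal A$ and $\lambda>0$. A Finsler space is a triple $(M,\mathcal A,F)$, where $M$ is a smooth manifold, $\mathcal A$ is a conic subbundle of $TM\setminus\{0\}$ with non-empty fibers, and the Finsler metric $F:TM\setminus\{0\}\to\mathbb R$ is a continuous map, smooth on $\mathcal A$, such that $F(x,\lambda y)=\lambda F(x,y)$ for all $\lambda>0$ and such that the fundamental tensor $g_{ij}=\bar\partial_i\bar\partial_j(\tfrac12F^2)$ is non-degenerate on $\mathcal A$ (its signature may be arbitrary). An $m$-Kropina space is a Finsler space with Finsler metric of the form $F=\alpha^{1+m}\beta^{-m}$, with $\alpha,\beta,m$ as in the claim. For null $b$ the value $m=1$ is excluded by this definition, since the fundamental tensor is then degenerate. The Cartan non-linear connection has coefficients $N^i_j(x,y)=\tfrac14\bar\partial_j\big(g^{ik}(y^l\partial_l\bar\partial_kF^2-\partial_kF^2)\big)$.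 $F$ is Berwald (the Finsler space is of Berwald type) if $N^i_j(x,y)=\Gamma^i_{jk}(x)y^k$ for a set of smooth functions $\Gamma^i_{jk}$ on $M$.
   Formalization: The parameter m is assumed to be nonzero: for m = 0, F = α is always Berwald, and the equivalence fails, e.g. for b = d(t − r) on Minkowski space minus a line, which is closed and null but has ∇b not proportional to b⊗b. *)

theory Defs
  imports "HOL-Analysis.Analysis"
begin

section \<open>Smooth maps and partial derivatives\<close>

primrec Ck_on :: "nat \<Rightarrow> 'a::real_normed_vector set \<Rightarrow> ('a \<Rightarrow> 'b::real_normed_vector) \<Rightarrow> bool" where
  "Ck_on 0 S f \<longleftrightarrow> continuous_on S f"
| "Ck_on (Suc k) S f \<longleftrightarrow> (\<forall>x\<in>S. f differentiable (at x)) \<and>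
     (\<forall>v. Ck_on k S (\<lambda>x. frechet_derivative f (at x) v))"

text \<open>Only used on open sets.\<close>

definition smooth_on :: "'a::real_normed_vector set \<Rightarrow> ('a \<Rightarrow> 'b::real_normed_vector) \<Rightarrow> bool" where
  "smooth_on S f \<longleftrightarrow> (\<forall>k. Ck_on k S f)"

definition pd :: "'n \<Rightarrow> (real^'n \<Rightarrow> real) \<Rightarrow> real^'n \<Rightarrow> real" where
  "pd i f x = frechet_derivative f (at x) (axis i 1)"

section \<open>Smooth manifolds\<close>

text \<open>The manifold is a whole second countable Hausdorff type \<open>'p\<close>. A chart is a pair of
  its domain and its coordinate map; values of the map outside the domain are irrelevant.\<close>

type_synonym ('p, 'n) chart = "'p set \<times> ('p \<Rightarrow> real^'n)"

abbreviation dom_of :: "('p, 'n) chart \<Rightarrow> 'p set" where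
  "dom_of c \<equiv> fst c"

abbreviation coords :: "('p, 'n) chart \<Rightarrow> 'p \<Rightarrow> real^'n" where
  "coords c \<equiv> snd c"

definition img :: "('p, 'n) chart \<Rightarrow> (real^'n) set" where
  "img c = coords c ` dom_of c"

definition pt :: "('p, 'n) chart \<Rightarrow> real^'n \<Rightarrow> 'p" where
  "pt c = inv_into (dom_of c) (coords c)"

definition is_chart :: "('p::topological_space, 'n::finite) chart \<Rightarrow> bool" where
  "is_chart c \<longleftrightarrow> open (dom_of c) \<and> open (img c) \<and>
     homeomorphism (dom_of c) (img c) (coords c) (pt c)"

definition transition :: "('p, 'n) chart \<Rightarrow> ('p, 'n) chart \<Rightarrow> real^'n \<Rightarrow> real^'n" where
  "transition c d x = coords d (pt c x)"

definition smooth_transition :: "('p, 'n::finite) chart \<Rightarrow> ('p, 'n) chart \<Rightarrow> bool" where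
  "smooth_transition c d \<longleftrightarrow>
     smooth_on (coords c ` (dom_of c \<inter> dom_of d)) (transition c d)"

text \<open>A smooth structure is a maximal atlas, so that its elements are precisely the local
  coordinate systems of the manifold.\<close>

definition smooth_structure :: "('p::topological_space, 'n::finite) chart set \<Rightarrow> bool" where
  "smooth_structure D \<longleftrightarrow>
     (\<forall>c\<in>D. is_chart c) \<and>
     (\<Union>c\<in>D. dom_of c) = UNIV \<and>
     (\<forall>c\<in>D. \<forall>d\<in>D. smooth_transition c d) \<and>
     (\<forall>c. is_chart c \<and> (\<forall>d\<in>D. smooth_transition c d \<and> smooth_transition d c) \<longrightarrow> c \<in> D)"

section \<open>The tangent bundle\<close>

text \<open>A tangent vector at \<open>p\<close> is the family of its components in all charts around \<open>p\<close>,
  related by the Jacobians of the transition maps, and (by convention) zero at all other charts.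
  Vector space operations are pointwise.\<close>

type_synonym ('p, 'n) tvec = "('p, 'n) chart \<Rightarrow> real^'n"

definition tangent_space :: "('p, 'n::finite) chart set \<Rightarrow> 'p \<Rightarrow> ('p, 'n) tvec set" where
  "tangent_space D p = {v.
     (\<forall>c\<in>D. \<forall>d\<in>D. p \<in> dom_of c \<inter> dom_of d \<longrightarrow>
        v d = frechet_derivative (transition c d) (at (coords c p)) (v c)) \<and>
     (\<forall>c. \<not> (c \<in> D \<and> p \<in> dom_of c) \<longrightarrow> v c = 0)}"

definition slit_bundle :: "('p, 'n::finite) chart set \<Rightarrow> ('p \<times> ('p, 'n) tvec) set" where
  "slit_bundle D = {(p, v). v \<in> tangent_space D p \<and> v \<noteq> (\<lambda>_. 0)}"

text \<open>\<open>tv D c x y\<close> is the tangent vector \<open>y\<^sup>i \<partial>\<^sub>i\<close> at the point with coordinates \<open>x\<close>;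
  thus \<open>(x, y) \<mapsto> (pt c x, tv D c x y)\<close> inverts the chart that \<open>c\<close> induces on the tangent
  bundle.\<close>

definition tv :: "('p, 'n::finite) chart set \<Rightarrow> ('p, 'n) chart \<Rightarrow> real^'n \<Rightarrow> real^'n \<Rightarrow> ('p, 'n) tvec" where
  "tv D c x y = (\<lambda>d. if d \<in> D \<and> pt c x \<in> dom_of d
     then frechet_derivative (transition c d) (at x) y else 0)"

definition local_set ::
  "('p, 'n::finite) chart set \<Rightarrow> ('p, 'n) chart \<Rightarrow> ('p \<times> ('p, 'n) tvec) set \<Rightarrow> ((real^'n) \<times> (real^'n)) set" where
  "local_set D c A = {(x, y). x \<in> img c \<and> (pt c x, tv D c x y) \<in> A}"

definition local_fun ::
  "('p, 'n::finite) chart set \<Rightarrow> ('p, 'n) chart \<Rightarrow> ('p \<Rightarrow> ('p, 'n) tvec \<Rightarrow> real) \<Rightarrow> real^'n \<Rightarrow> real^'n \<Rightarrow> real" where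
  "local_fun D c G x y = G (pt c x) (tv D c x y)"

section \<open>One-forms and pseudo-Riemannian metrics\<close>

definition linear_form_on :: "('c \<Rightarrow> real^'n) set \<Rightarrow> (('c \<Rightarrow> real^'n) \<Rightarrow> real) \<Rightarrow> bool" where
  "linear_form_on T f \<longleftrightarrow>
     (\<forall>v\<in>T. \<forall>w\<in>T. f (\<lambda>c. v c + w c) = f v + f w) \<and>
     (\<forall>r. \<forall>v\<in>T. f (\<lambda>c. r *\<^sub>R v c) = r * f v)"

definition covec ::
  "('p, 'n::finite) chart set \<Rightarrow> ('p, 'n) chart \<Rightarrow> ('p \<Rightarrow> ('p, 'n) tvec \<Rightarrow> real) \<Rightarrow> real^'n \<Rightarrow> real^'n" where
  "covec D c b x = (\<chi> i. b (pt c x) (tv D c x (axis i 1)))"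

definition metric_mat ::
  "('p, 'n::finite) chart set \<Rightarrow> ('p, 'n) chart \<Rightarrow> ('p \<Rightarrow> ('p, 'n) tvec \<Rightarrow> ('p, 'n) tvec \<Rightarrow> real) \<Rightarrow> real^'n \<Rightarrow> real^'n^'n" where
  "metric_mat D c a x =
     (\<chi> i j. a (pt c x) (tv D c x (axis i 1)) (tv D c x (axis j 1)))"

definition one_form :: "('p, 'n::finite) chart set \<Rightarrow> ('p \<Rightarrow> ('p, 'n) tvec \<Rightarrow> real) \<Rightarrow> bool" where
  "one_form D b \<longleftrightarrow>
     (\<forall>p. linear_form_on (tangent_space D p) (b p)) \<and>
     (\<forall>c\<in>D. \<forall>i. smooth_on (img c) (\<lambda>x. covec D c b x $ i))"

definition nowhere_vanishing :: "('p, 'n::finite) chart set \<Rightarrow> ('p \<Rightarrow> ('p, 'n) tvec \<Rightarrow> real) \<Rightarrow> bool" where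
  "nowhere_vanishing D b \<longleftrightarrow> (\<forall>p. \<exists>v\<in>tangent_space D p. b p v \<noteq> 0)"

definition closed_form :: "('p, 'n::finite) chart set \<Rightarrow> ('p \<Rightarrow> ('p, 'n) tvec \<Rightarrow> real) \<Rightarrow> bool" where
  "closed_form D b \<longleftrightarrow> (\<forall>c\<in>D. \<forall>x\<in>img c. \<forall>i j.
     pd i (\<lambda>z. covec D c b z $ j) x = pd j (\<lambda>z. covec D c b z $ i) x)"

definition pseudo_riemannian ::
  "('p, 'n::finite) chart set \<Rightarrow> ('p \<Rightarrow> ('p, 'n) tvec \<Rightarrow> ('p, 'n) tvec \<Rightarrow> real) \<Rightarrow> bool" where
  "pseudo_riemannian D a \<longleftrightarrow>
     (\<forall>p. (\<forall>v\<in>tangent_space D p. linear_form_on (tangent_space D p) (a p v)) \<and>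
          (\<forall>v\<in>tangent_space D p. \<forall>w\<in>tangent_space D p. a p v w = a p w v) \<and>
          (\<forall>v\<in>tangent_space D p. (\<forall>w\<in>tangent_space D p. a p v w = 0) \<longrightarrow> v = (\<lambda>_. 0))) \<and>
     (\<forall>c\<in>D. \<forall>i j. smooth_on (img c) (\<lambda>x. metric_mat D c a x $ i $ j))"

definition raised ::
  "('p, 'n::finite) chart set \<Rightarrow> ('p, 'n) chart \<Rightarrow> ('p \<Rightarrow> ('p, 'n) tvec \<Rightarrow> ('p, 'n) tvec \<Rightarrow> real) \<Rightarrow>
    ('p \<Rightarrow> ('p, 'n) tvec \<Rightarrow> real) \<Rightarrow> real^'n \<Rightarrow> real^'n" where
  "raised D c a b x =
     (\<chi> i. \<Sum>j\<in>UNIV. matrix_inv (metric_mat D c a x) $ i $ j * covec D c b x $ j)"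

definition norm_sq ::
  "('p, 'n::finite) chart set \<Rightarrow> ('p, 'n) chart \<Rightarrow> ('p \<Rightarrow> ('p, 'n) tvec \<Rightarrow> ('p, 'n) tvec \<Rightarrow> real) \<Rightarrow>
    ('p \<Rightarrow> ('p, 'n) tvec \<Rightarrow> real) \<Rightarrow> real^'n \<Rightarrow> real" where
  "norm_sq D c a b x = (\<Sum>i\<in>UNIV. \<Sum>j\<in>UNIV.
     metric_mat D c a x $ i $ j * raised D c a b x $ i * raised D c a b x $ j)"

definition null_form ::
  "('p, 'n::finite) chart set \<Rightarrow> ('p \<Rightarrow> ('p, 'n) tvec \<Rightarrow> ('p, 'n) tvec \<Rightarrow> real) \<Rightarrow>
    ('p \<Rightarrow> ('p, 'n) tvec \<Rightarrow> real) \<Rightarrow> bool" where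
  "null_form D a b \<longleftrightarrow> (\<forall>c\<in>D. \<forall>x\<in>img c. norm_sq D c a b x = 0)"

text \<open>\<open>christoffel D c a k i j\<close> is \<open>\<Gamma>\<^sup>k\<^sub>i\<^sub>j\<close> of the Levi-Civita connection, and
  \<open>nabla D c a b j i\<close> is \<open>\<nabla>\<^sub>j b\<^sub>i\<close>.\<close>

definition christoffel ::
  "('p, 'n::finite) chart set \<Rightarrow> ('p, 'n) chart \<Rightarrow> ('p \<Rightarrow> ('p, 'n) tvec \<Rightarrow> ('p, 'n) tvec \<Rightarrow> real) \<Rightarrow>
    'n \<Rightarrow> 'n \<Rightarrow> 'n \<Rightarrow> real^'n \<Rightarrow> real" where
  "christoffel D c a k i j x = (\<Sum>l\<in>UNIV. matrix_inv (metric_mat D c a x) $ k $ l *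
     (pd i (\<lambda>z. metric_mat D c a z $ l $ j) x + pd j (\<lambda>z. metric_mat D c a z $ l $ i) x
      - pd l (\<lambda>z. metric_mat D c a z $ i $ j) x)) / 2"

definition nabla ::
  "('p, 'n::finite) chart set \<Rightarrow> ('p, 'n) chart \<Rightarrow> ('p \<Rightarrow> ('p, 'n) tvec \<Rightarrow> ('p, 'n) tvec \<Rightarrow> real) \<Rightarrow>
    ('p \<Rightarrow> ('p, 'n) tvec \<Rightarrow> real) \<Rightarrow> 'n \<Rightarrow> 'n \<Rightarrow> real^'n \<Rightarrow> real" where
  "nabla D c a b j i x = pd j (\<lambda>z. covec D c b z $ i) x
     - (\<Sum>k\<in>UNIV. christoffel D c a k i j x * covec D c b x $ k)"

section \<open>Finsler spaces\<close>

definition fundamental_tensor ::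
  "('p, 'n::finite) chart set \<Rightarrow> ('p, 'n) chart \<Rightarrow> ('p \<Rightarrow> ('p, 'n) tvec \<Rightarrow> real) \<Rightarrow> real^'n \<Rightarrow> real^'n \<Rightarrow> real^'n^'n" where
  "fundamental_tensor D c F x y =
     (\<chi> i j. pd i (pd j (\<lambda>z. (1/2) * (local_fun D c F x z)\<^sup>2)) y)"

definition conic_subbundle :: "('p, 'n::finite) chart set \<Rightarrow> ('p \<times> ('p, 'n) tvec) set \<Rightarrow> bool" where
  "conic_subbundle D A \<longleftrightarrow>
     A \<noteq> {} \<and> A \<subseteq> slit_bundle D \<and>
     (\<forall>c\<in>D. open (local_set D c A)) \<and>
     (\<forall>p v. \<forall>r>0. (p, v) \<in> A \<longrightarrow> (p, \<lambda>c. r *\<^sub>R v c) \<in> A)"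

definition finsler_space ::
  "('p, 'n::finite) chart set \<Rightarrow> ('p \<times> ('p, 'n) tvec) set \<Rightarrow> ('p \<Rightarrow> ('p, 'n) tvec \<Rightarrow> real) \<Rightarrow> bool" where
  "finsler_space D A F \<longleftrightarrow>
     conic_subbundle D A \<and>
     (\<forall>p. \<exists>v. (p, v) \<in> A) \<and>
     (\<forall>c\<in>D. continuous_on (local_set D c (slit_bundle D)) (\<lambda>(x, y). local_fun D c F x y)) \<and>
     (\<forall>c\<in>D. smooth_on (local_set D c A) (\<lambda>(x, y). local_fun D c F x y)) \<and>
     (\<forall>(p, v)\<in>slit_bundle D. \<forall>r>0. F p (\<lambda>c. r *\<^sub>R v c) = r * F p v) \<and>
     (\<forall>c\<in>D. \<forall>(x, y)\<in>local_set D c A. invertible (fundamental_tensor D c F x y))"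

text \<open>Coefficients \<open>N\<^sup>i\<^sub>j = 1/4 \<partial>/\<partial>y\<^sup>j (g\<^sup>i\<^sup>k (y\<^sup>l \<partial>\<^sub>l \<partial>/\<partial>y\<^sup>k F\<^sup>2 - \<partial>\<^sub>k F\<^sup>2))\<close>, with
  \<open>\<partial>\<^sub>l\<close> differentiating in \<open>x\<close>.\<close>

definition cartan_connection ::
  "('p, 'n::finite) chart set \<Rightarrow> ('p, 'n) chart \<Rightarrow> ('p \<Rightarrow> ('p, 'n) tvec \<Rightarrow> real) \<Rightarrow>
    'n \<Rightarrow> 'n \<Rightarrow> real^'n \<Rightarrow> real^'n \<Rightarrow> real" where
  "cartan_connection D c F i j x y = (1/4) * pd j (\<lambda>w. \<Sum>k\<in>UNIV.
     matrix_inv (fundamental_tensor D c F x w) $ i $ k *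
     ((\<Sum>l\<in>UNIV. w $ l * pd l (\<lambda>z. pd k (\<lambda>w'. (local_fun D c F z w')\<^sup>2) w) x)
      - pd k (\<lambda>z. (local_fun D c F z w)\<^sup>2) x)) y"

definition berwald ::
  "('p, 'n::finite) chart set \<Rightarrow> ('p \<times> ('p, 'n) tvec) set \<Rightarrow> ('p \<Rightarrow> ('p, 'n) tvec \<Rightarrow> real) \<Rightarrow> bool" where
  "berwald D A F \<longleftrightarrow> (\<forall>c\<in>D. \<exists>\<Gamma> :: 'n \<Rightarrow> 'n \<Rightarrow> 'n \<Rightarrow> real^'n \<Rightarrow> real.
     (\<forall>i j k. smooth_on (img c) (\<Gamma> i j k)) \<and>
     (\<forall>(x, y)\<in>local_set D c A. \<forall>i j.
        cartan_connection D c F i j x y = (\<Sum>k\<in>UNIV. \<Gamma> i j k x * y $ k)))"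

section \<open>m-Kropina spaces\<close>

text \<open>Real powers are defined for positive base, and also for nonzero base if the exponent is
  an integer.\<close>

definition real_pow :: "real \<Rightarrow> real \<Rightarrow> real" where
  "real_pow x s = (if s \<in> \<int> then x powi \<lfloor>s\<rfloor> else x powr s)"

definition real_pow_defined :: "real \<Rightarrow> real \<Rightarrow> bool" where
  "real_pow_defined x s \<longleftrightarrow> x > 0 \<or> (x \<noteq> 0 \<and> s \<in> \<int>)"

text \<open>The formula for \<open>F\<close> is required on the conic subbundle \<open>A\<close>, where it has to make sense
  as a smooth real-valued function; all further geometry only involves \<open>F\<close> on \<open>A\<close>.\<close>

definition kropina_space ::
  "('p, 'n::finite) chart set \<Rightarrow> ('p \<times> ('p, 'n) tvec) set \<Rightarrow> ('p \<Rightarrow> ('p, 'n) tvec \<Rightarrow> real) \<Rightarrow>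
    ('p \<Rightarrow> ('p, 'n) tvec \<Rightarrow> ('p, 'n) tvec \<Rightarrow> real) \<Rightarrow> ('p \<Rightarrow> ('p, 'n) tvec \<Rightarrow> real) \<Rightarrow> real \<Rightarrow> bool" where
  "kropina_space D A F a b m \<longleftrightarrow>
     finsler_space D A F \<and>
     (\<forall>(p, v)\<in>A. a p v v > 0 \<and> real_pow_defined (b p v) (- m) \<and>
        F p v = sqrt (a p v v) powr (1 + m) * real_pow (b p v) (- m))"

definition berwald_condition ::
  "('p, 'n::finite) chart set \<Rightarrow> ('p \<Rightarrow> ('p, 'n) tvec \<Rightarrow> ('p, 'n) tvec \<Rightarrow> real) \<Rightarrow>
    ('p \<Rightarrow> ('p, 'n) tvec \<Rightarrow> real) \<Rightarrow> real \<Rightarrow> 'p set \<Rightarrow> ('p \<Rightarrow> real) \<Rightarrow> bool" where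
  "berwald_condition D a b m U c \<longleftrightarrow>
     (\<forall>d\<in>D. \<forall>q\<in>U \<inter> dom_of d. \<forall>i j. let x = coords d q in
        nabla D d a b j i x =
          c q * (m * norm_sq D d a b x * metric_mat D d a x $ i $ j
                 + (1 - m) * covec D d b x $ i * covec D d b x $ j))"

section \<open>Adapted coordinates\<close>

text \<open>The symmetrized product \<open>dx\<^sup>i dx\<^sup>j\<close>, evaluated on vectors with components \<open>y\<close>, \<open>z\<close>.\<close>

definition sym_prod :: "'n \<Rightarrow> 'n \<Rightarrow> real^'n \<Rightarrow> real^'n \<Rightarrow> real" where
  "sym_prod i j y z = (1/2) * (y $ i * z $ j + y $ j * z $ i)"

text \<open>The indices \<open>iu\<close>, \<open>iv\<close> carry the coordinates \<open>u\<close>, \<open>v\<close>; the others carry the coordinates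
  \<open>x\<^sup>a\<close>. Functions of \<open>(u, x)\<close> only are functions of the coordinates whose values agree at points
  with the same coordinates except possibly \<open>v\<close>.\<close>

definition adapted_coords ::
  "('p, 'n::finite) chart set \<Rightarrow> ('p \<Rightarrow> ('p, 'n) tvec \<Rightarrow> ('p, 'n) tvec \<Rightarrow> real) \<Rightarrow>
    ('p \<Rightarrow> ('p, 'n) tvec \<Rightarrow> real) \<Rightarrow> 'n \<Rightarrow> 'n \<Rightarrow> ('p, 'n) chart \<Rightarrow>
    (real^'n \<Rightarrow> real) \<Rightarrow> ('n \<Rightarrow> real^'n \<Rightarrow> real) \<Rightarrow> ('n \<Rightarrow> 'n \<Rightarrow> real^'n \<Rightarrow> real) \<Rightarrow> bool" where
  "adapted_coords D a b iu iv c H W h \<longleftrightarrow> c \<in> D \<and> (let T = UNIV - {iu, iv} in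
     smooth_on (img c) H \<and>
     (\<forall>k\<in>T. smooth_on (img c) (W k)) \<and>
     (\<forall>k\<in>T. \<forall>l\<in>T. smooth_on (img c) (h k l)) \<and>
     (\<forall>x\<in>img c. \<forall>x'\<in>img c. (\<forall>k. k \<noteq> iv \<longrightarrow> x $ k = x' $ k) \<longrightarrow>
        (\<forall>k\<in>T. W k x = W k x') \<and> (\<forall>k\<in>T. \<forall>l\<in>T. h k l x = h k l x')) \<and>
     (\<forall>x\<in>img c.
        (\<forall>k\<in>T. \<forall>l\<in>T. h k l x = h l k x) \<and>
        (\<forall>\<xi> :: 'n \<Rightarrow> real. (\<forall>k\<in>T. (\<Sum>l\<in>T. h k l x * \<xi> l) = 0) \<longrightarrow> (\<forall>l\<in>T. \<xi> l = 0))) \<and>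
     (\<forall>x\<in>img c. \<forall>y z.
        a (pt c x) (tv D c x y) (tv D c x z) =
          - 2 * sym_prod iu iv y z + H x * sym_prod iu iu y z
          + (\<Sum>k\<in>T. W k x * sym_prod iu k y z)
          + (\<Sum>k\<in>T. \<Sum>l\<in>T. h k l x * sym_prod k l y z)) \<and>
     (\<forall>x\<in>img c. \<forall>y. b (pt c x) (tv D c x y) = y $ iu))"

end

theory Submission
  imports Defs
begin

text \<open>The proof passes through the intermediate condition \<open>\<nabla>b = \<kappa> b
  \<otimes> b\<close>, for some function \<open>\<kappa>\<close>.

  From Berwald to this condition and back
  (\<open>berwald_iff_nabla_recurrent\<close>). Let \<open>L = F^2\<close> be the energy. If the
  Cartan connection is linear in \<open>y\<close>, then by homogeneity its symmetrization
  \<open>C\<close>, a torsion-free linear connection, annihilates \<open>L\<close> in horizontal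
  directions (\<open>horizontal_eq_0\<close>), and conversely a torsion-free linear connection
  that annihilates \<open>L\<close> is the Cartan connection
  (\<open>connection_of_parallel_energy\<close>). As \<open>L\<close> is \<open>a(y, y)^(1 + m)
  \<beta>^(-2 m)\<close>, annihilation in direction \<open>k\<close> means \<open>(1 + m) \<beta>
  (C a)(y, y) = 2 m a(y, y) (C b)(y)\<close>, where \<open>C a\<close> and \<open>C b\<close>
  denote the covariant derivatives in that direction: an identity of cubic polynomials in
  \<open>y\<close>. In dimension at least three \<open>\<beta>\<close> does not divide \<open>a(y,
  y)\<close>, hence \<open>C b = \<tau> b\<close> and \<open>C a = \<sigma> a\<close> with
  \<open>(1 + m) \<sigma> = 2 m \<tau>\<close> (\<open>proportional_of_cubic_identity\<close>). So
  \<open>C\<close> is a Weyl connection of \<open>a\<close>, closedness of \<open>b\<close> makes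
  \<open>\<tau>\<close> and \<open>\<sigma>\<close> multiples of \<open>b\<close>, and for null
  \<open>b\<close> the difference between \<open>C\<close> and \<open>\<nabla>\<close> contributes
  to the derivative of \<open>b\<close> another multiple of \<open>b \<otimes> b\<close>. All
  steps can be reversed by writing down the Weyl connection. The values \<open>m = 1\<close> and
  \<open>m = -1\<close> are impossible because the fundamental tensor would be degenerate.

  From this condition to adapted coordinates and back. The condition is tensorial
  (\<open>nabla_recurrent_transition\<close>). In coordinates with \<open>b = du\<close> in which
  \<open>\<partial>\<^sub>v\<close> is minus the vector dual to \<open>b\<close>, the metric
  automatically has the components \<open>-1\<close> for the pair \<open>u, v\<close> and
  \<open>0\<close> for all other pairs with an index \<open>v\<close>, and the covariant
  derivative of \<open>b\<close> is \<open>-1/2\<close> times the \<open>v\<close>-derivative of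
  \<open>a\<close> (\<open>nabla_in_null_frame\<close>). Hence the condition holds if and only if
  only the coefficient \<open>H\<close> of \<open>du^2\<close> depends on \<open>v\<close>, and
  then the factor \<open>(1 - m) c\<close> is \<open>-1/2\<close> times the
  \<open>v\<close>-derivative of \<open>H\<close>.

  Such coordinates exist around each point for every closed, null, nowhere vanishing
  \<open>b\<close> (\<open>ex_null_frame\<close>): locally \<open>b = du\<close>, the dual vector
  field is tangent to the level sets of \<open>u\<close>, and its flow away from a transversal
  hypersurface supplies \<open>v\<close>. This needs the smooth inverse function theorem
  (\<open>smooth_inverse_function\<close>) and a flow that is smooth in time and initial value
  (\<open>smooth_local_flow\<close>). The latter is obtained by showing that the Picard iterates
  converge together with all derivatives, on one fixed time interval.\<close>

section \<open>Calculus of smooth maps\<close>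

lemma Ck_on_subset: "Ck_on k S f \<Longrightarrow> T \<subseteq> S \<Longrightarrow> Ck_on k T f"
  by (induction k arbitrary: f) (auto intro: continuous_on_subset)

lemma Ck_on_SucD: "Ck_on (Suc k) S f \<Longrightarrow> Ck_on k S f"
proof (induction k arbitrary: f)
  case 0
  then show ?case
    by (auto intro!: continuous_at_imp_continuous_on differentiable_imp_continuous_within)
next
  case (Suc k)
  then show ?case by (metis Ck_on.simps(2))
qed

lemma Ck_on_cong:
  assumes "open S" and "\<And>x. x \<in> S \<Longrightarrow> f x = g x" and "Ck_on k S f"
  shows "Ck_on k S g"
  using assms(2,3)
proof (induction k arbitrary: f g)
  case 0
  then show ?case using continuous_on_cong by (metis Ck_on.simps(1))
next
  case (Suc k)
  have "frechet_derivative f (at x) v = frechet_derivative g (at x) v" if "x \<in> S" for x v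
    using frechet_derivative_transform_within_open[of f x S g] that assms(1) Suc.prems by auto
  moreover have "g differentiable (at x)" if "x \<in> S" for x
    using has_derivative_transform_within_open[of f _ x UNIV S g] that assms(1) Suc.prems
    unfolding differentiable_def Ck_on.simps by blast
  moreover have "Ck_on k S (\<lambda>x. frechet_derivative g (at x) v)" for v
    by (rule Suc.IH[of "\<lambda>x. frechet_derivative f (at x) v"]) (use calculation Suc.prems in auto)
  ultimately show ?case by simp
qed

lemma Ck_on_const [simp]: "Ck_on k S (\<lambda>x. c)"
  by (induction k arbitrary: c) (auto simp: continuous_on_const)

lemma Ck_on_bounded_linear:
  assumes "bounded_linear h" shows "Ck_on k S h"
proof (cases k)
  case 0
  then show ?thesis using assms by (simp add: linear_continuous_on)
next
  case (Suc l)
  have "frechet_derivative h (at x) = h" for x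
    using bounded_linear_imp_has_derivative[OF assms] frechet_derivative_at by metis
  then show ?thesis
    using Suc bounded_linear_imp_differentiable[OF assms] by simp
qed

text \<open>The recursion in the definition of \<open>Ck_on\<close> speaks of the derivative
  chosen by \<open>frechet_derivative\<close>; in proofs the derivative is known by a formula,
  which this rule accepts directly.\<close>

lemma Ck_on_SucI:
  assumes "open S" and "\<And>x. x \<in> S \<Longrightarrow> (f has_derivative f' x) (at x)"
    and "\<And>v. Ck_on k S (\<lambda>x. f' x v)"
  shows "Ck_on (Suc k) S f"
  unfolding Ck_on.simps
proof (intro conjI ballI allI)
  show "f differentiable at x" if "x \<in> S" for x
    using assms(2)[OF that] by (auto simp: differentiable_def)
  show "Ck_on k S (\<lambda>x. frechet_derivative f (at x) v)" for v
    by (rule Ck_on_cong[OF assms(1) _ assms(3)[of v]])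
       (use assms(2) frechet_derivative_at in metis)
qed

lemma Ck_on_has_derivative:
  assumes "Ck_on (Suc k) S f" "x \<in> S"
  shows "(f has_derivative frechet_derivative f (at x)) (at x)"
  using assms frechet_derivative_works by (auto simp only: Ck_on.simps)

lemma Ck_on_bounded_linear_compose:
  assumes "bounded_linear h" "open S" "Ck_on k S f" shows "Ck_on k S (\<lambda>x. h (f x))"
  using assms(3)
proof (induction k arbitrary: f)
  case 0
  then show ?case using bounded_linear.continuous_on[OF assms(1)] by auto
next
  case (Suc k)
  show ?case
  proof (rule Ck_on_SucI[OF assms(2)])
    show "((\<lambda>x. h (f x)) has_derivative (\<lambda>v. h (frechet_derivative f (at x) v))) (at x)"
      if "x \<in> S" for x
      using bounded_linear.has_derivative[OF assms(1) Ck_on_has_derivative[OF Suc.prems that]] .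
    show "Ck_on k S (\<lambda>x. h (frechet_derivative f (at x) v))" for v
      using Suc by auto
  qed
qed

lemma Ck_on_add:
  assumes "open S" "Ck_on k S f" "Ck_on k S g" shows "Ck_on k S (\<lambda>x. f x + g x)"
  using assms(2,3)
proof (induction k arbitrary: f g)
  case 0
  then show ?case by (auto intro: continuous_intros)
next
  case (Suc k)
  show ?case
  proof (rule Ck_on_SucI[OF assms(1)])
    show "((\<lambda>x. f x + g x) has_derivative
        (\<lambda>v. frechet_derivative f (at x) v + frechet_derivative g (at x) v)) (at x)"
      if "x \<in> S" for x
      by (intro has_derivative_add Ck_on_has_derivative[OF Suc.prems(1) that]
          Ck_on_has_derivative[OF Suc.prems(2) that])
  qed (use Suc in auto)
qed

lemma (in bounded_bilinear) Ck_on: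
  assumes "open S" "Ck_on k S f" "Ck_on k S g" shows "Ck_on k S (\<lambda>x. prod (f x) (g x))"
  using assms(2,3)
proof (induction k arbitrary: f g)
  case 0
  then show ?case by (auto intro: continuous_on)
next
  case (Suc k)
  show ?case
  proof (rule Ck_on_SucI[OF assms(1)])
    show "((\<lambda>x. prod (f x) (g x)) has_derivative (\<lambda>v.
        prod (f x) (frechet_derivative g (at x) v) + prod (frechet_derivative f (at x) v) (g x)))
            (at x)"
      if "x \<in> S" for x
      by (intro FDERIV Ck_on_has_derivative[OF Suc.prems(1) that]
          Ck_on_has_derivative[OF Suc.prems(2) that])
    show "Ck_on k S (\<lambda>x. prod (f x) (frechet_derivative g (at x) v)
        + prod (frechet_derivative f (at x) v) (g x))" for v
      using Suc.prems Ck_on_SucD[OF Suc.prems(1)] Ck_on_SucD[OF Suc.prems(2)]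
      by (intro Ck_on_add assms(1) Suc.IH) auto
  qed
qed

lemmas Ck_on_mult = bounded_bilinear.Ck_on[OF bounded_bilinear_mult]
lemmas Ck_on_scaleR = bounded_bilinear.Ck_on[OF bounded_bilinear_scaleR]

lemma Ck_on_sum:
  assumes "open S" "\<And>i. i \<in> I \<Longrightarrow> Ck_on k S (f i)" shows "Ck_on k S (\<lambda>x. \<Sum>i\<in>I. f i x)"
  using assms(2) by (induction I rule: infinite_finite_induct) (auto intro!: Ck_on_add assms(1))

lemma Ck_on_prod:
  fixes f :: "'i \<Rightarrow> 'a::real_normed_vector \<Rightarrow> 'b::real_normed_field"
  assumes "open S" "\<And>i. i \<in> I \<Longrightarrow> Ck_on k S (f i)" shows "Ck_on k S (\<lambda>x. \<Prod>i\<in>I. f i x)"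
  using assms(2) by (induction I rule: infinite_finite_induct) (auto intro!: Ck_on_mult assms(1))

lemma Ck_on_inverse:
  fixes f :: "'a::real_normed_vector \<Rightarrow> real"
  assumes "open S" "Ck_on k S f" "\<And>x. x \<in> S \<Longrightarrow> f x \<noteq> 0" shows "Ck_on k S (\<lambda>x. inverse (f x))"
  using assms(2)
proof (induction k)
  case 0
  then show ?case using assms(3) by (auto intro: continuous_on_inverse)
next
  case (Suc k)
  show ?case
  proof (rule Ck_on_SucI[OF assms(1)])
    show "((\<lambda>x. inverse (f x)) has_derivative
        (\<lambda>v. (- 1) * ((inverse (f x) * frechet_derivative f (at x) v) * inverse (f x)))) (at x)"
      if "x \<in> S" for x
      using Deriv.has_derivative_inverse[where f = f, OF assms(3)[OF that] Ck_on_has_derivative[OF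
          Suc.prems that]]
      by simp
    show "Ck_on k S (\<lambda>x. (- 1) * ((inverse (f x) * frechet_derivative f (at x) v) * inverse (f x)))"
      for v
      using Suc.IH[OF Ck_on_SucD[OF Suc.prems]] Suc.prems
      by (intro Ck_on_mult assms(1) Ck_on_const) auto
  qed
qed

lemma frechet_derivative_Basis:
  fixes f :: "'a::euclidean_space \<Rightarrow> 'b::real_normed_vector"
  assumes "f differentiable (at x)"
  shows "frechet_derivative f (at x) v = (\<Sum>b\<in>Basis. (v \<bullet> b) *\<^sub>R frechet_derivative f (at x) b)"
proof -
  interpret linear "frechet_derivative f (at x)" using linear_frechet_derivative[OF assms] .
  have "frechet_derivative f (at x) v = frechet_derivative f (at x) (\<Sum>b\<in>Basis. (v \<bullet> b) *\<^sub>R b)"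
    by (simp add: euclidean_representation)
  then show ?thesis by (simp add: sum scale)
qed

text \<open>Expanding the inner derivative in a basis turns the chain rule into a sum of
  products of compositions of one order less, to which the induction hypothesis applies. This is
  where finite dimension enters.\<close>

lemma Ck_on_compose:
  fixes g :: "'b::euclidean_space \<Rightarrow> 'c::real_normed_vector"
  assumes "open S" "open T" "Ck_on k S f" "Ck_on k T g" "f ` S \<subseteq> T"
  shows "Ck_on k S (\<lambda>x. g (f x))"
  using assms(3,4)
proof (induction k arbitrary: g)
  case 0
  then show ?case
    using continuous_on_compose2[of T g S f] assms(5) by simp
next
  case (Suc k)
  show ?case
  proof (rule Ck_on_SucI[OF assms(1)])
    fix x assume x: "x \<in> S"
    then have fx: "f x \<in> T" using assms(5) by auto
    note dg = Ck_on_has_derivative[OF Suc.prems(2) fx]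
    have "((\<lambda>x. g (f x)) has_derivative
        (\<lambda>v. frechet_derivative g (at (f x)) (frechet_derivative f (at x) v))) (at x)"
      by (rule has_derivative_compose[OF Ck_on_has_derivative[OF Suc.prems(1) x] dg])
    moreover have "frechet_derivative g (at (f x)) (frechet_derivative f (at x) v) =
        (\<Sum>b\<in>Basis. (frechet_derivative f (at x) v \<bullet> b) *\<^sub>R frechet_derivative g (at (f x)) b)" for v
      by (rule frechet_derivative_Basis) (use dg differentiable_def in blast)
    ultimately show "((\<lambda>x. g (f x)) has_derivative (\<lambda>v. \<Sum>b\<in>Basis.
        (frechet_derivative f (at x) v \<bullet> b) *\<^sub>R frechet_derivative g (at (f x)) b)) (at x)"
      by simp
  next
    fix v
    have "Ck_on k S (\<lambda>x. frechet_derivative f (at x) v \<bullet> b)" for b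
      using Suc.prems(1) by (intro Ck_on_bounded_linear_compose[OF bounded_linear_inner_left
          assms(1)]) auto
    moreover have "Ck_on k S (\<lambda>x. frechet_derivative g (at (f x)) b)" for b
      using Suc.prems by (intro Suc.IH Ck_on_SucD[of k S f]) auto
    ultimately show "Ck_on k S (\<lambda>x. \<Sum>b\<in>Basis.
        (frechet_derivative f (at x) v \<bullet> b) *\<^sub>R frechet_derivative g (at (f x)) b)"
      by (intro Ck_on_sum Ck_on_scaleR assms(1)) auto
  qed
qed

lemma smooth_onD: "smooth_on S f \<Longrightarrow> Ck_on k S f"
  by (simp add: smooth_on_def)

lemma smooth_on_subset: "smooth_on S f \<Longrightarrow> T \<subseteq> S \<Longrightarrow> smooth_on T f"
  using Ck_on_subset unfolding smooth_on_def by blast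

lemma smooth_on_cong: "open S \<Longrightarrow> (\<And>x. x \<in> S \<Longrightarrow> f x = g x) \<Longrightarrow> smooth_on S f \<Longrightarrow> smooth_on S g"
  using Ck_on_cong unfolding smooth_on_def by blast

lemma smooth_on_frechet_derivative:
  "smooth_on S f \<Longrightarrow> smooth_on S (\<lambda>x. frechet_derivative f (at x) v)"
  unfolding smooth_on_def by (metis Ck_on.simps(2))

lemma smooth_on_has_derivative:
  "smooth_on S f \<Longrightarrow> x \<in> S \<Longrightarrow> (f has_derivative frechet_derivative f (at x)) (at x)"
  using Ck_on_has_derivative smooth_onD by blast

lemma smooth_on_differentiable: "smooth_on S f \<Longrightarrow> x \<in> S \<Longrightarrow> f differentiable (at x)"
  using smooth_on_has_derivative differentiable_def by blast

lemma smooth_on_continuous_on: "smooth_on S f \<Longrightarrow> continuous_on S f"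
  using smooth_onD[of S f 0] by simp

lemma smooth_on_const: "smooth_on S (\<lambda>x. c)"
  by (simp add: smooth_on_def)

lemma smooth_on_bounded_linear: "bounded_linear h \<Longrightarrow> smooth_on S h"
  using Ck_on_bounded_linear smooth_on_def by blast

lemma smooth_on_linear:
  fixes h :: "'a::euclidean_space \<Rightarrow> 'b::real_normed_vector"
  shows "linear h \<Longrightarrow> smooth_on S h"
  using smooth_on_bounded_linear linear_conv_bounded_linear by blast

lemma smooth_on_bounded_linear_compose:
  "bounded_linear h \<Longrightarrow> open S \<Longrightarrow> smooth_on S f \<Longrightarrow> smooth_on S (\<lambda>x. h (f x))"
  using Ck_on_bounded_linear_compose unfolding smooth_on_def by blast

lemma smooth_on_add: "open S \<Longrightarrow> smooth_on S f \<Longrightarrow> smooth_on S g \<Longrightarrow> smooth_on S (\<lambda>x. f x + g x)"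
  using Ck_on_add unfolding smooth_on_def by blast

lemma smooth_on_scaleR:
  "open S \<Longrightarrow> smooth_on S f \<Longrightarrow> smooth_on S g \<Longrightarrow> smooth_on S (\<lambda>x. f x *\<^sub>R g x)"
  using Ck_on_scaleR unfolding smooth_on_def by blast

lemma smooth_on_mult:
  fixes f :: "_ \<Rightarrow> 'b::real_normed_algebra"
  shows "open S \<Longrightarrow> smooth_on S f \<Longrightarrow> smooth_on S g \<Longrightarrow> smooth_on S (\<lambda>x. f x * g x)"
  using Ck_on_mult unfolding smooth_on_def by blast

lemma smooth_on_uminus: "open S \<Longrightarrow> smooth_on S f \<Longrightarrow> smooth_on S (\<lambda>x. - f x)"
  by (rule smooth_on_bounded_linear_compose[OF bounded_linear_minus[OF bounded_linear_ident]])

lemma smooth_on_diff: "open S \<Longrightarrow> smooth_on S f \<Longrightarrow> smooth_on S g \<Longrightarrow> smooth_on S (\<lambda>x. f x - g x)"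
  using smooth_on_add[of S f "\<lambda>x. - g x"] smooth_on_uminus[of S g] by simp

lemma smooth_on_sum: "open S \<Longrightarrow> (\<And>i. i \<in> I \<Longrightarrow> smooth_on S (f i)) \<Longrightarrow> smooth_on S (\<lambda>x. \<Sum>i\<in>I. f i x)"
  by (simp add: smooth_on_def Ck_on_sum)

lemma smooth_on_prod:
  fixes f :: "'i \<Rightarrow> 'a::real_normed_vector \<Rightarrow> 'b::real_normed_field"
  shows "open S \<Longrightarrow> (\<And>i. i \<in> I \<Longrightarrow> smooth_on S (f i)) \<Longrightarrow> smooth_on S (\<lambda>x. \<Prod>i\<in>I. f i x)"
  by (simp add: smooth_on_def Ck_on_prod)

lemma smooth_on_divide:
  fixes f g :: "'a::real_normed_vector \<Rightarrow> real"
  shows "open S \<Longrightarrow> smooth_on S f \<Longrightarrow> smooth_on S g \<Longrightarrow> (\<And>x. x \<in> S \<Longrightarrow> g x \<noteq> 0) \<Longrightarrow>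
    smooth_on S (\<lambda>x. f x / g x)"
  using smooth_on_mult[of S f "\<lambda>x. inverse (g x)"] Ck_on_inverse[of S _ g]
  by (auto simp: divide_inverse smooth_on_def)

lemma smooth_on_compose:
  fixes g :: "'b::euclidean_space \<Rightarrow> 'c::real_normed_vector"
  shows "open S \<Longrightarrow> open T \<Longrightarrow> smooth_on S f \<Longrightarrow> smooth_on T g \<Longrightarrow> f ` S \<subseteq> T \<Longrightarrow>
    smooth_on S (\<lambda>x. g (f x))"
  using Ck_on_compose unfolding smooth_on_def by blast

lemma smooth_on_nth:
  "open S \<Longrightarrow> smooth_on S f \<Longrightarrow> smooth_on S (\<lambda>x. f x $ i)"
  by (rule smooth_on_bounded_linear_compose[OF bounded_linear_vec_nth])

lemma Ck_on_componentwise: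
  fixes f :: "'a::real_normed_vector \<Rightarrow> real^'n"
  assumes "open S" "\<And>i. Ck_on k S (\<lambda>x. f x $ i)" shows "Ck_on k S f"
proof -
  have "Ck_on k S (\<lambda>x. \<Sum>i\<in>UNIV. (f x $ i) *\<^sub>R axis i (1::real))"
    by (intro Ck_on_sum assms Ck_on_scaleR Ck_on_const)
  moreover have "(\<Sum>i\<in>UNIV. (f x $ i) *\<^sub>R axis i (1::real)) = f x" for x
    by (simp add: vec_eq_iff axis_def if_distrib cong: if_cong)
  ultimately show ?thesis by simp
qed

lemma smooth_on_componentwise:
  fixes f :: "'a::real_normed_vector \<Rightarrow> real^'n"
  shows "open S \<Longrightarrow> (\<And>i. smooth_on S (\<lambda>x. f x $ i)) \<Longrightarrow> smooth_on S f"
  using Ck_on_componentwise unfolding smooth_on_def by blast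

lemma smooth_on_Pair:
  fixes f :: "_ \<Rightarrow> 'b::euclidean_space" and g :: "_ \<Rightarrow> 'c::euclidean_space"
  assumes "open S" "smooth_on S f" "smooth_on S g" shows "smooth_on S (\<lambda>x. (f x, g x))"
proof -
  have "smooth_on S (\<lambda>x. (f x, 0::'c) + (0::'b, g x))"
    by (intro smooth_on_add assms
        smooth_on_bounded_linear_compose[OF bounded_linear_Pair[OF bounded_linear_ident
            bounded_linear_zero]]
        smooth_on_bounded_linear_compose[OF bounded_linear_Pair[OF bounded_linear_zero
            bounded_linear_ident]])
  then show ?thesis by simp
qed

lemma smooth_on_ident: "smooth_on S (\<lambda>x. x)"
  by (rule smooth_on_bounded_linear[OF bounded_linear_ident])

lemmas smooth_intros = smooth_on_const smooth_on_ident smooth_on_add smooth_on_diff smooth_on_uminus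
  smooth_on_mult smooth_on_scaleR smooth_on_sum smooth_on_prod smooth_on_divide smooth_on_nth
  smooth_on_frechet_derivative

lemma smooth_on_pd: "smooth_on S f \<Longrightarrow> smooth_on S (pd i f)"
  unfolding pd_def by (rule smooth_on_frechet_derivative)

lemma pd_cong:
  assumes "open S" "x \<in> S" "\<And>z. z \<in> S \<Longrightarrow> f z = g z" "f differentiable (at x)"
  shows "pd i f x = pd i g x"
  unfolding pd_def using frechet_derivative_transform_within_open[of f x S g] assms by auto

subsection \<open>Inverses of matrices\<close>

lemma matrix_inv_right_left:
  fixes M :: "real^'n^'n"
  assumes "invertible M"
  shows "M ** matrix_inv M = mat 1" "matrix_inv M ** M = mat 1"
  using someI_ex[of "\<lambda>B. M ** B = mat 1 \<and> B ** M = mat 1"] assms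
  unfolding invertible_def matrix_inv_def by auto

text \<open>By Cramer's rule the entries of the inverse are quotients of polynomials in the
  entries of the matrix.\<close>

lemma smooth_on_matrix_inv:
  fixes M :: "'a::real_normed_vector \<Rightarrow> real^'n^'n"
  assumes S: "open S" and M: "\<And>i j. smooth_on S (\<lambda>x. M x $ i $ j)"
    and inv: "\<And>x. x \<in> S \<Longrightarrow> invertible (M x)"
  shows "smooth_on S (\<lambda>x. matrix_inv (M x) $ i $ j)"
proof -
  have det: "smooth_on S (\<lambda>x. det (N x))"
    if "\<And>i j. smooth_on S (\<lambda>x. N x $ i $ j)" for N :: "'a \<Rightarrow> real^'n^'n"
    unfolding det_def by (intro smooth_intros S that)
  define C where "C x = (\<chi> k l. if l = i then axis j 1 $ k else M x $ k $ l)" for x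
  have "smooth_on S (\<lambda>x. C x $ k $ l)" for k l
    by (cases "l = i") (auto simp: C_def M smooth_on_const)
  then have "smooth_on S (\<lambda>x. det (C x) / det (M x))"
    using inv by (intro smooth_on_divide S det M) (auto simp: invertible_det_nz)
  moreover have "det (C x) / det (M x) = matrix_inv (M x) $ i $ j" if "x \<in> S" for x
  proof -
    let ?z = "matrix_inv (M x) *v axis j 1"
    have "M x *v ?z = axis j 1"
      by (simp add: matrix_vector_mul_assoc matrix_inv_right_left inv that)
    then have "?z = (\<chi> k. det (\<chi> a l. if l = k then axis j 1 $ a else M x $ a $ l) / det (M x))"
      using cramer[of "M x" ?z "axis j 1"] inv[OF that] by (simp add: invertible_det_nz)
    then have "?z $ i = det (C x) / det (M x)" by (simp add: C_def)
    then show ?thesis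
      by (simp add: matrix_vector_mult_def axis_def if_distrib cong: if_cong)
  qed
  ultimately show ?thesis by (rule smooth_on_cong[OF S, rotated])
qed

subsection \<open>Symmetry of second derivatives\<close>

text \<open>The mean value theorem, applied first in direction \<open>v\<close> and then in
  direction \<open>w\<close>. The left hand side is symmetric in \<open>v\<close> and
  \<open>w\<close> while the right hand side prefers one order of differentiation; this is the
  whole reason for the symmetry of second derivatives.\<close>

lemma second_difference_mean_value:
  fixes f :: "'a::real_normed_vector \<Rightarrow> real"
  assumes "s > 0"
    and sub: "\<And>\<xi> \<eta>. 0 \<le> \<xi> \<Longrightarrow> \<xi> \<le> s \<Longrightarrow> 0 \<le> \<eta> \<Longrightarrow> \<eta> \<le> s \<Longrightarrow> x + \<xi> *\<^sub>R v + \<eta> *\<^sub>R w \<in> S"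
    and f: "Ck_on 2 S f"
  shows "\<exists>\<xi> \<eta>. 0 < \<xi> \<and> \<xi> < s \<and> 0 < \<eta> \<and> \<eta> < s \<and>
    f (x + s *\<^sub>R v + s *\<^sub>R w) - f (x + s *\<^sub>R v) - f (x + s *\<^sub>R w) + f x =
    s\<^sup>2 * frechet_derivative (\<lambda>z. frechet_derivative f (at z) v) (at (x + \<xi> *\<^sub>R v + \<eta> *\<^sub>R w)) w"
proof -
  let ?D = "\<lambda>g y. frechet_derivative g (at y)"
  have D1: "(f has_derivative ?D f y) (at y)" if "y \<in> S" for y
    using Ck_on_has_derivative[of 1 S f] f that by (simp add: numeral_2_eq_2)
  have D2: "((\<lambda>z. ?D f z v) has_derivative ?D (\<lambda>z. ?D f z v) y) (at y)" if "y \<in> S" for y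
    using Ck_on_has_derivative[of 0 S "\<lambda>z. ?D f z v"] f that by (simp add: numeral_2_eq_2)
  define q where "q \<xi> = f (x + \<xi> *\<^sub>R v + s *\<^sub>R w) - f (x + \<xi> *\<^sub>R v + 0 *\<^sub>R w)" for \<xi>
  have "\<exists>\<xi>. \<xi> > 0 \<and> \<xi> < s \<and> q s - q 0 = (s - 0) *
      (?D f (x + \<xi> *\<^sub>R v + s *\<^sub>R w) v - ?D f (x + \<xi> *\<^sub>R v + 0 *\<^sub>R w) v)"
  proof (rule MVT2[OF assms(1)])
    fix \<xi> assume \<xi>: "0 \<le> \<xi>" "\<xi> \<le> s"
    have 1: "((\<lambda>\<xi>. f (x + \<xi> *\<^sub>R v + \<eta> *\<^sub>R w)) has_derivative
        (\<lambda>r. ?D f (x + \<xi> *\<^sub>R v + \<eta> *\<^sub>R w) (r *\<^sub>R v))) (at \<xi>)" if "0 \<le> \<eta>" "\<eta> \<le> s" for \<eta>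
      by (rule has_derivative_compose[where g = f and f = "\<lambda>\<xi>. x + \<xi> *\<^sub>R v + \<eta> *\<^sub>R w", OF _ D1[OF
          sub[OF \<xi> that]]])
         (auto intro!: derivative_eq_intros)
    have 2: "(\<lambda>r. ?D f y (r *\<^sub>R v)) = (*) (?D f y v)" if "y \<in> S" for y
      using linear_cmul[OF has_derivative_linear[OF D1[OF that]]] by (simp add: fun_eq_iff
          mult.commute)
    have 3: "((\<lambda>\<xi>. f (x + \<xi> *\<^sub>R v + \<eta> *\<^sub>R w)) has_real_derivative
        ?D f (x + \<xi> *\<^sub>R v + \<eta> *\<^sub>R w) v) (at \<xi>)" if "0 \<le> \<eta>" "\<eta> \<le> s" for \<eta>
      using 1[OF that] 2[OF sub[OF \<xi> that]] by (simp add: has_field_derivative_def)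
    from DERIV_diff[OF 3[of s] 3[of 0]] show "(q has_real_derivative
        ?D f (x + \<xi> *\<^sub>R v + s *\<^sub>R w) v - ?D f (x + \<xi> *\<^sub>R v + 0 *\<^sub>R w) v) (at \<xi>)"
      using assms(1) unfolding q_def by simp
  qed
  then obtain \<xi> where \<xi>: "0 < \<xi>" "\<xi> < s" and q: "q s - q 0 = s *
      (?D f (x + \<xi> *\<^sub>R v + s *\<^sub>R w) v - ?D f (x + \<xi> *\<^sub>R v + 0 *\<^sub>R w) v)" by auto
  have "\<exists>\<eta>. \<eta> > 0 \<and> \<eta> < s \<and>
      ?D f (x + \<xi> *\<^sub>R v + s *\<^sub>R w) v - ?D f (x + \<xi> *\<^sub>R v + 0 *\<^sub>R w) v =
      (s - 0) * ?D (\<lambda>z. ?D f z v) (x + \<xi> *\<^sub>R v + \<eta> *\<^sub>R w) w"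
  proof (rule MVT2[OF assms(1)])
    fix \<eta> assume \<eta>: "0 \<le> \<eta>" "\<eta> \<le> s"
    have y: "x + \<xi> *\<^sub>R v + \<eta> *\<^sub>R w \<in> S" using \<eta> \<xi> by (intro sub) auto
    have "((\<lambda>\<eta>. ?D f (x + \<xi> *\<^sub>R v + \<eta> *\<^sub>R w) v) has_derivative
        (\<lambda>r. ?D (\<lambda>z. ?D f z v) (x + \<xi> *\<^sub>R v + \<eta> *\<^sub>R w) (r *\<^sub>R w))) (at \<eta>)"
      by (rule has_derivative_compose[where g = "\<lambda>z. ?D f z v" and
          f = "\<lambda>\<eta>. x + \<xi> *\<^sub>R v + \<eta> *\<^sub>R w", OF _ D2[OF y]]) (auto intro!: derivative_eq_intros)
    moreover have "(\<lambda>r. ?D (\<lambda>z. ?D f z v) y (r *\<^sub>R w)) = (*) (?D (\<lambda>z. ?D f z v) y w)" if "y \<in> S" for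
        y
      using linear_cmul[OF has_derivative_linear[OF D2[OF that]]] by (simp add: fun_eq_iff
          mult.commute)
    ultimately show "((\<lambda>\<eta>. ?D f (x + \<xi> *\<^sub>R v + \<eta> *\<^sub>R w) v) has_real_derivative
        ?D (\<lambda>z. ?D f z v) (x + \<xi> *\<^sub>R v + \<eta> *\<^sub>R w) w) (at \<eta>)"
      using y by (simp add: has_field_derivative_def)
  qed
  then obtain \<eta> where "0 < \<eta>" "\<eta> < s" and
    "?D f (x + \<xi> *\<^sub>R v + s *\<^sub>R w) v - ?D f (x + \<xi> *\<^sub>R v + 0 *\<^sub>R w) v =
      s * ?D (\<lambda>z. ?D f z v) (x + \<xi> *\<^sub>R v + \<eta> *\<^sub>R w) w" by auto
  with q \<xi> show ?thesis
    by (intro exI[of _ \<xi>] exI[of _ \<eta>]) (auto simp: q_def power2_eq_square algebra_simps)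
qed

text \<open>Both mixed derivatives are within every error bound of the same second difference
  quotient, for small increments.\<close>

lemma Ck_on_second_derivative_symmetric:
  fixes f :: "'a::real_normed_vector \<Rightarrow> real"
  assumes S: "open S" "x \<in> S" and f: "Ck_on 2 S f"
  shows "frechet_derivative (\<lambda>z. frechet_derivative f (at z) v) (at x) w =
    frechet_derivative (\<lambda>z. frechet_derivative f (at z) w) (at x) v" (is "?A v w x = ?A w v x")
proof (rule ccontr)
  assume ne: "?A v w x \<noteq> ?A w v x"
  define e where "e = \<bar>?A v w x - ?A w v x\<bar> / 2"
  have e: "e > 0" using ne by (simp add: e_def)
  have lim: "(?A v w \<longlongrightarrow> ?A v w x) (nhds x)" for v w
  proof -
    have "continuous_on S (?A v w)" using f by (auto simp: numeral_2_eq_2)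
    then have "isCont (?A v w) x" using S continuous_on_eq_continuous_at by blast
    then show ?thesis
      using tendsto_at_iff_tendsto_nhds[of "?A v w" x] unfolding isCont_def by blast
  qed
  have "\<forall>\<^sub>F y in nhds x. y \<in> S \<and> \<bar>?A v w y - ?A v w x\<bar> < e \<and> \<bar>?A w v y - ?A w v x\<bar> < e"
    using tendstoD[OF lim e, of v w] tendstoD[OF lim e, of w v] eventually_nhds_in_open[OF S]
    by (intro eventually_conj) (auto simp: dist_real_def)
  then obtain d where d: "d > 0" and near: "\<And>y. dist y x < d \<Longrightarrow>
      y \<in> S \<and> \<bar>?A v w y - ?A v w x\<bar> < e \<and> \<bar>?A w v y - ?A w v x\<bar> < e"
    unfolding eventually_nhds_metric by blast
  define s where "s = d / (2 * (norm v + norm w + 1))"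
  have s: "s > 0" using d by (auto simp: s_def intro!: divide_pos_pos add_nonneg_pos)
  have close: "dist (x + \<xi> *\<^sub>R v + \<eta> *\<^sub>R w) x < d"
    if "0 \<le> \<xi>" "\<xi> \<le> s" "0 \<le> \<eta>" "\<eta> \<le> s" for \<xi> \<eta> v' w'
  proof -
    have "norm (\<xi> *\<^sub>R v + \<eta> *\<^sub>R w) \<le> \<xi> * norm v + \<eta> * norm w"
      using norm_triangle_ineq[of "\<xi> *\<^sub>R v" "\<eta> *\<^sub>R w"] that by simp
    also have "\<dots> \<le> s * norm v + s * norm w"
      using that by (intro add_mono mult_right_mono) auto
    also have "\<dots> < s * (2 * (norm v + norm w + 1))"
      using s by (auto simp: algebra_simps intro!: add_nonneg_pos)
    also have "\<dots> = d" unfolding s_def by (simp add: add_nonneg_pos less_imp_neq[symmetric])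
    finally show ?thesis by (simp add: dist_norm add.assoc)
  qed
  obtain \<xi> \<eta> where 1: "0 < \<xi>" "\<xi> < s" "0 < \<eta>" "\<eta> < s"
    "f (x + s *\<^sub>R v + s *\<^sub>R w) - f (x + s *\<^sub>R v) - f (x + s *\<^sub>R w) + f x =
      s\<^sup>2 * ?A v w (x + \<xi> *\<^sub>R v + \<eta> *\<^sub>R w)"
    using second_difference_mean_value[OF s _ f, of x v w] near close by blast
  have "x + \<xi> *\<^sub>R w + \<eta> *\<^sub>R v \<in> S" if "0 \<le> \<xi>" "\<xi> \<le> s" "0 \<le> \<eta>" "\<eta> \<le> s" for \<xi> \<eta>
    using near[OF close[of \<eta> \<xi>]] that by (simp add: add_ac)
  from second_difference_mean_value[OF s this f]
  obtain \<xi>' \<eta>' where 2: "0 < \<xi>'" "\<xi>' < s" "0 < \<eta>'" "\<eta>' < s"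
    "f (x + s *\<^sub>R w + s *\<^sub>R v) - f (x + s *\<^sub>R w) - f (x + s *\<^sub>R v) + f x =
      s\<^sup>2 * ?A w v (x + \<xi>' *\<^sub>R w + \<eta>' *\<^sub>R v)" by blast
  have "x + s *\<^sub>R v + s *\<^sub>R w = x + s *\<^sub>R w + s *\<^sub>R v" by (simp add: add_ac)
  note 1(5)[unfolded this]
  then have "s\<^sup>2 * ?A v w (x + \<xi> *\<^sub>R v + \<eta> *\<^sub>R w) = s\<^sup>2 * ?A w v (x + \<xi>' *\<^sub>R w + \<eta>' *\<^sub>R v)"
    using 2(5) by linarith
  moreover have "x + \<xi>' *\<^sub>R w + \<eta>' *\<^sub>R v = x + \<eta>' *\<^sub>R v + \<xi>' *\<^sub>R w" by (simp add: add_ac)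
  ultimately have "?A v w (x + \<xi> *\<^sub>R v + \<eta> *\<^sub>R w) = ?A w v (x + \<eta>' *\<^sub>R v + \<xi>' *\<^sub>R w)"
    using s by simp
  moreover have "\<bar>?A v w (x + \<xi> *\<^sub>R v + \<eta> *\<^sub>R w) - ?A v w x\<bar> < e"
    using near[OF close[of \<xi> \<eta>]] 1 by simp
  moreover have "\<bar>?A w v (x + \<eta>' *\<^sub>R v + \<xi>' *\<^sub>R w) - ?A w v x\<bar> < e"
    using near[OF close[of \<eta>' \<xi>']] 2 by simp
  ultimately show False unfolding e_def by (simp add: abs_if split: if_splits)
qed

subsection \<open>Local inversion of smooth maps\<close>

lemma inv_linear_conv_matrix_inv:
  fixes L :: "real^'n \<Rightarrow> real^'n"
  assumes "linear L" "bij L"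
  shows "inv L v = matrix_inv (matrix L) *v v" and "invertible (matrix L)"
proof -
  have L: "matrix L *v x = L x" for x
    using assms(1) by (simp add: matrix_vector_mul)
  then have "(*v) (matrix L) = L" by auto
  then show inv: "invertible (matrix L)"
    unfolding invertible_eq_bij using assms(2) by simp
  have "L (matrix_inv (matrix L) *v v) = matrix L *v (matrix_inv (matrix L) *v v)"
    by (simp add: L)
  also have "\<dots> = v"
    by (simp add: matrix_vector_mul_assoc matrix_inv_right_left inv)
  finally show "inv L v = matrix_inv (matrix L) *v v"
    using assms(2) by (intro inv_f_eq) (auto simp: bij_is_inj)
qed

text \<open>The inverse function theorem yields a once differentiable inverse. Its derivative is
  the inverse of the derivative at the preimage, hence a smooth function of the inverse map
  itself, so that the inverse gains one order of differentiability at a time.\<close>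

lemma smooth_inverse_function:
  fixes f :: "real^'n \<Rightarrow> real^'n"
  assumes S: "open S" "x0 \<in> S" and f: "smooth_on S f"
    and inj: "inj (frechet_derivative f (at x0))"
  obtains U V g where "open U" "U \<subseteq> S" "x0 \<in> U" "open V" "homeomorphism U V f g" "smooth_on V g"
    "\<And>x. x \<in> U \<Longrightarrow> bij (frechet_derivative f (at x))"
proof -
  let ?D = "\<lambda>x. frechet_derivative f (at x)"
  define f' where "f' x = Blinfun (?D x)" for x
  have D: "(f has_derivative ?D x) (at x)" if "x \<in> S" for x
    using smooth_on_has_derivative[OF f that] .
  have f': "blinfun_apply (f' x) = ?D x" if "x \<in> S" for x
    unfolding f'_def using bounded_linear_Blinfun_apply has_derivative_bounded_linear[OF D[OF that]]
    by blast
  have cont: "continuous_on S f'"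
  proof (rule continuous_on_blinfun_componentwise)
    fix i :: "real^'n"
    have "continuous_on S (\<lambda>x. ?D x i)"
      by (rule smooth_on_continuous_on[OF smooth_on_frechet_derivative[OF f]])
    then show "continuous_on S (\<lambda>x. blinfun_apply (f' x) i)"
      by (rule continuous_on_eq) (simp add: f')
  qed
  obtain G where G: "linear G" "G \<circ> ?D x0 = id"
    using linear_injective_left_inverse[OF has_derivative_linear[OF D[OF S(2)]] inj] by blast
  have "bounded_linear G" using G(1) linear_conv_bounded_linear by blast
  then have invf: "Blinfun G o\<^sub>L f' x0 = id_blinfun"
    using G(2) by (intro blinfun_eqI) (simp add: bounded_linear_Blinfun_apply f' S(2) pointfree_idE)
  have D': "(f has_derivative blinfun_apply (f' x)) (at x)" if "x \<in> S" for x
    using D[OF that] f'[OF that] by simp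
  obtain U V g g' where U: "open U" "U \<subseteq> S" "x0 \<in> U" and V: "open V" "f x0 \<in> V"
    and hom: "homeomorphism U V f g"
    and g': "\<And>y. y \<in> V \<Longrightarrow> (g has_derivative (g' y)) (at y)"
      "\<And>y. y \<in> V \<Longrightarrow> g' y = inv (blinfun_apply (f'(g y)))"
    and bij: "\<And>y. y \<in> V \<Longrightarrow> bij (blinfun_apply (f'(g y)))"
    using inverse_function_theorem[OF S(1) D' cont S(2) invf] by blast
  have gU: "g y \<in> U" if "y \<in> V" for y using hom that unfolding homeomorphism_def by blast
  have bijD: "bij (?D x)" if "x \<in> U" for x
  proof -
    have "f x \<in> V" "g (f x) = x" using hom that unfolding homeomorphism_def by blast+
    then show ?thesis using bij[of "f x"] f'[of x] U(2) that by auto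
  qed
  have linD: "linear (?D x)" if "x \<in> U" for x
    using has_derivative_linear[OF D] U(2) that by blast
  let ?M = "\<lambda>x. matrix (?D x)"
  have M: "smooth_on U (\<lambda>x. matrix_inv (?M x) $ i $ j)" for i j
    using inv_linear_conv_matrix_inv(2)[OF linD bijD]
    by (intro smooth_on_matrix_inv U(1))
       (auto simp: matrix_def intro!: smooth_on_nth smooth_on_frechet_derivative U(1)
           smooth_on_subset[OF f U(2)])
  have "Ck_on k V g" for k
  proof (induction k)
    case 0
    then show ?case using hom by (simp add: homeomorphism_def)
  next
    case (Suc k)
    show ?case
    proof (rule Ck_on_SucI[OF V(1)])
      show "(g has_derivative (\<lambda>v. matrix_inv (?M (g y)) *v v)) (at y)" if "y \<in> V" for y
      proof -
        have "g' y = (\<lambda>v. matrix_inv (?M (g y)) *v v)"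
          using g'(2)[OF that] f'[of "g y"] gU[OF that] U(2)
            inv_linear_conv_matrix_inv(1)[OF linD bijD, of "g y"] by (auto simp: subset_iff)
        then show ?thesis using g'(1)[OF that] by simp
      qed
      have "Ck_on k V (\<lambda>y. matrix_inv (?M (g y)) $ i $ j)" for i j
        using gU Ck_on_compose[OF V(1) U(1) Suc smooth_onD[OF M]] by blast
      then show "Ck_on k V (\<lambda>y. matrix_inv (?M (g y)) *v v)" for v
        by (intro Ck_on_componentwise V(1))
           (auto simp: matrix_vector_mult_def intro!: Ck_on_sum Ck_on_mult V(1))
    qed
  qed
  then have "smooth_on V g" by (simp add: smooth_on_def)
  then show ?thesis using that U V hom bijD by blast
qed

text \<open>An isometry moves \<open>b\<close> to the direction of the axis \<open>iu\<close>;
  the image of \<open>X\<close> is then orthogonal to that axis, and a reflection that fixes the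
  coordinate \<open>iu\<close> moves it to the direction of the axis \<open>iv\<close>. Rescaling
  the coordinates corrects the lengths.\<close>

lemma adapted_linear_frame:
  fixes b X :: "real^'n"
  assumes b: "b \<noteq> 0" and X: "X \<noteq> 0" and bX: "b \<bullet> X = 0" and ne: "iu \<noteq> iv"
  obtains L :: "real^'n \<Rightarrow> real^'n"
    where "linear L" "inj L" "\<And>y. L y $ iu = b \<bullet> y" "L X = axis iv 1"
proof -
  obtain Q :: "real^'n \<Rightarrow> real^'n"
    where Q: "orthogonal_transformation Q" "Q (b /\<^sub>R norm b) = axis iu 1"
    using orthogonal_transformation_exists_1[of "b /\<^sub>R norm b" "axis iu 1"] b by auto
  have linQ: "linear Q" and Qd: "Q x \<bullet> Q y = x \<bullet> y" for x y
    using Q(1) by (auto simp: orthogonal_transformation_def)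
  have Qb: "Q y \<bullet> axis iu 1 = (b \<bullet> y) / norm b" for y
    using Qd[of y "b /\<^sub>R norm b"] by (simp add: Q(2) inner_commute divide_inverse)
  define w where "w = Q (X /\<^sub>R norm X)"
  have ww: "w \<bullet> w = 1" using Qd[of "X /\<^sub>R norm X" "X /\<^sub>R norm X"] X by (simp add: w_def
      dot_square_norm power2_eq_square)
  have wu: "w $ iu = 0" using Qb[of "X /\<^sub>R norm X"] bX by (simp add: w_def inner_axis)
  define u where "u = w - axis iv 1"
  have uu: "u \<bullet> u = 2 - 2 * w $ iv"
    by (simp add: u_def inner_diff_left inner_diff_right ww inner_axis inner_axis')
  have uiu: "u $ iu = 0" using ne by (simp add: u_def wu axis_def)
  \<comment> \<open>The reflection that exchanges \<open>w\<close> and the axis vector \<open>iv\<close>; for \<open>u = 0\<close> the quotient is zero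
      and \<open>R\<close> is the identity, as it should be.\<close>
  define R where "R y = y - (2 * (y \<bullet> u) / (u \<bullet> u)) *\<^sub>R u" for y
  have linR: "linear R"
    by (rule linearI) (simp_all add: R_def inner_left_distrib add_divide_distrib scaleR_add_left
        algebra_simps)
  have Riu: "R y $ iu = y $ iu" for y by (simp add: R_def uiu)
  have RR: "R (R y) = y" for y
  proof (cases "u = 0")
    case False
    then have "R y \<bullet> u = - (y \<bullet> u)" by (simp add: R_def inner_diff_left)
    then show ?thesis by (simp add: R_def[of "R y"]) (simp add: R_def)
  qed (simp add: R_def)
  have Rw: "R w = axis iv 1"
  proof (cases "u = 0")
    case True then show ?thesis by (simp add: R_def) (simp add: u_def)
  next
    case False
    have "2 * (w \<bullet> u) = u \<bullet> u"
      by (simp add: uu) (simp add: u_def inner_diff_right ww inner_axis)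
    then have "R w = w - u" using False by (simp add: R_def)
    then show ?thesis by (simp add: u_def)
  qed
  define L where "L y = (\<chi> i. (if i = iu then norm b else 1 / norm X) * R (Q y) $ i)" for y
  have RQ: "linear (\<lambda>y. R (Q y))" using linear_compose[OF linQ linR] by (simp add: o_def)
  have "linear L"
    by (rule linearI)
       (simp_all add: L_def vec_eq_iff linear_add[OF RQ] linear_cmul[OF RQ] algebra_simps)
  moreover have "inj L"
  proof (rule injI)
    fix x y assume "L x = L y"
    then have eq: "L x $ i = L y $ i" for i by simp
    have "R (Q x) $ i = R (Q y) $ i" for i
      using b X eq[of i] by (cases "i = iu") (simp_all add: L_def)
    then have "R (Q x) = R (Q y)" by (simp add: vec_eq_iff)
    then have "Q x = Q y" by (metis RR)
    then show "x = y" using orthogonal_transformation_inj[OF Q(1)] by (simp add: inj_eq)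
  qed
  moreover have "L y $ iu = b \<bullet> y" for y
    using Qb[of y] b by (simp add: L_def Riu inner_axis)
  moreover have "L X = axis iv 1"
  proof -
    have "X = norm X *\<^sub>R (X /\<^sub>R norm X)" using X by simp
    then have "R (Q X) = norm X *\<^sub>R axis iv 1"
      using linear_cmul[OF RQ, of "norm X" "X /\<^sub>R norm X"] Rw by (simp add: w_def)
    then show ?thesis using X ne by (simp add: L_def vec_eq_iff axis_def)
  qed
  ultimately show ?thesis using that by blast
qed

section \<open>Convergence of sequences of maps with all derivatives\<close>

text \<open>Boundedness is part of the notion because products of uniformly Cauchy sequences are
  uniformly Cauchy only for bounded factors.\<close>

definition uniformly_Cauchy_bounded ::
  "'a set \<Rightarrow> (nat \<Rightarrow> 'a \<Rightarrow> 'b::real_normed_vector) \<Rightarrow> bool" where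
  "uniformly_Cauchy_bounded S f \<longleftrightarrow> (\<exists>C. \<forall>n. \<forall>x\<in>S. norm (f n x) \<le> C) \<and>
     (\<forall>e>0. \<exists>N. \<forall>m\<ge>N. \<forall>n\<ge>N. \<forall>x\<in>S. norm (f m x - f n x) \<le> e)"

text \<open>The analogue of \<open>Ck_on\<close> for sequences: all directional derivatives up
  to order \<open>k\<close> converge uniformly. The flow of a vector field will be a limit in this
  sense of its Picard iterates, each of which is smooth for trivial reasons.\<close>

primrec Ck_Cauchy ::
  "nat \<Rightarrow> 'a::real_normed_vector set \<Rightarrow> (nat \<Rightarrow> 'a \<Rightarrow> 'b::real_normed_vector) \<Rightarrow> bool" where
  "Ck_Cauchy 0 S f \<longleftrightarrow> uniformly_Cauchy_bounded S f"
| "Ck_Cauchy (Suc k) S f \<longleftrightarrow> uniformly_Cauchy_bounded S f \<and>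
     (\<forall>v. Ck_Cauchy k S (\<lambda>n x. frechet_derivative (f n) (at x) v))"

lemma uniformly_Cauchy_boundedE:
  assumes "uniformly_Cauchy_bounded S f"
  obtains C where "C > 0" "\<And>n x. x \<in> S \<Longrightarrow> norm (f n x) \<le> C"
  using assms unfolding uniformly_Cauchy_bounded_def
  by (metis less_numeral_extra(1) max.cobounded2 max.coboundedI1 max.strict_coboundedI2
      order.strict_trans2 linorder_not_le max_less_iff_conj)

lemma uniformly_Cauchy_boundedD:
  assumes "uniformly_Cauchy_bounded S f" "e > 0"
  obtains N where "\<And>m n x. m \<ge> N \<Longrightarrow> n \<ge> N \<Longrightarrow> x \<in> S \<Longrightarrow> norm (f m x - f n x) \<le> e"
  using assms unfolding uniformly_Cauchy_bounded_def by blast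

lemma uniformly_Cauchy_boundedI:
  assumes "\<And>n x. x \<in> S \<Longrightarrow> norm (f n x) \<le> C"
    "\<And>e. e > 0 \<Longrightarrow> \<exists>N. \<forall>m\<ge>N. \<forall>n\<ge>N. \<forall>x\<in>S. norm (f m x - f n x) \<le> e"
  shows "uniformly_Cauchy_bounded S f"
  using assms unfolding uniformly_Cauchy_bounded_def by blast

lemma uniformly_Cauchy_bounded_cong:
  "(\<And>n x. x \<in> S \<Longrightarrow> f n x = g n x) \<Longrightarrow> uniformly_Cauchy_bounded S f \<Longrightarrow> uniformly_Cauchy_bounded S g"
  unfolding uniformly_Cauchy_bounded_def by auto

lemma uniformly_Cauchy_bounded_const:
  assumes "\<And>x. x \<in> S \<Longrightarrow> norm (g x) \<le> C" shows "uniformly_Cauchy_bounded S (\<lambda>n. g)"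
  using assms by (intro uniformly_Cauchy_boundedI[where C = C]) auto

lemma uniformly_Cauchy_bounded_shift:
  assumes f: "uniformly_Cauchy_bounded S (\<lambda>n. f (Suc n))" and "uniformly_Cauchy_bounded S (\<lambda>n. f 0)"
  shows "uniformly_Cauchy_bounded S f"
proof -
  obtain C0 where f0: "\<And>x. x \<in> S \<Longrightarrow> norm (f 0 x) \<le> C0"
    using uniformly_Cauchy_boundedE[OF assms(2)] by metis
  obtain C where C: "\<And>n x. x \<in> S \<Longrightarrow> norm (f (Suc n) x) \<le> C"
    using uniformly_Cauchy_boundedE[OF f] by metis
  show ?thesis
  proof (rule uniformly_Cauchy_boundedI)
    show "norm (f n x) \<le> max C C0" if "x \<in> S" for n x
      using C[OF that] f0[OF that] by (cases n) (auto intro: max.coboundedI1 max.coboundedI2)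
  next
    fix e :: real assume "e > 0"
    then obtain N where N: "\<And>m n x. m \<ge> N \<Longrightarrow> n \<ge> N \<Longrightarrow> x \<in> S \<Longrightarrow> norm (f (Suc m) x - f (Suc n) x) \<le> e"
      using uniformly_Cauchy_boundedD[OF f] by metis
    have "norm (f m x - f n x) \<le> e" if "m \<ge> Suc N" "n \<ge> Suc N" "x \<in> S" for m n x
      using N[of "m - 1" "n - 1" x] that by simp
    then show "\<exists>N. \<forall>m\<ge>N. \<forall>n\<ge>N. \<forall>x\<in>S. norm (f m x - f n x) \<le> e" by blast
  qed
qed

lemma uniformly_Cauchy_bounded_add:
  assumes f: "uniformly_Cauchy_bounded S f" and g: "uniformly_Cauchy_bounded S g"
  shows "uniformly_Cauchy_bounded S (\<lambda>n x. f n x + g n x)"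
proof -
  obtain C where C: "\<And>n x. x \<in> S \<Longrightarrow> norm (f n x) \<le> C"
    using uniformly_Cauchy_boundedE[OF f] by metis
  obtain D where D: "\<And>n x. x \<in> S \<Longrightarrow> norm (g n x) \<le> D"
    using uniformly_Cauchy_boundedE[OF g] by metis
  show ?thesis
  proof (rule uniformly_Cauchy_boundedI)
    show "norm (f n x + g n x) \<le> C + D" if "x \<in> S" for n x
      using norm_triangle_ineq[of "f n x" "g n x"] C[OF that, of n] D[OF that, of n] by linarith
  next
    fix e :: real assume e: "e > 0"
    then have e2: "e / 2 > 0" by simp
    obtain N where N: "\<And>m n x. m \<ge> N \<Longrightarrow> n \<ge> N \<Longrightarrow> x \<in> S \<Longrightarrow> norm (f m x - f n x) \<le> e / 2"
      using uniformly_Cauchy_boundedD[OF f e2] by metis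
    obtain M where M: "\<And>m n x. m \<ge> M \<Longrightarrow> n \<ge> M \<Longrightarrow> x \<in> S \<Longrightarrow> norm (g m x - g n x) \<le> e / 2"
      using uniformly_Cauchy_boundedD[OF g e2] by metis
    have "norm (f m x + g m x - (f n x + g n x)) \<le> e"
      if "m \<ge> max M N" "n \<ge> max M N" "x \<in> S" for m n x
    proof -
      have "norm (f m x + g m x - (f n x + g n x)) \<le> norm (f m x - f n x) + norm (g m x - g n x)"
        by (rule norm_diff_triangle_ineq)
      then show ?thesis using N[of m n x] M[of m n x] that by simp
    qed
    then show "\<exists>N. \<forall>m\<ge>N. \<forall>n\<ge>N. \<forall>x\<in>S. norm (f m x + g m x - (f n x + g n x)) \<le> e" by blast
  qed
qed

lemma uniformly_Cauchy_bounded_scaleR: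
  assumes f: "uniformly_Cauchy_bounded S f" and g: "uniformly_Cauchy_bounded S g"
  shows "uniformly_Cauchy_bounded S (\<lambda>n x. f n x *\<^sub>R g n x)"
proof -
  obtain C where C0: "C > 0" and C: "\<And>n x. x \<in> S \<Longrightarrow> norm (f n x) \<le> C"
    using uniformly_Cauchy_boundedE[OF f] by metis
  obtain D where D0: "D > 0" and D: "\<And>n x. x \<in> S \<Longrightarrow> norm (g n x) \<le> D"
    using uniformly_Cauchy_boundedE[OF g] by metis
  show ?thesis
  proof (rule uniformly_Cauchy_boundedI)
    show "norm (f n x *\<^sub>R g n x) \<le> C * D" if "x \<in> S" for n x
      using C[OF that, of n] D[OF that, of n] C0 by (auto intro!: mult_mono)
  next
    fix e :: real assume e: "e > 0"
    then have e1: "e / (2 * D) > 0" and e2: "e / (2 * C) > 0" using C0 D0 by auto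
    obtain N where N: "\<And>m n x. m \<ge> N \<Longrightarrow> n \<ge> N \<Longrightarrow> x \<in> S \<Longrightarrow> norm (f m x - f n x) \<le> e / (2 * D)"
      using uniformly_Cauchy_boundedD[OF f e1] by metis
    obtain M where M: "\<And>m n x. m \<ge> M \<Longrightarrow> n \<ge> M \<Longrightarrow> x \<in> S \<Longrightarrow> norm (g m x - g n x) \<le> e / (2 * C)"
      using uniformly_Cauchy_boundedD[OF g e2] by metis
    have "norm (f m x *\<^sub>R g m x - f n x *\<^sub>R g n x) \<le> e"
      if "m \<ge> max M N" "n \<ge> max M N" "x \<in> S" for m n x
    proof -
      have "f m x *\<^sub>R g m x - f n x *\<^sub>R g n x = (f m x - f n x) *\<^sub>R g m x + f n x *\<^sub>R (g m x - g n
          x)"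
        by (simp add: algebra_simps)
      then have "norm (f m x *\<^sub>R g m x - f n x *\<^sub>R g n x) \<le>
          norm (f m x - f n x) * norm (g m x) + norm (f n x) * norm (g m x - g n x)"
        by (metis norm_scaleR norm_triangle_ineq real_norm_def)
      also have "\<dots> \<le> (e / (2 * D)) * D + C * (e / (2 * C))"
        using N[of m n x] M[of m n x] C[of x n] D[of x m] that C0 D0
        by (intro add_mono mult_mono) auto
      also have "\<dots> = e" using C0 D0 by (simp add: field_simps)
      finally show ?thesis .
    qed
    then show "\<exists>N. \<forall>m\<ge>N. \<forall>n\<ge>N. \<forall>x\<in>S. norm (f m x *\<^sub>R g m x - f n x *\<^sub>R g n x) \<le> e" by blast
  qed
qed

lemma uniformly_Cauchy_bounded_inner:
  fixes f :: "nat \<Rightarrow> 'a \<Rightarrow> 'b::euclidean_space"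
  assumes f: "uniformly_Cauchy_bounded S f"
  shows "uniformly_Cauchy_bounded S (\<lambda>n x. f n x \<bullet> b)"
proof -
  obtain C where C: "\<And>n x. x \<in> S \<Longrightarrow> norm (f n x) \<le> C"
    using uniformly_Cauchy_boundedE[OF f] by metis
  show ?thesis
  proof (rule uniformly_Cauchy_boundedI)
    show "norm (f n x \<bullet> b) \<le> C * norm b" if "x \<in> S" for n x
      using Cauchy_Schwarz_ineq2[of "f n x" b] mult_right_mono[OF C[OF that, of n], of "norm b"] by
          simp
  next
    fix e :: real assume e: "e > 0"
    then have e1: "e / (norm b + 1) > 0" by (simp add: add_nonneg_pos)
    obtain N where N: "\<And>m n x. m \<ge> N \<Longrightarrow> n \<ge> N \<Longrightarrow> x \<in> S \<Longrightarrow> norm (f m x - f n x) \<le> e / (norm b + 1)"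
      using uniformly_Cauchy_boundedD[OF f e1] by metis
    have "norm (f m x \<bullet> b - f n x \<bullet> b) \<le> e" if "m \<ge> N" "n \<ge> N" "x \<in> S" for m n x
    proof -
      have "norm (f m x \<bullet> b - f n x \<bullet> b) \<le> norm (f m x - f n x) * norm b"
        using Cauchy_Schwarz_ineq2[of "f m x - f n x" b] by (simp add: inner_diff_left)
      also have "\<dots> \<le> (e / (norm b + 1)) * (norm b + 1)"
        using N[OF that] e by (intro mult_mono) auto
      also have "\<dots> = e" by (simp add: add_nonneg_pos less_imp_neq[symmetric])
      finally show ?thesis .
    qed
    then show "\<exists>N. \<forall>m\<ge>N. \<forall>n\<ge>N. \<forall>x\<in>S. norm (f m x \<bullet> b - f n x \<bullet> b) \<le> e" by blast
  qed
qed

lemma uniformly_Cauchy_bounded_compose: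
  assumes f: "uniformly_Cauchy_bounded S f" and fK: "\<And>n x. x \<in> S \<Longrightarrow> f n x \<in> K"
    and K: "compact K" and X: "continuous_on K X"
  shows "uniformly_Cauchy_bounded S (\<lambda>n x. X (f n x))"
proof -
  have "bounded (X ` K)" using compact_continuous_image[OF X K] by (rule compact_imp_bounded)
  then obtain C where C: "\<And>y. y \<in> K \<Longrightarrow> norm (X y) \<le> C" unfolding bounded_iff by auto
  have uc: "uniformly_continuous_on K X" using compact_uniformly_continuous[OF X K] .
  show ?thesis
  proof (rule uniformly_Cauchy_boundedI)
    show "norm (X (f n x)) \<le> C" if "x \<in> S" for n x using C fK that by blast
  next
    fix e :: real assume e: "e > 0"
    then obtain d where d: "d > 0" "\<And>y z. y \<in> K \<Longrightarrow> z \<in> K \<Longrightarrow> dist z y < d \<Longrightarrow> dist (X z) (X y) < e"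
      using uc unfolding uniformly_continuous_on_def by metis
    then have d2: "d / 2 > 0" by simp
    obtain N where N: "\<And>m n x. m \<ge> N \<Longrightarrow> n \<ge> N \<Longrightarrow> x \<in> S \<Longrightarrow> norm (f m x - f n x) \<le> d / 2"
      using uniformly_Cauchy_boundedD[OF f d2] by metis
    have "norm (X (f m x) - X (f n x)) \<le> e" if "m \<ge> N" "n \<ge> N" "x \<in> S" for m n x
    proof -
      have "dist (f m x) (f n x) < d" using N[OF that] d by (simp add: dist_norm)
      then show ?thesis using d(2)[OF fK fK] that by (fastforce simp: dist_norm)
    qed
    then show "\<exists>N. \<forall>m\<ge>N. \<forall>n\<ge>N. \<forall>x\<in>S. norm (X (f m x) - X (f n x)) \<le> e" by blast
  qed
qed

lemma Ck_Cauchy_imp_uniformly: "Ck_Cauchy k S f \<Longrightarrow> uniformly_Cauchy_bounded S f"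
  by (cases k) auto

lemma Ck_Cauchy_frechet_derivative:
  "Ck_Cauchy (Suc k) S f \<Longrightarrow> Ck_Cauchy k S (\<lambda>n x. frechet_derivative (f n) (at x) v)"
  unfolding Ck_Cauchy.simps by blast

lemma Ck_Cauchy_SucD: "Ck_Cauchy (Suc k) S f \<Longrightarrow> Ck_Cauchy k S f"
proof (induction k arbitrary: f)
  case (Suc k)
  show ?case unfolding Ck_Cauchy.simps(2)[of k]
  proof (intro conjI allI)
    show "uniformly_Cauchy_bounded S f" using Suc.prems by simp
    show "Ck_Cauchy k S (\<lambda>n x. frechet_derivative (f n) (at x) v)" for v
      using Suc.prems by (intro Suc.IH) (simp only: Ck_Cauchy.simps(2)[of "Suc k" S f])
  qed
qed simp

lemma frechet_derivative_cong_open: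
  assumes "open S" "x \<in> S" "\<And>y. y \<in> S \<Longrightarrow> f y = g y"
  shows "frechet_derivative f (at x) = frechet_derivative g (at x)"
proof -
  have "(f has_derivative f') (at x) \<longleftrightarrow> (g has_derivative f') (at x)" for f'
    using has_derivative_transform_within_open[of f f' x UNIV S g]
      has_derivative_transform_within_open[of g f' x UNIV S f] assms by auto
  then show ?thesis unfolding frechet_derivative_def by simp
qed

lemma Ck_Cauchy_cong:
  assumes "open S" and "\<And>n x. x \<in> S \<Longrightarrow> f n x = g n x" and "Ck_Cauchy k S f"
  shows "Ck_Cauchy k S g"
  using assms(2,3)
proof (induction k arbitrary: f g)
  case 0
  then show ?case by (auto intro: uniformly_Cauchy_bounded_cong[of S f g])
next
  case (Suc k)
  have D: "frechet_derivative (f n) (at x) v = frechet_derivative (g n) (at x) v" if "x \<in> S" for n x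
      v
    using frechet_derivative_cong_open[OF assms(1) that, of "f n" "g n"] Suc.prems by simp
  show ?case unfolding Ck_Cauchy.simps(2)
  proof (intro conjI allI)
    show "uniformly_Cauchy_bounded S g"
      using uniformly_Cauchy_bounded_cong[of S f g] Suc.prems by simp
    show "Ck_Cauchy k S (\<lambda>n x. frechet_derivative (g n) (at x) v)" for v
      by (rule Suc.IH[of "\<lambda>n x. frechet_derivative (f n) (at x) v"]) (use D Suc.prems in auto)
  qed
qed

lemma Ck_Cauchy_SucI:
  assumes "open S" and "\<And>n x. x \<in> S \<Longrightarrow> (f n has_derivative f' n x) (at x)"
    and "uniformly_Cauchy_bounded S f" and "\<And>v. Ck_Cauchy k S (\<lambda>n x. f' n x v)"
  shows "Ck_Cauchy (Suc k) S f"
  unfolding Ck_Cauchy.simps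
proof (intro conjI allI)
  show "Ck_Cauchy k S (\<lambda>n x. frechet_derivative (f n) (at x) v)" for v
    by (rule Ck_Cauchy_cong[OF assms(1) _ assms(4)[of v]])
       (use assms(2) frechet_derivative_at in metis)
qed (rule assms)

lemma Ck_Cauchy_const: "Ck_Cauchy k S (\<lambda>n x. c)"
  by (induction k arbitrary: c) (auto intro: uniformly_Cauchy_bounded_const[of S _ "norm c" for c])

text \<open>A recursion expresses the derivatives of the member \<open>Suc n\<close>; the first
  member has to be treated separately.\<close>

lemma Ck_Cauchy_shift:
  assumes "Ck_Cauchy k S (\<lambda>n. f (Suc n))" "Ck_Cauchy k S (\<lambda>n. f 0)"
  shows "Ck_Cauchy k S f"
  using assms
proof (induction k arbitrary: f)
  case 0
  then show ?case
    by (simp add: uniformly_Cauchy_bounded_shift)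
next
  case (Suc k)
  show ?case unfolding Ck_Cauchy.simps
  proof (intro conjI allI)
    show "uniformly_Cauchy_bounded S f"
      using Suc.prems by (simp add: uniformly_Cauchy_bounded_shift)
    show "Ck_Cauchy k S (\<lambda>n x. frechet_derivative (f n) (at x) v)" for v
      by (rule Suc.IH) (use Suc.prems in \<open>simp_all only: Ck_Cauchy.simps\<close>)
  qed
qed

lemma Ck_Cauchy_add:
  assumes "open S" "\<And>n. smooth_on S (f n)" "\<And>n. smooth_on S (g n)" "Ck_Cauchy k S f" "Ck_Cauchy k S
      g"
  shows "Ck_Cauchy k S (\<lambda>n x. f n x + g n x)"
  using assms(2-)
proof (induction k arbitrary: f g)
  case 0
  then show ?case by (simp add: uniformly_Cauchy_bounded_add)
next
  case (Suc k)
  show ?case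
  proof (rule Ck_Cauchy_SucI[OF assms(1)])
    show "((\<lambda>x. f n x + g n x) has_derivative
        (\<lambda>v. frechet_derivative (f n) (at x) v + frechet_derivative (g n) (at x) v)) (at x)"
      if "x \<in> S" for x n
      by (intro has_derivative_add smooth_on_has_derivative[OF _ that] Suc.prems)
    show "Ck_Cauchy k S (\<lambda>n x. frechet_derivative (f n) (at x) v + frechet_derivative (g n) (at x)
        v)" for v
      using Suc.prems by (intro Suc.IH smooth_on_frechet_derivative) auto
  qed (use Suc.prems in \<open>simp add: uniformly_Cauchy_bounded_add\<close>)
qed

lemma Ck_Cauchy_scaleR:
  assumes "open S" "\<And>n. smooth_on S (f n)" "\<And>n. smooth_on S (g n)" "Ck_Cauchy k S f" "Ck_Cauchy k S
      g"
  shows "Ck_Cauchy k S (\<lambda>n x. f n x *\<^sub>R g n x)"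
  using assms(2-)
proof (induction k arbitrary: f g)
  case 0
  then show ?case by (simp add: uniformly_Cauchy_bounded_scaleR)
next
  case (Suc k)
  show ?case
  proof (rule Ck_Cauchy_SucI[OF assms(1)])
    show "((\<lambda>x. f n x *\<^sub>R g n x) has_derivative (\<lambda>v.
        f n x *\<^sub>R frechet_derivative (g n) (at x) v + frechet_derivative (f n) (at x) v *\<^sub>R g n x))
            (at x)"
      if "x \<in> S" for x n
      by (intro has_derivative_scaleR smooth_on_has_derivative[OF _ that] Suc.prems)
    show "Ck_Cauchy k S (\<lambda>n x. f n x *\<^sub>R frechet_derivative (g n) (at x) v
        + frechet_derivative (f n) (at x) v *\<^sub>R g n x)" for v
      using Suc.prems Ck_Cauchy_SucD[OF Suc.prems(3)] Ck_Cauchy_SucD[OF Suc.prems(4)]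
      by (intro Ck_Cauchy_add Suc.IH smooth_on_scaleR smooth_on_frechet_derivative assms(1)) auto
  qed (use Suc.prems in \<open>simp add: uniformly_Cauchy_bounded_scaleR\<close>)
qed

lemma Ck_Cauchy_sum:
  assumes "open S" "\<And>i n. i \<in> I \<Longrightarrow> smooth_on S (f i n)" "\<And>i. i \<in> I \<Longrightarrow> Ck_Cauchy k S (f i)"
  shows "Ck_Cauchy k S (\<lambda>n x. \<Sum>i\<in>I. f i n x)"
  using assms(2-)
  by (induction I rule: infinite_finite_induct)
     (auto intro!: Ck_Cauchy_add Ck_Cauchy_const smooth_on_sum assms(1))

lemma smooth_on_inner: "open S \<Longrightarrow> smooth_on S f \<Longrightarrow> smooth_on S (\<lambda>x. f x \<bullet> b)"
  by (rule smooth_on_bounded_linear_compose[OF bounded_linear_inner_left])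

lemma Ck_Cauchy_inner:
  fixes f :: "nat \<Rightarrow> 'a::real_normed_vector \<Rightarrow> 'b::euclidean_space"
  assumes "open S" "\<And>n. smooth_on S (f n)" "Ck_Cauchy k S f"
  shows "Ck_Cauchy k S (\<lambda>n x. f n x \<bullet> b)"
  using assms(2-)
proof (induction k arbitrary: f)
  case 0
  then show ?case by (simp add: uniformly_Cauchy_bounded_inner)
next
  case (Suc k)
  show ?case
  proof (rule Ck_Cauchy_SucI[OF assms(1)])
    show "((\<lambda>x. f n x \<bullet> b) has_derivative (\<lambda>v. frechet_derivative (f n) (at x) v \<bullet> b)) (at x)"
      if "x \<in> S" for x n
      by (intro has_derivative_inner_left smooth_on_has_derivative[OF _ that] Suc.prems)
    show "Ck_Cauchy k S (\<lambda>n x. frechet_derivative (f n) (at x) v \<bullet> b)" for v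
      using Suc.prems by (intro Suc.IH smooth_on_frechet_derivative) auto
  qed (use Suc.prems in \<open>simp add: uniformly_Cauchy_bounded_inner\<close>)
qed

lemma has_derivative_compose_Basis:
  fixes X :: "'b::euclidean_space \<Rightarrow> 'c::real_normed_vector"
  assumes "smooth_on O' X" "smooth_on S f" "x \<in> S" "f x \<in> O'"
  shows "((\<lambda>x. X (f x)) has_derivative (\<lambda>v. \<Sum>b\<in>Basis.
     (frechet_derivative f (at x) v \<bullet> b) *\<^sub>R frechet_derivative X (at (f x)) b)) (at x)"
  by (rule has_derivative_eq_rhs[OF has_derivative_compose[OF smooth_on_has_derivative[OF
      assms(2,3)]
        smooth_on_has_derivative[OF assms(1,4)]]])
     (rule ext, rule frechet_derivative_Basis[OF smooth_on_differentiable[OF assms(1,4)]])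

lemma Ck_Cauchy_compose:
  fixes X :: "'b::euclidean_space \<Rightarrow> 'c::real_normed_vector"
    and f :: "nat \<Rightarrow> 'a::real_normed_vector \<Rightarrow> 'b"
  assumes S: "open S" and f: "\<And>n. smooth_on S (f n)" and "Ck_Cauchy k S f"
    and K: "compact K" "K \<subseteq> O'" "open O'" "\<And>n x. x \<in> S \<Longrightarrow> f n x \<in> K" and X: "smooth_on O' X"
  shows "Ck_Cauchy k S (\<lambda>n x. X (f n x))"
  using assms(3) X
proof (induction k arbitrary: X)
  case 0
  have "continuous_on K X" using continuous_on_subset[OF smooth_on_continuous_on[OF 0(2)] K(2)] .
  then show ?case
    using uniformly_Cauchy_bounded_compose[OF _ K(4) K(1)] 0(1) by auto
next
  case (Suc k)
  have "continuous_on K X" using continuous_on_subset[OF smooth_on_continuous_on[OF Suc.prems(2)]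
      K(2)] .
  then have "uniformly_Cauchy_bounded S (\<lambda>n x. X (f n x))"
    using uniformly_Cauchy_bounded_compose[OF _ K(4) K(1)] Suc.prems(1) by auto
  moreover have "((\<lambda>x. X (f n x)) has_derivative (\<lambda>v. \<Sum>b\<in>Basis. (frechet_derivative (f n) (at x) v \<bullet>
      b)
      *\<^sub>R frechet_derivative X (at (f n x)) b)) (at x)" if "x \<in> S" for n x
    using has_derivative_compose_Basis[OF Suc.prems(2) f that] K(2) K(4)[OF that] by blast
  moreover have "Ck_Cauchy k S (\<lambda>n x. \<Sum>b\<in>Basis. (frechet_derivative (f n) (at x) v \<bullet> b)
      *\<^sub>R frechet_derivative X (at (f n x)) b)" for v
  proof (intro Ck_Cauchy_sum Ck_Cauchy_scaleR S smooth_on_scaleR smooth_on_inner Ck_Cauchy_inner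
        smooth_on_frechet_derivative f smooth_on_compose[OF S K(3) f smooth_on_frechet_derivative[OF
            Suc.prems(2)]])
    show "f n ` S \<subseteq> O'" for n using K(2,4) by blast
    then show "f n ` S \<subseteq> O'" for n .
    show "Ck_Cauchy k S (\<lambda>n x. frechet_derivative X (at (f n x)) b)" for b
      by (intro Suc.IH Ck_Cauchy_SucD[OF Suc.prems(1)] smooth_on_frechet_derivative Suc.prems(2))
    show "Ck_Cauchy k S (\<lambda>n x. frechet_derivative (f n) (at x) v)" using Suc.prems(1) by simp
  qed
  ultimately show ?case by (intro Ck_Cauchy_SucI[OF S])
qed

text \<open>Uniform convergence of the derivatives in each fixed direction is, in finite
  dimension, uniform on the unit ball of directions, which is what interchanging limit and
  derivative requires.\<close>

lemma Ck_Cauchy_has_derivative_limit: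
  fixes f :: "nat \<Rightarrow> 'a::euclidean_space \<Rightarrow> 'b::banach"
  assumes S: "open S" "convex S" and f: "\<And>n. smooth_on S (f n)"
    and C: "\<And>v. uniformly_Cauchy_bounded S (\<lambda>n x. frechet_derivative (f n) (at x) v)"
    and l: "\<And>x. x \<in> S \<Longrightarrow> (\<lambda>n. f n x) \<longlonglongrightarrow> l x"
    and x: "x \<in> S"
  shows "(l has_derivative (\<lambda>v. lim (\<lambda>n. frechet_derivative (f n) (at x) v))) (at x)"
    and "(\<lambda>n. frechet_derivative (f n) (at x) v) \<longlonglongrightarrow> lim (\<lambda>n. frechet_derivative (f n) (at x) v)"
proof -
  let ?D = "\<lambda>n x. frechet_derivative (f n) (at x)"
  define g' where "g' x v = lim (\<lambda>n. ?D n x v)" for x v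
  have D: "(f n has_derivative ?D n x) (at x)" if "x \<in> S" for n x
    using smooth_on_has_derivative[OF f that] .
  have conv: "(\<lambda>n. ?D n x v) \<longlonglongrightarrow> g' x v" if "x \<in> S" for x v
  proof -
    have "Cauchy (\<lambda>n. ?D n x v)"
      unfolding Cauchy_iff
    proof (intro allI impI)
      fix e :: real assume "e > 0"
      then have "e / 2 > 0" by simp
      from uniformly_Cauchy_boundedD[OF C[of v] this] obtain N where
        N: "\<And>m n x. m \<ge> N \<Longrightarrow> n \<ge> N \<Longrightarrow> x \<in> S \<Longrightarrow> norm (?D m x v - ?D n x v) \<le> e / 2" by metis
      have "e / 2 < e" using \<open>e > 0\<close> by simp
      then have "\<forall>m\<ge>N. \<forall>n\<ge>N. norm (?D m x v - ?D n x v) < e"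
        using N that le_less_trans by blast
      then show "\<exists>M. \<forall>m\<ge>M. \<forall>n\<ge>M. norm (?D m x v - ?D n x v) < e" by blast
    qed
    then show ?thesis unfolding g'_def by (simp add: Cauchy_convergent_iff convergent_LIMSEQ_iff)
  qed
  then show "(\<lambda>n. ?D n x v) \<longlonglongrightarrow> lim (\<lambda>n. ?D n x v)" using x by (simp add: g'_def)
  have unif: "\<forall>\<^sub>F n in sequentially. \<forall>x\<in>S. \<forall>h. norm (?D n x h - g' x h) \<le> e * norm h" if e: "e > 0"
      for e
  proof -
    define e' where "e' = e / DIM('a)"
    have e': "e' > 0" using e by (simp add: e'_def)
    have "\<forall>\<^sub>F n in sequentially. \<forall>x\<in>S. norm (?D n x b - g' x b) \<le> e'" for b
    proof -
      obtain N where N: "\<And>m n x. m \<ge> N \<Longrightarrow> n \<ge> N \<Longrightarrow> x \<in> S \<Longrightarrow> norm (?D m x b - ?D n x b) \<le> e'"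
        using uniformly_Cauchy_boundedD[OF C[of b] e'] by metis
      have "norm (?D m x b - g' x b) \<le> e'" if "m \<ge> N" "x \<in> S" for m x
      proof (rule LIMSEQ_le_const2)
        show "(\<lambda>n. norm (?D m x b - ?D n x b)) \<longlonglongrightarrow> norm (?D m x b - g' x b)"
          by (intro tendsto_intros conv that)
        show "\<exists>M. \<forall>n\<ge>M. norm (?D m x b - ?D n x b) \<le> e'" using N that by blast
      qed
      then show ?thesis unfolding eventually_sequentially by blast
    qed
    then have "\<forall>\<^sub>F n in sequentially. \<forall>b\<in>Basis. \<forall>x\<in>S. norm (?D n x b - g' x b) \<le> e'"
      by (intro eventually_ball_finite) auto
    then show ?thesis
    proof (rule eventually_mono, intro ballI allI)
      fix n x and h :: 'a assume b: "\<forall>b\<in>Basis. \<forall>x\<in>S. norm (?D n x b - g' x b) \<le> e'" and x: "x \<in> S"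
      have Dh: "?D n x h = (\<Sum>b\<in>Basis. (h \<bullet> b) *\<^sub>R ?D n x b)" for n
        by (rule frechet_derivative_Basis) (use D[OF x] differentiable_def in blast)
      have "(\<lambda>n. ?D n x h) \<longlonglongrightarrow> (\<Sum>b\<in>Basis. (h \<bullet> b) *\<^sub>R g' x b)"
        unfolding Dh by (intro tendsto_intros conv x)
      then have gh: "g' x h = (\<Sum>b\<in>Basis. (h \<bullet> b) *\<^sub>R g' x b)"
        using LIMSEQ_unique conv[OF x] by blast
      have "norm (?D n x h - g' x h) = norm (\<Sum>b\<in>Basis. (h \<bullet> b) *\<^sub>R (?D n x b - g' x b))"
        unfolding Dh gh by (simp add: sum_subtractf scaleR_diff_right)
      also have "\<dots> \<le> (\<Sum>b\<in>(Basis::'a set). norm h * e')"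
        using b x by (intro sum_norm_le) (auto intro!: mult_mono simp: Basis_le_norm)
      also have "\<dots> = e * norm h" by (simp add: e'_def)
      finally show "norm (?D n x h - g' x h) \<le> e * norm h" .
    qed
  qed
  have "\<exists>g. \<forall>x\<in>S. (\<lambda>n. f n x) \<longlonglongrightarrow> g x \<and> (g has_derivative g' x) (at x within S)"
    by (rule has_derivative_sequence[where f = f and f' = ?D and g' = g' and l = "l x", OF S(2) _
        unif x l[OF x]]) (rule has_derivative_at_withinI[OF D])
  then obtain g where g: "\<And>x. x \<in> S \<Longrightarrow> (\<lambda>n. f n x) \<longlonglongrightarrow> g x"
      "\<And>x. x \<in> S \<Longrightarrow> (g has_derivative g' x) (at x within S)" by blast
  have "g y = l y" if "y \<in> S" for y using LIMSEQ_unique[OF g(1)[OF that] l[OF that]] .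
  moreover have "(g has_derivative g' x) (at x)" using g(2)[OF x] at_within_open[OF x S(1)] by simp
  ultimately have "(l has_derivative g' x) (at x)"
    using has_derivative_transform_within_open[of g "g' x" x UNIV S l] S x by auto
  then show "(l has_derivative (\<lambda>v. lim (\<lambda>n. ?D n x v))) (at x)" by (simp add: g'_def[abs_def])
qed

text \<open>One order is lost because continuity of the limit is deduced from its
  differentiability.\<close>

lemma Ck_Cauchy_limit:
  fixes f :: "nat \<Rightarrow> 'a::euclidean_space \<Rightarrow> 'b::banach"
  assumes S: "open S" "convex S" and f: "\<And>n. smooth_on S (f n)" and "Ck_Cauchy (Suc k) S f"
    and l: "\<And>x. x \<in> S \<Longrightarrow> (\<lambda>n. f n x) \<longlonglongrightarrow> l x"
  shows "Ck_on k S l"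
  using assms(3-)
proof (induction k arbitrary: f l)
  case 0
  have "continuous_on S l"
  proof (intro continuous_at_imp_continuous_on ballI)
    fix x assume "x \<in> S"
    then show "isCont l x"
      using 0 has_derivative_continuous[OF Ck_Cauchy_has_derivative_limit(1)[OF S, of f l x]]
      by auto
  qed
  then show ?case by simp
next
  case (Suc k)
  have C: "uniformly_Cauchy_bounded S (\<lambda>n x. frechet_derivative (f n) (at x) v)" for v
    using Suc.prems(2) Ck_Cauchy_imp_uniformly[of "Suc k"] by (metis Ck_Cauchy.simps(2))
  note L = Ck_Cauchy_has_derivative_limit[OF S Suc.prems(1) C Suc.prems(3)]
  show ?case
  proof (rule Ck_on_SucI[OF S(1) L(1)])
    have "Ck_Cauchy (Suc k) S (\<lambda>n x. frechet_derivative (f n) (at x) v)" for v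
      using Suc.prems(2) unfolding Ck_Cauchy.simps(2)[of "Suc k"] by blast
    then show "Ck_on k S (\<lambda>x. lim (\<lambda>n. frechet_derivative (f n) (at x) v))" for v
      by (rule Suc.IH[OF smooth_on_frechet_derivative[OF Suc.prems(1)] _ L(2)])
  qed auto
qed

section \<open>The flow of a smooth vector field\<close>

text \<open>The integral of \<open>g(s, x)\<close> over \<open>s\<close> from \<open>0\<close>
  to \<open>t\<close>, substituted to the fixed interval \<open>{0..1}\<close>: one formula serves
  both signs of \<open>t\<close>, and differentiation under the integral sign applies in all
  variables at once.\<close>

definition time_integral :: "(real \<times> 'a \<Rightarrow> 'b::banach) \<Rightarrow> real \<times> 'a \<Rightarrow> 'b" where
  "time_integral g p = fst p *\<^sub>R integral {0..1} (\<lambda>s. g (s * fst p, snd p))"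

lemma scaled_time_in_slab:
  fixes p :: "real \<times> 'a"
  assumes "p \<in> {-T<..<T} \<times> B" "s \<in> {0..1}" shows "(s * fst p, snd p) \<in> {-T<..<T} \<times> B"
proof -
  have "\<bar>s * fst p\<bar> \<le> \<bar>fst p\<bar>" using assms(2) by (simp add: abs_mult mult_left_le_one_le)
  moreover have "\<bar>fst p\<bar> < T" using assms(1) by auto
  ultimately show ?thesis using assms(1) by auto
qed

lemma time_integral_cong:
  assumes "p \<in> {-T<..<T} \<times> B" "\<And>q. q \<in> {-T<..<T} \<times> B \<Longrightarrow> g q = h q"
  shows "time_integral g p = time_integral h p"
  unfolding time_integral_def
  by (intro arg_cong2[of _ _ _ _ "(*\<^sub>R)"] refl integral_cong assms(2) scaled_time_in_slab assms(1))

lemma continuous_on_scaled_time: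
  fixes g :: "real \<times> 'a::euclidean_space \<Rightarrow> 'b::banach"
  assumes "continuous_on ({-T<..<T} \<times> B) g"
  shows "continuous_on (({-T<..<T} \<times> B) \<times> cbox 0 1) (\<lambda>(p, s). g (s * fst p, snd p))"
proof -
  have "(\<lambda>(p, s). (s * fst p, snd p)) ` (({-T<..<T} \<times> B) \<times> cbox 0 1) \<subseteq> {-T<..<T} \<times> B"
    using scaled_time_in_slab[of _ T B] by auto
  moreover have "continuous_on (({-T<..<T} \<times> B) \<times> cbox 0 1) (\<lambda>(p, s). (s * fst p, snd p))"
    by (auto intro!: continuous_intros simp: case_prod_unfold)
  ultimately show ?thesis
    using continuous_on_compose2[OF assms, of _ "\<lambda>(p, s). (s * fst p, snd p)"] by (simp add:
        case_prod_unfold)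
qed

lemma continuous_on_scaled_time_at:
  fixes g :: "real \<times> 'a::euclidean_space \<Rightarrow> 'b::banach"
  assumes "continuous_on ({-T<..<T} \<times> B) g" "p \<in> {-T<..<T} \<times> B"
  shows "continuous_on {0..1} (\<lambda>s. g (s * fst p, snd p))"
proof -
  have "(\<lambda>s. (s * fst p, snd p)) ` {0..1} \<subseteq> {-T<..<T} \<times> B"
    using scaled_time_in_slab[OF assms(2)] by auto
  then show ?thesis
    by (intro continuous_on_compose2[OF assms(1)] continuous_intros)
qed

lemma continuous_on_time_integral:
  fixes g :: "real \<times> 'a::euclidean_space \<Rightarrow> 'b::banach"
  assumes "continuous_on ({-T<..<T} \<times> B) g"
  shows "continuous_on ({-T<..<T} \<times> B) (time_integral g)"
proof -
  have "continuous_on ({-T<..<T} \<times> B) (\<lambda>p. integral {0..1} (\<lambda>s. g (s * fst p, snd p)))"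
    using integral_continuous_on_param[OF continuous_on_scaled_time[OF assms]] by simp
  then show ?thesis unfolding time_integral_def[abs_def] by (intro continuous_intros)
qed

lemma norm_time_integral_le:
  fixes g :: "real \<times> 'a::euclidean_space \<Rightarrow> 'b::banach"
  assumes "continuous_on ({-T<..<T} \<times> B) g" "p \<in> {-T<..<T} \<times> B"
    and C: "\<And>q. q \<in> {-T<..<T} \<times> B \<Longrightarrow> norm (g q) \<le> C"
  shows "norm (time_integral g p) \<le> T * C"
proof -
  have "norm (integral {0..1} (\<lambda>s. g (s * fst p, snd p))) \<le> C * (1 - 0)"
    using C scaled_time_in_slab[OF assms(2)]
    by (intro integral_bound continuous_on_scaled_time_at[OF assms(1,2)]) auto
  moreover have "\<bar>fst p\<bar> \<le> T" using assms(2) by auto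
  moreover have "0 \<le> T" using assms(2) by auto
  ultimately show ?thesis unfolding time_integral_def by (auto intro!: mult_mono)
qed

lemma time_integral_diff:
  fixes g h :: "real \<times> 'a::euclidean_space \<Rightarrow> 'b::banach"
  assumes "continuous_on ({-T<..<T} \<times> B) g" "continuous_on ({-T<..<T} \<times> B) h" "p \<in> {-T<..<T} \<times> B"
  shows "time_integral g p - time_integral h p = time_integral (\<lambda>q. g q - h q) p"
  using continuous_on_scaled_time_at[OF assms(1,3)] continuous_on_scaled_time_at[OF assms(2,3)]
  unfolding time_integral_def
  by (simp add: integral_diff integrable_continuous_interval scaleR_diff_right)

text \<open>In the space directions one differentiates under the integral sign. In the time
  direction this produces the integral of the derivative of \<open>s g(s t, x)\<close> with
  respect to \<open>s\<close>, that is, the boundary term \<open>g(t, x)\<close>.\<close>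

lemma has_derivative_time_integral:
  fixes g :: "real \<times> 'a::euclidean_space \<Rightarrow> 'b::banach"
  assumes B: "open B" "convex B" and g: "Ck_on 1 ({-T<..<T} \<times> B) g" and p: "p \<in> {-T<..<T} \<times> B"
  shows "(time_integral g has_derivative (\<lambda>v. fst v *\<^sub>R g p +
    time_integral (\<lambda>q. frechet_derivative g (at q) (0, snd v)) p)) (at p)"
proof -
  let ?S = "{-T<..<T} \<times> B"
  let ?D = "\<lambda>q. frechet_derivative g (at q)"
  have oS: "open ?S" using B by (simp add: open_Times)
  have cS: "convex ?S" using B by (simp add: convex_Times)
  have D: "(g has_derivative ?D q) (at q)" if "q \<in> ?S" for q
    using Ck_on_has_derivative[of 0 ?S g] g that by simp
  have cg: "continuous_on ?S g" using Ck_on_SucD[of 0 ?S g] g by simp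
  have cD: "continuous_on ?S (\<lambda>q. ?D q v)" for v
    using g unfolding One_nat_def Ck_on.simps by blast
  have lin: "linear (?D q)" if "q \<in> ?S" for q using has_derivative_linear[OF D[OF that]] .
  define fx where "fx p s = Blinfun (\<lambda>v. ?D (s * fst p, snd p) (s * fst v, snd v))" for p :: "real \<times>
      'a" and s :: real
  have der: "((\<lambda>p. g (s * fst p, snd p)) has_derivative (\<lambda>v. ?D (s * fst q, snd q) (s * fst v, snd
      v))) (at q)"
    if "q \<in> ?S" "s \<in> {0..1}" for q s
    by (rule has_derivative_compose[where f = "\<lambda>p. (s * fst p, snd p)" and g = g,
          OF _ D[OF scaled_time_in_slab[OF that]]]) (auto intro!: derivative_eq_intros)
  have fx: "blinfun_apply (fx q s) = (\<lambda>v. ?D (s * fst q, snd q) (s * fst v, snd v))"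
    if "q \<in> ?S" "s \<in> {0..1}" for q s
    unfolding fx_def by (rule bounded_linear_Blinfun_apply[OF has_derivative_bounded_linear[OF
        der[OF that]]])
  have split: "?D q (r, x) = r *\<^sub>R ?D q (1, 0) + ?D q (0, x)" if "q \<in> ?S" for q r x
  proof -
    interpret linear "?D q" using lin[OF that] .
    show ?thesis using add[of "r *\<^sub>R (1, 0)" "(0, x)"] scaleR[of r "(1, 0)"] by simp
  qed
  have I: "((\<lambda>p. integral (cbox 0 1) (\<lambda>s. g (s * fst p, snd p))) has_derivative integral (cbox 0 1)
      (fx p)) (at p within ?S)"
  proof (rule leibniz_rule[OF _ _ _ p cS])
    show "((\<lambda>p. g (s * fst p, snd p)) has_derivative blinfun_apply (fx q s)) (at q within ?S)"
      if "q \<in> ?S" "s \<in> cbox 0 1" for q s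
      using der[of q s] fx[of q s] that by (auto intro: has_derivative_at_withinI)
    show "(\<lambda>s. g (s * fst q, snd q)) integrable_on cbox 0 1" if "q \<in> ?S" for q
      using continuous_on_scaled_time_at[OF cg that] by (simp add: integrable_continuous_interval)
    show "continuous_on (?S \<times> cbox 0 1) (\<lambda>(x, t). fx x t)"
    proof (rule continuous_on_blinfun_componentwise)
      fix i :: "real \<times> 'a"
      have "continuous_on (?S \<times> cbox 0 1) (\<lambda>(q, s). (s * fst i) *\<^sub>R ?D (s * fst q, snd q) (1, 0) +
          ?D (s * fst q, snd q) (0, snd i))"
        using continuous_on_scaled_time[OF cD[of "(1,0)"]] continuous_on_scaled_time[OF cD[of "(0,
            snd i)"]]
        by (auto simp: case_prod_unfold intro!: continuous_intros)
      moreover have "(case z of (q, s) \<Rightarrow> (s * fst i) *\<^sub>R ?D (s * fst q, snd q) (1, 0) + ?D (s * fst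
          q, snd q) (0, snd i))
        = blinfun_apply (case z of (q, s) \<Rightarrow> fx q s) i" if "z \<in> ?S \<times> cbox 0 1" for z
        using that fx[of "fst z" "snd z"] split[OF scaled_time_in_slab[of "fst z" T B "snd z"], of
            "snd z * fst i" "snd i"]
        by (auto simp: case_prod_unfold)
      ultimately show "continuous_on (?S \<times> cbox 0 1) (\<lambda>z. blinfun_apply (case z of (q, s) \<Rightarrow> fx q s)
          i)"
        by (rule continuous_on_eq)
    qed
  qed
  have "(\<lambda>s. fx p s) integrable_on cbox 0 1"
  proof (rule integrable_continuous, rule continuous_on_blinfun_componentwise)
    fix i :: "real \<times> 'a"
    have "continuous_on {0..1} (\<lambda>s. (s * fst i) *\<^sub>R ?D (s * fst p, snd p) (1, 0) + ?D (s * fst p,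
        snd p) (0, snd i))"
      using continuous_on_scaled_time_at[OF cD[of "(1,0)"] p] continuous_on_scaled_time_at[OF cD[of
          "(0, snd i)"] p]
      by (auto intro!: continuous_intros)
    then have "continuous_on {0..1} (\<lambda>s. blinfun_apply (fx p s) i)"
    proof (rule continuous_on_eq)
      fix s :: real assume "s \<in> {0..1}"
      then show "(s * fst i) *\<^sub>R ?D (s * fst p, snd p) (1, 0) + ?D (s * fst p, snd p) (0, snd i) =
          blinfun_apply (fx p s) i"
        using fx[OF p] split[OF scaled_time_in_slab[OF p], of s "s * fst i" "snd i"] by simp
    qed
    then show "continuous_on (cbox 0 1) (\<lambda>s. blinfun_apply (fx p s) i)" by simp
  qed
  then have Iv: "blinfun_apply (integral (cbox 0 1) (fx p)) v = integral (cbox 0 1) (\<lambda>s.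
      blinfun_apply (fx p s) v)" for v
    by (rule blinfun_apply_integral)
  let ?G = "integral {0..1} (\<lambda>s. g (s * fst p, snd p))"
  have "(time_integral g has_derivative (\<lambda>v. fst p *\<^sub>R integral {0..1} (\<lambda>s. blinfun_apply (fx p s)
      v) + fst v *\<^sub>R ?G)) (at p within ?S)"
    unfolding time_integral_def[abs_def]
    by (rule has_derivative_eq_rhs[OF has_derivative_scaleR[OF has_derivative_fst[OF
        has_derivative_ident] I[simplified]]])
       (simp add: Iv[simplified])
  then have main: "(time_integral g has_derivative (\<lambda>v. fst p *\<^sub>R integral {0..1} (\<lambda>s. blinfun_apply
      (fx p s) v) + fst v *\<^sub>R ?G)) (at p)"
    using at_within_open[OF p oS] by simp
  \<comment> \<open>The time derivative: integrate the derivative of \<open>s \<mapsto> s g(s t, x)\<close>.\<close>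
  have "((\<lambda>s. fst p *\<^sub>R (s *\<^sub>R ?D (s * fst p, snd p) (1, 0)) + g (s * fst p, snd p)) has_integral
      1 *\<^sub>R g (1 * fst p, snd p) - 0 *\<^sub>R g (0 * fst p, snd p)) {0..1}"
  proof (rule fundamental_theorem_of_calculus)
    fix s :: real assume s: "s \<in> {0..1}"
    have "((\<lambda>s. g (s * fst p, snd p)) has_derivative (\<lambda>r. ?D (s * fst p, snd p) (r * fst p, 0))) (at
        s)"
      by (rule has_derivative_compose[where f = "\<lambda>s. (s * fst p, snd p)" and g = g,
          OF _ D[OF scaled_time_in_slab[OF p s]]]) (auto intro!: derivative_eq_intros)
    moreover have "?D (s * fst p, snd p) (r * fst p, 0) = r *\<^sub>R (fst p *\<^sub>R ?D (s * fst p, snd p) (1,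
        0))" for r
      using split[OF scaled_time_in_slab[OF p s], of "r * fst p" 0] linear_0[OF lin[OF
          scaled_time_in_slab[OF p s]]]
      by (simp add: zero_prod_def)
    ultimately have "((\<lambda>s. g (s * fst p, snd p)) has_vector_derivative fst p *\<^sub>R ?D (s * fst p, snd
        p) (1, 0)) (at s)"
      by (simp add: has_vector_derivative_def)
    from has_vector_derivative_at_within[OF has_vector_derivative_scaleR[OF DERIV_ident this]]
    show "((\<lambda>s. s *\<^sub>R g (s * fst p, snd p)) has_vector_derivative
        fst p *\<^sub>R (s *\<^sub>R ?D (s * fst p, snd p) (1, 0)) + g (s * fst p, snd p)) (at s within {0..1})"
      by (simp only: scaleR_one scaleR_left_commute[of s])
  qed simp
  then have ftc: "integral {0..1} (\<lambda>s. fst p *\<^sub>R (s *\<^sub>R ?D (s * fst p, snd p) (1, 0)) + g (s * fst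
      p, snd p)) = g p"
    by (simp add: integral_unique)
  note c1 = continuous_on_scaled_time_at[OF cD[of "(1,0)"] p]
  have i1: "(\<lambda>s. s *\<^sub>R ?D (s * fst p, snd p) (1, 0)) integrable_on {0..1}"
    by (intro integrable_continuous_interval continuous_intros c1)
  have i2: "(\<lambda>s. ?D (s * fst p, snd p) (0, x)) integrable_on {0..1}" for x
    by (intro integrable_continuous_interval continuous_on_scaled_time_at[OF cD p])
  have i3: "(\<lambda>s. g (s * fst p, snd p)) integrable_on {0..1}"
    by (intro integrable_continuous_interval continuous_on_scaled_time_at[OF cg p])
  have "g p = fst p *\<^sub>R integral {0..1} (\<lambda>s. s *\<^sub>R ?D (s * fst p, snd p) (1, 0)) + ?G"
    unfolding ftc[symmetric] integral_add[OF integrable_cmul[OF i1, of "fst p"] i3] integral_cmul ..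
  moreover have "fst p *\<^sub>R integral {0..1} (\<lambda>s. blinfun_apply (fx p s) v) =
      fst v *\<^sub>R (fst p *\<^sub>R integral {0..1} (\<lambda>s. s *\<^sub>R ?D (s * fst p, snd p) (1, 0))) +
      time_integral (\<lambda>q. ?D q (0, snd v)) p" for v
  proof -
    have "integral {0..1} (\<lambda>s. blinfun_apply (fx p s) v) =
        integral {0..1} (\<lambda>s. fst v *\<^sub>R (s *\<^sub>R ?D (s * fst p, snd p) (1, 0)) + ?D (s * fst p, snd p)
            (0, snd v))"
    proof (rule integral_cong)
      fix s :: real assume "s \<in> {0..1}"
      then show "blinfun_apply (fx p s) v = fst v *\<^sub>R (s *\<^sub>R ?D (s * fst p, snd p) (1, 0)) + ?D (s *
          fst p, snd p) (0, snd v)"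
        using fx[OF p] split[OF scaled_time_in_slab[OF p], of s "s * fst v" "snd v"] by (simp add:
            mult.commute)
    qed
    also have "\<dots> = fst v *\<^sub>R integral {0..1} (\<lambda>s. s *\<^sub>R ?D (s * fst p, snd p) (1, 0)) +
        integral {0..1} (\<lambda>s. ?D (s * fst p, snd p) (0, snd v))"
      unfolding integral_add[OF integrable_cmul[OF i1, of "fst v"] i2[of "snd v"]] integral_cmul ..
    finally show ?thesis by (simp add: time_integral_def scaleR_add_right mult.commute)
  qed
  ultimately have "(\<lambda>v. fst p *\<^sub>R integral {0..1} (\<lambda>s. blinfun_apply (fx p s) v) + fst v *\<^sub>R ?G) =
      (\<lambda>v. fst v *\<^sub>R g p + time_integral (\<lambda>q. ?D q (0, snd v)) p)"
    by (simp add: scaleR_add_right fun_eq_iff)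
  with main show ?thesis by simp
qed

lemma Ck_on_time_integral:
  fixes g :: "real \<times> 'a::euclidean_space \<Rightarrow> 'b::banach"
  assumes B: "open B" "convex B" and g: "Ck_on k ({-T<..<T} \<times> B) g"
  shows "Ck_on k ({-T<..<T} \<times> B) (time_integral g)"
  using g
proof (induction k arbitrary: g)
  case 0
  then show ?case by (simp add: continuous_on_time_integral)
next
  case (Suc k)
  have g1: "Ck_on 1 ({-T<..<T} \<times> B) g"
    using Suc.prems by (induction k) (auto dest: Ck_on_SucD simp del: Ck_on.simps)
  have oS: "open ({-T<..<T} \<times> B)" using B by (simp add: open_Times)
  show ?case
  proof (rule Ck_on_SucI[OF oS has_derivative_time_integral[OF B g1]])
    show "Ck_on k ({-T<..<T} \<times> B) (\<lambda>p. fst v *\<^sub>R g p +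
        time_integral (\<lambda>q. frechet_derivative g (at q) (0, snd v)) p)" for v
      using Suc Ck_on_SucD[OF Suc.prems]
      by (intro Ck_on_add Ck_on_scaleR Ck_on_const oS Suc.IH) auto
  qed auto
qed

lemma smooth_on_time_integral:
  fixes g :: "real \<times> 'a::euclidean_space \<Rightarrow> 'b::banach"
  shows "open B \<Longrightarrow> convex B \<Longrightarrow> smooth_on ({-T<..<T} \<times> B) g \<Longrightarrow>
    smooth_on ({-T<..<T} \<times> B) (time_integral g)"
  using Ck_on_time_integral unfolding smooth_on_def by blast

lemma uniformly_Cauchy_bounded_time_integral:
  fixes g :: "nat \<Rightarrow> real \<times> 'a::euclidean_space \<Rightarrow> 'b::banach"
  assumes T: "T > 0" and g: "\<And>n. continuous_on ({-T<..<T} \<times> B) (g n)"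
    and C: "uniformly_Cauchy_bounded ({-T<..<T} \<times> B) g"
  shows "uniformly_Cauchy_bounded ({-T<..<T} \<times> B) (\<lambda>n. time_integral (g n))"
proof -
  obtain M where M: "\<And>n x. x \<in> {-T<..<T} \<times> B \<Longrightarrow> norm (g n x) \<le> M"
    using uniformly_Cauchy_boundedE[OF C] by metis
  show ?thesis
  proof (rule uniformly_Cauchy_boundedI)
    show "norm (time_integral (g n) p) \<le> T * M" if "p \<in> {-T<..<T} \<times> B" for n p
      by (rule norm_time_integral_le[OF g that M])
  next
    fix e :: real assume "e > 0"
    then have "e / T > 0" using T by simp
    then obtain N where N: "\<And>m n x. m \<ge> N \<Longrightarrow> n \<ge> N \<Longrightarrow> x \<in> {-T<..<T} \<times> B \<Longrightarrow> norm (g m x - g n x) \<le> e /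
        T"
      using uniformly_Cauchy_boundedD[OF C] by metis
    have "norm (time_integral (g m) p - time_integral (g n) p) \<le> e"
      if "m \<ge> N" "n \<ge> N" "p \<in> {-T<..<T} \<times> B" for m n p
    proof -
      have "norm (time_integral (\<lambda>q. g m q - g n q) p) \<le> T * (e / T)"
        by (rule norm_time_integral_le[OF continuous_on_diff[OF g g] that(3) N[OF that(1,2)]])
      then show ?thesis using time_integral_diff[OF g g that(3)] T by simp
    qed
    then show "\<exists>N. \<forall>m\<ge>N. \<forall>n\<ge>N. \<forall>p\<in>{-T<..<T} \<times> B.
        norm (time_integral (g m) p - time_integral (g n) p) \<le> e" by blast
  qed
qed

lemma Ck_Cauchy_time_integral:
  fixes g :: "nat \<Rightarrow> real \<times> 'a::euclidean_space \<Rightarrow> 'b::banach"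
  assumes T: "T > 0" and B: "open B" "convex B" and g: "\<And>n. smooth_on ({-T<..<T} \<times> B) (g n)"
    and "Ck_Cauchy k ({-T<..<T} \<times> B) g"
  shows "Ck_Cauchy k ({-T<..<T} \<times> B) (\<lambda>n. time_integral (g n))"
  using assms(4-)
proof (induction k arbitrary: g)
  case 0
  then show ?case
    using uniformly_Cauchy_bounded_time_integral[OF T smooth_on_continuous_on[OF 0(1)]] by auto
next
  case (Suc k)
  have oS: "open ({-T<..<T} \<times> B)" using B by (simp add: open_Times)
  show ?case
  proof (rule Ck_Cauchy_SucI[OF oS has_derivative_time_integral[OF B smooth_onD[OF Suc.prems(1)]]])
    show "uniformly_Cauchy_bounded ({-T<..<T} \<times> B) (\<lambda>n. time_integral (g n))"
      using uniformly_Cauchy_bounded_time_integral[OF T smooth_on_continuous_on[OF Suc.prems(1)]]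
          Suc.prems(2)
      by simp
    show "Ck_Cauchy k ({-T<..<T} \<times> B) (\<lambda>n p. fst v *\<^sub>R g n p +
        time_integral (\<lambda>q. frechet_derivative (g n) (at q) (0, snd v)) p)" for v
    proof (intro Ck_Cauchy_add Ck_Cauchy_scaleR Ck_Cauchy_const smooth_on_const smooth_on_scaleR oS
          smooth_on_time_integral B smooth_on_frechet_derivative Suc.prems Ck_Cauchy_SucD[OF
              Suc.prems(2)] Suc.IH)
      show "Ck_Cauchy k ({-T<..<T} \<times> B) (\<lambda>n q. frechet_derivative (g n) (at q) (0, snd v))"
        using Suc.prems(2) by simp
    qed
  qed auto
qed

subsection \<open>Picard iteration\<close>

text \<open>If one step halves the distances up to a perturbation that tends to zero, then after
  \<open>j\<close> steps a bound \<open>2 C\<close> on the distances has become \<open>2 C /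
  2^j\<close>, up to an arbitrarily small error.\<close>

lemma uniformly_Cauchy_bounded_perturbed_contraction:
  fixes w :: "nat \<Rightarrow> 'a \<Rightarrow> 'b::real_normed_vector"
  assumes C: "\<And>n x. x \<in> S \<Longrightarrow> norm (w n x) \<le> C"
    and step: "\<And>e. e > 0 \<Longrightarrow> \<exists>N. \<forall>m\<ge>N. \<forall>n\<ge>N. \<forall>d.
      (\<forall>x\<in>S. norm (w m x - w n x) \<le> d) \<longrightarrow> (\<forall>x\<in>S. norm (w (Suc m) x - w (Suc n) x) \<le> e + d / 2)"
  shows "uniformly_Cauchy_bounded S w"
proof (rule uniformly_Cauchy_boundedI[OF C])
  fix e :: real assume e: "e > 0"
  then have "e / 4 > 0" by simp
  from step[OF this] obtain N where N: "\<And>m n d. m \<ge> N \<Longrightarrow> n \<ge> N \<Longrightarrow>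
      (\<forall>x\<in>S. norm (w m x - w n x) \<le> d) \<Longrightarrow> (\<forall>x\<in>S. norm (w (Suc m) x - w (Suc n) x) \<le> e / 4 + d / 2)"
    by metis
  have *: "\<forall>m\<ge>N + j. \<forall>n\<ge>N + j. \<forall>x\<in>S. norm (w m x - w n x) \<le> 2 * C / 2 ^ j + e / 2" for j
  proof (induction j)
    case 0
    have "norm (w m x - w n x) \<le> 2 * C" if "x \<in> S" for m n x
      using norm_triangle_ineq4[of "w m x" "w n x"] C[OF that, of m] C[OF that, of n] by linarith
    then show ?case using e by (auto intro: add_increasing2)
  next
    case (Suc j)
    show ?case
    proof (intro allI impI ballI)
      fix m n x assume mn: "N + Suc j \<le> m" "N + Suc j \<le> n" and x: "x \<in> S"
      obtain m' n' where m': "m = Suc m'" "n = Suc n'" using mn by (metis Suc_le_D add_Suc_right)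
      then have "\<forall>x\<in>S. norm (w m' x - w n' x) \<le> 2 * C / 2 ^ j + e / 2" using Suc mn by auto
      from N[OF _ _ this] x mn m' have "norm (w m x - w n x) \<le> e / 4 + (2 * C / 2 ^ j + e / 2) / 2"
          by auto
      then show "norm (w m x - w n x) \<le> 2 * C / 2 ^ Suc j + e / 2" by (simp add: field_simps)
    qed
  qed
  have "(\<lambda>j. 2 * C / 2 ^ j) \<longlonglongrightarrow> 0"
    using LIMSEQ_divide_realpow_zero[of 2 "2 * C"] by simp
  then have "\<forall>\<^sub>F j in sequentially. 2 * C / 2 ^ j < e / 2"
    using e by (intro order_tendstoD) auto
  then obtain j where "2 * C / 2 ^ j < e / 2" unfolding eventually_sequentially by blast
  with * [of j] show "\<exists>N. \<forall>m\<ge>N. \<forall>n\<ge>N. \<forall>x\<in>S. norm (w m x - w n x) \<le> e"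
    by (intro exI[of _ "N + j"]) force
qed

lemma uniformly_Cauchy_bounded_uniformly_finite:
  assumes "finite I" "\<And>i. i \<in> I \<Longrightarrow> uniformly_Cauchy_bounded S (f i)" "e > 0"
  shows "\<exists>N. \<forall>i\<in>I. \<forall>m\<ge>N. \<forall>n\<ge>N. \<forall>x\<in>S. norm (f i m x - f i n x) \<le> e"
proof -
  have "\<exists>N. \<forall>m\<ge>N. \<forall>n\<ge>N. \<forall>x\<in>S. norm (f i m x - f i n x) \<le> e" if "i \<in> I" for i
    using assms(2)[OF that] assms(3) unfolding uniformly_Cauchy_bounded_def by blast
  then obtain N where N: "\<And>i. i \<in> I \<Longrightarrow> \<forall>m\<ge>N i. \<forall>n\<ge>N i. \<forall>x\<in>S. norm (f i m x - f i n x) \<le> e" by metis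
  have "N i \<le> Max (N ` I)" if "i \<in> I" for i using assms(1) that by simp
  then show ?thesis using N by (intro exI[of _ "Max (N ` I)"]) (meson order_trans)
qed

text \<open>The iteration for the linear equation \<open>w = c + \<integral> \<beta> w\<close>,
  whose data \<open>c\<close> and \<open>\<beta>\<close> may vary with the step as long as they
  converge. The members stay bounded, so that the variation of \<open>\<beta>\<close> is a small
  perturbation of a contraction.\<close>

lemma uniformly_Cauchy_bounded_linear_Picard:
  fixes w c :: "nat \<Rightarrow> real \<times> 'a::euclidean_space \<Rightarrow> 'b::euclidean_space"
  assumes T: "T > 0" and B: "open B" "convex B"
  defines "S \<equiv> {-T<..<T} \<times> B"
  assumes w: "\<And>n. smooth_on S (w n)" and \<beta>: "\<And>b n. smooth_on S (\<beta> b n)"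
    and eq: "\<And>n p. p \<in> S \<Longrightarrow> w (Suc n) p = c n p + time_integral (\<lambda>q. \<Sum>b\<in>Basis. (w n q \<bullet> b) *\<^sub>R \<beta> b n
        q) p"
    and contr: "\<And>n p y. p \<in> S \<Longrightarrow> T * norm (\<Sum>b\<in>Basis. (y \<bullet> b) *\<^sub>R \<beta> b n p) \<le> norm y / 2"
    and cC: "uniformly_Cauchy_bounded S c" and \<beta>C: "\<And>b. b \<in> Basis \<Longrightarrow> uniformly_Cauchy_bounded S (\<beta>
        b)"
    and w0: "uniformly_Cauchy_bounded S (\<lambda>n. w 0)"
  shows "uniformly_Cauchy_bounded S w"
proof -
  define L where "L n q y = (\<Sum>b\<in>Basis. (y \<bullet> b) *\<^sub>R \<beta> b n q)" for n q y
  have oS: "open S" using B by (simp add: S_def open_Times)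
  have cL: "continuous_on S (\<lambda>q. L n q (w n q))" for n
    unfolding L_def by (intro smooth_on_continuous_on smooth_on_sum smooth_on_scaleR smooth_on_inner
        oS w \<beta>)
  have eq: "w (Suc n) p = c n p + time_integral (\<lambda>q. L n q (w n q)) p" if "p \<in> S" for n p
    using eq[OF that] by (simp add: L_def)
  have L: "norm (L n p y) \<le> norm y / (2 * T)" if "p \<in> S" for n p y
    using contr[OF that, of y n] T by (simp add: L_def field_simps)
  obtain Cc where Cc: "\<And>n x. x \<in> S \<Longrightarrow> norm (c n x) \<le> Cc" using uniformly_Cauchy_boundedE[OF cC] by
      metis
  obtain C0 where C0: "C0 > 0" "\<And>x. x \<in> S \<Longrightarrow> norm (w 0 x) \<le> C0" using uniformly_Cauchy_boundedE[OF
      w0] by metis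
  define C where "C = max C0 (2 * Cc)"
  have C: "norm (w n p) \<le> C" if "p \<in> S" for n p
    using that
  proof (induction n arbitrary: p)
    case 0
    then show ?case using C0(2)[of p] by (simp add: C_def)
  next
    case (Suc n)
    have "norm (L n q (w n q)) \<le> C / (2 * T)" if "q \<in> S" for q
    proof -
      have "norm (L n q (w n q)) \<le> norm (w n q) / (2 * T)" using L[OF that] .
      also have "\<dots> \<le> C / (2 * T)" using Suc.IH[OF that] T by (simp add: divide_right_mono)
      finally show ?thesis .
    qed
    then have "norm (time_integral (\<lambda>q. L n q (w n q)) p) \<le> T * (C / (2 * T))"
      using norm_time_integral_le[of T B "\<lambda>q. L n q (w n q)" p "C / (2 * T)"] cL Suc.prems
      by (auto simp: S_def)
    then have "norm (w (Suc n) p) \<le> Cc + C / 2"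
      using eq[OF Suc.prems, of n] Cc[OF Suc.prems, of n] T
        norm_triangle_ineq[of "c n p" "time_integral (\<lambda>q. L n q (w n q)) p"] by simp
    also have "\<dots> \<le> C" by (simp add: C_def)
    finally show ?case .
  qed
  have Cpos: "C > 0" using C0(1) by (simp add: C_def)
  show ?thesis
  proof (rule uniformly_Cauchy_bounded_perturbed_contraction[OF C])
    fix e :: real assume e: "e > 0"
    then have "e / 2 > 0" by simp
    then obtain N1 where N1: "\<And>m n x. m \<ge> N1 \<Longrightarrow> n \<ge> N1 \<Longrightarrow> x \<in> S \<Longrightarrow> norm (c m x - c n x) \<le> e / 2"
      using uniformly_Cauchy_boundedD[OF cC] by metis
    define e' where "e' = e / (2 * T * C * DIM('b))"
    have e': "e' > 0" using e T Cpos by (simp add: e'_def)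
    obtain N2 where N2: "\<And>b m n x. b \<in> Basis \<Longrightarrow> m \<ge> N2 \<Longrightarrow> n \<ge> N2 \<Longrightarrow> x \<in> S \<Longrightarrow> norm (\<beta> b m x - \<beta> b n x) \<le>
        e'"
      using uniformly_Cauchy_bounded_uniformly_finite[of "Basis::'b set" S \<beta> e'] \<beta>C e' by (metis
          finite_Basis)
    have "norm (w (Suc m) p - w (Suc n) p) \<le> e + d / 2"
      if mn: "m \<ge> max N1 N2" "n \<ge> max N1 N2" and d: "\<forall>x\<in>S. norm (w m x - w n x) \<le> d" and p: "p \<in> S"
          for m n d p
    proof -
      have "norm (L m q (w m q) - L n q (w n q)) \<le> d / (2 * T) + e / (2 * T)" if q: "q \<in> S" for q
      proof -
        have split: "L m q (w m q) - L n q (w n q) = L m q (w m q - w n q) + (\<Sum>b\<in>Basis. (w n q \<bullet> b)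
            *\<^sub>R (\<beta> b m q - \<beta> b n q))"
          by (simp add: L_def inner_diff_left algebra_simps sum_subtractf sum.distrib)
        have 1: "norm (L m q (w m q - w n q)) \<le> d / (2 * T)"
          using L[OF q, of m "w m q - w n q"] d q T by (smt (verit) divide_right_mono)
        have 2: "norm (\<Sum>b\<in>Basis. (w n q \<bullet> b) *\<^sub>R (\<beta> b m q - \<beta> b n q)) \<le> (\<Sum>b\<in>(Basis::'b set). C *
            e')"
        proof (rule sum_norm_le)
          fix b :: 'b assume b: "b \<in> Basis"
          have "\<bar>w n q \<bullet> b\<bar> \<le> C" using Basis_le_norm[OF b, of "w n q"] C[OF q, of n] by linarith
          then show "norm ((w n q \<bullet> b) *\<^sub>R (\<beta> b m q - \<beta> b n q)) \<le> C * e'"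
            using N2[OF b _ _ q, of m n] mn Cpos by (auto intro!: mult_mono)
        qed
        have 3: "(\<Sum>b\<in>(Basis::'b set). C * e') = e / (2 * T)"
          using Cpos T by (simp add: e'_def)
        show ?thesis
          unfolding split using norm_triangle_le[OF add_mono[OF 1 2]] unfolding 3 .
      qed
      then have "norm (time_integral (\<lambda>q. L m q (w m q) - L n q (w n q)) p) \<le> T * (d / (2 * T) + e /
          (2 * T))"
        using norm_time_integral_le[of T B "\<lambda>q. L m q (w m q) - L n q (w n q)" p "d / (2 * T) + e /
            (2 * T)"] continuous_on_diff[OF cL[of m] cL[of n]] p
        by (auto simp: S_def)
      also have "\<dots> = d / 2 + e / 2" using T by (simp add: field_simps)
      finally have 1: "norm (time_integral (\<lambda>q. L m q (w m q)) p - time_integral (\<lambda>q. L n q (w n q))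
          p) \<le> d / 2 + e / 2"
        using time_integral_diff[of T B "\<lambda>q. L m q (w m q)" "\<lambda>q. L n q (w n q)" p] cL p by (simp
            add: S_def)
      have "norm (c m p - c n p) \<le> e / 2" using N1 mn p by simp
      then show ?thesis
        using 1 norm_diff_triangle_ineq[of "c m p" "time_integral (\<lambda>q. L m q (w m q)) p" "c n p"
            "time_integral (\<lambda>q. L n q (w n q)) p"]
        unfolding eq[OF p] by linarith
    qed
    then show "\<exists>N. \<forall>m\<ge>N. \<forall>n\<ge>N. \<forall>d. (\<forall>x\<in>S. norm (w m x - w n x) \<le> d) \<longrightarrow>
        (\<forall>x\<in>S. norm (w (Suc m) x - w (Suc n) x) \<le> e + d / 2)" by blast
  qed
qed

text \<open>The space derivatives of the iterates are again iterates for a linear equation with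
  the same \<open>\<beta>\<close>, only with a new inhomogeneity, and the time derivatives are
  given by the integrand. Hence the contraction condition is needed for \<open>\<beta>\<close>
  alone, and the time interval does not shrink as the order of differentiation grows.\<close>

lemma Ck_Cauchy_linear_Picard:
  fixes w c :: "nat \<Rightarrow> real \<times> 'a::euclidean_space \<Rightarrow> 'b::euclidean_space"
  assumes T: "T > 0" and B: "open B" "convex B"
  defines "S \<equiv> {-T<..<T} \<times> B"
  assumes w: "\<And>n. smooth_on S (w n)" and c: "\<And>n. smooth_on S (c n)" and \<beta>: "\<And>b n. smooth_on S (\<beta> b
      n)"
    and eq: "\<And>n p. p \<in> S \<Longrightarrow> w (Suc n) p = c n p + time_integral (\<lambda>q. \<Sum>b\<in>Basis. (w n q \<bullet> b) *\<^sub>R \<beta> b n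
        q) p"
    and contr: "\<And>n p y. p \<in> S \<Longrightarrow> T * norm (\<Sum>b\<in>Basis. (y \<bullet> b) *\<^sub>R \<beta> b n p) \<le> norm y / 2"
    and cC: "Ck_Cauchy k S c" and \<beta>C: "\<And>b. b \<in> Basis \<Longrightarrow> Ck_Cauchy k S (\<beta> b)"
    and w0: "Ck_Cauchy k S (\<lambda>n. w 0)"
  shows "Ck_Cauchy k S w"
  using w c eq cC \<beta>C w0
proof (induction k arbitrary: w c)
  case 0
  note h = 0[unfolded S_def]
  have "uniformly_Cauchy_bounded S w"
    unfolding S_def
    by (rule uniformly_Cauchy_bounded_linear_Picard[where w = w and c = c and \<beta> = \<beta>, OF T B h(1)
        \<beta>[unfolded S_def] h(3) contr[unfolded S_def]])
       (use h in auto)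
  then show ?case by simp
next
  case (Suc k)
  have oS: "open S" using B by (simp add: S_def open_Times)
  let ?D = "\<lambda>f p. frechet_derivative f (at p)"
  define L where "L n q = (\<Sum>b\<in>Basis. (w n q \<bullet> b) *\<^sub>R \<beta> b n q)" for n q
  note w = Suc.prems(1) and c = Suc.prems(2)
  have sL: "smooth_on S (L n)" for n
    unfolding L_def[abs_def] by (intro smooth_on_sum smooth_on_scaleR smooth_on_inner oS w \<beta>)
  have cC: "Ck_Cauchy k S c" and \<beta>C: "\<And>b. b \<in> Basis \<Longrightarrow> Ck_Cauchy k S (\<beta> b)" and w0: "Ck_Cauchy k S
      (\<lambda>n. w 0)"
    using Suc.prems(4-6) Ck_Cauchy_SucD by blast+
  have wC: "Ck_Cauchy k S w"
    by (rule Suc.IH[OF w c Suc.prems(3) cC \<beta>C w0])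
  have LC: "Ck_Cauchy k S L"
    unfolding L_def[abs_def]
    by (intro Ck_Cauchy_sum Ck_Cauchy_scaleR Ck_Cauchy_inner smooth_on_scaleR smooth_on_inner oS w \<beta>
        wC \<beta>C)
  have DL: "?D (L n) q u = (\<Sum>b\<in>Basis. (?D (w n) q u \<bullet> b) *\<^sub>R \<beta> b n q) + (\<Sum>b\<in>Basis. (w n q \<bullet> b) *\<^sub>R
      ?D (\<beta> b n) q u)"
    if "q \<in> S" for n q u
  proof -
    have "(L n has_derivative (\<lambda>u. \<Sum>b\<in>Basis. (w n q \<bullet> b) *\<^sub>R ?D (\<beta> b n) q u + (?D (w n) q u \<bullet> b) *\<^sub>R
        \<beta> b n q)) (at q)"
      unfolding L_def[abs_def]
      by (intro has_derivative_sum has_derivative_scaleR has_derivative_inner_left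
          smooth_on_has_derivative[OF _ that] w \<beta>)
    from frechet_derivative_at[OF this, symmetric] show ?thesis
      by (simp add: sum.distrib add.commute)
  qed
  have Dw: "(w (Suc n) has_derivative (\<lambda>v. ?D (c n) p v + (fst v *\<^sub>R L n p + time_integral (\<lambda>q. ?D
      (L n) q (0, snd v)) p))) (at p)"
    if p: "p \<in> S" for n p
  proof (rule has_derivative_transform_within_open[OF _ oS p])
    show "((\<lambda>p. c n p + time_integral (L n) p) has_derivative (\<lambda>v. ?D (c n) p v + (fst v *\<^sub>R L n p +
        time_integral (\<lambda>q. ?D (L n) q (0, snd v)) p))) (at p)"
      by (intro has_derivative_add smooth_on_has_derivative[OF c p]
          has_derivative_time_integral[OF B, where T = T]) (use smooth_onD[OF sL] p in \<open>auto simp: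
              S_def\<close>)
    show "c n q + time_integral (L n) q = w (Suc n) q" if "q \<in> S" for q
      using Suc.prems(3)[OF that] by (simp add: L_def[abs_def])
  qed
  have Dw_eq: "?D (w (Suc n)) p v = ?D (c n) p v + (fst v *\<^sub>R L n p + time_integral (\<lambda>q. ?D (L n) q
      (0, snd v)) p)" if "p \<in> S" for n p v
    using frechet_derivative_at[OF Dw[OF that, of n], symmetric] by simp
  have sDw: "smooth_on S (\<lambda>q. ?D (w n) q v)" for n v by (rule smooth_on_frechet_derivative[OF w])
  have DwC: "Ck_Cauchy k S (\<lambda>n q. ?D (w n) q (0, u))" for u
  proof (rule Suc.IH[where c = "\<lambda>n p. ?D (c n) p (0, u) + time_integral (\<lambda>q. \<Sum>b\<in>Basis. (w n q \<bullet> b)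
      *\<^sub>R ?D (\<beta> b n) q (0, u)) p"])
    let ?g = "\<lambda>n q. \<Sum>b\<in>Basis. (w n q \<bullet> b) *\<^sub>R ?D (\<beta> b n) q (0, u)"
    have sg: "smooth_on S (?g n)" for n
      by (intro smooth_on_sum smooth_on_scaleR smooth_on_inner oS w smooth_on_frechet_derivative \<beta>)
    have sI: "smooth_on S (time_integral (?g n))" for n
      using sg smooth_on_time_integral[OF B] unfolding S_def by blast
    show "smooth_on S (\<lambda>p. ?D (c n) p (0, u) + time_integral (?g n) p)" for n
      by (intro smooth_on_add oS smooth_on_frechet_derivative c sI)
    have gC: "Ck_Cauchy k S ?g"
      by (intro Ck_Cauchy_sum Ck_Cauchy_scaleR Ck_Cauchy_inner smooth_on_scaleR smooth_on_inner
          smooth_on_frechet_derivative oS w \<beta> wC Ck_Cauchy_frechet_derivative Suc.prems(5))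
    have IC: "Ck_Cauchy k S (\<lambda>n. time_integral (?g n))"
      unfolding S_def by (rule Ck_Cauchy_time_integral[OF T B, of ?g, OF sg[unfolded S_def]
          gC[unfolded S_def]])
    show "Ck_Cauchy k S (\<lambda>n p. ?D (c n) p (0, u) + time_integral (?g n) p)"
      by (intro Ck_Cauchy_add oS smooth_on_frechet_derivative c sI IC Ck_Cauchy_frechet_derivative
          Suc.prems(4))
    show "Ck_Cauchy k S (\<lambda>n q. ?D (w 0) q (0, u))" by (rule Ck_Cauchy_frechet_derivative[OF
        Suc.prems(6)])
    fix n p assume p: "p \<in> S"
    let ?h = "\<lambda>q. \<Sum>b\<in>Basis. (?D (w n) q (0, u) \<bullet> b) *\<^sub>R \<beta> b n q"
    have sh: "smooth_on S ?h"
      by (intro smooth_on_sum smooth_on_scaleR smooth_on_inner oS sDw \<beta>)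
    have "time_integral (\<lambda>q. ?D (L n) q (0, u)) p - time_integral (?g n) p = time_integral (\<lambda>q. ?D
        (L n) q (0, u) - ?g n q) p"
      using time_integral_diff[of T B _ "?g n" p] smooth_on_continuous_on[OF
          smooth_on_frechet_derivative[OF sL]]
        smooth_on_continuous_on[OF sg] p by (simp add: S_def)
    also have "\<dots> = time_integral ?h p"
      by (rule time_integral_cong[OF p[unfolded S_def]]) (simp add: DL[unfolded S_def])
    finally have "time_integral (\<lambda>q. ?D (L n) q (0, u)) p = time_integral (?g n) p + time_integral
        ?h p"
      unfolding diff_eq_eq by (simp only: add.commute)
    then show "?D (w (Suc n)) p (0, u) = ?D (c n) p (0, u) + time_integral (?g n) p + time_integral
        ?h p"
      using Dw_eq[OF p, of n "(0, u)"] by simp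
  qed (use sDw \<beta>C in auto)
  have DLC: "Ck_Cauchy k S (\<lambda>n q. ?D (L n) q (0, u))" for u
  proof (rule Ck_Cauchy_cong[OF oS DL[symmetric]])
    show "Ck_Cauchy k S (\<lambda>n q. (\<Sum>b\<in>Basis. (?D (w n) q (0, u) \<bullet> b) *\<^sub>R \<beta> b n q) + (\<Sum>b\<in>Basis. (w n q \<bullet>
        b) *\<^sub>R ?D (\<beta> b n) q (0, u)))"
      by (intro Ck_Cauchy_add Ck_Cauchy_sum Ck_Cauchy_scaleR Ck_Cauchy_inner smooth_on_sum
          smooth_on_scaleR smooth_on_inner
          smooth_on_frechet_derivative oS w \<beta> wC \<beta>C DwC Ck_Cauchy_frechet_derivative[OF
              Suc.prems(5)])
  qed
  show ?case unfolding Ck_Cauchy.simps(2)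
  proof (intro conjI allI)
    show "uniformly_Cauchy_bounded S w" using Ck_Cauchy_imp_uniformly[OF wC] .
    fix v :: "real \<times> 'a"
    have "Ck_Cauchy k S (\<lambda>n p. ?D (c n) p v + (fst v *\<^sub>R L n p + time_integral (\<lambda>q. ?D (L n) q (0,
        snd v)) p))"
    proof (intro Ck_Cauchy_add Ck_Cauchy_scaleR Ck_Cauchy_const smooth_on_add smooth_on_const
        smooth_on_scaleR oS smooth_on_frechet_derivative c sL LC)
      show "Ck_Cauchy k S (\<lambda>n p. ?D (c n) p v)" by (rule Ck_Cauchy_frechet_derivative[OF
          Suc.prems(4)])
      show "smooth_on S (time_integral (\<lambda>q. ?D (L n) q (0, snd v)))" for n
        using smooth_on_time_integral[OF B] smooth_on_frechet_derivative[OF sL] unfolding S_def by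
            blast
      then show "smooth_on S (time_integral (\<lambda>q. ?D (L n) q (0, snd v)))" for n .
      show "Ck_Cauchy k S (\<lambda>n. time_integral (\<lambda>q. ?D (L n) q (0, snd v)))"
        using Ck_Cauchy_time_integral[OF T B, of "\<lambda>n q. ?D (L n) q (0, snd v)"]
            smooth_on_frechet_derivative[OF sL] DLC
        unfolding S_def by blast
    qed
    then have "Ck_Cauchy k S (\<lambda>n p. ?D (w (Suc n)) p v)"
      by (rule Ck_Cauchy_cong[OF oS Dw_eq[symmetric], rotated])
    then show "Ck_Cauchy k S (\<lambda>n p. ?D (w n) p v)"
      by (rule Ck_Cauchy_shift) (rule Ck_Cauchy_frechet_derivative[OF Suc.prems(6)])
  qed
qed

text \<open>The Picard iterates of \<open>\<phi> = x + \<integral> X(\<phi>)\<close> converge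
  uniformly by contraction. Their space derivatives are Picard iterates of the variational
  equation, which is linear with coefficients \<open>DX(\<phi>)\<close>; convergence of order
  \<open>k\<close> of the iterates gives convergence of order \<open>k\<close> of these
  coefficients, and thus of order \<open>k + 1\<close> of the iterates. So the limit is smooth in
  time and initial value together.\<close>

theorem smooth_local_flow:
  fixes X :: "'a::euclidean_space \<Rightarrow> 'a"
  assumes O': "open O'" "x0 \<in> O'" and X: "smooth_on O' X"
  obtains T r :: real and \<phi> where "T > 0" "r > 0" "ball x0 r \<subseteq> O'" "smooth_on ({-T<..<T} \<times> ball x0
      r) \<phi>"
    "\<And>p. p \<in> {-T<..<T} \<times> ball x0 r \<Longrightarrow> \<phi> p \<in> O'"
    "\<And>x. x \<in> ball x0 r \<Longrightarrow> \<phi> (0, x) = x"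
    "\<And>p. p \<in> {-T<..<T} \<times> ball x0 r \<Longrightarrow> frechet_derivative \<phi> (at p) (1, 0) = X (\<phi> p)"
proof -
  let ?D = "\<lambda>f p. frechet_derivative f (at p)"
  obtain R where R: "R > 0" "cball x0 R \<subseteq> O'" using O' open_contains_cball by blast
  let ?K = "cball x0 R"
  have bound: "\<exists>M>0. \<forall>y\<in>?K. norm (f y) \<le> M" if "smooth_on O' f" for f :: "'a \<Rightarrow> 'a"
  proof -
    have "compact (f ` ?K)"
      using continuous_on_subset[OF smooth_on_continuous_on[OF that] R(2)] by (intro
          compact_continuous_image) auto
    then show ?thesis using compact_imp_bounded[of "f ` ?K"] unfolding bounded_pos by auto
  qed
  obtain M where M: "M > 0" "\<And>y. y \<in> ?K \<Longrightarrow> norm (X y) \<le> M" using bound[OF X] by blast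
  have "\<forall>b. \<exists>N>0. \<forall>y\<in>?K. norm (?D X y b) \<le> N" using bound[OF smooth_on_frechet_derivative[OF X]] by
      blast
  then obtain N where N: "\<And>b. N b > 0" "\<And>b y. y \<in> ?K \<Longrightarrow> norm (?D X y b) \<le> N b" by metis
  define K where "K = (\<Sum>b\<in>(Basis::'a set). N b)"
  have K: "K > 0" unfolding K_def using N(1) by (intro sum_pos) auto
  have DX: "norm (\<Sum>b\<in>Basis. (v \<bullet> b) *\<^sub>R ?D X y b) \<le> K * norm v" if "y \<in> ?K" for y v
  proof -
    have "norm (\<Sum>b\<in>Basis. (v \<bullet> b) *\<^sub>R ?D X y b) \<le> (\<Sum>b\<in>(Basis::'a set). norm v * N b)"
      by (intro sum_norm_le) (auto intro!: mult_mono N(2)[OF that] simp: Basis_le_norm)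
    then show ?thesis by (simp add: K_def sum_distrib_left mult.commute)
  qed
  have lip: "norm (X y - X z) \<le> K * norm (y - z)" if "y \<in> ?K" "z \<in> ?K" for y z
  proof (rule differentiable_bound[where S = ?K and f' = "\<lambda>y. ?D X y"])
    fix y assume y: "y \<in> ?K"
    then have d: "(X has_derivative ?D X y) (at y)" using R(2) smooth_on_has_derivative[OF X] by
        blast
    then show "(X has_derivative ?D X y) (at y within ?K)" by (rule has_derivative_at_withinI)
    have "norm (?D X y v) \<le> K * norm v" for v
      using DX[OF y, of v] frechet_derivative_Basis[of X y v] d differentiable_def by metis
    then show "onorm (?D X y) \<le> K" by (rule onorm_le)
  qed (use that in auto)
  \<comment> \<open>The first bound keeps the iterates that start within \<open>R / 2\<close> inside the ball of radius \<open>R\<close>, the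
      second makes the iteration halve distances.\<close>
  define T where "T = min (R / (2 * M)) (1 / (2 * K))"
  have T: "T > 0" using R M K by (simp add: T_def)
  have TM: "T * M \<le> R / 2"
  proof -
    have "T * M \<le> R / (2 * M) * M" using M by (intro mult_right_mono) (auto simp: T_def)
    then show ?thesis using M by simp
  qed
  have TK: "T * K \<le> 1 / 2"
  proof -
    have "T * K \<le> 1 / (2 * K) * K" using K by (intro mult_right_mono) (auto simp: T_def)
    then show ?thesis using K by simp
  qed
  let ?B = "ball x0 (R / 2)"
  define S where "S = {-T<..<T} \<times> ?B"
  have oS: "open S" and cS: "convex S" and bS: "bounded S"
    unfolding S_def by (auto intro!: open_Times convex_Times bounded_Times)
  \<comment> \<open>Starting from a constant makes all derivatives of the first iterate vanish.\<close>
  define \<phi> where "\<phi> = rec_nat (\<lambda>p. x0) (\<lambda>n f p. snd p + time_integral (\<lambda>q. X (f q)) p)"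
  have \<phi>0: "\<phi> 0 = (\<lambda>p. x0)" and \<phi>Suc: "\<phi> (Suc n) = (\<lambda>p. snd p + time_integral (\<lambda>q. X (\<phi> n q)) p)"
      for n
    by (simp_all add: \<phi>_def)
  have inv: "smooth_on S (\<phi> n) \<and> (\<forall>p\<in>S. \<phi> n p \<in> ?K)" for n
  proof (induction n)
    case 0
    then show ?case using R by (simp add: \<phi>0 smooth_on_const)
  next
    case (Suc n)
    then have s: "smooth_on S (\<phi> n)" and k: "\<And>p. p \<in> S \<Longrightarrow> \<phi> n p \<in> ?K" by auto
    have sX: "smooth_on S (\<lambda>q. X (\<phi> n q))"
      using k R(2) by (intro smooth_on_compose[OF oS O'(1) s X]) blast
    have "smooth_on S (time_integral (\<lambda>q. X (\<phi> n q)))"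
      using sX smooth_on_time_integral[of ?B T] unfolding S_def by auto
    then have "smooth_on S (\<phi> (Suc n))"
      unfolding \<phi>Suc by (rule smooth_on_add[OF oS smooth_on_bounded_linear[OF bounded_linear_snd]])
    moreover have "\<phi> (Suc n) p \<in> ?K" if p: "p \<in> S" for p
    proof -
      have "norm (time_integral (\<lambda>q. X (\<phi> n q)) p) \<le> T * M"
        by (rule norm_time_integral_le[of T ?B])
           (use smooth_on_continuous_on[OF sX] p k M(2) in \<open>auto simp: S_def\<close>)
      moreover have "norm (snd p - x0) \<le> R / 2"
        using p by (auto simp: S_def dist_norm norm_minus_commute)
      ultimately have "norm ((snd p - x0) + time_integral (\<lambda>q. X (\<phi> n q)) p) \<le> R"
        using TM norm_triangle_ineq[of "snd p - x0" "time_integral (\<lambda>q. X (\<phi> n q)) p"] by linarith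
      then show ?thesis by (simp add: \<phi>Suc dist_norm norm_minus_commute algebra_simps)
    qed
    ultimately show ?case by blast
  qed
  then have s\<phi>: "\<And>n. smooth_on S (\<phi> n)" and k\<phi>: "\<And>n p. p \<in> S \<Longrightarrow> \<phi> n p \<in> ?K" by auto
  have sX: "smooth_on S (\<lambda>q. f (\<phi> n q))" if "smooth_on O' f" for f :: "'a \<Rightarrow> 'a" and n
    using k\<phi> R(2) by (intro smooth_on_compose[OF oS O'(1) s\<phi> that]) blast
  have DX\<phi>: "?D (\<lambda>q. X (\<phi> n q)) q v = (\<Sum>b\<in>Basis. (?D (\<phi> n) q v \<bullet> b) *\<^sub>R ?D X (\<phi> n q) b)" if "q \<in> S"
      for n q v
  proof -
    have "\<phi> n q \<in> O'" using k\<phi>[OF that] R(2) by blast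
    from frechet_derivative_at[OF has_derivative_compose_Basis[OF X s\<phi> that this], symmetric]
    show ?thesis by simp
  qed
  have D\<phi>: "?D (\<phi> (Suc n)) p v = snd v + (fst v *\<^sub>R X (\<phi> n p) + time_integral (\<lambda>q. ?D (\<lambda>q. X (\<phi> n
      q)) q (0, snd v)) p)"
    if p: "p \<in> S" for n p v
  proof -
    have "(\<phi> (Suc n) has_derivative (\<lambda>v. snd v + (fst v *\<^sub>R X (\<phi> n p) + time_integral (\<lambda>q. ?D (\<lambda>q. X
        (\<phi> n q)) q (0, snd v)) p))) (at p)"
      unfolding \<phi>Suc
      by (intro has_derivative_add has_derivative_snd[OF has_derivative_ident]
          has_derivative_time_integral[where B = ?B and T = T])
         (use smooth_onD[OF sX[OF X]] p in \<open>auto simp: S_def\<close>)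
    from frechet_derivative_at[OF this, symmetric] show ?thesis by simp
  qed
  have cauchy0: "uniformly_Cauchy_bounded S \<phi>"
  proof (rule uniformly_Cauchy_bounded_perturbed_contraction)
    show "norm (\<phi> n p) \<le> norm x0 + R" if "p \<in> S" for n p
      using k\<phi>[OF that, of n] norm_triangle_sub[of "\<phi> n p" x0] by (simp add: dist_norm
          norm_minus_commute)
    fix e :: real assume e: "e > 0"
    have "norm (\<phi> (Suc m) p - \<phi> (Suc n) p) \<le> e + d / 2"
      if d: "\<forall>p\<in>S. norm (\<phi> m p - \<phi> n p) \<le> d" and p: "p \<in> S" for m n d p
    proof -
      have cont: "continuous_on ({-T<..<T} \<times> ?B) (\<lambda>q. X (\<phi> n q))" for n
        using smooth_on_continuous_on[OF sX[OF X]] by (simp add: S_def)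
      have "norm (time_integral (\<lambda>q. X (\<phi> m q) - X (\<phi> n q)) p) \<le> T * (K * d)"
      proof (rule norm_time_integral_le[OF continuous_on_diff[OF cont cont]])
        show "p \<in> {-T<..<T} \<times> ?B" using p by (simp add: S_def)
        fix q assume "q \<in> {-T<..<T} \<times> ?B"
        then have q: "q \<in> S" by (simp add: S_def)
        have "norm (X (\<phi> m q) - X (\<phi> n q)) \<le> K * norm (\<phi> m q - \<phi> n q)" using lip k\<phi>[OF q] by blast
        also have "\<dots> \<le> K * d" using d q K by (intro mult_left_mono) auto
        finally show "norm (X (\<phi> m q) - X (\<phi> n q)) \<le> K * d" .
      qed
      moreover have "d \<ge> 0" using d p norm_ge_zero order_trans by blast
      then have "T * (K * d) \<le> 1 / 2 * d" using mult_right_mono[OF TK, of d] by (simp add: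
          mult.assoc)
      moreover have "\<phi> (Suc m) p - \<phi> (Suc n) p = time_integral (\<lambda>q. X (\<phi> m q) - X (\<phi> n q)) p"
        using time_integral_diff[OF cont cont, of p m n] p by (simp add: \<phi>Suc S_def)
      ultimately show ?thesis using e by simp
    qed
    then show "\<exists>N. \<forall>m\<ge>N. \<forall>n\<ge>N. \<forall>d. (\<forall>x\<in>S. norm (\<phi> m x - \<phi> n x) \<le> d) \<longrightarrow>
        (\<forall>x\<in>S. norm (\<phi> (Suc m) x - \<phi> (Suc n) x) \<le> e + d / 2)" by blast
  qed
  have comp: "Ck_Cauchy k S (\<lambda>n p. f (\<phi> n p))" if "Ck_Cauchy k S \<phi>" "smooth_on O' f" for k and f ::
      "'a \<Rightarrow> 'a"
    by (rule Ck_Cauchy_compose[OF oS s\<phi> that(1) compact_cball R(2) O'(1) k\<phi> that(2)])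
  have cauchy: "Ck_Cauchy k S \<phi>" for k
  proof (induction k)
    case 0
    then show ?case using cauchy0 by simp
  next
    case (Suc k)
    let ?\<beta> = "\<lambda>b n p. ?D X (\<phi> n p) b"
    have s\<beta>: "smooth_on S (?\<beta> b n)" for b n by (rule sX[OF smooth_on_frechet_derivative[OF X]])
    have \<beta>C: "Ck_Cauchy k S (?\<beta> b)" for b by (rule comp[OF Suc smooth_on_frechet_derivative[OF X]])
    have sD: "smooth_on S (\<lambda>p. ?D (\<phi> n) p v)" for n v by (rule smooth_on_frechet_derivative[OF s\<phi>])
    have space: "Ck_Cauchy k S (\<lambda>n p. ?D (\<phi> n) p (0, u))" for u
      unfolding S_def
    proof (rule Ck_Cauchy_linear_Picard[OF T, where c = "\<lambda>n p. u" and \<beta> = ?\<beta>], unfold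
        S_def[symmetric])
      fix n p assume p: "p \<in> S"
      have "time_integral (\<lambda>q. ?D (\<lambda>q. X (\<phi> n q)) q (0, u)) p =
          time_integral (\<lambda>q. \<Sum>b\<in>Basis. (?D (\<phi> n) q (0, u) \<bullet> b) *\<^sub>R ?\<beta> b n q) p"
        by (rule time_integral_cong[OF p[unfolded S_def]]) (simp add: DX\<phi>[unfolded S_def])
      then show "?D (\<phi> (Suc n)) p (0, u) = u + time_integral (\<lambda>q. \<Sum>b\<in>Basis. (?D (\<phi> n) q (0, u) \<bullet> b)
          *\<^sub>R ?\<beta> b n q) p"
        using D\<phi>[OF p, of n "(0, u)"] by simp
    next
      fix n p and y :: 'a assume p: "p \<in> S"
      have "T * norm (\<Sum>b\<in>Basis. (y \<bullet> b) *\<^sub>R ?\<beta> b n p) \<le> T * (K * norm y)"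
        using DX[OF k\<phi>[OF p]] T by (intro mult_left_mono) auto
      also have "\<dots> \<le> 1 / 2 * norm y" using mult_right_mono[OF TK, of "norm y"] by (simp add:
          mult.assoc)
      finally show "T * norm (\<Sum>b\<in>Basis. (y \<bullet> b) *\<^sub>R ?\<beta> b n p) \<le> norm y / 2" by simp
    qed (use sD s\<beta> \<beta>C in \<open>auto simp: \<phi>0 Ck_Cauchy_const smooth_on_const\<close>)
    have spaceX: "Ck_Cauchy k S (\<lambda>n q. ?D (\<lambda>q. X (\<phi> n q)) q (0, u))" for u
    proof (rule Ck_Cauchy_cong[OF oS DX\<phi>[symmetric]])
      show "Ck_Cauchy k S (\<lambda>n q. \<Sum>b\<in>Basis. (?D (\<phi> n) q (0, u) \<bullet> b) *\<^sub>R ?\<beta> b n q)"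
        by (intro Ck_Cauchy_sum Ck_Cauchy_scaleR Ck_Cauchy_inner smooth_on_scaleR smooth_on_inner oS
            sD s\<beta> \<beta>C space)
    qed
    show ?case unfolding Ck_Cauchy.simps(2)
    proof (intro conjI allI cauchy0)
      fix v :: "real \<times> 'a"
      have sI: "smooth_on S (time_integral (\<lambda>q. ?D (\<lambda>q. X (\<phi> n q)) q (0, snd v)))" for n
        unfolding S_def
        by (rule smooth_on_time_integral) (use smooth_on_frechet_derivative[OF sX[OF X]] in \<open>auto
            simp: S_def\<close>)
      have IC: "Ck_Cauchy k S (\<lambda>n. time_integral (\<lambda>q. ?D (\<lambda>q. X (\<phi> n q)) q (0, snd v)))"
        unfolding S_def
        by (rule Ck_Cauchy_time_integral[OF T]) (use smooth_on_frechet_derivative[OF sX[OF X]]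
            spaceX in \<open>auto simp: S_def\<close>)
      have "Ck_Cauchy k S (\<lambda>n p. snd v + (fst v *\<^sub>R X (\<phi> n p) + time_integral (\<lambda>q. ?D (\<lambda>q. X (\<phi> n
          q)) q (0, snd v)) p))"
        by (intro Ck_Cauchy_add Ck_Cauchy_scaleR Ck_Cauchy_const smooth_on_add smooth_on_const
            smooth_on_scaleR
            oS sX[OF X] comp[OF Suc X] sI IC)
      then have "Ck_Cauchy k S (\<lambda>n p. ?D (\<phi> (Suc n)) p v)"
        by (rule Ck_Cauchy_cong[OF oS D\<phi>[symmetric], rotated])
      then show "Ck_Cauchy k S (\<lambda>n p. ?D (\<phi> n) p v)"
        by (rule Ck_Cauchy_shift[where f = "\<lambda>n p. ?D (\<phi> n) p v"])
           (simp only: \<phi>0 frechet_derivative_const Ck_Cauchy_const)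
    qed
  qed
  define \<psi> where "\<psi> p = lim (\<lambda>n. \<phi> n p)" for p
  have lim: "(\<lambda>n. \<phi> n p) \<longlonglongrightarrow> \<psi> p" if "p \<in> S" for p
  proof -
    have "Cauchy (\<lambda>n. \<phi> n p)"
      unfolding Cauchy_iff
    proof (intro allI impI)
      fix e :: real assume "e > 0"
      then have "e / 2 > 0" "e / 2 < e" by auto
      moreover from uniformly_Cauchy_boundedD[OF cauchy0 this(1)] obtain n0 where
        "\<And>m n x. m \<ge> n0 \<Longrightarrow> n \<ge> n0 \<Longrightarrow> x \<in> S \<Longrightarrow> norm (\<phi> m x - \<phi> n x) \<le> e / 2" by metis
      ultimately have "\<forall>m\<ge>n0. \<forall>n\<ge>n0. norm (\<phi> m p - \<phi> n p) < e" using that le_less_trans by blast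
      then show "\<exists>M. \<forall>m\<ge>M. \<forall>n\<ge>M. norm (\<phi> m p - \<phi> n p) < e" by blast
    qed
    then show ?thesis unfolding \<psi>_def by (simp add: Cauchy_convergent_iff convergent_LIMSEQ_iff)
  qed
  have smooth: "smooth_on S \<psi>"
    unfolding smooth_on_def using Ck_Cauchy_limit[OF oS cS s\<phi> cauchy lim] by blast
  have K\<psi>: "\<psi> p \<in> ?K" if "p \<in> S" for p
    using closed_sequentially[OF closed_cball, of "\<lambda>n. \<phi> n p"] k\<phi>[OF that] lim[OF that] by blast
  have start: "\<psi> (0, x) = x" if "x \<in> ?B" for x
  proof -
    have "(0, x) \<in> S" using that T by (simp add: S_def)
    from LIMSEQ_Suc[OF lim[OF this]] show ?thesis
      by (simp add: \<phi>Suc time_integral_def LIMSEQ_const_iff)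
  qed
  have ode: "?D \<psi> p (1, 0) = X (\<psi> p)" if p: "p \<in> S" for p
  proof -
    have C1: "uniformly_Cauchy_bounded S (\<lambda>n x. ?D (\<phi> n) x v)" for v
      using Ck_Cauchy_frechet_derivative[OF cauchy[of "Suc 0"]] by simp
    note L = Ck_Cauchy_has_derivative_limit[OF oS cS s\<phi> C1 lim p]
    have "(\<lambda>n. ?D (\<phi> n) p (1, 0)) \<longlonglongrightarrow> ?D \<psi> p (1, 0)"
      using L(2)[of "(1, 0)"] frechet_derivative_at[OF L(1), symmetric] by simp
    then have "(\<lambda>n. ?D (\<phi> (Suc n)) p (1, 0)) \<longlonglongrightarrow> ?D \<psi> p (1, 0)" by (rule LIMSEQ_Suc)
    moreover have "?D (\<phi> (Suc n)) p (1, 0) = X (\<phi> n p)" for n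
    proof -
      have "?D (\<lambda>q. X (\<phi> n q)) q (0, 0) = 0" if "q \<in> S" for q
        using linear_0[OF linear_frechet_derivative[OF smooth_on_differentiable[OF sX[OF X] that]]]
        by (simp add: zero_prod_def)
      then have "time_integral (\<lambda>q. ?D (\<lambda>q. X (\<phi> n q)) q (0, 0)) p = time_integral (\<lambda>q. 0) p"
        by (intro time_integral_cong[OF p[unfolded S_def]]) (simp add: S_def)
      then have "time_integral (\<lambda>q. ?D (\<lambda>q. X (\<phi> n q)) q (0, 0)) p = 0"
        by (simp add: time_integral_def)
      then show ?thesis using D\<phi>[OF p, of n "(1, 0)"] by simp
    qed
    moreover have "(\<lambda>n. X (\<phi> n p)) \<longlonglongrightarrow> X (\<psi> p)"
      using K\<psi>[OF p] R(2) smooth_on_differentiable[OF X] differentiable_imp_continuous_within lim[OF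
          p]
      by (intro isCont_tendsto_compose[of "\<psi> p" X]) blast+
    ultimately show ?thesis using LIMSEQ_unique by fastforce
  qed
  have "?B \<subseteq> O'" using R by (auto intro!: subsetD[OF R(2)])
  then show ?thesis
    using that[of T "R / 2" \<psi>] T R smooth K\<psi> start ode unfolding S_def by (auto simp: subset_iff)
qed

section \<open>Closed one-forms on balls\<close>

lemma frechet_derivative_axis_sum:
  fixes f :: "real^'n \<Rightarrow> 'b::real_normed_vector"
  assumes "f differentiable (at x)"
  shows "frechet_derivative f (at x) v = (\<Sum>i\<in>UNIV. (v $ i) *\<^sub>R frechet_derivative f (at x) (axis i
      1))"
proof -
  interpret linear "frechet_derivative f (at x)" using linear_frechet_derivative[OF assms] .
  have "v = (\<Sum>i\<in>UNIV. (v $ i) *\<^sub>R axis i (1::real))"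
    by (simp add: vec_eq_iff axis_def if_distrib cong: if_cong)
  then have "frechet_derivative f (at x) v = frechet_derivative f (at x) (\<Sum>i\<in>UNIV. (v $ i) *\<^sub>R axis
      i (1::real))"
    by simp
  then show ?thesis by (simp add: sum scale)
qed

lemma frechet_derivative_pd_sum:
  assumes "f differentiable (at x)"
  shows "frechet_derivative f (at x) v = (\<Sum>i\<in>UNIV. v $ i * pd i f x)"
  using frechet_derivative_axis_sum[OF assms, of v] unfolding pd_def real_scaleR_def .

lemma smooth_on_inner_vec:
  fixes f g :: "'a::real_normed_vector \<Rightarrow> real^'n"
  shows "open S \<Longrightarrow> smooth_on S f \<Longrightarrow> smooth_on S g \<Longrightarrow> smooth_on S (\<lambda>x. f x \<bullet> g x)"
  unfolding inner_vec_def by (simp add: smooth_on_sum smooth_on_mult smooth_on_nth)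

lemma closed_form_derivative_symmetric:
  fixes b :: "real^'n \<Rightarrow> real^'n"
  assumes "open S" "smooth_on S b" "x \<in> S"
    and closed: "\<And>i j. pd i (\<lambda>z. b z $ j) x = pd j (\<lambda>z. b z $ i) x"
  shows "frechet_derivative b (at x) v \<bullet> w = frechet_derivative b (at x) w \<bullet> v"
proof -
  have "frechet_derivative b (at x) v \<bullet> w = (\<Sum>j\<in>UNIV. \<Sum>i\<in>UNIV. v $ i * pd i (\<lambda>z. b z $ j) x * w $
      j)" for v w
  proof -
    have "frechet_derivative b (at x) v $ j = (\<Sum>i\<in>UNIV. v $ i * pd i (\<lambda>z. b z $ j) x)" for j
    proof -
      have d: "((\<lambda>z. b z $ j) has_derivative (\<lambda>v. frechet_derivative b (at x) v $ j)) (at x)"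
        by (rule bounded_linear.has_derivative[OF bounded_linear_vec_nth smooth_on_has_derivative[OF
            assms(2,3)]])
      then have "frechet_derivative (\<lambda>z. b z $ j) (at x) v = frechet_derivative b (at x) v $ j"
        by (simp add: frechet_derivative_at[symmetric])
      moreover have "(\<lambda>z. b z $ j) differentiable (at x)" using d differentiable_def by blast
      ultimately show ?thesis using frechet_derivative_pd_sum[of "\<lambda>z. b z $ j" x v] by simp
    qed
    then show ?thesis by (simp add: inner_vec_def sum_distrib_right)
  qed
  from this[of v w] this[of w v] show ?thesis
    using closed by (subst (asm) (2) sum.swap) (simp add: mult_ac)
qed

text \<open>The potential is the integral of the form along rays. Its derivative in direction
  \<open>w\<close> is an integral whose integrand is, by closedness, the derivative of \<open>t
  b(x0 + t y) w\<close> with respect to \<open>t\<close>. The radius is halved only so that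
  \<open>time_integral\<close>, which needs an open time interval around \<open>1\<close>, can be
  used for the integral.\<close>

lemma closed_form_potential:
  fixes b :: "real^'n \<Rightarrow> real^'n"
  assumes r: "r > 0" and b: "smooth_on (ball x0 r) b"
    and closed: "\<And>x i j. x \<in> ball x0 r \<Longrightarrow> pd i (\<lambda>z. b z $ j) x = pd j (\<lambda>z. b z $ i) x"
  obtains u where "smooth_on (ball x0 (r / 2)) u" "u x0 = 0"
    "\<And>x v. x \<in> ball x0 (r / 2) \<Longrightarrow> frechet_derivative u (at x) v = b x \<bullet> v"
proof -
  let ?B = "ball (0::real^'n) (r / 2)" and ?S = "{-2<..<2::real} \<times> ball (0::real^'n) (r / 2)"
  define g where "g p = b (x0 + fst p *\<^sub>R snd p) \<bullet> snd p" for p :: "real \<times> (real^'n)"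
  have oS: "open ?S" by (simp add: open_Times)
  have inB: "x0 + fst p *\<^sub>R snd p \<in> ball x0 r" if "p \<in> ?S" for p
  proof -
    have "\<bar>fst p\<bar> * norm (snd p) < 2 * (r / 2)"
      using that by (intro mult_strict_mono') auto
    then show ?thesis by (simp add: dist_norm)
  qed
  have saff: "smooth_on ?S (\<lambda>p. x0 + fst p *\<^sub>R snd p)"
    by (intro smooth_on_add smooth_on_scaleR smooth_on_const oS smooth_on_bounded_linear
        bounded_linear_fst bounded_linear_snd)
  have "smooth_on ?S (\<lambda>p. b (x0 + fst p *\<^sub>R snd p))"
    using inB by (intro smooth_on_compose[OF oS open_ball saff b]) blast
  then have sg: "smooth_on ?S g"
    unfolding g_def[abs_def]
    by (rule smooth_on_inner_vec[OF oS _ smooth_on_bounded_linear[OF bounded_linear_snd]])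
  have Db: "(b has_derivative frechet_derivative b (at x)) (at x)" if "x \<in> ball x0 r" for x
    using smooth_on_has_derivative[OF b that] .
  have Dg: "frechet_derivative g (at p) (0, w) =
      fst p * (frechet_derivative b (at (x0 + fst p *\<^sub>R snd p)) w \<bullet> snd p) + b (x0 + fst p *\<^sub>R snd
          p) \<bullet> w"
    if p: "p \<in> ?S" for p w
  proof -
    let ?Db = "frechet_derivative b (at (x0 + fst p *\<^sub>R snd p))"
    have "((\<lambda>p. b (x0 + fst p *\<^sub>R snd p)) has_derivative (\<lambda>v. ?Db (fst p *\<^sub>R snd v + fst v *\<^sub>R snd
        p))) (at p)"
      by (rule has_derivative_compose[where f = "\<lambda>p. x0 + fst p *\<^sub>R snd p" and g = b, OF _ Db[OF
          inB[OF p]]])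
         (auto intro!: derivative_eq_intros)
    then have "(g has_derivative (\<lambda>v. b (x0 + fst p *\<^sub>R snd p) \<bullet> snd v + ?Db (fst p *\<^sub>R snd v + fst
        v *\<^sub>R snd p) \<bullet> snd p)) (at p)"
      unfolding g_def[abs_def] by (intro has_derivative_inner has_derivative_snd
          has_derivative_ident)
    from frechet_derivative_at[OF this, symmetric] show ?thesis
      using linear_cmul[OF has_derivative_linear[OF Db[OF inB[OF p]]], of "fst p" w] by simp
  qed
  define U where "U y = time_integral g (1, y)" for y
  have DU: "(U has_derivative (\<lambda>w. b (x0 + y) \<bullet> w)) (at y)" if y: "y \<in> ?B" for y
  proof -
    have p: "(1, y) \<in> ?S" using y by simp
    have 1: "(time_integral g has_derivative (\<lambda>v. fst v *\<^sub>R g (1, y) +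
        time_integral (\<lambda>q. frechet_derivative g (at q) (0, snd v)) (1, y))) (at (1, y))"
      by (rule has_derivative_time_integral[OF _ _ smooth_onD[OF sg] p]) auto
    have 2: "((\<lambda>y. (1::real, y)) has_derivative (\<lambda>w. (0, w))) (at y)"
      by (intro has_derivative_Pair has_derivative_const has_derivative_ident)
    have "(U has_derivative (\<lambda>w. time_integral (\<lambda>q. frechet_derivative g (at q) (0, w)) (1, y))) (at
        y)"
      unfolding U_def[abs_def] using has_derivative_compose[OF 2 1] by simp
    moreover have "time_integral (\<lambda>q. frechet_derivative g (at q) (0, w)) (1, y) = b (x0 + y) \<bullet> w"
        for w
    proof -
      have "((\<lambda>s. frechet_derivative g (at (s, y)) (0, w)) has_integral
          1 * (b (x0 + 1 *\<^sub>R y) \<bullet> w) - 0 * (b (x0 + 0 *\<^sub>R y) \<bullet> w)) {0..1}"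
      proof (rule fundamental_theorem_of_calculus)
        fix s :: real assume s: "s \<in> {0..1}"
        then have q: "(s, y) \<in> ?S" using y by auto
        let ?z = "x0 + s *\<^sub>R y"
        have z: "?z \<in> ball x0 r" using inB[OF q] by simp
        have lin: "linear (frechet_derivative b (at ?z))" using has_derivative_linear[OF Db[OF z]] .
        have "((\<lambda>s. b (x0 + s *\<^sub>R y)) has_derivative (\<lambda>t. frechet_derivative b (at ?z) (t *\<^sub>R y)))
            (at s)"
          by (rule has_derivative_compose[where f = "\<lambda>s. x0 + s *\<^sub>R y" and g = b, OF _ Db[OF z]])
             (auto intro!: derivative_eq_intros)
        then have "((\<lambda>s. b (x0 + s *\<^sub>R y) \<bullet> w) has_derivative (\<lambda>t. frechet_derivative b (at ?z) (t
            *\<^sub>R y) \<bullet> w)) (at s)"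
          by (rule has_derivative_inner_left)
        moreover have "(\<lambda>t. frechet_derivative b (at ?z) (t *\<^sub>R y) \<bullet> w) = (*) (frechet_derivative b
            (at ?z) y \<bullet> w)"
          using linear_cmul[OF lin, of _ y] by (simp add: fun_eq_iff)
        ultimately have "((\<lambda>s. b (x0 + s *\<^sub>R y) \<bullet> w) has_real_derivative frechet_derivative b (at
            ?z) y \<bullet> w) (at s)"
          by (simp add: has_field_derivative_def)
        from DERIV_mult[OF DERIV_ident this]
        have "((\<lambda>s. s * (b (x0 + s *\<^sub>R y) \<bullet> w)) has_real_derivative
            b ?z \<bullet> w + s * (frechet_derivative b (at ?z) y \<bullet> w)) (at s)" by (simp add: mult_ac)
        moreover have "frechet_derivative b (at ?z) y \<bullet> w = frechet_derivative b (at ?z) w \<bullet> y"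
          by (rule closed_form_derivative_symmetric[OF open_ball b z closed[OF z]])
        ultimately have "((\<lambda>s. s * (b (x0 + s *\<^sub>R y) \<bullet> w)) has_real_derivative frechet_derivative g
            (at (s, y)) (0, w)) (at s)"
          using Dg[OF q, of w] by (simp add: add.commute)
        then show "((\<lambda>s. s * (b (x0 + s *\<^sub>R y) \<bullet> w)) has_vector_derivative frechet_derivative g (at
            (s, y)) (0, w)) (at s within {0..1})"
          by (rule has_vector_derivative_at_within[OF iffD1[OF
              has_real_derivative_iff_has_vector_derivative]])
      qed simp
      then show ?thesis by (simp add: time_integral_def integral_unique)
    qed
    ultimately show ?thesis by simp
  qed
  define u where "u x = U (x - x0)" for x
  have Du: "(u has_derivative (\<lambda>w. b x \<bullet> w)) (at x)" if "x \<in> ball x0 (r / 2)" for x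
  proof -
    have "x - x0 \<in> ?B" using that by (simp add: dist_norm norm_minus_commute)
    from DU[OF this] have "(U has_derivative (\<lambda>w. b x \<bullet> w)) (at (x - x0))" by simp
    moreover have "((\<lambda>x. x - x0) has_derivative (\<lambda>w. w)) (at x)"
      by (auto intro!: derivative_eq_intros)
    ultimately show ?thesis
      using has_derivative_compose[of "\<lambda>x. x - x0" "\<lambda>w. w" x UNIV U] unfolding u_def[abs_def] by
          simp
  qed
  have "Ck_on (Suc k) (ball x0 (r / 2)) u" for k
  proof (rule Ck_on_SucI[OF open_ball Du])
    have "smooth_on (ball x0 (r / 2)) (\<lambda>x. b x \<bullet> v)" for v
      using r by (intro smooth_on_inner open_ball smooth_on_subset[OF b]) auto
    then show "Ck_on k (ball x0 (r / 2)) (\<lambda>x. b x \<bullet> v)" for v by (rule smooth_onD)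
  qed
  then have "smooth_on (ball x0 (r / 2)) u" unfolding smooth_on_def using Ck_on_SucD by blast
  moreover have "u x0 = 0" by (simp add: u_def U_def time_integral_def g_def)
  moreover have "frechet_derivative u (at x) v = b x \<bullet> v" if "x \<in> ball x0 (r / 2)" for x v
    using frechet_derivative_at[OF Du[OF that], symmetric] by simp
  ultimately show ?thesis using that by blast
qed

section \<open>Charts and tangent vectors\<close>

abbreviation jacobian_map :: "('p, 'n::finite) chart \<Rightarrow> ('p, 'n) chart \<Rightarrow> real^'n \<Rightarrow> real^'n \<Rightarrow> real^'n"
    where
  "jacobian_map c d x \<equiv> frechet_derivative (transition c d) (at x)"

text \<open>The domain of \<open>transition c d\<close>.\<close>

definition overlap :: "('p, 'n) chart \<Rightarrow> ('p, 'n) chart \<Rightarrow> (real^'n) set" where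
  "overlap c d = {x \<in> img c. pt c x \<in> dom_of d}"

lemma is_chart_coords_pt:
  assumes "is_chart c" "x \<in> img c" shows "coords c (pt c x) = x" "pt c x \<in> dom_of c"
  using assms unfolding is_chart_def homeomorphism_def by auto

lemma is_chart_pt_coords:
  assumes "is_chart c" "p \<in> dom_of c" shows "pt c (coords c p) = p" "coords c p \<in> img c"
  using assms unfolding is_chart_def homeomorphism_def by auto

lemma overlap_eq:
  assumes "is_chart c" shows "overlap c d = coords c ` (dom_of c \<inter> dom_of d)"
proof
  show "overlap c d \<subseteq> coords c ` (dom_of c \<inter> dom_of d)"
  proof
    fix x assume x: "x \<in> overlap c d"
    then have "x = coords c (pt c x)" "pt c x \<in> dom_of c \<inter> dom_of d"
      using is_chart_coords_pt[OF assms] by (auto simp: overlap_def)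
    then show "x \<in> coords c ` (dom_of c \<inter> dom_of d)" by (rule image_eqI)
  qed
  show "coords c ` (dom_of c \<inter> dom_of d) \<subseteq> overlap c d"
    using is_chart_pt_coords[OF assms] by (auto simp: overlap_def)
qed

lemma open_overlap_charts:
  assumes "is_chart c" "is_chart d" shows "open (overlap c d)"
proof -
  have "overlap c d = img c \<inter> pt c -` dom_of d" by (auto simp: overlap_def)
  moreover have "continuous_on (img c) (pt c)" using assms by (simp add: is_chart_def
      homeomorphism_def)
  ultimately show ?thesis
    using assms continuous_open_preimage[of "img c" "pt c" "dom_of d"] by (simp add: is_chart_def)
qed

locale smooth_manifold =
  fixes D :: "('p::topological_space, 'n::finite) chart set"
  assumes smooth_structure: "smooth_structure D"
begin

lemma chart: "c \<in> D \<Longrightarrow> is_chart c"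
  using smooth_structure by (simp add: smooth_structure_def)

lemma open_img: "c \<in> D \<Longrightarrow> open (img c)"
  using chart by (auto simp: is_chart_def)

lemmas coords_pt = is_chart_coords_pt[OF chart]
lemmas pt_coords = is_chart_pt_coords[OF chart]

lemma ex_chart: obtains c where "c \<in> D" "p \<in> dom_of c"
  using smooth_structure unfolding smooth_structure_def by blast

lemma smooth_on_transition: "c \<in> D \<Longrightarrow> d \<in> D \<Longrightarrow> smooth_on (overlap c d) (transition c d)"
  using smooth_structure overlap_eq[OF chart] unfolding smooth_structure_def smooth_transition_def
      by metis

lemma open_overlap: "c \<in> D \<Longrightarrow> d \<in> D \<Longrightarrow> open (overlap c d)"
  using open_overlap_charts chart by blast

lemma transition_has_derivative:
  "c \<in> D \<Longrightarrow> d \<in> D \<Longrightarrow> x \<in> overlap c d \<Longrightarrow> (transition c d has_derivative jacobian_map c d x) (at x)"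
  using smooth_on_has_derivative[OF smooth_on_transition] .

lemma transition_in:
  assumes "c \<in> D" "d \<in> D" "x \<in> overlap c d"
  shows "transition c d x \<in> overlap d c" "pt d (transition c d x) = pt c x" "transition c d x \<in> img
      d"
  using assms coords_pt[of c x] pt_coords[of d "pt c x"] by (auto simp: overlap_def transition_def)

lemma transition_trans:
  assumes "c \<in> D" "d \<in> D" "x \<in> overlap c d"
  shows "transition d e (transition c d x) = transition c e x"
  using transition_in[OF assms] by (simp add: transition_def)

lemma jacobian_map_chain:
  assumes "c \<in> D" "d \<in> D" "e \<in> D" "x \<in> overlap c d" "x \<in> overlap c e"
  shows "jacobian_map d e (transition c d x) (jacobian_map c d x y) = jacobian_map c e x y"
proof -
  have 1: "transition c d x \<in> overlap d e"
    using transition_in[OF assms(1,2,4)] assms(5) by (simp add: overlap_def)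
  have "((\<lambda>x. transition d e (transition c d x)) has_derivative
      (\<lambda>y. jacobian_map d e (transition c d x) (jacobian_map c d x y))) (at x)"
    using has_derivative_compose[OF transition_has_derivative[OF assms(1,2,4)]
        transition_has_derivative[OF assms(2,3) 1]] .
  then have "(transition c e has_derivative (\<lambda>y. jacobian_map d e (transition c d x) (jacobian_map c
      d x y))) (at x)"
    by (rule has_derivative_transform_within_open[OF _ open_overlap[OF assms(1,2)] assms(4)])
       (rule transition_trans[OF assms(1,2)])
  from frechet_derivative_at[OF this] show ?thesis by metis
qed

lemma jacobian_map_refl:
  assumes "c \<in> D" "x \<in> img c" shows "jacobian_map c c x y = y"
proof -
  have "((\<lambda>x. x) has_derivative (\<lambda>y. y)) (at x)" by (rule has_derivative_ident)
  then have "(transition c c has_derivative (\<lambda>y. y)) (at x)"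
    by (rule has_derivative_transform_within_open[OF _ open_img[OF assms(1)] assms(2)])
       (use coords_pt[OF assms(1)] in \<open>simp add: transition_def\<close>)
  from frechet_derivative_at[OF this] show ?thesis by metis
qed

lemma linear_jacobian_map: "c \<in> D \<Longrightarrow> d \<in> D \<Longrightarrow> x \<in> overlap c d \<Longrightarrow> linear (jacobian_map c d x)"
  using has_derivative_linear[OF transition_has_derivative] .

lemma overlap_refl: "c \<in> D \<Longrightarrow> x \<in> img c \<Longrightarrow> x \<in> overlap c c"
  using coords_pt by (simp add: overlap_def)

lemma tv_apply: "d \<in> D \<Longrightarrow> x \<in> overlap c d \<Longrightarrow> tv D c x y d = jacobian_map c d x y"
  by (simp add: tv_def overlap_def)

lemma tv_self: "c \<in> D \<Longrightarrow> x \<in> img c \<Longrightarrow> tv D c x y c = y"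
  using tv_apply overlap_refl jacobian_map_refl by metis

lemma tv_transition:
  assumes "c \<in> D" "d \<in> D" "x \<in> overlap c d"
  shows "tv D c x y = tv D d (transition c d x) (jacobian_map c d x y)"
proof
  fix e
  show "tv D c x y e = tv D d (transition c d x) (jacobian_map c d x y) e"
  proof (cases "e \<in> D \<and> pt c x \<in> dom_of e")
    case True
    then have "x \<in> overlap c e" using assms(3) by (simp add: overlap_def)
    then show ?thesis
      using True jacobian_map_chain[OF assms(1,2) _ assms(3), of e y] transition_in[OF assms]
      by (simp add: tv_def)
  next
    case False
    then show ?thesis using transition_in[OF assms] by (auto simp: tv_def)
  qed
qed

lemma tv_in_tangent_space:
  assumes "c \<in> D" "x \<in> img c" shows "tv D c x y \<in> tangent_space D (pt c x)"
  unfolding tangent_space_def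
proof (intro CollectI conjI ballI allI impI)
  fix d e assume d: "d \<in> D" and e: "e \<in> D" and p: "pt c x \<in> dom_of d \<inter> dom_of e"
  have od: "x \<in> overlap c d" and oe: "x \<in> overlap c e" using p assms by (auto simp: overlap_def)
  show "tv D c x y e = frechet_derivative (transition d e) (at (coords d (pt c x))) (tv D c x y d)"
    using jacobian_map_chain[OF assms(1) d e od oe, of y] tv_apply[OF e oe] tv_apply[OF d od]
    by (simp add: transition_def)
qed (auto simp: tv_def)

lemma tangent_space_conv_tv:
  assumes "c \<in> D" "p \<in> dom_of c" "v \<in> tangent_space D p"
  shows "v = tv D c (coords c p) (v c)"
proof
  fix e
  show "v e = tv D c (coords c p) (v c) e"
  proof (cases "e \<in> D \<and> p \<in> dom_of e")
    case True
    then have "v e = jacobian_map c e (coords c p) (v c)"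
      using assms unfolding tangent_space_def by blast
    then show ?thesis using True pt_coords[OF assms(1,2)] by (simp add: tv_def)
  next
    case False
    then have "v e = 0" using assms(3) unfolding tangent_space_def by blast
    then show ?thesis using False pt_coords[OF assms(1,2)] by (auto simp: tv_def)
  qed
qed

lemma tv_add: "c \<in> D \<Longrightarrow> x \<in> img c \<Longrightarrow> tv D c x (y + z) = (\<lambda>d. tv D c x y d + tv D c x z d)"
  using linear_add[OF linear_jacobian_map[of c _ x]] by (fastforce simp: tv_def overlap_def)

lemma tv_scaleR: "c \<in> D \<Longrightarrow> x \<in> img c \<Longrightarrow> tv D c x (r *\<^sub>R y) = (\<lambda>d. r *\<^sub>R tv D c x y d)"
  using linear_cmul[OF linear_jacobian_map[of c _ x]] by (fastforce simp: tv_def overlap_def)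

lemma tv_eq_0_iff: "c \<in> D \<Longrightarrow> x \<in> img c \<Longrightarrow> tv D c x y = (\<lambda>_. 0) \<longleftrightarrow> y = 0"
  using tv_self tv_scaleR[of c x 0 y] by (metis scaleR_zero_left)

subsection \<open>New charts from local parametrizations\<close>

text \<open>Maximality of the atlas makes every local diffeomorphism into the image of a chart
  the inverse of a chart. Prescribing the inverse has the advantage that the image of the new
  chart can be chosen, for instance as a ball.\<close>

lemma chart_from_parametrization:
  assumes c: "c \<in> D" and hom: "homeomorphism V U \<Phi> g" and V: "open V" and U: "open U" "U \<subseteq> img c"
    and \<Phi>: "smooth_on V \<Phi>" and g: "smooth_on U g"
  defines "c' \<equiv> (pt c ` U, g \<circ> coords c)"
  shows "c' \<in> D" "img c' = V" "\<And>z. z \<in> V \<Longrightarrow> pt c' z = pt c (\<Phi> z)" "pt c ` U \<subseteq> dom_of c"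
proof -
  have hc: "homeomorphism (dom_of c) (img c) (coords c) (pt c)" and od: "open (dom_of c)"
    using chart[OF c] by (auto simp: is_chart_def)
  have gV: "g ` U = V" and \<Phi>U: "\<Phi> ` V = U" and g\<Phi>: "\<And>z. z \<in> V \<Longrightarrow> g (\<Phi> z) = z" and \<Phi>g: "\<And>x. x \<in> U \<Longrightarrow> \<Phi>
      (g x) = x"
    using hom by (auto simp: homeomorphism_def)
  have ptU: "coords c (pt c x) = x" "pt c x \<in> dom_of c" if "x \<in> U" for x
    using coords_pt[OF c] U(2) that by blast+
  show sub: "pt c ` U \<subseteq> dom_of c" using ptU by auto
  have cU: "coords c ` pt c ` U = U" using ptU by force
  have "homeomorphism (pt c ` U) U (coords c) (pt c)"
    by (rule homeomorphism_of_subsets[OF hc sub U(2) cU])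
  then have h1: "homeomorphism (pt c ` U) V (g \<circ> coords c) (pt c \<circ> \<Phi>)"
    by (rule homeomorphism_compose[OF _ homeomorphism_symD[OF hom]])
  have dom': "dom_of c' = pt c ` U" and co': "coords c' = g \<circ> coords c" by (simp_all add: c'_def)
  show img': "img c' = V" unfolding img_def dom' co' using h1 by (simp add: homeomorphism_def)
  show pt': "pt c' z = pt c (\<Phi> z)" if "z \<in> V" for z
  proof -
    have inj: "inj_on (coords c') (dom_of c')"
      unfolding dom' co' by (rule inj_on_inverseI, rule homeomorphism_apply1[OF h1])
    have "pt c (\<Phi> z) \<in> dom_of c'" "coords c' (pt c (\<Phi> z)) = z"
      using that \<Phi>U ptU(1) g\<Phi> by (auto simp: dom' co')
    then show ?thesis unfolding pt_def[of c'] by (metis inj inv_into_f_f)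
  qed
  have "openin (top_of_set (dom_of c)) (pt c ` U)"
    using homeomorphism_imp_open_map[OF homeomorphism_symD[OF hc], of U] U open_openin_trans
    by (simp add: openin_open_eq od openin_open_subtopology open_img[OF c] openin_open_eq)
  then have "open (pt c ` U)" using od openin_open_eq by blast
  then have ch': "is_chart c'"
    unfolding is_chart_def dom' img' co'
    using V homeomorphism_cong[OF h1 refl refl] pt' by (simp add: o_def)
  have smooth1: "smooth_transition c' d" if d: "d \<in> D" for d
  proof -
    let ?W = "overlap c' d"
    have o: "open ?W" using open_overlap_charts[OF ch' chart[OF d]] .
    have W: "?W = {z \<in> V. \<Phi> z \<in> overlap c d}"
      using pt' U(2) \<Phi>U by (auto simp: overlap_def img')
    have "smooth_on ?W (\<lambda>z. transition c d (\<Phi> z))"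
      by (rule smooth_on_compose[OF o open_overlap[OF c d] smooth_on_subset[OF \<Phi>]
          smooth_on_transition[OF c d]])
         (auto simp: W)
    then have "smooth_on ?W (transition c' d)"
      by (rule smooth_on_cong[OF o, rotated]) (simp add: W transition_def pt')
    then show ?thesis unfolding smooth_transition_def overlap_eq[OF ch'] .
  qed
  have smooth2: "smooth_transition d c'" if d: "d \<in> D" for d
  proof -
    let ?W = "overlap d c'"
    have o: "open ?W" using open_overlap_charts[OF chart[OF d] ch'] .
    have W: "z \<in> overlap d c \<and> transition d c z \<in> U" if "z \<in> ?W" for z
      using that ptU sub by (auto simp: overlap_def dom' transition_def)
    have "smooth_on ?W (\<lambda>z. g (transition d c z))"
      by (rule smooth_on_compose[OF o U(1) smooth_on_subset[OF smooth_on_transition[OF d c]] g])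
          (use W in auto)
    then have "smooth_on ?W (transition d c')" by (simp add: transition_def[abs_def] co')
    then show ?thesis unfolding smooth_transition_def overlap_eq[OF chart[OF d]] .
  qed
  show "c' \<in> D" using smooth_structure ch' smooth1 smooth2 unfolding smooth_structure_def by blast
qed

end

section \<open>Covariant derivatives of one-forms\<close>

definition bform :: "real^'n^'n \<Rightarrow> real^'n \<Rightarrow> real^'n \<Rightarrow> real" where
  "bform N y z = (\<Sum>i\<in>UNIV. \<Sum>j\<in>UNIV. N $ i $ j * y $ i * z $ j)"

lemma bform_conv_inner: "bform N y z = y \<bullet> (N *v z)"
  by (simp add: bform_def inner_vec_def matrix_vector_mult_def sum_distrib_left mult_ac)

lemma bform_add_left: "bform N (y + y') z = bform N y z + bform N y' z"
  and bform_add_right: "bform N y (z + z') = bform N y z + bform N y z'"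
  and bform_scaleR_left: "bform N (r *\<^sub>R y) z = r * bform N y z"
  and bform_scaleR_right: "bform N y (r *\<^sub>R z) = r * bform N y z"
  by (simp_all add: bform_conv_inner inner_left_distrib inner_right_distrib
      matrix_vector_right_distrib
      matrix_vector_mult_scaleR)

lemma bform_zero_left [simp]: "bform N 0 z = 0" and bform_zero_right [simp]: "bform N y 0 = 0"
  by (simp_all add: bform_def)

lemma bform_axis: "bform N (axis i 1) (axis j 1) = N $ i $ j"
  by (simp add: bform_def axis_def if_distrib[of "\<lambda>u. _ * u"] if_distrib[of "\<lambda>u. u * _"] cong:
      if_cong)

lemma bform_commute:
  assumes "\<And>i j. N $ i $ j = N $ j $ i" shows "bform N y z = bform N z y"
  unfolding bform_def by (subst sum.swap) (simp add: assms mult_ac)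

lemma linear_bilinear_conv_bform:
  fixes f :: "real^'n \<Rightarrow> real^'n \<Rightarrow> real"
  assumes "\<And>z. linear (\<lambda>y. f y z)" "\<And>y. linear (f y)"
  shows "f y z = bform (\<chi> i j. f (axis i 1) (axis j 1)) y z"
proof -
  have e: "v = (\<Sum>i\<in>UNIV. v $ i *\<^sub>R axis i 1)" for v :: "real^'n"
    by (simp add: vec_eq_iff axis_def if_distrib cong: if_cong)
  have "f y z = (\<Sum>i\<in>UNIV. y $ i * f (axis i 1) z)" for z
    using linear_sum[OF assms(1), of "\<lambda>i. y $ i *\<^sub>R axis i 1" UNIV z] linear_cmul[OF assms(1)] e[of
        y] by simp
  moreover have "f y z = (\<Sum>i\<in>UNIV. z $ i * f y (axis i 1))" for y
    using linear_sum[OF assms(2), of y "\<lambda>i. z $ i *\<^sub>R axis i 1" UNIV] linear_cmul[OF assms(2)] e[of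
        z] by simp
  ultimately have "f y z = (\<Sum>j\<in>UNIV. \<Sum>i\<in>UNIV. f (axis i 1) (axis j 1) * y $ i * z $ j)"
    by (simp add: sum_distrib_left mult_ac)
  then show ?thesis unfolding bform_def by (subst sum.swap) simp
qed

context smooth_manifold
begin

lemma one_form_tv:
  assumes "one_form D b" and c: "c \<in> D" "x \<in> img c"
  shows "b (pt c x) (tv D c x y) = covec D c b x \<bullet> y"
proof -
  have l: "linear_form_on (tangent_space D (pt c x)) (b (pt c x))" using assms(1) by (simp add:
      one_form_def)
  have "linear (\<lambda>y. b (pt c x) (tv D c x y))"
    using l tv_in_tangent_space[OF c] by (intro linearI) (auto simp: linear_form_on_def tv_add[OF c]
        tv_scaleR[OF c])
  then interpret linear "\<lambda>y. b (pt c x) (tv D c x y)" .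
  have "y = (\<Sum>i\<in>UNIV. y $ i *\<^sub>R axis i 1)"
    by (simp add: vec_eq_iff axis_def if_distrib cong: if_cong)
  then have "b (pt c x) (tv D c x y) = b (pt c x) (tv D c x (\<Sum>i\<in>UNIV. y $ i *\<^sub>R axis i 1))" by simp
  also have "\<dots> = covec D c b x \<bullet> y"
    by (simp add: sum scale covec_def inner_vec_def mult.commute)
  finally show ?thesis .
qed

lemma metric_tv:
  assumes "pseudo_riemannian D a" and c: "c \<in> D" "x \<in> img c"
  shows "a (pt c x) (tv D c x y) (tv D c x z) = bform (metric_mat D c a x) y z"
proof -
  let ?T = "tangent_space D (pt c x)"
  have l: "linear_form_on ?T (a (pt c x) v)" and s: "\<And>w. w \<in> ?T \<Longrightarrow> a (pt c x) v w = a (pt c x) w v"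
      if "v \<in> ?T" for v
    using assms(1) that by (auto simp: pseudo_riemannian_def)
  have l2: "linear (\<lambda>z. a (pt c x) (tv D c x y) (tv D c x z))" for y
    using l[OF tv_in_tangent_space[OF c, of y]] tv_in_tangent_space[OF c]
    by (intro linearI) (auto simp: linear_form_on_def tv_add[OF c] tv_scaleR[OF c])
  have "(\<lambda>y. a (pt c x) (tv D c x y) (tv D c x z)) = (\<lambda>y. a (pt c x) (tv D c x z) (tv D c x y))" for
      z
    using s tv_in_tangent_space[OF c] by blast
  then have l1: "linear (\<lambda>y. a (pt c x) (tv D c x y) (tv D c x z))" for z using l2 by simp
  show ?thesis
    unfolding metric_mat_def
    by (rule linear_bilinear_conv_bform[of "\<lambda>y z. a (pt c x) (tv D c x y) (tv D c x z)", OF l1 l2])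
qed

lemma metric_mat_symmetric:
  assumes "pseudo_riemannian D a" "c \<in> D" "x \<in> img c"
  shows "metric_mat D c a x $ i $ j = metric_mat D c a x $ j $ i"
  using assms(1) tv_in_tangent_space[OF assms(2,3)] by (simp add: pseudo_riemannian_def
      metric_mat_def)

lemma metric_mat_invertible:
  assumes "pseudo_riemannian D a" and c: "c \<in> D" "x \<in> img c"
  shows "invertible (metric_mat D c a x)"
proof -
  have "z = 0" if "metric_mat D c a x *v z = 0" for z
  proof -
    have "a (pt c x) (tv D c x z) w = 0" if w: "w \<in> tangent_space D (pt c x)" for w
    proof -
      have "w = tv D c x (w c)"
        using tangent_space_conv_tv[OF c(1) _ w] coords_pt[OF c] by simp
      then have "a (pt c x) (tv D c x z) w = bform (metric_mat D c a x) (w c) z"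
        using metric_tv[OF assms, of z "w c"] bform_commute[of "metric_mat D c a x", OF
            metric_mat_symmetric[OF assms]] by metis
      then show ?thesis using \<open>metric_mat D c a x *v z = 0\<close> by (simp add: bform_conv_inner)
    qed
    then have "tv D c x z = (\<lambda>_. 0)"
      using assms(1) tv_in_tangent_space[OF c] unfolding pseudo_riemannian_def by blast
    then show ?thesis using tv_eq_0_iff[OF c] by simp
  qed
  then show ?thesis using matrix_left_invertible_ker invertible_left_inverse by blast
qed

lemma raised_conv: "raised D c a b x = matrix_inv (metric_mat D c a x) *v covec D c b x"
  by (simp add: raised_def matrix_vector_mult_def vec_eq_iff)

lemma bform_raised:
  assumes "pseudo_riemannian D a" and c: "c \<in> D" "x \<in> img c"
  shows "bform (metric_mat D c a x) (raised D c a b x) y = covec D c b x \<bullet> y"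
    and "bform (metric_mat D c a x) y (raised D c a b x) = covec D c b x \<bullet> y"
proof -
  show 2: "bform (metric_mat D c a x) y (raised D c a b x) = covec D c b x \<bullet> y"
    by (simp add: bform_conv_inner raised_conv matrix_vector_mul_assoc inner_commute
        matrix_inv_right_left metric_mat_invertible[OF assms])
  then show "bform (metric_mat D c a x) (raised D c a b x) y = covec D c b x \<bullet> y"
    using bform_commute[of "metric_mat D c a x", OF metric_mat_symmetric[OF assms]] by metis
qed

text \<open>The usual way to compute the vector dual to \<open>b\<close> without inverting a
  matrix.\<close>

lemma raised_unique:
  assumes "pseudo_riemannian D a" and c: "c \<in> D" "x \<in> img c"
    and "\<And>y. bform (metric_mat D c a x) X y = covec D c b x \<bullet> y"
  shows "raised D c a b x = X"
proof -
  let ?M = "metric_mat D c a x"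
  have "y \<bullet> (?M *v X) = y \<bullet> (?M *v raised D c a b x)" for y
    using assms(4)[of y] bform_raised(2)[OF assms(1-3), of y b]
      bform_commute[of ?M, OF metric_mat_symmetric[OF assms(1-3)], of y X] by (simp add:
          bform_conv_inner)
  then have "?M *v X = ?M *v raised D c a b x" using vector_eq_ldot by blast
  then show ?thesis
    using inj_matrix_vector_mult[OF metric_mat_invertible[OF assms(1-3)]] by (simp add: inj_eq)
qed

lemma norm_sq_conv:
  assumes "pseudo_riemannian D a" "c \<in> D" "x \<in> img c"
  shows "norm_sq D c a b x = covec D c b x \<bullet> raised D c a b x"
  using bform_raised(2)[OF assms, of "raised D c a b x" b] by (simp add: norm_sq_def bform_def)

lemma smooth_on_metric_mat: "pseudo_riemannian D a \<Longrightarrow> c \<in> D \<Longrightarrow> smooth_on (img c) (\<lambda>x. metric_mat D c a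
    x $ i $ j)"
  by (simp add: pseudo_riemannian_def)

lemma smooth_on_covec: "one_form D b \<Longrightarrow> c \<in> D \<Longrightarrow> smooth_on (img c) (covec D c b)"
  by (intro smooth_on_componentwise open_img) (auto simp: one_form_def)

lemma smooth_on_raised:
  assumes "pseudo_riemannian D a" "one_form D b" "c \<in> D"
  shows "smooth_on (img c) (raised D c a b)"
proof (rule smooth_on_componentwise[OF open_img[OF assms(3)]])
  have "smooth_on (img c) (\<lambda>x. \<Sum>j\<in>UNIV. matrix_inv (metric_mat D c a x) $ i $ j * covec D c b x $
      j)" for i
    by (intro smooth_on_sum smooth_on_mult smooth_on_matrix_inv smooth_on_metric_mat
        smooth_on_nth[OF _ smooth_on_covec] open_img metric_mat_invertible assms)
  then show "smooth_on (img c) (\<lambda>x. raised D c a b x $ i)" for i by (simp add: raised_def)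
qed

lemma smooth_on_christoffel:
  assumes "pseudo_riemannian D a" "c \<in> D"
  shows "smooth_on (img c) (christoffel D c a k i j)"
  unfolding christoffel_def
  by (intro smooth_on_divide smooth_on_const smooth_on_sum smooth_on_mult smooth_on_matrix_inv
      smooth_on_add smooth_on_diff
      smooth_on_pd smooth_on_metric_mat open_img metric_mat_invertible assms) auto

lemma smooth_on_nabla:
  assumes "pseudo_riemannian D a" "one_form D b" "c \<in> D"
  shows "smooth_on (img c) (nabla D c a b j i)"
  unfolding nabla_def
  by (intro smooth_on_diff smooth_on_sum smooth_on_mult smooth_on_pd smooth_on_nth smooth_on_covec
      smooth_on_christoffel
      open_img assms)

text \<open>Contracting the Christoffel symbols with \<open>b\<close> cancels the inverse metric
  against the index of \<open>b\<close>, by symmetry of the inverse.\<close>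

lemma nabla_eq:
  assumes "pseudo_riemannian D a" and c: "c \<in> D" "x \<in> img c"
  shows "nabla D c a b j i x = pd j (\<lambda>z. covec D c b z $ i) x - (\<Sum>l\<in>UNIV. raised D c a b x $ l *
     (pd i (\<lambda>z. metric_mat D c a z $ l $ j) x + pd j (\<lambda>z. metric_mat D c a z $ l $ i) x
      - pd l (\<lambda>z. metric_mat D c a z $ i $ j) x)) / 2"
proof -
  let ?M = "metric_mat D c a x"
  let ?t = "\<lambda>l. pd i (\<lambda>z. metric_mat D c a z $ l $ j) x + pd j (\<lambda>z. metric_mat D c a z $ l $ i) x
      - pd l (\<lambda>z. metric_mat D c a z $ i $ j) x"
  have "transpose ?M = ?M" using metric_mat_symmetric[OF assms] by (simp add: transpose_def
      vec_eq_iff)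
  then have "transpose (matrix_inv ?M) ** ?M = mat 1"
    using matrix_inv_right_left(1)[OF metric_mat_invertible[OF assms]]
    by (metis matrix_transpose_mul transpose_mat)
  then have "transpose (matrix_inv ?M) = matrix_inv ?M"
    using matrix_inv_right_left[OF metric_mat_invertible[OF assms]]
    by (metis matrix_mul_assoc matrix_mul_lid matrix_mul_rid)
  then have sym: "matrix_inv ?M $ k $ l = matrix_inv ?M $ l $ k" for k l
    by (metis (no_types, lifting) transpose_def vec_lambda_beta)
  have "(\<Sum>k\<in>UNIV. christoffel D c a k i j x * covec D c b x $ k) =
      (\<Sum>k\<in>UNIV. \<Sum>l\<in>UNIV. matrix_inv ?M $ k $ l * ?t l * covec D c b x $ k) / 2"
    unfolding christoffel_def by (simp add: sum_distrib_right sum_divide_distrib)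
  also have "(\<Sum>k\<in>UNIV. \<Sum>l\<in>UNIV. matrix_inv ?M $ k $ l * ?t l * covec D c b x $ k) =
      (\<Sum>l\<in>UNIV. \<Sum>k\<in>UNIV. matrix_inv ?M $ l $ k * covec D c b x $ k * ?t l)"
    using sym by (subst sum.swap) (simp add: mult_ac)
  also have "\<dots> = (\<Sum>l\<in>UNIV. raised D c a b x $ l * ?t l)"
    by (simp add: raised_def sum_distrib_right)
  finally show ?thesis by (simp add: nabla_def)
qed

end

subsection \<open>Tensoriality of the covariant derivative\<close>

lemma has_derivative_bform:
  fixes N :: "'a::real_normed_vector \<Rightarrow> real^'n^'n"
  assumes N: "\<And>i j. ((\<lambda>z. N z $ i $ j) has_derivative N' i j) (at x)"
    and p: "(p has_derivative p') (at x)" and q: "(q has_derivative q') (at x)"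
  shows "((\<lambda>z. bform (N z) (p z) (q z)) has_derivative
    (\<lambda>h. bform (\<chi> i j. N' i j h) (p x) (q x) + bform (N x) (p' h) (q x) + bform (N x) (p x) (q' h)))
        (at x)"
proof -
  have p': "((\<lambda>z. p z $ i) has_derivative (\<lambda>h. p' h $ i)) (at x)" for i
    by (rule bounded_linear.has_derivative[OF bounded_linear_vec_nth p])
  have q': "((\<lambda>z. q z $ i) has_derivative (\<lambda>h. q' h $ i)) (at x)" for i
    by (rule bounded_linear.has_derivative[OF bounded_linear_vec_nth q])
  have "((\<lambda>z. bform (N z) (p z) (q z)) has_derivative (\<lambda>h. \<Sum>i\<in>UNIV. \<Sum>j\<in>UNIV.
      (N x $ i $ j * p x $ i) * q' h $ j + (N x $ i $ j * p' h $ i + N' i j h * p x $ i) * q x $ j))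
          (at x)"
    unfolding bform_def by (intro has_derivative_sum has_derivative_mult N p' q')
  then show ?thesis
    by (rule has_derivative_eq_rhs) (simp add: bform_def fun_eq_iff sum.distrib algebra_simps)
qed

lemma smooth_second_derivative_symmetric:
  fixes f :: "'a::real_normed_vector \<Rightarrow> real^'n"
  assumes S: "open S" "x \<in> S" and f: "smooth_on S f"
  shows "frechet_derivative (\<lambda>z. frechet_derivative f (at z) v) (at x) w =
    frechet_derivative (\<lambda>z. frechet_derivative f (at z) w) (at x) v"
proof -
  have D: "frechet_derivative (\<lambda>z. g z $ i) (at z) u = frechet_derivative g (at z) u $ i"
    if "smooth_on S g" "z \<in> S" for g :: "'a \<Rightarrow> real^'n" and i z u
    using frechet_derivative_at[OF bounded_linear.has_derivative[OF bounded_linear_vec_nth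
        smooth_on_has_derivative[OF that]], symmetric, of i] by simp
  have "frechet_derivative (\<lambda>z. frechet_derivative f (at z) v) (at x) w $ i =
      frechet_derivative (\<lambda>z. frechet_derivative (\<lambda>z. f z $ i) (at z) v) (at x) w" for v w i
  proof -
    have "frechet_derivative (\<lambda>z. frechet_derivative f (at z) v) (at x) w $ i =
        frechet_derivative (\<lambda>z. frechet_derivative f (at z) v $ i) (at x) w"
      using D[OF smooth_on_frechet_derivative[OF f] S(2), of v i w] by simp
    moreover have "frechet_derivative (\<lambda>z. frechet_derivative f (at z) v $ i) (at x) =
        frechet_derivative (\<lambda>z. frechet_derivative (\<lambda>z. f z $ i) (at z) v) (at x)"
      by (rule frechet_derivative_cong_open[OF S]) (simp add: D[OF f])
    ultimately show ?thesis by simp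
  qed
  then show ?thesis
    using Ck_on_second_derivative_symmetric[OF S smooth_onD[OF smooth_on_nth[OF S(1) f]]]
    by (simp add: vec_eq_iff)
qed

context smooth_manifold
begin

lemma covec_transition:
  assumes "one_form D b" "c \<in> D" "d \<in> D" "x \<in> overlap c d"
  shows "covec D c b x \<bullet> y = covec D d b (transition c d x) \<bullet> jacobian_map c d x y"
  using one_form_tv[OF assms(1,2), of x y] one_form_tv[OF assms(1,3) transition_in(3)[OF
      assms(2-4)], of "jacobian_map c d x y"]
    tv_transition[OF assms(2-4), of y] transition_in(2)[OF assms(2-4)] assms(4)
  by (simp add: overlap_def)

lemma metric_transition:
  assumes "pseudo_riemannian D a" "c \<in> D" "d \<in> D" "x \<in> overlap c d"
  shows "bform (metric_mat D c a x) y z =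
    bform (metric_mat D d a (transition c d x)) (jacobian_map c d x y) (jacobian_map c d x z)"
  using metric_tv[OF assms(1,2), of x y z]
    metric_tv[OF assms(1,3) transition_in(3)[OF assms(2-4)], of "jacobian_map c d x y" "jacobian_map
        c d x z"]
    tv_transition[OF assms(2-4)] transition_in(2)[OF assms(2-4)] assms(4)
  by (simp add: overlap_def)

lemma jacobian_map_inverse:
  assumes "c \<in> D" "d \<in> D" "x \<in> overlap c d"
  shows "jacobian_map c d x (jacobian_map d c (transition c d x) y) = y"
proof -
  note o = transition_in[OF assms]
  have "x \<in> img c" using assms(3) by (simp add: overlap_def)
  then have "transition d c (transition c d x) = x"
    using transition_trans[OF assms, of c] coords_pt[OF assms(1)] by (simp add: transition_def)
  then show ?thesis
    using jacobian_map_chain[OF assms(2,1,2) o(1) overlap_refl[OF assms(2) o(3)], of y]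
      jacobian_map_refl[OF assms(2) o(3)] by simp
qed

lemma raised_transition:
  assumes "pseudo_riemannian D a" "one_form D b" "c \<in> D" "d \<in> D" "x \<in> overlap c d"
  shows "raised D d a b (transition c d x) = jacobian_map c d x (raised D c a b x)"
proof (rule raised_unique[OF assms(1,4) transition_in(3)[OF assms(3-5)]])
  fix y
  let ?y = "jacobian_map d c (transition c d x) y"
  have x: "x \<in> img c" using assms(5) by (simp add: overlap_def)
  have y: "jacobian_map c d x ?y = y" by (rule jacobian_map_inverse[OF assms(3-5)])
  have "bform (metric_mat D d a (transition c d x)) (jacobian_map c d x (raised D c a b x))
      (jacobian_map c d x ?y)
      = covec D c b x \<bullet> ?y"
    using metric_transition[OF assms(1,3-5)] bform_raised(1)[OF assms(1,3) x] by metis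
  also have "\<dots> = covec D d b (transition c d x) \<bullet> jacobian_map c d x ?y"
    by (rule covec_transition[OF assms(2-5)])
  finally show "bform (metric_mat D d a (transition c d x)) (jacobian_map c d x (raised D c a b x))
      y =
      covec D d b (transition c d x) \<bullet> y" by (simp only: y)
qed

lemma metric_mat_differentiable:
  "pseudo_riemannian D a \<Longrightarrow> c \<in> D \<Longrightarrow> x \<in> img c \<Longrightarrow> (\<lambda>z. metric_mat D c a z $ i $ j) differentiable (at
      x)"
  using smooth_on_differentiable[OF smooth_on_metric_mat] .

lemma covec_differentiable:
  "one_form D b \<Longrightarrow> c \<in> D \<Longrightarrow> x \<in> img c \<Longrightarrow> covec D c b differentiable (at x)"
  using smooth_on_differentiable[OF smooth_on_covec] .

lemma frechet_derivative_metric: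
  assumes "pseudo_riemannian D a" "c \<in> D" "x \<in> img c"
  shows "frechet_derivative (\<lambda>z. bform (metric_mat D c a z) y w) (at x) v =
    (\<Sum>k\<in>UNIV. \<Sum>i\<in>UNIV. \<Sum>j\<in>UNIV. v $ k * pd k (\<lambda>z. metric_mat D c a z $ i $ j) x * y $ i * w $ j)"
proof -
  let ?M = "\<lambda>i j z. metric_mat D c a z $ i $ j"
  have "((\<lambda>z. bform (metric_mat D c a z) y w) has_derivative
      (\<lambda>h. bform (\<chi> i j. frechet_derivative (?M i j) (at x) h) y w
        + bform (metric_mat D c a x) 0 w + bform (metric_mat D c a x) y 0)) (at x)"
    by (rule has_derivative_bform)
       (use metric_mat_differentiable[OF assms] frechet_derivative_works in auto)
  from frechet_derivative_at[OF this, symmetric]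
  have "frechet_derivative (\<lambda>z. bform (metric_mat D c a z) y w) (at x) v =
      bform (\<chi> i j. \<Sum>k\<in>UNIV. v $ k * pd k (?M i j) x) y w"
    using frechet_derivative_pd_sum[OF metric_mat_differentiable[OF assms]] by simp
  also have "\<dots> = (\<Sum>i\<in>UNIV. \<Sum>j\<in>UNIV. \<Sum>k\<in>UNIV. v $ k * pd k (?M i j) x * y $ i * w $ j)"
    by (simp add: bform_def sum_distrib_right)
  also have "\<dots> = (\<Sum>i\<in>UNIV. \<Sum>k\<in>UNIV. \<Sum>j\<in>UNIV. v $ k * pd k (?M i j) x * y $ i * w $ j)"
    by (rule sum.cong[OF refl], rule sum.swap)
  also have "\<dots> = (\<Sum>k\<in>UNIV. \<Sum>i\<in>UNIV. \<Sum>j\<in>UNIV. v $ k * pd k (?M i j) x * y $ i * w $ j)"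
    by (rule sum.swap)
  finally show ?thesis .
qed

text \<open>The dual vector \<open>X\<close> enters with its value at the point only. Hence
  comparing this formula in two charts requires second derivatives of the transition map but no
  derivative of \<open>X\<close> or of the inverse metric.\<close>

lemma nabla_bform:
  assumes a: "pseudo_riemannian D a" and b: "one_form D b" and c: "c \<in> D" "x \<in> img c"
  defines "X \<equiv> raised D c a b x"
  shows "bform (\<chi> j i. nabla D c a b j i x) v w =
    frechet_derivative (\<lambda>z. covec D c b z \<bullet> w) (at x) v -
    (frechet_derivative (\<lambda>z. bform (metric_mat D c a z) X v) (at x) w +
     frechet_derivative (\<lambda>z. bform (metric_mat D c a z) X w) (at x) v -
     frechet_derivative (\<lambda>z. bform (metric_mat D c a z) w v) (at x) X) / 2"
proof -
  let ?d = "\<lambda>k i j. pd k (\<lambda>z. metric_mat D c a z $ i $ j) x"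
  have "frechet_derivative (\<lambda>z. covec D c b z \<bullet> w) (at x) v = (\<Sum>j\<in>UNIV. \<Sum>i\<in>UNIV. pd j (\<lambda>z. covec D c
      b z $ i) x * v $ j * w $ i)"
  proof -
    have d: "(\<lambda>z. covec D c b z $ i) differentiable (at x)" for i
      by (rule smooth_on_differentiable[OF smooth_on_nth[OF open_img[OF c(1)] smooth_on_covec[OF b
          c(1)]] c(2)])
    have "((\<lambda>z. \<Sum>i\<in>UNIV. covec D c b z $ i * w $ i) has_derivative
        (\<lambda>v. \<Sum>i\<in>UNIV. frechet_derivative (\<lambda>z. covec D c b z $ i) (at x) v * w $ i)) (at x)"
      by (intro has_derivative_sum has_derivative_mult_left) (use d frechet_derivative_works in
          auto)
    from frechet_derivative_at[OF this, symmetric]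
    have "frechet_derivative (\<lambda>z. covec D c b z \<bullet> w) (at x) v = (\<Sum>i\<in>UNIV. \<Sum>j\<in>UNIV. pd j (\<lambda>z. covec D
        c b z $ i) x * v $ j * w $ i)"
      using frechet_derivative_pd_sum[OF d] by (simp add: inner_vec_def sum_distrib_left mult_ac)
    then show ?thesis by (subst sum.swap)
  qed
  moreover have "frechet_derivative (\<lambda>z. bform (metric_mat D c a z) X v) (at x) w =
      (\<Sum>j\<in>UNIV. \<Sum>i\<in>UNIV. \<Sum>l\<in>UNIV. X $ l * ?d i l j * v $ j * w $ i)"
  proof -
    have "frechet_derivative (\<lambda>z. bform (metric_mat D c a z) X v) (at x) w =
        (\<Sum>i\<in>UNIV. \<Sum>l\<in>UNIV. \<Sum>j\<in>UNIV. X $ l * ?d i l j * v $ j * w $ i)"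
      unfolding frechet_derivative_metric[OF a c] by (simp add: mult_ac)
    also have "\<dots> = (\<Sum>i\<in>UNIV. \<Sum>j\<in>UNIV. \<Sum>l\<in>UNIV. X $ l * ?d i l j * v $ j * w $ i)"
      by (rule sum.cong[OF refl], rule sum.swap)
    also have "\<dots> = (\<Sum>j\<in>UNIV. \<Sum>i\<in>UNIV. \<Sum>l\<in>UNIV. X $ l * ?d i l j * v $ j * w $ i)" by (rule sum.swap)
    finally show ?thesis .
  qed
  moreover have "frechet_derivative (\<lambda>z. bform (metric_mat D c a z) X w) (at x) v =
      (\<Sum>j\<in>UNIV. \<Sum>i\<in>UNIV. \<Sum>l\<in>UNIV. X $ l * ?d j l i * v $ j * w $ i)"
  proof -
    have "frechet_derivative (\<lambda>z. bform (metric_mat D c a z) X w) (at x) v =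
        (\<Sum>j\<in>UNIV. \<Sum>l\<in>UNIV. \<Sum>i\<in>UNIV. X $ l * ?d j l i * v $ j * w $ i)"
      unfolding frechet_derivative_metric[OF a c] by (simp add: mult_ac)
    also have "\<dots> = (\<Sum>j\<in>UNIV. \<Sum>i\<in>UNIV. \<Sum>l\<in>UNIV. X $ l * ?d j l i * v $ j * w $ i)"
      by (rule sum.cong[OF refl], rule sum.swap)
    finally show ?thesis .
  qed
  moreover have "frechet_derivative (\<lambda>z. bform (metric_mat D c a z) w v) (at x) X =
      (\<Sum>j\<in>UNIV. \<Sum>i\<in>UNIV. \<Sum>l\<in>UNIV. X $ l * ?d l i j * v $ j * w $ i)"
  proof -
    have "frechet_derivative (\<lambda>z. bform (metric_mat D c a z) w v) (at x) X =
        (\<Sum>l\<in>UNIV. \<Sum>i\<in>UNIV. \<Sum>j\<in>UNIV. X $ l * ?d l i j * v $ j * w $ i)"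
      unfolding frechet_derivative_metric[OF a c] by (simp add: mult_ac)
    also have "\<dots> = (\<Sum>l\<in>UNIV. \<Sum>j\<in>UNIV. \<Sum>i\<in>UNIV. X $ l * ?d l i j * v $ j * w $ i)"
      by (rule sum.cong[OF refl], rule sum.swap)
    also have "\<dots> = (\<Sum>j\<in>UNIV. \<Sum>l\<in>UNIV. \<Sum>i\<in>UNIV. X $ l * ?d l i j * v $ j * w $ i)" by (rule sum.swap)
    also have "\<dots> = (\<Sum>j\<in>UNIV. \<Sum>i\<in>UNIV. \<Sum>l\<in>UNIV. X $ l * ?d l i j * v $ j * w $ i)"
      by (rule sum.cong[OF refl], rule sum.swap)
    finally show ?thesis .
  qed
  moreover have "bform (\<chi> j i. nabla D c a b j i x) v w =
      (\<Sum>j\<in>UNIV. \<Sum>i\<in>UNIV. (pd j (\<lambda>z. covec D c b z $ i) x -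
        (\<Sum>l\<in>UNIV. X $ l * (?d i l j + ?d j l i - ?d l i j)) / 2) * v $ j * w $ i)"
    unfolding bform_def by (simp add: nabla_eq[OF a c] X_def)
  moreover have "\<dots> = (\<Sum>j\<in>UNIV. \<Sum>i\<in>UNIV. pd j (\<lambda>z. covec D c b z $ i) x * v $ j * w $ i) -
      ((\<Sum>j\<in>UNIV. \<Sum>i\<in>UNIV. \<Sum>l\<in>UNIV. X $ l * ?d i l j * v $ j * w $ i) +
       (\<Sum>j\<in>UNIV. \<Sum>i\<in>UNIV. \<Sum>l\<in>UNIV. X $ l * ?d j l i * v $ j * w $ i) -
       (\<Sum>j\<in>UNIV. \<Sum>i\<in>UNIV. \<Sum>l\<in>UNIV. X $ l * ?d l i j * v $ j * w $ i)) / 2"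
    by (simp add: left_diff_distrib right_diff_distrib distrib_left distrib_right sum_subtractf
        sum.distrib sum_distrib_right sum_distrib_left sum_divide_distrib
        diff_divide_distrib add_divide_distrib mult_ac)
  ultimately show ?thesis by simp
qed

text \<open>Differentiating the transformation laws of \<open>b\<close> and \<open>a\<close>
  produces the second derivative \<open>H\<close> of the transition map. The term from
  \<open>b\<close> is \<open>b(H v w)\<close>; those from \<open>a\<close> in which
  \<open>H\<close> is applied to \<open>X\<close> cancel by the symmetry of \<open>H\<close>, and
  the remaining two are each \<open>a(X, H v w) = b(H v w)\<close>, so that half their sum cancels
  the term from \<open>b\<close>.\<close>

lemma nabla_transition:
  assumes a: "pseudo_riemannian D a" and b: "one_form D b" and cd: "c \<in> D" "d \<in> D" "x \<in> overlap c d"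
  defines "\<phi> \<equiv> transition c d" and "J \<equiv> jacobian_map c d"
  shows "bform (\<chi> j i. nabla D c a b j i x) v w = bform (\<chi> j i. nabla D d a b j i (\<phi> x)) (J x v) (J
      x w)"
proof -
  have x: "x \<in> img c" using cd(3) by (simp add: overlap_def)
  have x': "\<phi> x \<in> img d" using transition_in(3)[OF cd] by (simp add: \<phi>_def)
  have o: "open (overlap c d)" by (rule open_overlap[OF cd(1,2)])
  define X where "X = raised D c a b x"
  have X': "raised D d a b (\<phi> x) = J x X"
    using raised_transition[OF a b cd] by (simp add: X_def \<phi>_def J_def)
  define H where "H v w = frechet_derivative (\<lambda>z. J z w) (at x) v" for v w
  have DJ: "((\<lambda>z. J z w) has_derivative (\<lambda>v. H v w)) (at x)" for w
    unfolding H_def J_def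
    by (rule smooth_on_has_derivative[OF smooth_on_frechet_derivative[OF smooth_on_transition[OF
        cd(1,2)]] cd(3)])
  have Hsym: "H v w = H w v" for v w
    unfolding H_def J_def
    by (rule smooth_second_derivative_symmetric[OF o cd(3) smooth_on_transition[OF cd(1,2)]])
  have D\<phi>: "(\<phi> has_derivative J x) (at x)" unfolding \<phi>_def J_def by (rule
      transition_has_derivative[OF cd])
  have D1: "frechet_derivative (\<lambda>z. covec D c b z \<bullet> w) (at x) v =
      frechet_derivative (\<lambda>z. covec D d b z \<bullet> J x w) (at (\<phi> x)) (J x v) + covec D d b (\<phi> x) \<bullet> H v w"
          for v w
  proof -
    have Db: "(covec D d b has_derivative frechet_derivative (covec D d b) (at (\<phi> x))) (at (\<phi> x))"
      using covec_differentiable[OF b cd(2) x'] frechet_derivative_works by blast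
    have "((\<lambda>z. covec D d b (\<phi> z) \<bullet> J z w) has_derivative (\<lambda>v. covec D d b (\<phi> x) \<bullet> H v w +
        frechet_derivative (covec D d b) (at (\<phi> x)) (J x v) \<bullet> J x w)) (at x)"
      by (rule has_derivative_inner[OF has_derivative_compose[OF D\<phi> Db] DJ])
    then have F: "((\<lambda>z. covec D c b z \<bullet> w) has_derivative (\<lambda>v. covec D d b (\<phi> x) \<bullet> H v w +
        frechet_derivative (covec D d b) (at (\<phi> x)) (J x v) \<bullet> J x w)) (at x)"
      by (rule has_derivative_transform_within_open[OF _ o cd(3)])
         (simp add: covec_transition[OF b cd(1,2)] \<phi>_def J_def)
    have E: "frechet_derivative (\<lambda>z. covec D d b z \<bullet> J x w) (at (\<phi> x)) =
        (\<lambda>u. frechet_derivative (covec D d b) (at (\<phi> x)) u \<bullet> J x w)"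
      using frechet_derivative_at[OF has_derivative_inner_left[OF Db]] by metis
    show ?thesis unfolding frechet_derivative_at[OF F, symmetric] E by simp
  qed
  let ?M = "metric_mat D d a (\<phi> x)"
  have D2: "frechet_derivative (\<lambda>z. bform (metric_mat D c a z) y w) (at x) v =
      frechet_derivative (\<lambda>z. bform (metric_mat D d a z) (J x y) (J x w)) (at (\<phi> x)) (J x v)
      + bform ?M (H v y) (J x w) + bform ?M (J x y) (H v w)" for v y w
  proof -
    let ?N = "\<lambda>i j. frechet_derivative (\<lambda>z. metric_mat D d a z $ i $ j) (at (\<phi> x))"
    have DN: "((\<lambda>z. metric_mat D d a z $ i $ j) has_derivative ?N i j) (at (\<phi> x))" for i j
      using metric_mat_differentiable[OF a cd(2) x'] frechet_derivative_works by blast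
    have "((\<lambda>z. bform (metric_mat D d a (\<phi> z)) (J z y) (J z w)) has_derivative
        (\<lambda>v. bform (\<chi> i j. ?N i j (J x v)) (J x y) (J x w) + bform ?M (H v y) (J x w) + bform ?M (J
            x y) (H v w))) (at x)"
      by (rule has_derivative_bform[OF has_derivative_compose[OF D\<phi> DN] DJ DJ])
    then have F: "((\<lambda>z. bform (metric_mat D c a z) y w) has_derivative
        (\<lambda>v. bform (\<chi> i j. ?N i j (J x v)) (J x y) (J x w) + bform ?M (H v y) (J x w) + bform ?M (J
            x y) (H v w))) (at x)"
      by (rule has_derivative_transform_within_open[OF _ o cd(3)])
         (simp add: metric_transition[OF a cd(1,2)] \<phi>_def J_def)
    have E: "frechet_derivative (\<lambda>z. bform (metric_mat D d a z) (J x y) (J x w)) (at (\<phi> x)) =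
        (\<lambda>u. bform (\<chi> i j. ?N i j u) (J x y) (J x w))"
      using frechet_derivative_at[OF has_derivative_bform[OF DN has_derivative_const
          has_derivative_const], symmetric] by simp
    show ?thesis unfolding frechet_derivative_at[OF F, symmetric] E by simp
  qed
  have M: "bform ?M (J x X) y = covec D d b (\<phi> x) \<bullet> y" for y
    using bform_raised(1)[OF a cd(2) x', of b y] X' by simp
  have Msym: "bform ?M y z = bform ?M z y" for y z
    by (rule bform_commute[OF metric_mat_symmetric[OF a cd(2) x']])
  show ?thesis
    unfolding nabla_bform[OF a b cd(1) x] nabla_bform[OF a b cd(2) x'] X' X_def[symmetric] D1 D2 M
    using Hsym[of X v] Hsym[of X w] Hsym[of v w] Msym[of "J x w" "H v X"] Msym[of "J x v" "H w X"]
    by (simp add: field_simps)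
qed

text \<open>This is what allows the condition to be verified in one convenient chart around each
  point.\<close>

lemma nabla_recurrent_transition:
  assumes a: "pseudo_riemannian D a" and b: "one_form D b" and cd: "c \<in> D" "d \<in> D" "x \<in> overlap c d"
    and rec: "\<And>i j. nabla D d a b j i (transition c d x) =
      k * (covec D d b (transition c d x) $ i * covec D d b (transition c d x) $ j)"
  shows "nabla D c a b j i x = k * (covec D c b x $ i * covec D c b x $ j)"
proof -
  let ?J = "jacobian_map c d x" and ?B = "covec D d b (transition c d x)"
  have r: "bform (\<chi> j i. k * (?B $ i * ?B $ j)) v w = k * ((?B \<bullet> w) * (?B \<bullet> v))" for v w
    by (simp add: bform_def inner_vec_def sum_distrib_left sum_distrib_right sum_product mult_ac)
       (subst sum.swap, simp add: mult_ac)
  have "nabla D c a b j i x = bform (\<chi> j i. nabla D c a b j i x) (axis j 1) (axis i 1)"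
    by (simp add: bform_axis)
  also have "\<dots> = k * ((?B \<bullet> ?J (axis i 1)) * (?B \<bullet> ?J (axis j 1)))"
    unfolding nabla_transition[OF a b cd] rec r ..
  also have "\<dots> = k * ((covec D c b x \<bullet> axis i 1) * (covec D c b x \<bullet> axis j 1))"
    using covec_transition[OF b cd] by simp
  finally show ?thesis by (simp add: inner_axis)
qed

end

section \<open>Sprays of homogeneous energies\<close>

subsection \<open>Homogeneous functions and partial derivatives\<close>

text \<open>Both sides are the derivative of \<open>s \<mapsto> h(s y)\<close> at \<open>s =
  1\<close>.\<close>

lemma euler_homogeneous:
  fixes h :: "real^'n \<Rightarrow> real"
  assumes h: "\<And>r. r > 0 \<Longrightarrow> h (r *\<^sub>R y) = r ^ d * h y" and diff: "h differentiable (at y)"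
  shows "(\<Sum>k\<in>UNIV. y $ k * pd k h y) = d * h y"
proof -
  have "((\<lambda>s. h (s *\<^sub>R y)) has_derivative (\<lambda>s. frechet_derivative h (at y) (s *\<^sub>R y))) (at 1)"
  proof (rule has_derivative_compose[where f = "\<lambda>s. s *\<^sub>R y" and g = h])
    show "((\<lambda>s. s *\<^sub>R y) has_derivative (\<lambda>s. s *\<^sub>R y)) (at 1)" by (auto intro!:
        derivative_eq_intros)
    show "(h has_derivative frechet_derivative h (at y)) (at (1 *\<^sub>R y))" using diff[unfolded
        frechet_derivative_works] by simp
  qed
  moreover have "((\<lambda>s. h (s *\<^sub>R y)) has_derivative (\<lambda>s. (d * h y) * s)) (at 1)"
  proof (rule has_derivative_transform_within_open[where s = "{0<..}" and f = "\<lambda>s. s ^ d * h y"])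
    show "((\<lambda>s. s ^ d * h y) has_derivative (\<lambda>s. (d * h y) * s)) (at 1)"
      by (auto intro!: derivative_eq_intros simp: mult_ac)
  qed (use h in auto)
  ultimately have "(\<lambda>s. frechet_derivative h (at y) (s *\<^sub>R y)) = (\<lambda>s. (d * h y) * s)"
    by (rule has_derivative_unique)
  from fun_cong[OF this, of 1] show ?thesis using frechet_derivative_pd_sum[OF diff, of y] by simp
qed

lemma pd_homogeneous:
  fixes h :: "real^'n \<Rightarrow> real"
  assumes U: "open U" "y \<in> U" and h: "\<And>w. w \<in> U \<Longrightarrow> h (r *\<^sub>R w) = r ^ Suc d * h w" and r: "r > 0"
    and diff: "h differentiable (at y)" "h differentiable (at (r *\<^sub>R y))"
  shows "pd k h (r *\<^sub>R y) = r ^ d * pd k h y"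
proof -
  have "((\<lambda>w. h (r *\<^sub>R w)) has_derivative (\<lambda>v. frechet_derivative h (at (r *\<^sub>R y)) (r *\<^sub>R v))) (at
      y)"
    by (rule has_derivative_compose[where f = "\<lambda>w. r *\<^sub>R w" and g = h])
       (use diff frechet_derivative_works in \<open>auto intro!: derivative_eq_intros\<close>)
  moreover have "((\<lambda>w. h (r *\<^sub>R w)) has_derivative (\<lambda>v. r ^ Suc d * frechet_derivative h (at y) v))
      (at y)"
  proof (rule has_derivative_transform_within_open[OF _ U, where f = "\<lambda>w. r ^ Suc d * h w"])
    show "((\<lambda>w. r ^ Suc d * h w) has_derivative (\<lambda>v. r ^ Suc d * frechet_derivative h (at y) v)) (at
        y)"
      by (rule has_derivative_mult_right) (use diff frechet_derivative_works in auto)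
  qed (use h in auto)
  ultimately have "(\<lambda>v. frechet_derivative h (at (r *\<^sub>R y)) (r *\<^sub>R v)) = (\<lambda>v. r ^ Suc d *
      frechet_derivative h (at y) v)"
    by (rule has_derivative_unique)
  from fun_cong[OF this, of "axis k 1"]
  have "r * pd k h (r *\<^sub>R y) = r * (r ^ d * pd k h y)"
    using linear_cmul[OF linear_frechet_derivative[OF diff(2)], of r "axis k 1"] by (simp add:
        pd_def mult_ac)
  then show ?thesis using r by simp
qed

lemma pd_diff: "f differentiable (at x) \<Longrightarrow> g differentiable (at x) \<Longrightarrow> pd k (\<lambda>z. f z - g z) x = pd k f
    x - pd k g x"
  unfolding pd_def frechet_derivative_works
  by (subst frechet_derivative_at[OF has_derivative_diff, symmetric]) auto

lemma pd_mult: "f differentiable (at x) \<Longrightarrow> g differentiable (at x) \<Longrightarrow>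
    pd k (\<lambda>z. f z * g z) x = f x * pd k g x + pd k f x * g x"
  unfolding pd_def frechet_derivative_works
  by (subst frechet_derivative_at[OF has_derivative_mult, symmetric]) auto

lemma pd_cmult: "f differentiable (at x) \<Longrightarrow> pd k (\<lambda>z. c * f z) x = c * pd k f x"
  unfolding pd_def frechet_derivative_works
  by (subst frechet_derivative_at[OF has_derivative_mult_right, symmetric]) auto

lemma pd_sum: "(\<And>i. i \<in> I \<Longrightarrow> f i differentiable (at x)) \<Longrightarrow> pd k (\<lambda>z. \<Sum>i\<in>I. f i z) x = (\<Sum>i\<in>I. pd k (f
    i) x)"
  unfolding pd_def frechet_derivative_works
  by (subst frechet_derivative_at[OF has_derivative_sum, symmetric]) auto

lemma pd_const [simp]: "pd k (\<lambda>z. c) x = 0" by (simp add: pd_def)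

lemma differentiable_nth [simp]: "(\<lambda>z::real^'n. z $ i) differentiable (at x)"
  by (rule bounded_linear_imp_differentiable[OF bounded_linear_vec_nth])

lemma pd_nth: "pd k (\<lambda>z. z $ i) x = (if i = k then 1 else 0)"
  unfolding pd_def
  by (subst frechet_derivative_at[OF bounded_linear_imp_has_derivative[OF bounded_linear_vec_nth],
      symmetric])
     (simp add: axis_def)

lemma differentiable_setsum [intro]:
  "finite I \<Longrightarrow> (\<And>i. i \<in> I \<Longrightarrow> f i differentiable (at x)) \<Longrightarrow> (\<lambda>z. \<Sum>i\<in>I. f i z) differentiable (at x)"
  by (rule differentiable_sum) auto

lemma pd_quadratic:
  fixes C :: "'n::finite \<Rightarrow> 'n \<Rightarrow> real"
  assumes "\<And>p q. C p q = C q p"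
  shows "pd j (\<lambda>w. \<Sum>p\<in>UNIV. \<Sum>q\<in>UNIV. C p q * w $ p * w $ q) y = 2 * (\<Sum>k\<in>UNIV. C j k * y $ k)"
proof -
  have d1: "(\<lambda>w. C p q * w $ p) differentiable (at y)" for p q by (intro differentiable_mult) auto
  have d2: "(\<lambda>w. C p q * w $ p * w $ q) differentiable (at y)" for p q by (intro differentiable_mult
      d1) auto
  have "pd j (\<lambda>w. \<Sum>p\<in>UNIV. \<Sum>q\<in>UNIV. C p q * w $ p * w $ q) y =
      (\<Sum>p\<in>UNIV. \<Sum>q\<in>UNIV. C p q * y $ p * (if q = j then 1 else 0) + C p q * (if p = j then 1 else 0)
          * y $ q)"
    by (simp add: pd_sum differentiable_setsum d2 pd_mult[OF d1 differentiable_nth] pd_nth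
        pd_cmult[OF differentiable_nth])
  also have "\<dots> = (\<Sum>p\<in>UNIV. C p j * y $ p) + (\<Sum>p\<in>UNIV. \<Sum>q\<in>UNIV. if p = j then C p q * y $ q else 0)"
    by (simp add: sum.distrib if_distrib[of "\<lambda>u. _ * u"] if_distrib[of "\<lambda>u. u * _"] cong: if_cong)
  also have "(\<Sum>p\<in>UNIV. \<Sum>q\<in>UNIV. if p = j then C p q * y $ q else 0) = (\<Sum>q\<in>UNIV. C j q * y $ q)"
    by (subst sum.swap) simp
  also have "(\<Sum>p\<in>UNIV. C p j * y $ p) = (\<Sum>q\<in>UNIV. C j q * y $ q)"
    by (rule sum.cong[OF refl]) (metis assms)
  finally show ?thesis by simp
qed

subsection \<open>The spray and the horizontal derivative\<close>

text \<open>An energy \<open>L = F^2\<close> in one chart. The set \<open>\<Omega>\<close>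
  represents the conic subbundle, and the fundamental tensor is written exactly as in its
  definition so that no derivative has to be moved when the locale is interpreted.\<close>

locale conic_energy =
  fixes \<Omega> :: "((real^'n) \<times> (real^'n)) set" and L :: "real^'n \<Rightarrow> real^'n \<Rightarrow> real"
  assumes open_\<Omega>: "open \<Omega>" and smooth_L: "smooth_on \<Omega> (\<lambda>(x, y). L x y)"
    and cone: "\<And>x y r. (x, y) \<in> \<Omega> \<Longrightarrow> r > 0 \<Longrightarrow> (x, r *\<^sub>R y) \<in> \<Omega>"
    and homogeneous: "\<And>x y r. (x, y) \<in> \<Omega> \<Longrightarrow> r > 0 \<Longrightarrow> L x (r *\<^sub>R y) = r\<^sup>2 * L x y"
    and nondegenerate: "\<And>x y. (x, y) \<in> \<Omega> \<Longrightarrow> invertible (\<chi> i j. pd i (pd j (\<lambda>z. (1/2) * L x z)) y)"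
begin

definition Lx where "Lx k x y = pd k (\<lambda>z. L z y) x"
definition Ly where "Ly k x y = pd k (L x) y"

definition metric :: "real^'n \<Rightarrow> real^'n \<Rightarrow> real^'n^'n" where
  "metric x y = (\<chi> i j. pd i (pd j (\<lambda>z. (1/2) * L x z)) y)"

text \<open>Four times the spray coefficients: the Cartan non-linear connection is a quarter of
  their derivative.\<close>

definition spray4 :: "'n \<Rightarrow> real^'n \<Rightarrow> real^'n \<Rightarrow> real" where
  "spray4 i x w = (\<Sum>k\<in>UNIV. matrix_inv (metric x w) $ i $ k *
     ((\<Sum>l\<in>UNIV. w $ l * pd l (\<lambda>z. pd k (\<lambda>w'. L z w') w) x) - pd k (\<lambda>z. L z w) x))"

lemma open_fibre: "open {y. (x, y) \<in> \<Omega>}"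
proof -
  have "{y. (x, y) \<in> \<Omega>} = (\<lambda>y. (x, y)) -` \<Omega>" by auto
  then show ?thesis using open_vimage[OF open_\<Omega>, of "\<lambda>y. (x, y)"] by (simp add: continuous_intros)
qed

lemma open_base: "open {x. (x, y) \<in> \<Omega>}"
proof -
  have "{x. (x, y) \<in> \<Omega>} = (\<lambda>x. (x, y)) -` \<Omega>" by auto
  then show ?thesis using open_vimage[OF open_\<Omega>, of "\<lambda>x. (x, y)"] by (simp add: continuous_intros)
qed

lemma smooth_fibre:
  assumes "smooth_on \<Omega> (\<lambda>(x, y). G x y)" shows "smooth_on {y. (x, y) \<in> \<Omega>} (G x)"
proof -
  have "smooth_on {y. (x, y) \<in> \<Omega>} (\<lambda>y. (\<lambda>(x, y). G x y) (x, y))"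
    by (rule smooth_on_compose[OF open_fibre open_\<Omega> _ assms])
       (auto intro!: smooth_on_Pair open_fibre smooth_on_const smooth_on_ident)
  then show ?thesis by simp
qed

lemma partial_has_derivative:
  fixes G :: "real^'n \<Rightarrow> real^'n \<Rightarrow> 'c::real_normed_vector"
  assumes "smooth_on \<Omega> (\<lambda>(x, y). G x y)" "(x, y) \<in> \<Omega>"
  shows "(G x has_derivative (\<lambda>v. frechet_derivative (\<lambda>(x, y). G x y) (at (x, y)) (0, v))) (at y)"
    and "((\<lambda>z. G z y) has_derivative (\<lambda>v. frechet_derivative (\<lambda>(x, y). G x y) (at (x, y)) (v, 0)))
        (at x)"
proof -
  note D = smooth_on_has_derivative[OF assms]
  have "((\<lambda>y. (x, y)) has_derivative (\<lambda>v. (0, v))) (at y)"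
    by (intro has_derivative_Pair has_derivative_const has_derivative_ident)
  from has_derivative_compose[OF this D]
  show "(G x has_derivative (\<lambda>v. frechet_derivative (\<lambda>(x, y). G x y) (at (x, y)) (0, v))) (at y)" by
      simp
  have "((\<lambda>z. (z, y)) has_derivative (\<lambda>v. (v, 0))) (at x)"
    by (intro has_derivative_Pair has_derivative_const has_derivative_ident)
  from has_derivative_compose[OF this D]
  show "((\<lambda>z. G z y) has_derivative (\<lambda>v. frechet_derivative (\<lambda>(x, y). G x y) (at (x, y)) (v, 0)))
      (at x)" by simp
qed

lemma pd_partial:
  assumes "smooth_on \<Omega> (\<lambda>(x, y). G x y)" "(x, y) \<in> \<Omega>"
  shows "pd k (G x) y = frechet_derivative (\<lambda>(x, y). G x y) (at (x, y)) (0, axis k 1)"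
    and "pd k (\<lambda>z. G z y) x = frechet_derivative (\<lambda>(x, y). G x y) (at (x, y)) (axis k 1, 0)"
  unfolding pd_def
  using frechet_derivative_at[OF partial_has_derivative(1)[OF assms], symmetric]
    frechet_derivative_at[OF partial_has_derivative(2)[OF assms], symmetric] by simp_all

lemma smooth_partial:
  assumes "smooth_on \<Omega> (\<lambda>(x, y). G x y)"
  shows "smooth_on \<Omega> (\<lambda>(x, y). pd k (G x) y)" "smooth_on \<Omega> (\<lambda>(x, y). pd k (\<lambda>z. G z y) x)"
  by (rule smooth_on_cong[OF open_\<Omega> _ smooth_on_frechet_derivative[OF assms, of "(0, axis k 1)"]],
      use pd_partial(1)[OF assms] in force)
     (rule smooth_on_cong[OF open_\<Omega> _ smooth_on_frechet_derivative[OF assms, of "(axis k 1, 0)"]],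
      use pd_partial(2)[OF assms] in force)

lemma smooth_Lx: "smooth_on \<Omega> (\<lambda>(x, y). Lx k x y)" and smooth_Ly: "smooth_on \<Omega> (\<lambda>(x, y). Ly k x y)"
  using smooth_partial[OF smooth_L] by (simp_all add: Lx_def Ly_def)

lemma pd_Ly_eq_pd_Lx:
  assumes "(x, y) \<in> \<Omega>" shows "pd l (\<lambda>z. Ly k z y) x = pd k (Lx l x) y"
proof -
  let ?G = "\<lambda>(x, y). L x y"
  have "pd l (\<lambda>z. Ly k z y) x = frechet_derivative (\<lambda>(x, y). Ly k x y) (at (x, y)) (axis l 1, 0)"
    by (rule pd_partial(2)[OF smooth_Ly assms])
  also have "\<dots> = frechet_derivative (\<lambda>p. frechet_derivative ?G (at p) (0, axis k 1)) (at (x, y))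
      (axis l 1, 0)"
    by (subst frechet_derivative_cong_open[OF open_\<Omega> assms, of _ "\<lambda>p. frechet_derivative ?G (at p)
        (0, axis k 1)"])
       (auto simp: Ly_def pd_partial(1)[OF smooth_L])
  also have "\<dots> = frechet_derivative (\<lambda>p. frechet_derivative ?G (at p) (axis l 1, 0)) (at (x, y)) (0,
      axis k 1)"
    by (rule Ck_on_second_derivative_symmetric[OF open_\<Omega> assms smooth_onD[OF smooth_L]])
  also have "\<dots> = frechet_derivative (\<lambda>(x, y). Lx l x y) (at (x, y)) (0, axis k 1)"
    by (subst frechet_derivative_cong_open[OF open_\<Omega> assms, of _ "\<lambda>(x, y). Lx l x y"])
       (auto simp: Lx_def pd_partial(2)[OF smooth_L])
  also have "\<dots> = pd k (Lx l x) y" by (rule pd_partial(1)[OF smooth_Lx assms, symmetric])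
  finally show ?thesis .
qed

lemma differentiable_fibre:
  assumes "(x, y) \<in> \<Omega>" shows "Lx k x differentiable (at y)" "Ly k x differentiable (at y)" "L x
      differentiable (at y)"
  using assms smooth_on_differentiable[OF smooth_fibre[OF smooth_Lx]]
    smooth_on_differentiable[OF smooth_fibre[OF smooth_Ly]] smooth_on_differentiable[OF
        smooth_fibre[OF smooth_L]]
  by simp_all

lemma metric_entry:
  assumes "(x, y) \<in> \<Omega>" shows "metric x y $ i $ j = (1/2) * pd i (Ly j x) y"
proof -
  have "pd i (pd j (\<lambda>z. (1/2) * L x z)) y = pd i (\<lambda>y. (1/2) * Ly j x y) y"
    unfolding pd_def[of i]
  proof (subst frechet_derivative_cong_open[OF open_fibre[of x], of y _ "\<lambda>y. (1/2) * Ly j x y"])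
    show "pd j (\<lambda>z. (1/2) * L x z) w = (1/2) * Ly j x w" if "w \<in> {y. (x, y) \<in> \<Omega>}" for w
      using that pd_cmult[OF differentiable_fibre(3), of x w j "1/2"] by (simp add: Ly_def)
  qed (use assms in auto)
  also have "\<dots> = (1/2) * pd i (Ly j x) y" by (rule pd_cmult[OF differentiable_fibre(2)[OF assms]])
  finally show ?thesis by (simp add: metric_def)
qed

definition spray_rhs where
  "spray_rhs k x w = (\<Sum>l\<in>UNIV. w $ l * pd k (Lx l x) w) - Lx k x w"

lemma spray4_eq:
  assumes "(x, w) \<in> \<Omega>"
  shows "spray4 i x w = (\<Sum>k\<in>UNIV. matrix_inv (metric x w) $ i $ k * spray_rhs k x w)"
  using pd_Ly_eq_pd_Lx[OF assms] by (simp add: spray4_def spray_rhs_def Ly_def Lx_def)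

lemma invertible_metric: "(x, y) \<in> \<Omega> \<Longrightarrow> invertible (metric x y)"
  using nondegenerate by (simp add: metric_def)

text \<open>Multiplying with the fundamental tensor replaces its inverse by a linear system. The
  factor 2 is the one in \<open>g = Hess(L) / 2\<close>.\<close>

lemma spray4_unique:
  assumes "(x, w) \<in> \<Omega>"
  shows "(\<forall>i. spray4 i x w = G i) \<longleftrightarrow> (\<forall>k. (\<Sum>i\<in>UNIV. G i * pd k (Ly i x) w) = 2 * spray_rhs k x w)"
proof -
  let ?M = "metric x w" and ?s = "\<chi> k. spray_rhs k x w" and ?G = "\<chi> i. G i"
  note inv = matrix_inv_right_left[OF invertible_metric[OF assms]]
  have "(\<forall>i. spray4 i x w = G i) \<longleftrightarrow> matrix_inv ?M *v ?s = ?G"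
    by (simp add: spray4_eq[OF assms] vec_eq_iff matrix_vector_mult_def)
  also have "\<dots> \<longleftrightarrow> ?M *v ?G = ?s"
    using inv by (metis matrix_vector_mul_assoc matrix_vector_mul_lid)
  also have "\<dots> \<longleftrightarrow> (\<forall>k. (\<Sum>i\<in>UNIV. G i * pd k (Ly i x) w) = 2 * spray_rhs k x w)"
    by (simp add: vec_eq_iff matrix_vector_mult_def metric_entry[OF assms] mult.commute
        flip: sum_divide_distrib)
  finally show ?thesis .
qed

lemma Lx_homogeneous:
  assumes "(x, y) \<in> \<Omega>" "r > 0" shows "Lx k x (r *\<^sub>R y) = r ^ 2 * Lx k x y"
proof -
  have d: "(\<lambda>z. L z y) differentiable (at x)"
    using partial_has_derivative(2)[OF smooth_L assms(1)] differentiable_def by blast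
  have "pd k (\<lambda>z. L z (r *\<^sub>R y)) x = pd k (\<lambda>z. r\<^sup>2 * L z y) x"
    unfolding pd_def
    by (subst frechet_derivative_cong_open[OF open_base[of y], of x _ "\<lambda>z. r\<^sup>2 * L z y"])
       (use assms homogeneous in auto)
  then show ?thesis by (simp add: Lx_def pd_cmult[OF d])
qed

lemma Ly_homogeneous:
  assumes "(x, y) \<in> \<Omega>" "r > 0" shows "Ly k x (r *\<^sub>R y) = r ^ 1 * Ly k x y"
  unfolding Ly_def
  by (rule pd_homogeneous[OF open_fibre[of x]])
     (use assms homogeneous differentiable_fibre(3) cone in \<open>auto simp: numeral_2_eq_2
         power2_eq_square\<close>)

lemma spray4_homogeneous:
  assumes "(x, y) \<in> \<Omega>" "r > 0" shows "spray4 i x (r *\<^sub>R y) = r ^ 2 * spray4 i x y"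
proof -
  note ry = cone[OF assms]
  have Lyy: "pd k (Ly j x) (r *\<^sub>R y) = pd k (Ly j x) y" for j k
    using pd_homogeneous[OF open_fibre[of x], of y "Ly j x" r 0 k] assms Ly_homogeneous
        differentiable_fibre(2) ry
    by simp
  have Lxy: "pd k (Lx j x) (r *\<^sub>R y) = r * pd k (Lx j x) y" for j k
    using pd_homogeneous[OF open_fibre[of x], of y "Lx j x" r 1 k] assms Lx_homogeneous
        differentiable_fibre(1) ry
    by (simp add: power2_eq_square)
  have "spray_rhs k x (r *\<^sub>R y) = r\<^sup>2 * spray_rhs k x y" for k
    using Lx_homogeneous[OF assms] Lxy
    by (simp add: spray_rhs_def sum_distrib_left right_diff_distrib power2_eq_square mult_ac)
  moreover have "metric x (r *\<^sub>R y) = metric x y"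
    unfolding vec_eq_iff by (simp only: metric_entry[OF assms(1)] metric_entry[OF ry] Lyy simp_thms)
  ultimately show ?thesis
    by (simp add: spray4_eq[OF assms(1)] spray4_eq[OF ry] sum_distrib_left mult_ac)
qed

lemma spray4_differentiable:
  assumes "(x, y) \<in> \<Omega>" shows "spray4 i x differentiable (at y)"
proof -
  let ?U = "{y. (x, y) \<in> \<Omega>}"
  note o = open_fibre[of x]
  have "smooth_on ?U (\<lambda>w. (1/2) * pd i (Ly j x) w)" for i j
    by (intro smooth_on_mult o smooth_on_const smooth_on_pd smooth_fibre[OF smooth_Ly])
  then have "smooth_on ?U (\<lambda>w. metric x w $ i $ j)" for i j
    by (rule smooth_on_cong[OF o, rotated]) (simp add: metric_entry)
  then have M: "smooth_on ?U (\<lambda>w. matrix_inv (metric x w) $ i $ k)" for k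
    by (rule smooth_on_matrix_inv[OF o]) (use invertible_metric in auto)
  have "smooth_on ?U (spray_rhs k x)" for k
    unfolding spray_rhs_def[abs_def]
    by (intro smooth_on_diff smooth_on_sum smooth_on_mult smooth_on_nth[OF _ smooth_on_ident]
        smooth_on_pd o smooth_fibre[OF smooth_Lx])
  then have "smooth_on ?U (\<lambda>w. \<Sum>k\<in>UNIV. matrix_inv (metric x w) $ i $ k * spray_rhs k x w)"
    by (intro smooth_on_sum smooth_on_mult o M)
  then have "smooth_on ?U (spray4 i x)"
    by (rule smooth_on_cong[OF o, rotated]) (simp add: spray4_eq)
  then show ?thesis using smooth_on_differentiable assms by blast
qed

text \<open>Euler's relation recovers the spray, which has degree two, from its
  derivatives.\<close>

lemma linear_connection_imp_quadratic_spray: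
  assumes N: "\<And>i j. (1/4) * pd j (spray4 i x) y = (\<Sum>k\<in>UNIV. \<Gamma> i j k * y $ k)" and xy: "(x, y) \<in> \<Omega>"
  shows "spray4 i x y = 2 * (\<Sum>j\<in>UNIV. \<Sum>k\<in>UNIV. (\<Gamma> i j k + \<Gamma> i k j) / 2 * y $ j * y $ k)"
proof -
  have "2 * spray4 i x y = (\<Sum>j\<in>UNIV. y $ j * pd j (spray4 i x) y)"
    using euler_homogeneous[OF spray4_homogeneous[OF xy] spray4_differentiable[OF xy], of i] by simp
  also have "\<dots> = 4 * (\<Sum>j\<in>UNIV. \<Sum>k\<in>UNIV. \<Gamma> i j k * y $ j * y $ k)"
  proof -
    have "pd j (spray4 i x) y = 4 * (\<Sum>k\<in>UNIV. \<Gamma> i j k * y $ k)" for j using N[of j i] by simp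
    then show ?thesis by (simp add: sum_distrib_left mult_ac)
  qed
  finally have 1: "spray4 i x y = 2 * (\<Sum>j\<in>UNIV. \<Sum>k\<in>UNIV. \<Gamma> i j k * y $ j * y $ k)" by simp
  have "(\<Sum>j\<in>UNIV. \<Sum>k\<in>UNIV. \<Gamma> i k j * y $ j * y $ k) = (\<Sum>j\<in>UNIV. \<Sum>k\<in>UNIV. \<Gamma> i j k * y $ j * y $ k)"
    by (subst sum.swap) (simp add: mult_ac)
  then have "(\<Sum>j\<in>UNIV. \<Sum>k\<in>UNIV. (\<Gamma> i j k + \<Gamma> i k j) / 2 * y $ j * y $ k) = (\<Sum>j\<in>UNIV. \<Sum>k\<in>UNIV. \<Gamma> i j
      k * y $ j * y $ k)"
    by (simp add: add_divide_distrib distrib_right sum.distrib flip: sum_divide_distrib)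
  with 1 show ?thesis by simp
qed

text \<open>The derivative of the energy along the horizontal lift, with respect to a linear
  connection with coefficients \<open>C\<close>, of the coordinate vector field with index
  \<open>k\<close>.\<close>

definition horizontal :: "('n \<Rightarrow> 'n \<Rightarrow> 'n \<Rightarrow> real) \<Rightarrow> 'n \<Rightarrow> real^'n \<Rightarrow> real^'n \<Rightarrow> real" where
  "horizontal C k x y = Lx k x y - (\<Sum>i\<in>UNIV. \<Sum>l\<in>UNIV. C i k l * y $ l * Ly i x y)"

lemma horizontal_differentiable:
  "(x, y) \<in> \<Omega> \<Longrightarrow> horizontal C k x differentiable (at y)"
  unfolding horizontal_def[abs_def]
  by (intro differentiable_diff differentiable_setsum differentiable_mult differentiable_fibre) auto

lemma pd_horizontal:
  assumes xy: "(x, y) \<in> \<Omega>"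
  shows "pd k (horizontal C j x) y = pd k (Lx j x) y - (\<Sum>i\<in>UNIV. C i j k * Ly i x y)
    - (\<Sum>i\<in>UNIV. (\<Sum>l\<in>UNIV. C i j l * y $ l) * pd k (Ly i x) y)"
proof -
  note d = differentiable_fibre[OF xy]
  have d1: "(\<lambda>w. C i j l * w $ l) differentiable (at y)" for i l by (intro differentiable_mult) auto
  have d2: "(\<lambda>w. C i j l * w $ l * Ly i x w) differentiable (at y)" for i l by (intro
      differentiable_mult d1 d)
  have "pd k (horizontal C j x) y = pd k (Lx j x) y -
      (\<Sum>i\<in>UNIV. \<Sum>l\<in>UNIV. C i j l * y $ l * pd k (Ly i x) y + C i j l * (if l = k then 1 else 0) * Ly
          i x y)"
    unfolding horizontal_def[abs_def]
    by (simp add: pd_diff pd_sum differentiable_setsum d d2 pd_mult[OF d1 d(2)] pd_cmult[OF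
        differentiable_nth] pd_nth)
  also have "(\<Sum>i\<in>UNIV. \<Sum>l\<in>UNIV. C i j l * y $ l * pd k (Ly i x) y + C i j l * (if l = k then 1 else
      0) * Ly i x y) =
      (\<Sum>i\<in>UNIV. (\<Sum>l\<in>UNIV. C i j l * y $ l) * pd k (Ly i x) y) + (\<Sum>i\<in>UNIV. C i j k * Ly i x y)"
    by (simp add: sum.distrib sum_distrib_right if_distrib[of "\<lambda>u. _ * u"] if_distrib[of "\<lambda>u. u *
        _"] cong: if_cong)
  finally show ?thesis by simp
qed

lemma contracted_pd_horizontal:
  assumes xy: "(x, y) \<in> \<Omega>" and C: "\<And>i j k. C i j k = C i k j"
  shows "(\<Sum>j\<in>UNIV. y $ j * pd k (horizontal C j x) y) = horizontal C k x y + spray_rhs k x y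
    - (\<Sum>i\<in>UNIV. (\<Sum>j\<in>UNIV. \<Sum>l\<in>UNIV. C i j l * y $ j * y $ l) * pd k (Ly i x) y)"
proof -
  have "(\<Sum>j\<in>UNIV. y $ j * pd k (horizontal C j x) y) = (\<Sum>j\<in>UNIV. y $ j * pd k (Lx j x) y)
      - (\<Sum>j\<in>UNIV. \<Sum>i\<in>UNIV. C i k j * y $ j * Ly i x y)
      - (\<Sum>j\<in>UNIV. \<Sum>i\<in>UNIV. (\<Sum>l\<in>UNIV. C i j l * y $ j * y $ l) * pd k (Ly i x) y)"
    using C by (simp add: pd_horizontal[OF xy] right_diff_distrib sum_subtractf sum_distrib_left
        sum_distrib_right mult_ac)
  also have "(\<Sum>j\<in>UNIV. \<Sum>i\<in>UNIV. C i k j * y $ j * Ly i x y) = (\<Sum>i\<in>UNIV. \<Sum>j\<in>UNIV. C i k j * y $ j *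
      Ly i x y)"
    by (rule sum.swap)
  also have "(\<Sum>j\<in>UNIV. \<Sum>i\<in>UNIV. (\<Sum>l\<in>UNIV. C i j l * y $ j * y $ l) * pd k (Ly i x) y) =
      (\<Sum>i\<in>UNIV. \<Sum>j\<in>UNIV. (\<Sum>l\<in>UNIV. C i j l * y $ j * y $ l) * pd k (Ly i x) y)"
    by (rule sum.swap)
  finally show ?thesis by (simp add: horizontal_def[of C k x y] spray_rhs_def sum_distrib_right)
qed

text \<open>Differentiating the horizontal derivatives along the fibre and contracting with
  \<open>y\<close> reproduces the linear system of the spray: the difference of its two sides is
  the difference of the two sides here.\<close>

lemma quadratic_spray_iff:
  assumes xy: "(x, y) \<in> \<Omega>" and C: "\<And>i j k. C i j k = C i k j"
  shows "(\<forall>i. spray4 i x y = 2 * (\<Sum>j\<in>UNIV. \<Sum>k\<in>UNIV. C i j k * y $ j * y $ k)) \<longleftrightarrow>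
    (\<forall>k. (\<Sum>j\<in>UNIV. y $ j * pd k (horizontal C j x) y) = horizontal C k x y)"
  unfolding spray4_unique[OF xy] contracted_pd_horizontal[where C = C, OF xy C]
  by (simp add: mult.assoc flip: sum_distrib_left) (auto simp: mult.commute)

text \<open>If the spray is quadratic then the energy is constant along horizontal directions: by
  homogeneity the contraction \<open>R\<close> of the horizontal derivative with \<open>y\<close> satisfies both
  \<open>y \<cdot> \<partial>R = 3 R\<close> and \<open>\<partial>R = 2 \<cdot> horizontal\<close>, whence \<open>R = 0\<close> and then everything vanishes.\<close>

lemma horizontal_eq_0:
  assumes C: "\<And>i j k. C i j k = C i k j"
    and G: "\<And>y i. (x, y) \<in> \<Omega> \<Longrightarrow> spray4 i x y = 2 * (\<Sum>j\<in>UNIV. \<Sum>k\<in>UNIV. C i j k * y $ j * y $ k)"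
    and xy: "(x, y) \<in> \<Omega>"
  shows "horizontal C k x y = 0"
proof -
  let ?Q = "\<lambda>k. horizontal C k x"
  have Q: "(\<Sum>j\<in>UNIV. y $ j * pd k (?Q j) y) = ?Q k y" if "(x, y) \<in> \<Omega>" for y k
    using quadratic_spray_iff[where C = C, OF that C] G[OF that] by blast
  have Qhom: "?Q k (r *\<^sub>R y) = r ^ 2 * ?Q k y" if "(x, y) \<in> \<Omega>" "r > 0" for k r y
    using Lx_homogeneous[OF that] Ly_homogeneous[OF that]
    by (simp add: horizontal_def right_diff_distrib sum_distrib_left power2_eq_square mult_ac)
  define R where "R y = (\<Sum>j\<in>UNIV. y $ j * ?Q j y)" for y
  have d: "(\<lambda>y. y $ j * ?Q j y) differentiable (at y)" if "(x, y) \<in> \<Omega>" for y j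
    by (intro differentiable_mult horizontal_differentiable that) auto
  have dR: "R differentiable (at y)" if "(x, y) \<in> \<Omega>" for y
    unfolding R_def[abs_def] using d[OF that] by auto
  have pdR: "pd k R y = 2 * ?Q k y" if xy: "(x, y) \<in> \<Omega>" for y k
  proof -
    have "pd k R y = (\<Sum>j\<in>UNIV. y $ j * pd k (?Q j) y + (if j = k then 1 else 0) * ?Q j y)"
      unfolding R_def[abs_def]
      by (simp add: pd_sum d[OF xy] pd_mult[OF differentiable_nth horizontal_differentiable[OF xy]]
          pd_nth)
    also have "\<dots> = ?Q k y + ?Q k y"
      using Q[OF xy, of k] by (simp add: sum.distrib if_distrib[of "\<lambda>u. u * _"] cong: if_cong)
    finally show ?thesis by simp
  qed
  have R0: "R y = 0" if xy: "(x, y) \<in> \<Omega>" for y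
  proof -
    have "R (r *\<^sub>R y) = r ^ 3 * R y" if "r > 0" for r
      using Qhom[OF xy that] by (simp add: R_def sum_distrib_left power2_eq_square power3_eq_cube
          mult_ac)
    from euler_homogeneous[OF this dR[OF xy]] have "(\<Sum>k\<in>UNIV. y $ k * pd k R y) = 3 * R y" by simp
    moreover have "(\<Sum>k\<in>UNIV. y $ k * pd k R y) = 2 * R y"
      by (simp add: pdR[OF xy] R_def[of y] sum_distrib_left mult_ac)
    ultimately show ?thesis by simp
  qed
  have "pd k R y = pd k (\<lambda>y. 0) y"
    unfolding pd_def
    by (subst frechet_derivative_cong_open[OF open_fibre[of x], of y R "\<lambda>y. 0"]) (use xy R0 in auto)
  with pdR[OF xy, of k] show ?thesis by simp
qed

text \<open>The converse: if the horizontal derivatives vanish, so do their fibre derivatives,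
  and the spray is the one of the linear connection.\<close>

lemma connection_of_parallel_energy:
  assumes C: "\<And>i j k. C i j k = C i k j"
    and hor: "\<And>y k. (x, y) \<in> \<Omega> \<Longrightarrow> horizontal C k x y = 0"
    and xy: "(x, y) \<in> \<Omega>"
  shows "(1/4) * pd j (spray4 i x) y = (\<Sum>k\<in>UNIV. C i j k * y $ k)"
proof -
  have "spray4 i x y = 2 * (\<Sum>j\<in>UNIV. \<Sum>k\<in>UNIV. C i j k * y $ j * y $ k)" if xy: "(x, y) \<in> \<Omega>" for y i
  proof -
    have "pd k (horizontal C j x) y = 0" for j k
    proof -
      have "pd k (horizontal C j x) y = pd k (\<lambda>y. 0) y"
        unfolding pd_def
        by (subst frechet_derivative_cong_open[OF open_fibre[of x], of y _ "\<lambda>y. 0"]) (use xy hor in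
            auto)
      then show ?thesis by simp
    qed
    then show ?thesis using quadratic_spray_iff[where C = C, OF xy C] hor[OF xy] by simp
  qed
  then have "pd j (spray4 i x) y = pd j (\<lambda>y. 2 * (\<Sum>j\<in>UNIV. \<Sum>k\<in>UNIV. C i j k * y $ j * y $ k)) y"
    unfolding pd_def
    by (subst frechet_derivative_cong_open[OF open_fibre[of x], of y _ "\<lambda>y. 2 * (\<Sum>j\<in>UNIV. \<Sum>k\<in>UNIV. C
        i j k * y $ j * y $ k)"]) (use xy in auto)
  also have "\<dots> = 2 * (2 * (\<Sum>k\<in>UNIV. C i j k * y $ k))"
  proof (subst pd_cmult)
    show "(\<lambda>y. \<Sum>j\<in>UNIV. \<Sum>k\<in>UNIV. C i j k * y $ j * y $ k) differentiable (at y)"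
      by (intro differentiable_setsum differentiable_mult) auto
  qed (simp add: pd_quadratic[OF C])
  finally show ?thesis by simp
qed

text \<open>The coefficients of a linear Cartan connection need not be given symmetrically, but
  only their symmetrization enters the spray.\<close>

lemma horizontal_of_linear_connection:
  assumes "\<And>y i j. (x, y) \<in> \<Omega> \<Longrightarrow> (1/4) * pd j (spray4 i x) y = (\<Sum>k\<in>UNIV. \<Gamma> i j k * y $ k)" "(x, y) \<in>
      \<Omega>"
  shows "horizontal (\<lambda>i j k. (\<Gamma> i j k + \<Gamma> i k j) / 2) k x y = 0"
  by (rule horizontal_eq_0[OF _ linear_connection_imp_quadratic_spray[OF assms(1)] assms(2)])
     (simp_all add: add.commute)

end

section \<open>Null one-forms and quadratic forms\<close>

lemma quadratic_on_line:
  assumes "\<And>i j. N $ i $ j = N $ j $ i"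
  shows "bform N (y + s *\<^sub>R v) (y + s *\<^sub>R v) = bform N y y + s * (2 * bform N y v) + s\<^sup>2 * bform N v
      v"
  using bform_commute[of N, OF assms, of v y]
  by (simp add: bform_add_left bform_add_right bform_scaleR_left bform_scaleR_right algebra_simps
      power2_eq_square)

text \<open>Restricted to a line through a point of the open set both sides are polynomials of
  degree three that agree on an interval.\<close>

lemma cubic_identity_everywhere:
  fixes P N :: "real^'n^'n" and b t :: "real^'n"
  assumes P: "\<And>i j. P $ i $ j = P $ j $ i" and N: "\<And>i j. N $ i $ j = N $ j $ i"
    and U: "open U" "y0 \<in> U"
    and eq: "\<And>y. y \<in> U \<Longrightarrow> c1 * (b \<bullet> y) * bform P y y = c2 * bform N y y * (t \<bullet> y)"
  shows "c1 * (b \<bullet> y) * bform P y y = c2 * bform N y y * (t \<bullet> y)"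
proof -
  define v where "v = y - y0"
  define p where "p = Polynomial.smult c1 ([:b \<bullet> y0, b \<bullet> v:] * [:bform P y0 y0, 2 * bform P y0 v,
      bform P v v:])
      - Polynomial.smult c2 ([:bform N y0 y0, 2 * bform N y0 v, bform N v v:] * [:t \<bullet> y0, t \<bullet> v:])"
  have p: "poly p s = c1 * (b \<bullet> (y0 + s *\<^sub>R v)) * bform P (y0 + s *\<^sub>R v) (y0 + s *\<^sub>R v)
      - c2 * bform N (y0 + s *\<^sub>R v) (y0 + s *\<^sub>R v) * (t \<bullet> (y0 + s *\<^sub>R v))" for s
    unfolding p_def quadratic_on_line[of P, OF P] quadratic_on_line[of N, OF N]
    by (simp add: inner_add_right power2_eq_square algebra_simps)
  have "open ((\<lambda>s. y0 + s *\<^sub>R v) -` U)"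
    by (rule open_vimage[OF U(1)]) (auto intro!: continuous_intros)
  then obtain e where e: "e > 0" "ball 0 e \<subseteq> (\<lambda>s. y0 + s *\<^sub>R v) -` U"
    using U(2) openE[of "(\<lambda>s. y0 + s *\<^sub>R v) -` U" 0] by auto
  have "ball 0 e \<subseteq> {s. poly p s = 0}"
    using e(2) eq by (auto simp: p)
  moreover have "infinite (ball (0::real) e)"
    using e(1) by (simp add: ball_eq_greaterThanLessThan infinite_Ioo)
  ultimately have "p = 0" using poly_roots_finite finite_subset by blast
  then have "poly p 1 = 0" by simp
  then show ?thesis unfolding p by (simp add: v_def)
qed

text \<open>If the kernel of \<open>b\<close> were totally isotropic, each of its vectors would
  be dual to a multiple of \<open>b\<close>, so that the kernel would be a line; but its dimension
  is at least two.\<close>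

lemma kernel_not_isotropic:
  fixes N :: "real^'n^'n" and b X :: "real^'n"
  assumes card: "CARD('n) > 2" and N: "\<And>i j. N $ i $ j = N $ j $ i" and inv: "invertible N"
    and b: "b \<noteq> 0" and X: "\<And>y. bform N X y = b \<bullet> y"
  obtains y where "b \<bullet> y = 0" "bform N y y \<noteq> 0"
proof (rule ccontr)
  assume "\<not> thesis"
  then have iso: "bform N y y = 0" if "b \<bullet> y = 0" for y using that \<open>\<And>y. \<lbrakk>b \<bullet> y = 0; bform N y y \<noteq> 0\<rbrakk>
      \<Longrightarrow> thesis\<close> by blast
  have iso2: "bform N y z = 0" if "b \<bullet> y = 0" "b \<bullet> z = 0" for y z
  proof -
    have "b \<bullet> (y + z) = 0" using that by (simp add: inner_add_right)
    from iso[OF this] have "bform N y z + bform N z y = 0"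
      using iso that by (simp add: bform_add_left bform_add_right)
    then show ?thesis using bform_commute[of N, OF N, of y z] by simp
  qed
  have span: "\<exists>r. y = r *\<^sub>R X" if y: "b \<bullet> y = 0" for y
  proof -
    define r where "r = bform N y b / (b \<bullet> b)"
    have "bform N y z = bform N (r *\<^sub>R X) z" for z
    proof -
      define k where "k = (b \<bullet> z) / (b \<bullet> b)"
      have "b \<bullet> (z - k *\<^sub>R b) = 0" using b by (simp add: k_def inner_diff_right)
      from iso2[OF y this] have "bform N y z = k * bform N y b"
        using bform_add_right[of N y "z - k *\<^sub>R b" "k *\<^sub>R b"] by (simp add: bform_scaleR_right)
      also have "\<dots> = r * (b \<bullet> z)" by (simp add: k_def r_def)
      finally show ?thesis by (simp add: bform_scaleR_left X)
    qed
    then have "bform N z y = bform N z (r *\<^sub>R X)" for z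
      using bform_commute[of N, OF N] by metis
    then have "N *v y = N *v (r *\<^sub>R X)"
      using vector_eq_ldot[of "N *v y" "N *v (r *\<^sub>R X)"] by (simp add: bform_conv_inner)
    then show ?thesis using inj_matrix_vector_mult[OF inv] by (auto simp: inj_eq)
  qed
  obtain i where i: "b $ i \<noteq> 0" using b by (auto simp: vec_eq_iff)
  have "(UNIV :: 'n set) \<noteq> {i}"
  proof
    assume "(UNIV :: 'n set) = {i}"
    from arg_cong[OF this, of card] show False using card by simp
  qed
  then obtain j where j: "j \<noteq> i" by blast
  have "(UNIV :: 'n set) \<noteq> {i, j}"
  proof
    assume "(UNIV :: 'n set) = {i, j}"
    from arg_cong[OF this, of card] show False using card j by simp
  qed
  then obtain k where k: "k \<noteq> i" "k \<noteq> j" by blast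
  define y :: "real^'n" where "y = axis j 1 - (b $ j / b $ i) *\<^sub>R axis i 1"
  define z :: "real^'n" where "z = axis k 1 - (b $ k / b $ i) *\<^sub>R axis i 1"
  have "b \<bullet> y = 0" "b \<bullet> z = 0" using i by (simp_all add: y_def z_def inner_diff_right inner_axis)
  then obtain r q where r: "y = r *\<^sub>R X" and q: "z = q *\<^sub>R X" using span by blast
  have "y $ j = 1" "y $ k = 0" "z $ k = 1" using j k by (auto simp: y_def z_def axis_def)
  then have "r * X $ j = 1" "r * X $ k = 0" "q * X $ k = 1" unfolding r q by simp_all
  then show False by auto
qed

text \<open>The linear form \<open>b\<close> does not divide the quadratic form of
  \<open>N\<close>, so it divides \<open>t\<close>, and the quotient identity remains. Concretely:
  on the kernel of \<open>b\<close> the product of \<open>N\<close> and \<open>t\<close> vanishes;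
  since \<open>N\<close> does not vanish there, \<open>t\<close> does.\<close>

lemma proportional_of_cubic_identity:
  fixes P N :: "real^'n^'n" and b t X :: "real^'n"
  assumes card: "CARD('n) > 2" and N: "\<And>i j. N $ i $ j = N $ j $ i" and inv: "invertible N"
    and b: "b \<noteq> 0" and X: "\<And>y. bform N X y = b \<bullet> y" and P: "\<And>i j. P $ i $ j = P $ j $ i"
    and c: "c1 \<noteq> 0" "c2 \<noteq> 0"
    and eq: "\<And>y. c1 * (b \<bullet> y) * bform P y y = c2 * bform N y y * (t \<bullet> y)"
  obtains \<tau> where "t = \<tau> *\<^sub>R b" "\<And>i j. P $ i $ j = (c2 * \<tau> / c1) * N $ i $ j"
proof -
  obtain y2 where y2: "b \<bullet> y2 = 0" "bform N y2 y2 \<noteq> 0"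
    using kernel_not_isotropic[OF card N inv b X] by blast
  have prod: "bform N y y = 0 \<or> t \<bullet> y = 0" if "b \<bullet> y = 0" for y using eq[of y] that c by auto
  have ker: "t \<bullet> y1 = 0" if y1: "b \<bullet> y1 = 0" for y1
  proof (rule ccontr)
    assume ty1: "t \<bullet> y1 \<noteq> 0"
    have ty2: "t \<bullet> y2 = 0" using prod y2 by blast
    have "bform N y1 y1 + s * (2 * bform N y1 y2) + s\<^sup>2 * bform N y2 y2 = 0" for s
    proof -
      have "b \<bullet> (y1 + s *\<^sub>R y2) = 0" "t \<bullet> (y1 + s *\<^sub>R y2) \<noteq> 0"
        using y1 y2 ty1 ty2 by (simp_all add: inner_add_right)
      then show ?thesis using prod quadratic_on_line[of N, OF N] by metis
    qed
    from this[of 0] this[of 1] this[of "-1"] show False using y2(2) by simp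
  qed
  define \<tau> where "\<tau> = (t \<bullet> b) / (b \<bullet> b)"
  define d where "d = t - \<tau> *\<^sub>R b"
  have bd: "b \<bullet> d = 0" using b by (simp add: d_def \<tau>_def inner_diff_right inner_commute)
  have "d \<bullet> d = t \<bullet> d - \<tau> * (b \<bullet> d)" by (simp add: d_def inner_diff_left)
  then have "d = 0" using ker[OF bd] bd by simp
  then have t: "t = \<tau> *\<^sub>R b" by (simp add: d_def)
  define s where "s = c2 * \<tau> / c1"
  have off: "bform P y y = s * bform N y y" if "b \<bullet> y \<noteq> 0" for y
    using eq[of y] that c by (simp add: t s_def field_simps)
  have diag: "bform P y y = s * bform N y y" for y
  proof (cases "b \<bullet> y = 0")
    case True
    define q where "q Z r = bform Z y y + r * (2 * bform Z y b) + r\<^sup>2 * bform Z b b" for Z ::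
        "real^'n^'n" and r
    have "q P r = s * q N r" if "r \<noteq> 0" for r
    proof -
      have "b \<bullet> (y + r *\<^sub>R b) \<noteq> 0" using True b that by (simp add: inner_add_right)
      then show ?thesis
        using off quadratic_on_line[of P, OF P] quadratic_on_line[of N, OF N] by (metis q_def)
    qed
    \<comment> \<open>A quadratic polynomial is determined by its values at three nonzero points, in particular its
        value at zero.\<close>
    from this[of 1] this[of "-1"] this[of 2] show ?thesis by (simp add: q_def algebra_simps)
  qed (rule off)
  have "P $ i $ j = s * N $ i $ j" for i j
  proof -
    have "bform P (axis i 1 + 1 *\<^sub>R axis j 1) (axis i 1 + 1 *\<^sub>R axis j 1)
        = s * bform N (axis i 1 + 1 *\<^sub>R axis j 1) (axis i 1 + 1 *\<^sub>R axis j 1)" by (rule diag)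
    then show ?thesis
      using diag[of "axis i 1"] diag[of "axis j 1"]
      unfolding quadratic_on_line[of P, OF P] quadratic_on_line[of N, OF N]
      by (simp add: bform_axis distrib_left)
  qed
  then show ?thesis using that t unfolding s_def by blast
qed

section \<open>The energy of a Kropina metric\<close>

lemma real_pow_has_real_derivative:
  assumes "real_pow_defined x s"
  shows "((\<lambda>x. real_pow x s) has_real_derivative s * real_pow x s / x) (at x)"
proof (cases "s \<in> \<int>")
  case True
  have x: "x \<noteq> 0" using assms by (auto simp: real_pow_defined_def)
  have "((\<lambda>x. x powi \<lfloor>s\<rfloor>) has_real_derivative of_int \<lfloor>s\<rfloor> * (x powi (\<lfloor>s\<rfloor> - 1)) * 1) (at x)"
    using x by (intro DERIV_power_int DERIV_ident) auto
  moreover have "x powi (\<lfloor>s\<rfloor> - 1) = x powi \<lfloor>s\<rfloor> / x" using x by (simp add: power_int_diff)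
  ultimately show ?thesis using True by (simp add: real_pow_def of_int_floor)
next
  case False
  then have x: "x > 0" using assms by (auto simp: real_pow_defined_def)
  have "((\<lambda>x. x powr s) has_real_derivative s * x powr (s - 1)) (at x)"
    using x by (rule has_real_derivative_powr)
  then show ?thesis using False x by (simp add: real_pow_def powr_diff)
qed

lemma real_pow_nonzero: "real_pow_defined x s \<Longrightarrow> real_pow x s \<noteq> 0"
  by (auto simp: real_pow_def real_pow_defined_def)

text \<open>Logarithmic differentiation of \<open>\<alpha>^(1+m) \<beta>^(-2m)\<close>, where
  \<open>\<alpha>\<close> stands for the square \<open>a(y, y)\<close> of the usual
  \<open>\<alpha>\<close>. It is carried out by hand because \<open>\<beta>\<close> may be
  negative when the exponent is an integer.\<close>

lemma kropina_energy_has_derivative: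
  fixes \<alpha> \<beta> :: "'a::real_normed_vector \<Rightarrow> real"
  assumes \<alpha>: "(\<alpha> has_derivative \<alpha>') (at z)" "\<alpha> z > 0" and \<beta>: "(\<beta> has_derivative \<beta>') (at z)"
      "real_pow_defined (\<beta> z) (- m)"
  defines "E \<equiv> (\<lambda>z. (sqrt (\<alpha> z) powr (1 + m) * real_pow (\<beta> z) (- m))\<^sup>2)"
  shows "(E has_derivative (\<lambda>h. E z * ((1 + m) * \<alpha>' h / \<alpha> z - 2 * m * \<beta>' h / \<beta> z))) (at z)"
proof -
  let ?p = "\<lambda>z. sqrt (\<alpha> z) powr (1 + m)" and ?q = "\<lambda>z. real_pow (\<beta> z) (- m)"
  have \<beta>0: "\<beta> z \<noteq> 0" using \<beta>(2) by (auto simp: real_pow_defined_def)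
  have "((\<lambda>r. sqrt r powr (1 + m)) has_real_derivative (1 + m) * sqrt (\<alpha> z) powr (1 + m - 1) *
      (inverse (sqrt (\<alpha> z)) / 2)) (at (\<alpha> z))"
    using \<alpha>(2) by (intro DERIV_chain2[OF has_real_derivative_powr DERIV_real_sqrt]) auto
  moreover have "(1 + m) * sqrt (\<alpha> z) powr (1 + m - 1) * (inverse (sqrt (\<alpha> z)) / 2) = (1 + m) * ?p z
      / (2 * \<alpha> z)"
  proof -
    have "sqrt (\<alpha> z) powr (1 + m - 1) = ?p z / sqrt (\<alpha> z)" using \<alpha>(2) by (simp add: powr_diff
        powr_add)
    moreover have "(1 + m) * (q / u) * (inverse u / 2) = (1 + m) * q / (2 * (u * u))" if "u \<noteq> 0" for
        q u :: real
      using that by (simp add: field_simps)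
    moreover have "sqrt (\<alpha> z) * sqrt (\<alpha> z) = \<alpha> z" "sqrt (\<alpha> z) \<noteq> 0" using \<alpha>(2) by simp_all
    ultimately show ?thesis by metis
  qed
  ultimately have "((\<lambda>r. sqrt r powr (1 + m)) has_real_derivative (1 + m) * ?p z / (2 * \<alpha> z)) (at (\<alpha>
      z))"
    by (simp only:)
  then have "((\<lambda>r. sqrt r powr (1 + m)) has_derivative (*) ((1 + m) * ?p z / (2 * \<alpha> z))) (at (\<alpha> z))"
    unfolding has_field_derivative_def .
  from has_derivative_compose[OF \<alpha>(1) this]
  have p: "(?p has_derivative (\<lambda>h. (1 + m) * ?p z / (2 * \<alpha> z) * \<alpha>' h)) (at z)" .
  have "((\<lambda>r. real_pow r (- m)) has_derivative (*) (- m * ?q z / \<beta> z)) (at (\<beta> z))"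
    using real_pow_has_real_derivative[OF \<beta>(2)] by (simp add: has_field_derivative_def)
  from has_derivative_compose[OF \<beta>(1) this]
  have q: "(?q has_derivative (\<lambda>h. - m * ?q z / \<beta> z * \<beta>' h)) (at z)" .
  have "(E has_derivative (\<lambda>h. (?p z * ?q z) * (?p z * (- m * ?q z / \<beta> z * \<beta>' h) + (1 + m) * ?p z /
      (2 * \<alpha> z) * \<alpha>' h * ?q z)
      + (?p z * (- m * ?q z / \<beta> z * \<beta>' h) + (1 + m) * ?p z / (2 * \<alpha> z) * \<alpha>' h * ?q z) * (?p z * ?q
          z))) (at z)"
    unfolding E_def power2_eq_square by (intro has_derivative_mult p q)
  then show ?thesis
    by (rule has_derivative_eq_rhs) (use \<alpha>(2) \<beta>0 in \<open>simp add: E_def fun_eq_iff field_simps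
        power2_eq_square\<close>)
qed

subsection \<open>Kropina spaces of closed null one-forms\<close>

locale null_kropina = smooth_manifold D
  for D :: "('p::topological_space, 'n::finite) chart set" +
  fixes a :: "'p \<Rightarrow> ('p, 'n) tvec \<Rightarrow> ('p, 'n) tvec \<Rightarrow> real"
    and b :: "'p \<Rightarrow> ('p, 'n) tvec \<Rightarrow> real"
    and A :: "('p \<times> ('p, 'n) tvec) set"
    and F :: "'p \<Rightarrow> ('p, 'n) tvec \<Rightarrow> real"
    and m :: real
  assumes card: "CARD('n) > 2" and metric_a: "pseudo_riemannian D a" and form_b: "one_form D b"
    and b_nonvanishing: "nowhere_vanishing D b" and closed: "closed_form D b" and null: "null_form D
        a b"
    and m0: "m \<noteq> 0" and kropina: "kropina_space D A F a b m"
begin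

abbreviation "M c \<equiv> metric_mat D c a"
abbreviation "B c \<equiv> covec D c b"
abbreviation "X c \<equiv> raised D c a b"

lemma B_nonzero:
  assumes "c \<in> D" "x \<in> img c" shows "B c x \<noteq> 0"
proof
  assume 0: "B c x = 0"
  obtain v where v: "v \<in> tangent_space D (pt c x)" "b (pt c x) v \<noteq> 0"
    using b_nonvanishing by (auto simp: nowhere_vanishing_def)
  have "v = tv D c x (v c)" using tangent_space_conv_tv[OF assms(1) _ v(1)] coords_pt[OF assms] by
      simp
  then have "b (pt c x) v = B c x \<bullet> v c" using one_form_tv[OF form_b assms] by metis
  then show False using 0 v(2) by simp
qed

lemma B_X: "c \<in> D \<Longrightarrow> x \<in> img c \<Longrightarrow> B c x \<bullet> X c x = 0"
  using null norm_sq_conv[OF metric_a] by (simp add: null_form_def)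

lemma bform_X: "c \<in> D \<Longrightarrow> x \<in> img c \<Longrightarrow> bform (M c x) (X c x) y = B c x \<bullet> y"
  by (rule bform_raised(1)[OF metric_a])

lemma X_M:
  assumes "c \<in> D" "x \<in> img c"
  shows "(\<Sum>l\<in>UNIV. X c x $ l * M c x $ l $ j) = B c x $ j"
proof -
  have "bform (M c x) (X c x) (axis j 1) = (\<Sum>l\<in>UNIV. M c x $ l $ j * X c x $ l)"
    by (simp add: bform_def axis_def if_distrib[of "\<lambda>u. _ * u"] cong: if_cong)
  then have "(\<Sum>l\<in>UNIV. X c x $ l * M c x $ l $ j) = bform (M c x) (X c x) (axis j 1)"
    by (simp add: mult.commute)
  then show ?thesis using bform_X[OF assms, of "axis j 1"] by (simp add: inner_axis)
qed

lemma X_nonzero: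
  assumes "c \<in> D" "x \<in> img c" shows "X c x \<noteq> 0"
proof
  assume "X c x = 0"
  then have "B c x \<bullet> B c x = 0" using bform_X[OF assms, of "B c x"] by simp
  then show False using B_nonzero[OF assms] by simp
qed

lemmas M_sym = metric_mat_symmetric[OF metric_a]

lemma finsler: "finsler_space D A F"
  using kropina by (simp add: kropina_space_def)

lemma A_slit: "(p, v) \<in> A \<Longrightarrow> (p, v) \<in> slit_bundle D"
  using finsler by (auto simp: finsler_space_def conic_subbundle_def)

lemma local_energy:
  assumes c: "c \<in> D"
  shows "conic_energy (local_set D c A) (\<lambda>x y. (local_fun D c F x y)\<^sup>2)"
proof
  show "open (local_set D c A)" using finsler c by (simp add: finsler_space_def conic_subbundle_def)
  then show "smooth_on (local_set D c A) (\<lambda>(x, y). (local_fun D c F x y)\<^sup>2)"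
    using smooth_on_mult[of "local_set D c A" "\<lambda>(x, y). local_fun D c F x y" "\<lambda>(x, y). local_fun D c
        F x y"] finsler c
    by (simp add: finsler_space_def power2_eq_square case_prod_unfold)
  fix x y :: "real^'n" assume xy: "(x, y) \<in> local_set D c A"
  then have x: "x \<in> img c" and inA: "(pt c x, tv D c x y) \<in> A" by (auto simp: local_set_def)
  show "invertible (\<chi> i j. pd i (pd j (\<lambda>z. (1/2) * (local_fun D c F x z)\<^sup>2)) y)"
    using finsler c xy by (force simp: finsler_space_def fundamental_tensor_def)
  fix r :: real assume r: "r > 0"
  show "(x, r *\<^sub>R y) \<in> local_set D c A"
    using finsler inA x r by (simp add: local_set_def tv_scaleR[OF c x] finsler_space_def
        conic_subbundle_def)
  have "F (pt c x) (\<lambda>d. r *\<^sub>R tv D c x y d) = r * F (pt c x) (tv D c x y)"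
    using finsler A_slit[OF inA] r unfolding finsler_space_def by blast
  then show "(local_fun D c F x (r *\<^sub>R y))\<^sup>2 = r\<^sup>2 * (local_fun D c F x y)\<^sup>2"
    by (simp add: local_fun_def tv_scaleR[OF c x] power_mult_distrib)
qed

lemma fibre_nonempty:
  assumes c: "c \<in> D" "x \<in> img c" shows "\<exists>y. (x, y) \<in> local_set D c A"
proof -
  obtain v where v: "(pt c x, v) \<in> A" using finsler unfolding finsler_space_def by blast
  then have "v \<in> tangent_space D (pt c x)" using A_slit by (auto simp: slit_bundle_def)
  then have "v = tv D c x (v c)" using tangent_space_conv_tv[OF c(1), of "pt c x" v] coords_pt[OF c]
      by simp
  then show ?thesis using v c(2) by (metis (mono_tags, lifting) local_set_def case_prodI
      mem_Collect_eq)
qed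

context
  fixes c assumes c: "c \<in> D"
begin

interpretation E: conic_energy "local_set D c A" "\<lambda>x y. (local_fun D c F x y)\<^sup>2"
  by (rule local_energy[OF c])

text \<open>In this context \<open>\<alpha>\<close> is \<open>a(y, y)\<close>, the square of the
  function that is usually called \<open>\<alpha>\<close>.\<close>

abbreviation "\<Omega> \<equiv> local_set D c A"
abbreviation "L x y \<equiv> (local_fun D c F x y)\<^sup>2"
abbreviation "\<alpha> x y \<equiv> bform (M c x) y y"
abbreviation "\<beta> x y \<equiv> B c x \<bullet> y"

lemma in_img: "(x, y) \<in> \<Omega> \<Longrightarrow> x \<in> img c" by (simp add: local_set_def)

lemma energy:
  assumes "(x, y) \<in> \<Omega>"
  shows "\<alpha> x y > 0" "real_pow_defined (\<beta> x y) (- m)" "\<beta> x y \<noteq> 0"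
    "L x y = (sqrt (\<alpha> x y) powr (1 + m) * real_pow (\<beta> x y) (- m))\<^sup>2" "L x y \<noteq> 0"
proof -
  have x: "x \<in> img c" and inA: "(pt c x, tv D c x y) \<in> A" using assms by (auto simp: local_set_def)
  have *: "a (pt c x) (tv D c x y) (tv D c x y) > 0" "real_pow_defined (b (pt c x) (tv D c x y)) (-
      m)"
    "F (pt c x) (tv D c x y) = sqrt (a (pt c x) (tv D c x y) (tv D c x y)) powr (1 + m) * real_pow
        (b (pt c x) (tv D c x y)) (- m)"
    using kropina inA unfolding kropina_space_def by blast+
  note f = metric_tv[OF metric_a c x, of y y] one_form_tv[OF form_b c x, of y]
  show 1: "\<alpha> x y > 0" "real_pow_defined (\<beta> x y) (- m)" using *(1,2) f by simp_all
  then show "\<beta> x y \<noteq> 0" by (auto simp: real_pow_defined_def)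
  show 2: "L x y = (sqrt (\<alpha> x y) powr (1 + m) * real_pow (\<beta> x y) (- m))\<^sup>2"
    using *(3) f by (simp add: local_fun_def)
  show "L x y \<noteq> 0" unfolding 2 using 1 real_pow_nonzero by auto
qed

lemma Ly_eq:
  assumes xy: "(x, y) \<in> \<Omega>"
  shows "E.Ly i x y = L x y * ((1 + m) * (2 * bform (M c x) (axis i 1) y) / \<alpha> x y - 2 * m * B c x $
      i / \<beta> x y)"
proof -
  note x = in_img[OF xy]
  have d\<alpha>: "((\<lambda>y. \<alpha> x y) has_derivative (\<lambda>h. 2 * bform (M c x) h y)) (at y)"
    by (rule has_derivative_eq_rhs[OF has_derivative_bform[OF has_derivative_const
        has_derivative_ident has_derivative_ident]])
       (use bform_commute[of "M c x", OF M_sym[OF c x], of y] in \<open>simp add: fun_eq_iff bform_def\<close>)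
  have d\<beta>: "((\<lambda>y. \<beta> x y) has_derivative (\<lambda>h. B c x \<bullet> h)) (at y)" by (intro
      has_derivative_inner_right has_derivative_ident)
  have "(L x has_derivative (\<lambda>h. L x y * ((1 + m) * (2 * bform (M c x) h y) / \<alpha> x y - 2 * m * (B c x
      \<bullet> h) / \<beta> x y))) (at y)"
    unfolding energy(4)[OF xy]
    by (rule has_derivative_transform_within_open[OF kropina_energy_has_derivative[OF d\<alpha>
        energy(1)[OF xy] d\<beta> energy(2)[OF xy]]
          E.open_fibre[of x]]) (use xy energy(4) in auto)
  from frechet_derivative_at[OF this, symmetric] show ?thesis by (simp add: E.Ly_def pd_def
      inner_axis)
qed

lemma Lx_eq:
  assumes xy: "(x, y) \<in> \<Omega>"
  shows "E.Lx k x y = L x y * ((1 + m) * bform (\<chi> p q. pd k (\<lambda>z. M c z $ p $ q) x) y y / \<alpha> x y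
    - 2 * m * ((\<chi> p. pd k (\<lambda>z. B c z $ p) x) \<bullet> y) / \<beta> x y)"
proof -
  note x = in_img[OF xy]
  have d\<alpha>: "((\<lambda>z. \<alpha> z y) has_derivative (\<lambda>h. bform (\<chi> p q. frechet_derivative (\<lambda>z. M c z $ p $ q)
      (at x) h) y y)) (at x)"
    by (rule has_derivative_eq_rhs[OF has_derivative_bform[OF iffD1[OF frechet_derivative_works
        metric_mat_differentiable[OF metric_a c x]]
            has_derivative_const has_derivative_const]]) simp
  have DB: "((\<lambda>z. B c z $ p) has_derivative frechet_derivative (\<lambda>z. B c z $ p) (at x)) (at x)" for p
    using smooth_on_has_derivative[OF smooth_on_nth[OF open_img[OF c] smooth_on_covec[OF form_b c]]
        x] .
  have d\<beta>: "((\<lambda>z. \<beta> z y) has_derivative (\<lambda>h. \<Sum>p\<in>UNIV. frechet_derivative (\<lambda>z. B c z $ p) (at x) h *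
      y $ p)) (at x)"
    unfolding inner_vec_def inner_real_def by (intro has_derivative_sum has_derivative_mult_left DB)
  have "((\<lambda>z. L z y) has_derivative (\<lambda>h. L x y * ((1 + m) * (bform (\<chi> p q. frechet_derivative (\<lambda>z. M
      c z $ p $ q) (at x) h) y y) / \<alpha> x y
      - 2 * m * (\<Sum>p\<in>UNIV. frechet_derivative (\<lambda>z. B c z $ p) (at x) h * y $ p) / \<beta> x y))) (at x)"
    unfolding energy(4)[OF xy]
    by (rule has_derivative_transform_within_open[OF kropina_energy_has_derivative[OF d\<alpha>
        energy(1)[OF xy] d\<beta> energy(2)[OF xy]]
          E.open_base[of y]]) (use xy energy(4) in auto)
  from frechet_derivative_at[OF this, symmetric] show ?thesis
    by (simp add: E.Lx_def pd_def inner_vec_def)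
qed

text \<open>The covariant derivatives of \<open>a\<close> and \<open>b\<close> in direction
  \<open>k\<close> with respect to the linear connection with coefficients
  \<open>C\<close>.\<close>

definition metric_defect where
  "metric_defect C k x = (\<chi> p q. pd k (\<lambda>z. M c z $ p $ q) x - (\<Sum>i\<in>UNIV. C i k p * M c x $ i $ q) -
      (\<Sum>i\<in>UNIV. C i k q * M c x $ i $ p))"

definition form_defect where
  "form_defect C k x = (\<chi> p. pd k (\<lambda>z. B c z $ p) x - (\<Sum>i\<in>UNIV. C i k p * B c x $ i))"

lemma horizontal_eq:
  assumes xy: "(x, y) \<in> \<Omega>"
  shows "E.horizontal C k x y = L x y * ((1 + m) * bform (metric_defect C k x) y y / \<alpha> x y
    - 2 * m * (form_defect C k x \<bullet> y) / \<beta> x y)"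
proof -
  define S where "S = (\<Sum>p\<in>UNIV. \<Sum>q\<in>UNIV. (\<Sum>i\<in>UNIV. C i k p * M c x $ i $ q) * y $ p * y $ q)"
  have S': "(\<Sum>p\<in>UNIV. \<Sum>q\<in>UNIV. (\<Sum>i\<in>UNIV. C i k q * M c x $ i $ p) * y $ p * y $ q) = S"
    unfolding S_def by (subst sum.swap) (simp add: mult_ac)
  have 1: "(\<Sum>i\<in>UNIV. \<Sum>l\<in>UNIV. C i k l * y $ l * bform (M c x) (axis i 1) y) = S"
  proof -
    have "bform (M c x) (axis i 1) y = (\<Sum>q\<in>UNIV. M c x $ i $ q * y $ q)" for i
      by (simp add: bform_conv_inner inner_axis' matrix_vector_mult_def)
    then have "(\<Sum>i\<in>UNIV. \<Sum>l\<in>UNIV. C i k l * y $ l * bform (M c x) (axis i 1) y) =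
        (\<Sum>i\<in>UNIV. \<Sum>l\<in>UNIV. \<Sum>q\<in>UNIV. C i k l * M c x $ i $ q * y $ l * y $ q)"
      by (simp add: sum_distrib_left mult_ac)
    also have "\<dots> = (\<Sum>l\<in>UNIV. \<Sum>i\<in>UNIV. \<Sum>q\<in>UNIV. C i k l * M c x $ i $ q * y $ l * y $ q)" by (rule
        sum.swap)
    also have "\<dots> = (\<Sum>l\<in>UNIV. \<Sum>q\<in>UNIV. \<Sum>i\<in>UNIV. C i k l * M c x $ i $ q * y $ l * y $ q)"
      by (rule sum.cong[OF refl], rule sum.swap)
    finally show ?thesis by (simp add: S_def sum_distrib_right)
  qed
  define R where "R = (\<Sum>p\<in>UNIV. (\<Sum>i\<in>UNIV. C i k p * B c x $ i) * y $ p)"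
  have 2: "(\<Sum>i\<in>UNIV. \<Sum>l\<in>UNIV. C i k l * y $ l * B c x $ i) = R"
    unfolding R_def by (subst sum.swap) (simp add: sum_distrib_left mult_ac)
  have mp: "bform (metric_defect C k x) y y = bform (\<chi> p q. pd k (\<lambda>z. M c z $ p $ q) x) y y - 2 * S"
    using S' by (simp add: metric_defect_def bform_def left_diff_distrib sum_subtractf S_def)
  have fp: "form_defect C k x \<bullet> y = (\<chi> p. pd k (\<lambda>z. B c z $ p) x) \<bullet> y - R"
    by (simp add: form_defect_def inner_vec_def left_diff_distrib sum_subtractf R_def)
  have "(\<Sum>i\<in>UNIV. \<Sum>l\<in>UNIV. C i k l * y $ l * E.Ly i x y) =
      L x y * ((1 + m) * (2 * (\<Sum>i\<in>UNIV. \<Sum>l\<in>UNIV. C i k l * y $ l * bform (M c x) (axis i 1) y)) / \<alpha>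
          x y
        - 2 * m * (\<Sum>i\<in>UNIV. \<Sum>l\<in>UNIV. C i k l * y $ l * B c x $ i) / \<beta> x y)"
    by (simp add: Ly_eq[OF xy] right_diff_distrib sum_subtractf sum_distrib_left sum_divide_distrib
        mult_ac)
  then show ?thesis
    unfolding E.horizontal_def Lx_eq[OF xy] 1 2 mp fp
    by (simp add: right_diff_distrib diff_divide_distrib)
qed

text \<open>For each \<open>k\<close> this is an identity between cubic polynomials in
  \<open>y\<close>, to which the algebra of the preceding section applies.\<close>

lemma horizontal_eq_0_iff:
  assumes xy: "(x, y) \<in> \<Omega>"
  shows "E.horizontal C k x y = 0 \<longleftrightarrow>
    (1 + m) * \<beta> x y * bform (metric_defect C k x) y y = 2 * m * \<alpha> x y * (form_defect C k x \<bullet> y)"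
proof -
  have "E.horizontal C k x y = 0 \<longleftrightarrow>
      (1 + m) * bform (metric_defect C k x) y y / \<alpha> x y - 2 * m * (form_defect C k x \<bullet> y) / \<beta> x y =
          0"
    unfolding horizontal_eq[OF xy] using energy(5)[OF xy] by simp
  then show ?thesis using energy(1,3)[OF xy] by (simp add: field_simps)
qed

lemma pd_Ly_contracted:
  assumes xy: "(x, y) \<in> \<Omega>"
  shows "(\<Sum>i\<in>UNIV. w $ i * pd k (E.Ly i x) y) = pd k (\<lambda>y. \<Sum>i\<in>UNIV. w $ i * E.Ly i x y) y"
proof -
  note d = E.differentiable_fibre(2)[OF xy]
  have "(\<lambda>y. w $ i * E.Ly i x y) differentiable (at y)" for i by (intro differentiable_mult d) auto
  then show ?thesis by (simp add: pd_sum pd_cmult[OF d])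
qed

lemma Ly_contracted_X:
  assumes xy: "(x, y) \<in> \<Omega>"
  shows "(\<Sum>i\<in>UNIV. X c x $ i * E.Ly i x y) = 2 * (1 + m) * (L x y * \<beta> x y / \<alpha> x y)"
proof -
  note x = in_img[OF xy]
  have 1: "(\<Sum>i\<in>UNIV. X c x $ i * bform (M c x) (axis i 1) y) = \<beta> x y"
  proof -
    have "bform (M c x) (axis i 1) y = (M c x *v y) $ i" for i by (simp add: bform_conv_inner
        inner_axis')
    then show ?thesis using bform_X[OF c x, of y] by (simp only: bform_conv_inner inner_vec_def
        inner_real_def)
  qed
  have 2: "(\<Sum>i\<in>UNIV. X c x $ i * B c x $ i) = 0"
    using B_X[OF c x] by (simp add: inner_vec_def mult.commute)
  have "(\<Sum>i\<in>UNIV. X c x $ i * E.Ly i x y) = L x y * ((1 + m) * (2 * (\<Sum>i\<in>UNIV. X c x $ i * bform (M c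
      x) (axis i 1) y)) / \<alpha> x y
      - 2 * m * (\<Sum>i\<in>UNIV. X c x $ i * B c x $ i) / \<beta> x y)"
    by (simp add: Ly_eq[OF xy] right_diff_distrib sum_subtractf sum_distrib_left sum_divide_distrib
        mult_ac)
  then show ?thesis unfolding 1 2 by simp
qed

text \<open>The fundamental tensor is half the Hessian of the energy, so that the Hessian has no
  kernel. This is what excludes the values \<open>1\<close> and \<open>-1\<close> of
  \<open>m\<close>.\<close>

lemma metric_kernel_trivial:
  assumes xy: "(x, y) \<in> \<Omega>" and "\<And>k. (\<Sum>i\<in>UNIV. w $ i * pd k (E.Ly i x) y) = 0"
  shows "w = 0"
proof -
  have "E.metric x y *v w = E.metric x y *v 0"
    using assms(2) by (simp add: vec_eq_iff matrix_vector_mult_def E.metric_entry[OF xy]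
        mult.commute flip: sum_divide_distrib)
  then show ?thesis by (rule injD[OF inj_matrix_vector_mult[OF E.invertible_metric[OF xy]]])
qed

lemma pd_X_Ly:
  assumes xy: "(x, y) \<in> \<Omega>"
  shows "(\<Sum>i\<in>UNIV. X c x $ i * pd k (E.Ly i x) y) = 2 * (1 + m) * pd k (\<lambda>y. L x y * (\<beta> x y / \<alpha> x y))
      y"
    and "pd k (\<lambda>y. L x y * (\<beta> x y / \<alpha> x y)) y =
      E.Ly k x y * \<beta> x y / \<alpha> x y + L x y * (B c x $ k / \<alpha> x y - \<beta> x y * (2 * bform (M c x) (axis k
          1) y) / (\<alpha> x y)\<^sup>2)"
proof -
  note x = in_img[OF xy]
  have \<alpha>0: "\<alpha> x y \<noteq> 0" using energy(1)[OF xy] by simp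
  have d\<alpha>: "((\<lambda>y. \<alpha> x y) has_derivative (\<lambda>h. 2 * bform (M c x) h y)) (at y)"
    by (rule has_derivative_eq_rhs[OF has_derivative_bform[OF has_derivative_const
        has_derivative_ident has_derivative_ident]])
       (use bform_commute[of "M c x", OF M_sym[OF c x], of y] in \<open>simp add: fun_eq_iff bform_def\<close>)
  have d\<beta>: "((\<lambda>y. \<beta> x y) has_derivative (\<lambda>h. B c x \<bullet> h)) (at y)" by (intro
      has_derivative_inner_right has_derivative_ident)
  note dL = E.differentiable_fibre(3)[OF xy, unfolded frechet_derivative_works]
  have D: "((\<lambda>y. L x y * (\<beta> x y / \<alpha> x y)) has_derivative (\<lambda>h. L x y * ((- \<beta> x y * (inverse (\<alpha> x y) *
      (2 * bform (M c x) h y) * inverse (\<alpha> x y))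
      + (B c x \<bullet> h) / \<alpha> x y)) + frechet_derivative (L x) (at y) h * (\<beta> x y / \<alpha> x y))) (at y)"
    by (rule has_derivative_mult[OF dL has_derivative_divide[OF d\<beta> d\<alpha> \<alpha>0]])
  show "pd k (\<lambda>y. L x y * (\<beta> x y / \<alpha> x y)) y =
      E.Ly k x y * \<beta> x y / \<alpha> x y + L x y * (B c x $ k / \<alpha> x y - \<beta> x y * (2 * bform (M c x) (axis k
          1) y) / (\<alpha> x y)\<^sup>2)"
    unfolding pd_def[of k "\<lambda>y. L x y * (\<beta> x y / \<alpha> x y)"] frechet_derivative_at[OF D, symmetric]
    by (simp add: E.Ly_def pd_def inner_axis power2_eq_square[of "\<alpha> x y"] divide_inverse
        algebra_simps)
  have "pd k (\<lambda>y. \<Sum>i\<in>UNIV. X c x $ i * E.Ly i x y) y = pd k (\<lambda>y. (2 * (1 + m)) * (L x y * (\<beta> x y / \<alpha>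
      x y))) y"
    unfolding pd_def
    by (subst frechet_derivative_cong_open[OF E.open_fibre[of x], of y _ "\<lambda>y. (2 * (1 + m)) * (L x y
        * (\<beta> x y / \<alpha> x y))"])
       (use xy Ly_contracted_X in auto)
  also have "\<dots> = 2 * (1 + m) * pd k (\<lambda>y. L x y * (\<beta> x y / \<alpha> x y)) y"
    by (rule pd_cmult) (use D differentiable_def in blast)
  finally show "(\<Sum>i\<in>UNIV. X c x $ i * pd k (E.Ly i x) y) = 2 * (1 + m) * pd k (\<lambda>y. L x y * (\<beta> x y /
      \<alpha> x y)) y"
    unfolding pd_Ly_contracted[OF xy] .
qed

text \<open>For \<open>m = -1\<close> the energy is \<open>\<beta>^2\<close>, which does not
  change in the direction \<open>X\<close>.\<close>

lemma m_neq_minus_1: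
  assumes "x \<in> img c" shows "m \<noteq> -1"
proof
  assume m: "m = -1"
  obtain y where xy: "(x, y) \<in> \<Omega>" using fibre_nonempty[OF c assms] by blast
  have "(\<Sum>i\<in>UNIV. X c x $ i * pd k (E.Ly i x) y) = 0" for k using pd_X_Ly(1)[OF xy] m by simp
  from metric_kernel_trivial[OF xy this] X_nonzero[OF c assms] show False by simp
qed

text \<open>For \<open>m = 1\<close> contraction of the Hessian with \<open>X\<close> gives
  \<open>2 \<beta> / \<alpha>\<close> times the fibre derivative of the energy, and contraction
  with \<open>y\<close> gives that derivative itself, by Euler's relation.\<close>

lemma m_neq_1:
  assumes "x \<in> img c" shows "m \<noteq> 1"
proof
  assume m: "m = 1"
  obtain y where xy: "(x, y) \<in> \<Omega>" using fibre_nonempty[OF c assms] by blast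
  note e = energy[OF xy]
  define w where "w = y - (\<alpha> x y / (2 * \<beta> x y)) *\<^sub>R X c x"
  have "(\<Sum>i\<in>UNIV. w $ i * pd k (E.Ly i x) y) = 0" for k
  proof -
    have sym: "pd k (E.Ly i x) y = pd i (E.Ly k x) y" for i
      unfolding E.Ly_def[abs_def] pd_def
      by (rule Ck_on_second_derivative_symmetric[OF E.open_fibre[of x] _ smooth_onD[OF
          E.smooth_fibre[OF E.smooth_L]]])
         (use xy in simp)
    have "(\<Sum>i\<in>UNIV. y $ i * pd k (E.Ly i x) y) = E.Ly k x y"
      unfolding sym using euler_homogeneous[OF E.Ly_homogeneous[OF xy] E.differentiable_fibre(2)[OF
          xy], of k] by simp
    then have "(\<Sum>i\<in>UNIV. w $ i * pd k (E.Ly i x) y) =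
        E.Ly k x y - \<alpha> x y / (2 * \<beta> x y) * (\<Sum>i\<in>UNIV. X c x $ i * pd k (E.Ly i x) y)"
      by (simp add: w_def left_diff_distrib sum_subtractf sum_distrib_left mult.assoc)
    also have "\<dots> = 0"
      unfolding pd_X_Ly[OF xy] Ly_eq[OF xy, of k] m using e(1,3) by (simp add: field_simps
          power2_eq_square)
    finally show ?thesis .
  qed
  from metric_kernel_trivial[OF xy this] have "y = (\<alpha> x y / (2 * \<beta> x y)) *\<^sub>R X c x" by (simp add:
      w_def)
  then have "\<beta> x y = (\<alpha> x y / (2 * \<beta> x y)) * (B c x \<bullet> X c x)" by (metis inner_scaleR_right)
  then show False using B_X[OF c assms] e(3) by simp
qed

lemma cartan_connection_eq: "cartan_connection D c F i j x y = (1/4) * pd j (E.spray4 i x) y"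
  unfolding cartan_connection_def E.spray4_def[abs_def] E.metric_def fundamental_tensor_def ..

text \<open>Let \<open>C\<close> be the symmetrization of the given connection. The cubic
  identity shows that \<open>C\<close> preserves \<open>b\<close> and \<open>a\<close> up to
  factors \<open>\<tau>\<close> and \<open>\<sigma>\<close>, which are themselves multiples of
  \<open>b\<close> because \<open>b\<close> is closed and \<open>C\<close> is symmetric. Thus
  \<open>C\<close> is a Weyl connection of \<open>a\<close>; passing to the Levi-Civita connection
  changes the derivative of \<open>b\<close> by a multiple of \<open>b \<otimes> b\<close>, the
  trace term being zero because \<open>b\<close> is null.\<close>

lemma nabla_of_linear_connection:
  assumes x: "x \<in> img c"
    and N: "\<And>y i j. (x, y) \<in> \<Omega> \<Longrightarrow> cartan_connection D c F i j x y = (\<Sum>k\<in>UNIV. \<Gamma> i j k * y $ k)"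
  shows "\<exists>\<kappa>. \<forall>i j. nabla D c a b j i x = \<kappa> * (B c x $ i * B c x $ j)"
proof -
  define C where "C i j k = (\<Gamma> i j k + \<Gamma> i k j) / 2" for i j k
  have Csym: "C i j k = C i k j" for i j k by (simp add: C_def add.commute)
  have hor: "E.horizontal C k x y = 0" if "(x, y) \<in> \<Omega>" for k y
    unfolding C_def[abs_def] using E.horizontal_of_linear_connection[of x \<Gamma> y k] N that by (simp
        add: cartan_connection_eq)
  have m1: "1 + m \<noteq> 0" using m_neq_minus_1[OF x] by auto
  obtain y0 where y0: "(x, y0) \<in> \<Omega>" using fibre_nonempty[OF c x] by blast
  have Psym: "metric_defect C k x $ i $ j = metric_defect C k x $ j $ i" for k i j
  proof -
    have "pd k (\<lambda>z. M c z $ i $ j) x = pd k (\<lambda>z. M c z $ j $ i) x"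
      by (rule pd_cong[OF open_img[OF c] x _ metric_mat_differentiable[OF metric_a c x]]) (rule
          M_sym[OF c])
    then show ?thesis by (simp add: metric_defect_def)
  qed
  have "\<exists>\<tau>. form_defect C k x = \<tau> *\<^sub>R B c x \<and> (\<forall>i j. metric_defect C k x $ i $ j = (2 * m * \<tau> / (1 +
      m)) * M c x $ i $ j)" for k
  proof -
    have "(1 + m) * \<beta> x y * bform (metric_defect C k x) y y = 2 * m * \<alpha> x y * (form_defect C k x \<bullet>
        y)" for y
      by (rule cubic_identity_everywhere[OF Psym M_sym[OF c x] E.open_fibre[of x], of y0])
         (use y0 hor horizontal_eq_0_iff in auto)
    from proportional_of_cubic_identity[OF card M_sym[OF c x] metric_mat_invertible[OF metric_a c x]
        B_nonzero[OF c x] bform_X[OF c x] Psym m1 _ this]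
    show ?thesis using m0 by (metis mult_eq_0_iff zero_neq_numeral)
  qed
  then obtain \<tau> where \<tau>: "\<And>k. form_defect C k x = \<tau> k *\<^sub>R B c x"
      and \<sigma>: "\<And>k i j. metric_defect C k x $ i $ j = (2 * m * \<tau> k / (1 + m)) * M c x $ i $ j" by
          metis
  have "form_defect C k x $ p = form_defect C p x $ k" for k p
    using closed c x Csym by (simp add: form_defect_def closed_form_def)
  then have \<tau>sym: "\<tau> k * B c x $ p = \<tau> p * B c x $ k" for k p using \<tau> by simp
  obtain p0 where p0: "B c x $ p0 \<noteq> 0" using B_nonzero[OF c x] by (auto simp: vec_eq_iff)
  define \<theta> where "\<theta> = \<tau> p0 / B c x $ p0"
  have \<theta>: "\<tau> k = \<theta> * B c x $ k" for k using \<tau>sym[of k p0] p0 by (simp add: \<theta>_def field_simps)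
  define s where "s = 2 * m * \<theta> / (1 + m)"
  have dB: "pd k (\<lambda>z. B c z $ p) x = \<theta> * B c x $ k * B c x $ p + (\<Sum>i\<in>UNIV. C i k p * B c x $ i)" for
      k p
    using arg_cong[OF \<tau>[of k], of "\<lambda>v. v $ p"] by (simp add: form_defect_def \<theta>)
  have dM: "pd k (\<lambda>z. M c z $ p $ q) x = s * B c x $ k * M c x $ p $ q + (\<Sum>i\<in>UNIV. C i k p * M c x $
      i $ q) + (\<Sum>i\<in>UNIV. C i k q * M c x $ i $ p)" for k p q
    using \<sigma>[of k p q] by (simp add: metric_defect_def \<theta> s_def)
  note XM = X_M[OF c x]
  have XB: "(\<Sum>l\<in>UNIV. X c x $ l * B c x $ l) = 0" using B_X[OF c x] by (simp add: inner_vec_def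
      mult.commute)
  have "nabla D c a b j i x = (\<theta> - s) * (B c x $ i * B c x $ j)" for i j
  proof -
    have "pd i (\<lambda>z. M c z $ l $ j) x + pd j (\<lambda>z. M c z $ l $ i) x - pd l (\<lambda>z. M c z $ i $ j) x =
        s * (B c x $ i * M c x $ l $ j + B c x $ j * M c x $ l $ i - B c x $ l * M c x $ i $ j) + 2
            * (\<Sum>r\<in>UNIV. C r j i * M c x $ r $ l)" for l
      using Csym[of _ i l] Csym[of _ j l] Csym[of _ i j] unfolding dM by (simp add: algebra_simps)
    then have "(\<Sum>l\<in>UNIV. X c x $ l * (pd i (\<lambda>z. M c z $ l $ j) x + pd j (\<lambda>z. M c z $ l $ i) x - pd l
        (\<lambda>z. M c z $ i $ j) x)) =
        (\<Sum>l\<in>UNIV. X c x $ l * (s * (B c x $ i * M c x $ l $ j + B c x $ j * M c x $ l $ i - B c x $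
            l * M c x $ i $ j)
          + 2 * (\<Sum>r\<in>UNIV. C r j i * M c x $ r $ l)))"
      by (simp only:)
    also have "\<dots> =
        s * (B c x $ i * (\<Sum>l\<in>UNIV. X c x $ l * M c x $ l $ j) + B c x $ j * (\<Sum>l\<in>UNIV. X c x $ l * M
            c x $ l $ i)
          - (\<Sum>l\<in>UNIV. X c x $ l * B c x $ l) * M c x $ i $ j) + 2 * (\<Sum>l\<in>UNIV. \<Sum>r\<in>UNIV. X c x $ l *
              (C r j i * M c x $ r $ l))"
      by (simp add: algebra_simps sum.distrib sum_subtractf sum_distrib_left)
    also have "(\<Sum>l\<in>UNIV. \<Sum>r\<in>UNIV. X c x $ l * (C r j i * M c x $ r $ l)) = (\<Sum>r\<in>UNIV. C r j i *
        (\<Sum>l\<in>UNIV. X c x $ l * M c x $ l $ r))"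
      using M_sym[OF c x] by (subst sum.swap) (simp add: sum_distrib_left mult_ac)
    finally show ?thesis
      unfolding nabla_eq[OF metric_a c x] dB XM XB by (simp add: algebra_simps)
  qed
  then show ?thesis by blast
qed

text \<open>The Weyl connection that belongs to \<open>\<sigma> = 2 h b\<close> with \<open>h =
  m \<kappa> / (1 - m)\<close>, where \<open>\<kappa>\<close> is read off from \<open>\<nabla>b =
  \<kappa> b \<otimes> b\<close> by contraction with \<open>b\<close> in the Euclidean metric of
  the chart. This makes the coefficients visibly smooth on the whole chart.\<close>

definition weyl :: "('n \<Rightarrow> 'n \<Rightarrow> 'n \<Rightarrow> real^'n \<Rightarrow> real)" where
  "weyl i j k x = christoffel D c a i j k x - (m / (1 - m)) *
     ((\<Sum>p\<in>UNIV. \<Sum>q\<in>UNIV. nabla D c a b p q x * B c x $ p * B c x $ q) / (B c x \<bullet> B c x)\<^sup>2) *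
     (B c x $ j * (if i = k then 1 else 0) + B c x $ k * (if i = j then 1 else 0) - X c x $ i * M c
         x $ j $ k)"

lemma smooth_on_weyl: "smooth_on (img c) (weyl i j k)"
proof -
  note o = open_img[OF c]
  have sB: "smooth_on (img c) (\<lambda>x. B c x $ p)" for p by (rule smooth_on_nth[OF o smooth_on_covec[OF
      form_b c]])
  have sX: "smooth_on (img c) (\<lambda>x. X c x $ p)" for p by (rule smooth_on_nth[OF o smooth_on_raised[OF
      metric_a form_b c]])
  have nz: "(B c x \<bullet> B c x)\<^sup>2 \<noteq> 0" if "x \<in> img c" for x using B_nonzero[OF c that] by simp
  have sBB: "smooth_on (img c) (\<lambda>x. (B c x \<bullet> B c x)\<^sup>2)"
    unfolding power2_eq_square by (intro smooth_on_mult o smooth_on_inner_vec smooth_on_covec[OF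
        form_b c])
  show ?thesis
    unfolding weyl_def[abs_def]
    by (intro smooth_on_diff smooth_on_add smooth_on_mult smooth_on_divide[OF o _ sBB nz]
        smooth_on_sum o smooth_on_const
        smooth_on_christoffel[OF metric_a c] smooth_on_nabla[OF metric_a form_b c] sB sX
            smooth_on_metric_mat[OF metric_a c])
qed

lemma christoffel_symmetric:
  assumes x: "x \<in> img c" shows "christoffel D c a k i j x = christoffel D c a k j i x"
proof -
  have "pd l (\<lambda>z. M c z $ i $ j) x = pd l (\<lambda>z. M c z $ j $ i) x" for l
    by (rule pd_cong[OF open_img[OF c] x _ metric_mat_differentiable[OF metric_a c x]]) (rule
        M_sym[OF c])
  then show ?thesis by (simp add: christoffel_def add.commute)
qed

lemma christoffel_lower:
  assumes x: "x \<in> img c"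
  shows "(\<Sum>i\<in>UNIV. christoffel D c a i k p x * M c x $ i $ q) =
    (pd k (\<lambda>z. M c z $ q $ p) x + pd p (\<lambda>z. M c z $ q $ k) x - pd q (\<lambda>z. M c z $ k $ p) x) / 2"
proof -
  let ?t = "\<lambda>l. pd k (\<lambda>z. M c z $ l $ p) x + pd p (\<lambda>z. M c z $ l $ k) x - pd l (\<lambda>z. M c z $ k $ p)
      x"
  have "(\<Sum>i\<in>UNIV. christoffel D c a i k p x * M c x $ i $ q) =
      (\<Sum>i\<in>UNIV. \<Sum>l\<in>UNIV. M c x $ q $ i * matrix_inv (M c x) $ i $ l * ?t l) / 2"
    using M_sym[OF c x] unfolding christoffel_def
    by (simp add: sum_distrib_left sum_distrib_right sum_divide_distrib mult_ac)
  also have "(\<Sum>i\<in>UNIV. \<Sum>l\<in>UNIV. M c x $ q $ i * matrix_inv (M c x) $ i $ l * ?t l) = (\<Sum>l\<in>UNIV. (M c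
      x ** matrix_inv (M c x)) $ q $ l * ?t l)"
    by (subst sum.swap) (simp add: matrix_matrix_mult_def sum_distrib_right)
  also have "\<dots> = ?t q"
    by (simp add: matrix_inv_right_left[OF metric_mat_invertible[OF metric_a c x]] mat_def
        if_distrib[of "\<lambda>u. u * _"] cong: if_cong)
  finally show ?thesis .
qed

text \<open>The Weyl connection is chosen such that \<open>a\<close> and \<open>b\<close> are
  multiplied by factors that balance in the cubic identity; this is the equation \<open>mh\<close>
  in the proof.\<close>

lemma linear_connection_of_nabla:
  assumes rec: "\<And>i j. nabla D c a b j i x = \<kappa> * (B c x $ i * B c x $ j)" and xy: "(x, y) \<in> \<Omega>"
  shows "cartan_connection D c F i j x y = (\<Sum>k\<in>UNIV. weyl i j k x * y $ k)"
proof -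
  note x = in_img[OF xy]
  have m1: "1 - m \<noteq> 0" using m_neq_1[OF x] by auto
  have "(\<Sum>p\<in>UNIV. \<Sum>q\<in>UNIV. nabla D c a b p q x * B c x $ p * B c x $ q) = \<kappa> * (B c x \<bullet> B c x)\<^sup>2"
    by (simp add: rec inner_vec_def power2_eq_square sum_product sum_distrib_left mult_ac)
  then have \<kappa>: "(\<Sum>p\<in>UNIV. \<Sum>q\<in>UNIV. nabla D c a b p q x * B c x $ p * B c x $ q) / (B c x \<bullet> B c x)\<^sup>2
      = \<kappa>"
    using B_nonzero[OF c x] by simp
  define h where "h = (m / (1 - m)) * \<kappa>"
  define C where "C i j k = weyl i j k x" for i j k
  have C: "C i j k = christoffel D c a i j k x - h *
      (B c x $ j * (if i = k then 1 else 0) + B c x $ k * (if i = j then 1 else 0) - X c x $ i * M c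
          x $ j $ k)" for i j k
    unfolding C_def weyl_def \<kappa> h_def ..
  have Csym: "C i j k = C i k j" for i j k
    unfolding C using christoffel_symmetric[OF x] M_sym[OF c x, of j k] by (simp add: add.commute)
  note XM = X_M[OF c x]
  have XB: "(\<Sum>l\<in>UNIV. X c x $ l * B c x $ l) = 0" using B_X[OF c x] by (simp add: inner_vec_def
      mult.commute)
  have CB: "(\<Sum>i\<in>UNIV. C i k p * B c x $ i) = (\<Sum>i\<in>UNIV. christoffel D c a i k p x * B c x $ i) - h *
      (2 * (B c x $ k * B c x $ p))" for k p
  proof -
    have "(\<Sum>i\<in>UNIV. C i k p * B c x $ i) = (\<Sum>i\<in>UNIV. christoffel D c a i k p x * B c x $ i)
        - h * (B c x $ k * B c x $ p + B c x $ p * B c x $ k - (\<Sum>i\<in>UNIV. X c x $ i * B c x $ i) * M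
            c x $ k $ p)"
      unfolding C
      by (simp add: algebra_simps sum.distrib sum_subtractf sum_distrib_left if_distrib[of "\<lambda>u. _ *
          u"] if_distrib[of "\<lambda>u. u * _"] cong: if_cong)
    then show ?thesis by (simp add: XB)
  qed
  have CM: "(\<Sum>i\<in>UNIV. C i k p * M c x $ i $ q) = (\<Sum>i\<in>UNIV. christoffel D c a i k p x * M c x $ i $
      q)
      - h * (B c x $ k * M c x $ p $ q + B c x $ p * M c x $ k $ q - B c x $ q * M c x $ k $ p)" for
          k p q
  proof -
    have "(\<Sum>i\<in>UNIV. C i k p * M c x $ i $ q) = (\<Sum>i\<in>UNIV. christoffel D c a i k p x * M c x $ i $ q)
        - h * (B c x $ k * M c x $ p $ q + B c x $ p * M c x $ k $ q - (\<Sum>i\<in>UNIV. X c x $ i * M c x $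
            i $ q) * M c x $ k $ p)"
      unfolding C
      by (simp add: algebra_simps sum.distrib sum_subtractf sum_distrib_left if_distrib[of "\<lambda>u. _ *
          u"] if_distrib[of "\<lambda>u. u * _"] cong: if_cong)
    then show ?thesis by (simp add: XM)
  qed
  have fd: "form_defect C k x = ((\<kappa> + 2 * h) * B c x $ k) *\<^sub>R B c x" for k
  proof -
    have "form_defect C k x $ p = (\<kappa> + 2 * h) * B c x $ k * B c x $ p" for p
    proof -
      have "form_defect C k x $ p = nabla D c a b k p x + h * (2 * (B c x $ k * B c x $ p))"
        using christoffel_symmetric[OF x] by (simp add: form_defect_def CB nabla_def)
      then show ?thesis by (simp add: rec algebra_simps)
    qed
    then show ?thesis by (simp add: vec_eq_iff)
  qed
  have md: "metric_defect C k x = (2 * h * B c x $ k) *\<^sub>R M c x" for k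
  proof -
    have psym: "pd k (\<lambda>z. M c z $ i $ j) x = pd k (\<lambda>z. M c z $ j $ i) x" for k i j
      by (rule pd_cong[OF open_img[OF c] x _ metric_mat_differentiable[OF metric_a c x]]) (rule
          M_sym[OF c])
    have "metric_defect C k x $ p $ q = 2 * h * B c x $ k * M c x $ p $ q" for p q
      using psym[of k q p] psym[of p q k] psym[of q p k] M_sym[OF c x, of q p] M_sym[OF c x, of q k]
          M_sym[OF c x, of p k]
      by (simp add: metric_defect_def CM christoffel_lower[OF x] field_simps)
    then show ?thesis by (simp add: vec_eq_iff)
  qed
  have "E.horizontal C k x y = 0" if xy: "(x, y) \<in> \<Omega>" for k y
  proof -
    have bs: "bform (r *\<^sub>R M c x) y y = r * \<alpha> x y" for r by (simp add: bform_def sum_distrib_left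
        mult_ac)
    have mh: "(1 + m) * (2 * h) = 2 * m * (\<kappa> + 2 * h)" using m1 by (simp add: h_def field_simps)
    have "(1 + m) * \<beta> x y * bform (metric_defect C k x) y y = ((1 + m) * (2 * h)) * (\<beta> x y * B c x $
        k * \<alpha> x y)"
      unfolding md bs by (simp add: mult_ac)
    also have "\<dots> = 2 * m * \<alpha> x y * (form_defect C k x \<bullet> y)"
      unfolding mh fd by (simp add: mult_ac)
    finally show ?thesis unfolding horizontal_eq_0_iff[OF xy] .
  qed
  from E.connection_of_parallel_energy[where C = C, OF Csym this xy] show ?thesis
    unfolding cartan_connection_eq by (simp add: C_def)
qed

end

text \<open>The analytic half of the result: the Berwald property is a first order condition on
  \<open>b\<close>.\<close>

lemma berwald_iff_nabla_recurrent:
  "berwald D A F \<longleftrightarrow>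
    (\<forall>c\<in>D. \<forall>x\<in>img c. \<exists>\<kappa>. \<forall>i j. nabla D c a b j i x = \<kappa> * (B c x $ i * B c x $ j))"
proof
  assume ber: "berwald D A F"
  show "\<forall>c\<in>D. \<forall>x\<in>img c. \<exists>\<kappa>. \<forall>i j. nabla D c a b j i x = \<kappa> * (B c x $ i * B c x $ j)"
  proof (intro ballI)
    fix c x assume c: "c \<in> D" and x: "x \<in> img c"
    obtain \<Gamma> :: "'n \<Rightarrow> 'n \<Rightarrow> 'n \<Rightarrow> real^'n \<Rightarrow> real" where
      "\<forall>(x, y)\<in>local_set D c A. \<forall>i j. cartan_connection D c F i j x y = (\<Sum>k\<in>UNIV. \<Gamma> i j k x * y $
          k)"
      using ber c unfolding berwald_def by blast
    then show "\<exists>\<kappa>. \<forall>i j. nabla D c a b j i x = \<kappa> * (B c x $ i * B c x $ j)"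
      by (intro nabla_of_linear_connection[OF c x, of "\<lambda>i j k. \<Gamma> i j k x"]) auto
  qed
next
  assume rec: "\<forall>c\<in>D. \<forall>x\<in>img c. \<exists>\<kappa>. \<forall>i j. nabla D c a b j i x = \<kappa> * (B c x $ i * B c x $ j)"
  show "berwald D A F"
    unfolding berwald_def
  proof (intro ballI exI conjI allI)
    fix c assume c: "c \<in> D"
    show "smooth_on (img c) (weyl c i j k)" for i j k by (rule smooth_on_weyl[OF c])
    show "case z of (x, y) \<Rightarrow> \<forall>i j. cartan_connection D c F i j x y = (\<Sum>k\<in>UNIV. weyl c i j k x * y $
        k)"
      if "z \<in> local_set D c A" for z
      using that rec c in_img[OF c] linear_connection_of_nabla[OF c] by (cases z) blast
  qed
qed

lemma m_not_1: "m \<noteq> 1"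
proof -
  obtain c where "c \<in> D" "undefined \<in> dom_of c" using ex_chart by blast
  then show ?thesis using m_neq_1 pt_coords by blast
qed

end

section \<open>Adapted coordinates\<close>

lemma pd_eq_0_of_independent:
  fixes f :: "real^'n \<Rightarrow> real"
  assumes S: "open S" "x \<in> S" and f: "f differentiable (at x)"
    and indep: "\<And>z. z \<in> S \<Longrightarrow> (\<forall>k. k \<noteq> i \<longrightarrow> z $ k = x $ k) \<Longrightarrow> f z = f x"
  shows "pd i f x = 0"
proof -
  have "((\<lambda>t. f (x + t *\<^sub>R axis i 1)) has_derivative (\<lambda>t. frechet_derivative f (at x) (t *\<^sub>R axis i
      1))) (at 0)"
    by (rule has_derivative_compose[where f = "\<lambda>t. x + t *\<^sub>R axis i 1" and g = f])
       (use f[unfolded frechet_derivative_works] in \<open>auto intro!: derivative_eq_intros\<close>)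
  moreover have "((\<lambda>t. f (x + t *\<^sub>R axis i 1)) has_derivative (\<lambda>t. 0)) (at 0)"
  proof (rule has_derivative_transform_within_open[OF has_derivative_const])
    show "open ((\<lambda>t. x + t *\<^sub>R axis i 1) -` S)" by (rule open_vimage[OF S(1)]) (auto intro!:
        continuous_intros)
    show "f x = f (x + t *\<^sub>R axis i 1)" if "t \<in> (\<lambda>t. x + t *\<^sub>R axis i 1) -` S" for t
      using indep[of "x + t *\<^sub>R axis i 1"] that by (simp add: axis_def)
  qed (use S in auto)
  ultimately have "(\<lambda>t. frechet_derivative f (at x) (t *\<^sub>R axis i 1)) = (\<lambda>t. 0)"
    by (rule has_derivative_unique)
  from fun_cong[OF this, of 1] show ?thesis by (simp add: pd_def)
qed

lemma independent_of_pd_eq_0: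
  fixes f :: "real^'n \<Rightarrow> real"
  assumes S: "convex S" and f: "\<And>x. x \<in> S \<Longrightarrow> f differentiable (at x)" and pd: "\<And>x. x \<in> S \<Longrightarrow> pd i f x =
      0"
    and x: "x \<in> S" "x' \<in> S" and eq: "\<And>k. k \<noteq> i \<Longrightarrow> x $ k = x' $ k"
  shows "f x = f x'"
proof -
  define r where "r = x' $ i - x $ i"
  have x': "x' = x + r *\<^sub>R axis i 1"
    using eq by (simp add: vec_eq_iff r_def axis_def)
  have seg: "x + (t * r) *\<^sub>R axis i 1 \<in> S" if "t \<in> {0..1}" for t
  proof -
    have "x + (t * r) *\<^sub>R axis i 1 = (1 - t) *\<^sub>R x + t *\<^sub>R x'" by (simp add: x' algebra_simps)
    then show ?thesis using convexD_alt[OF S x, of t] that by simp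
  qed
  have "((\<lambda>t. f (x + (t * r) *\<^sub>R axis i 1)) has_real_derivative 0) (at t)" if t: "0 \<le> t" "t \<le> 1" for
      t
  proof -
    let ?z = "x + (t * r) *\<^sub>R axis i 1"
    have z: "?z \<in> S" using seg t by simp
    have "((\<lambda>t. f (x + (t * r) *\<^sub>R axis i 1)) has_derivative (\<lambda>q. frechet_derivative f (at ?z) ((q *
        r) *\<^sub>R axis i 1))) (at t)"
      by (rule has_derivative_compose[where f = "\<lambda>t. x + (t * r) *\<^sub>R axis i 1" and g = f])
         (use f[OF z, unfolded frechet_derivative_works] in \<open>auto intro!: derivative_eq_intros\<close>)
    moreover have "frechet_derivative f (at ?z) ((q * r) *\<^sub>R axis i 1) = 0" for q
      using linear_cmul[OF linear_frechet_derivative[OF f[OF z]], of "q * r" "axis i 1"] pd[OF z] by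
          (simp add: pd_def)
    ultimately show ?thesis by (simp add: has_field_derivative_def lambda_zero)
  qed
  then show ?thesis
    using MVT2[of 0 1 "\<lambda>t. f (x + (t * r) *\<^sub>R axis i 1)" "\<lambda>_. 0"] by (auto simp: x')
qed

lemma sum_split_two:
  fixes f :: "'n::finite \<Rightarrow> real"
  assumes "iu \<noteq> iv" shows "sum f UNIV = f iu + f iv + sum f (UNIV - {iu, iv})"
proof -
  have "sum f UNIV = sum f (UNIV - {iu, iv}) + sum f {iu, iv}" by (rule sum.subset_diff) auto
  then show ?thesis using assms by simp
qed

context null_kropina
begin

text \<open>If \<open>b = du\<close> and \<open>\<partial>\<^sub>v\<close> is minus the vector
  dual to \<open>b\<close>, then \<open>b\<close> and the row of \<open>a\<close> with index
  \<open>v\<close> are constant, so that of all derivatives only those in direction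
  \<open>v\<close> survive.\<close>

lemma nabla_in_null_frame:
  assumes c: "c \<in> D"
    and B: "\<And>z y. z \<in> img c \<Longrightarrow> B c z \<bullet> y = y $ iu"
    and V: "\<And>z y. z \<in> img c \<Longrightarrow> bform (M c z) (axis iv 1) y = - y $ iu"
    and x: "x \<in> img c"
  shows "nabla D c a b j i x = - pd iv (\<lambda>z. M c z $ i $ j) x / 2"
proof -
  have "raised D c a b x = - axis iv 1"
  proof (rule raised_unique[OF metric_a c x])
    show "bform (M c x) (- axis iv 1) y = B c x \<bullet> y" for y
      using bform_scaleR_left[of "M c x" "-1" "axis iv 1" y] V[OF x] B[OF x] by simp
  qed
  then have X: "X c x $ l = (if l = iv then - 1 else 0)" for l by (simp add: axis_def)
  have Bi: "pd k (\<lambda>z. B c z $ i) x = 0" for k i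
  proof -
    have "B c z $ i = axis i 1 $ iu" if "z \<in> img c" for z using B[OF that, of "axis i 1"] by (simp
        add: inner_axis)
    then have "pd k (\<lambda>z. B c z $ i) x = pd k (\<lambda>z. axis i 1 $ iu) x"
      using pd_cong[OF open_img[OF c] x, of "\<lambda>z. axis i 1 $ iu" "\<lambda>z. B c z $ i" k] by simp
    then show ?thesis by simp
  qed
  have Mi: "pd k (\<lambda>z. M c z $ iv $ i) x = 0" for k i
  proof -
    have "M c z $ iv $ i = - axis i 1 $ iu" if "z \<in> img c" for z using V[OF that, of "axis i 1"] by
        (simp add: bform_axis)
    then have "pd k (\<lambda>z. M c z $ iv $ i) x = pd k (\<lambda>z. - axis i 1 $ iu) x"
      using pd_cong[OF open_img[OF c] x, of "\<lambda>z. - axis i 1 $ iu" "\<lambda>z. M c z $ iv $ i" k] by simp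
    then show ?thesis by simp
  qed
  have "(\<Sum>l\<in>UNIV. X c x $ l * (pd i (\<lambda>z. M c z $ l $ j) x + pd j (\<lambda>z. M c z $ l $ i) x - pd l (\<lambda>z. M
      c z $ i $ j) x)) =
      pd iv (\<lambda>z. M c z $ i $ j) x"
    by (simp add: X Mi if_distrib[of "\<lambda>u. u * _"] cong: if_cong)
  then show ?thesis by (simp add: nabla_eq[OF metric_a c x] Bi)
qed

lemma adapted_coords_entries:
  assumes ad: "adapted_coords D a b iu iv c H W h" and ne: "iu \<noteq> iv" and x: "x \<in> img c"
  defines "T \<equiv> UNIV - {iu, iv}"
  shows "B c x \<bullet> y = y $ iu"
    and "bform (M c x) y z = - 2 * sym_prod iu iv y z + H x * sym_prod iu iu y z
          + (\<Sum>k\<in>T. W k x * sym_prod iu k y z) + (\<Sum>k\<in>T. \<Sum>l\<in>T. h k l x * sym_prod k l y z)"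
    and "bform (M c x) (axis iv 1) y = - y $ iu"
proof -
  have c: "c \<in> D" using ad by (simp add: adapted_coords_def)
  show "B c x \<bullet> y = y $ iu"
    using ad x one_form_tv[OF form_b c x, of y] by (simp add: adapted_coords_def Let_def)
  have form: "bform (M c x) y z = - 2 * sym_prod iu iv y z + H x * sym_prod iu iu y z
          + (\<Sum>k\<in>T. W k x * sym_prod iu k y z) + (\<Sum>k\<in>T. \<Sum>l\<in>T. h k l x * sym_prod k l y z)" for y z
  proof -
    have "\<forall>x\<in>img c. \<forall>y z. a (pt c x) (tv D c x y) (tv D c x z) =
        - 2 * sym_prod iu iv y z + H x * sym_prod iu iu y z
          + (\<Sum>k\<in>T. W k x * sym_prod iu k y z) + (\<Sum>k\<in>T. \<Sum>l\<in>T. h k l x * sym_prod k l y z)"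
      using ad unfolding adapted_coords_def Let_def T_def by (elim conjE)
    from this[rule_format, OF x, of y z] show ?thesis unfolding metric_tv[OF metric_a c x] .
  qed
  then show "bform (M c x) y z = - 2 * sym_prod iu iv y z + H x * sym_prod iu iu y z
          + (\<Sum>k\<in>T. W k x * sym_prod iu k y z) + (\<Sum>k\<in>T. \<Sum>l\<in>T. h k l x * sym_prod k l y z)" .
  have "(\<Sum>k\<in>T. W k x * sym_prod iu k (axis iv 1) y) = 0"
    by (rule sum.neutral) (use ne in \<open>auto simp: T_def sym_prod_def axis_def\<close>)
  moreover have "(\<Sum>k\<in>T. \<Sum>l\<in>T. h k l x * sym_prod k l (axis iv 1) y) = 0"
    by (intro sum.neutral ballI) (auto simp: T_def sym_prod_def axis_def)
  ultimately show "bform (M c x) (axis iv 1) y = - y $ iu"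
    unfolding form using ne by (simp add: sym_prod_def axis_def)
qed

lemma nabla_in_adapted_coords:
  assumes ad: "adapted_coords D a b iu iv c H W h" and ne: "iu \<noteq> iv" and x: "x \<in> img c"
  shows "nabla D c a b j i x = (- pd iv H x / 2) * (B c x $ i * B c x $ j)"
proof -
  define T where "T = UNIV - {iu, iv}"
  have c: "c \<in> D" using ad by (simp add: adapted_coords_def)
  note e = adapted_coords_entries[OF ad ne, folded T_def]
  have Bi: "B c x $ i = axis i 1 $ iu" for i using e(1)[OF x, of "axis i 1"] by (simp add:
      inner_axis)
  define d :: real where "d = axis i 1 $ iu * axis j 1 $ iu"
  define K where "K z = M c z $ i $ j - d * H z" for z
  have "smooth_on (img c) H" using ad by (simp add: adapted_coords_def Let_def)
  then have dH: "H differentiable (at x)" using x by (rule smooth_on_differentiable)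
  have dM: "(\<lambda>z. M c z $ i $ j) differentiable (at x)" by (rule metric_mat_differentiable[OF
      metric_a c x])
  have dHd: "(\<lambda>z. d * H z) differentiable (at x)" by (intro differentiable_mult dH) auto
  have K: "K z = - 2 * sym_prod iu iv (axis i 1) (axis j 1)
      + (\<Sum>k\<in>T. W k z * sym_prod iu k (axis i 1) (axis j 1)) + (\<Sum>k\<in>T. \<Sum>l\<in>T. h k l z * sym_prod k l
          (axis i 1) (axis j 1))"
    if "z \<in> img c" for z
    using e(2)[OF that, of "axis i 1" "axis j 1"]
    by (simp add: K_def bform_axis d_def sym_prod_def[of iu iu])
  have "pd iv K x = 0"
  proof (rule pd_eq_0_of_independent[OF open_img[OF c] x])
    show "K differentiable (at x)" unfolding K_def[abs_def] by (rule differentiable_diff[OF dM dHd])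
    fix z assume z: "z \<in> img c" "\<forall>k. k \<noteq> iv \<longrightarrow> z $ k = x $ k"
    have "\<forall>x\<in>img c. \<forall>x'\<in>img c. (\<forall>k. k \<noteq> iv \<longrightarrow> x $ k = x' $ k) \<longrightarrow>
        (\<forall>k\<in>T. W k x = W k x') \<and> (\<forall>k\<in>T. \<forall>l\<in>T. h k l x = h k l x')"
      using ad unfolding adapted_coords_def Let_def T_def by (elim conjE)
    from mp[OF bspec[OF bspec[OF this z(1)] x] z(2)]
    have "(\<forall>k\<in>T. W k z = W k x) \<and> (\<forall>k\<in>T. \<forall>l\<in>T. h k l z = h k l x)" .
    then show "K z = K x" unfolding K[OF z(1)] K[OF x] by simp
  qed
  then have "pd iv (\<lambda>z. M c z $ i $ j) x = d * pd iv H x"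
    unfolding K_def[abs_def] by (simp add: pd_diff[OF dM dHd] pd_cmult[OF dH])
  then show ?thesis
    using nabla_in_null_frame[OF c e(1) e(3) x, of j i] by (simp add: Bi d_def)
qed

text \<open>By the preceding formula the condition \<open>\<nabla>b = \<kappa> b \<otimes>
  b\<close> says that no component of \<open>a\<close> other than the one with two indices
  \<open>u\<close> depends on \<open>v\<close>. Convexity of the image of the chart turns
  vanishing of derivatives into equality of values. The factor 2 in \<open>W\<close> comes from
  the symmetrized product.\<close>

lemma adapted_coords_of_null_frame:
  assumes c: "c \<in> D" and conv: "convex (img c)" and ne: "iu \<noteq> iv"
    and B: "\<And>z y. z \<in> img c \<Longrightarrow> B c z \<bullet> y = y $ iu"
    and V: "\<And>z y. z \<in> img c \<Longrightarrow> bform (M c z) (axis iv 1) y = - y $ iu"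
    and rec: "\<And>x. x \<in> img c \<Longrightarrow> \<exists>\<kappa>. \<forall>i j. nabla D c a b j i x = \<kappa> * (B c x $ i * B c x $ j)"
  shows "adapted_coords D a b iu iv c (\<lambda>x. M c x $ iu $ iu) (\<lambda>k x. 2 * M c x $ iu $ k) (\<lambda>k l x. M c
      x $ k $ l)"
proof -
  define T where "T = UNIV - {iu, iv}"
  note o = open_img[OF c]
  have Bi: "B c x $ i = axis i 1 $ iu" if "x \<in> img c" for x i using B[OF that, of "axis i 1"] by
      (simp add: inner_axis)
  have Mv: "M c x $ iv $ i = - axis i 1 $ iu" if "x \<in> img c" for x i using V[OF that, of "axis i 1"]
      by (simp add: bform_axis)
  have Mv': "M c x $ i $ iv = - axis i 1 $ iu" if "x \<in> img c" for x i using Mv[OF that] M_sym[OF c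
      that] by metis
  have pd0: "pd iv (\<lambda>z. M c z $ i $ j) x = 0" if "x \<in> img c" "i \<noteq> iu \<or> j \<noteq> iu" for x i j
  proof -
    from rec[OF that(1)] obtain \<kappa> where "\<forall>i j. nabla D c a b j i x = \<kappa> * (B c x $ i * B c x $ j)" by
        blast
    then have "nabla D c a b j i x = \<kappa> * (B c x $ i * B c x $ j)" by blast
    moreover have "B c x $ i * B c x $ j = 0" using that(2) by (auto simp: Bi[OF that(1)] axis_def)
    ultimately show ?thesis using nabla_in_null_frame[OF c B V that(1), of j i] by simp
  qed
  have indep: "M c x $ i $ j = M c x' $ i $ j"
    if "x \<in> img c" "x' \<in> img c" "\<forall>k. k \<noteq> iv \<longrightarrow> x $ k = x' $ k" "i \<noteq> iu \<or> j \<noteq> iu" for x x' i j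
    by (rule independent_of_pd_eq_0[OF conv metric_mat_differentiable[OF metric_a c] pd0[OF _
        that(4)] that(1,2)]) (use that in auto)
  show ?thesis
    unfolding adapted_coords_def Let_def T_def[symmetric]
  proof (intro conjI ballI allI impI)
    show "c \<in> D" by (rule c)
    show "smooth_on (img c) (\<lambda>x. M c x $ iu $ iu)" "smooth_on (img c) (\<lambda>x. M c x $ k $ l)"
      "smooth_on (img c) (\<lambda>x. 2 * M c x $ iu $ k)" for k l
      by (intro smooth_on_mult smooth_on_const smooth_on_metric_mat[OF metric_a c] o)+
  next
    fix x x' k assume "x \<in> img c" "x' \<in> img c" "\<forall>k. k \<noteq> iv \<longrightarrow> x $ k = x' $ k" "k \<in> T"
    then show "2 * M c x $ iu $ k = 2 * M c x' $ iu $ k" using indep[of x x' iu k] by (simp add: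
        T_def)
  next
    fix x x' k l assume "x \<in> img c" "x' \<in> img c" "\<forall>k. k \<noteq> iv \<longrightarrow> x $ k = x' $ k" "k \<in> T" "l \<in> T"
    then show "M c x $ k $ l = M c x' $ k $ l" using indep[of x x' k l] by (simp add: T_def)
  next
    fix x k l assume "x \<in> img c"
    then show "M c x $ k $ l = M c x $ l $ k" by (rule M_sym[OF c])
  next
    fix x and \<xi> :: "'n \<Rightarrow> real" and l
    assume x: "x \<in> img c" and 0: "\<forall>k\<in>T. (\<Sum>l\<in>T. M c x $ k $ l * \<xi> l) = 0" and l: "l \<in> T"
    \<comment> \<open>A null vector of \<open>h\<close>, completed by a suitable \<open>v\<close>-component, is a null vector of \<open>a\<close>.\<close>
    define r where "r = (\<Sum>l\<in>T. M c x $ iu $ l * \<xi> l)"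
    define w :: "real^'n" where "w = (\<chi> i. if i \<in> T then \<xi> i else if i = iv then r else 0)"
    have w: "w $ iu = 0" "w $ iv = r" "\<And>l. l \<in> T \<Longrightarrow> w $ l = \<xi> l" using ne by (auto simp: w_def T_def)
    have "(M c x *v w) $ i = 0" for i
    proof -
      have s: "(M c x *v w) $ i = - axis i 1 $ iu * r + (\<Sum>l\<in>T. M c x $ i $ l * \<xi> l)"
        using sum_split_two[OF ne, of "\<lambda>j. M c x $ i $ j * w $ j"] w Mv'[OF x, of i]
        by (simp add: matrix_vector_mult_def T_def)
      consider "i = iu" | "i = iv" | "i \<in> T" by (auto simp: T_def)
      then show ?thesis
      proof cases
        case 1 then show ?thesis unfolding s by (simp add: r_def)
      next
        case 2
        then have "(\<Sum>l\<in>T. M c x $ i $ l * \<xi> l) = 0"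
          by (intro sum.neutral) (auto simp: Mv[OF x] T_def axis_def)
        then show ?thesis unfolding s using 2 ne by (simp add: axis_def)
      next
        case 3 then show ?thesis unfolding s using 0 by (auto simp: T_def axis_def)
      qed
    qed
    then have "M c x *v w = M c x *v 0" by (simp add: vec_eq_iff)
    then have "w = 0" by (rule injD[OF inj_matrix_vector_mult[OF metric_mat_invertible[OF metric_a c
        x]]])
    then show "\<xi> l = 0" using w(3)[OF l] by simp
  next
    fix x y z assume x: "x \<in> img c"
    have row: "(\<Sum>j\<in>UNIV. M c x $ i $ j * y $ i * z $ j) =
        M c x $ i $ iu * y $ i * z $ iu + M c x $ i $ iv * y $ i * z $ iv + (\<Sum>l\<in>T. M c x $ i $ l * y
            $ i * z $ l)" for i
      using sum_split_two[OF ne, of "\<lambda>j. M c x $ i $ j * y $ i * z $ j"] by (simp add: T_def)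
    have ivrow: "(\<Sum>j\<in>UNIV. M c x $ iv $ j * y $ iv * z $ j) = - (y $ iv * z $ iu)"
    proof -
      have "(\<Sum>l\<in>T. M c x $ iv $ l * y $ iv * z $ l) = 0"
        by (intro sum.neutral) (auto simp: Mv[OF x] T_def axis_def)
      then show ?thesis unfolding row using ne by (simp add: Mv[OF x] axis_def)
    qed
    have iurow: "(\<Sum>j\<in>UNIV. M c x $ iu $ j * y $ iu * z $ j) =
        M c x $ iu $ iu * y $ iu * z $ iu - y $ iu * z $ iv + (\<Sum>l\<in>T. M c x $ iu $ l * y $ iu * z $
            l)"
      unfolding row by (simp add: Mv'[OF x])
    have Trow: "(\<Sum>k\<in>T. \<Sum>j\<in>UNIV. M c x $ k $ j * y $ k * z $ j) =
        (\<Sum>k\<in>T. M c x $ iu $ k * y $ k * z $ iu) + (\<Sum>k\<in>T. \<Sum>l\<in>T. M c x $ k $ l * y $ k * z $ l)"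
    proof -
      have "(\<Sum>j\<in>UNIV. M c x $ k $ j * y $ k * z $ j) = M c x $ iu $ k * y $ k * z $ iu + (\<Sum>l\<in>T. M c
          x $ k $ l * y $ k * z $ l)"
        if "k \<in> T" for k
        unfolding row using that M_sym[OF c x, of k iu] by (auto simp: Mv'[OF x] T_def axis_def)
      then show ?thesis by (simp add: sum.distrib)
    qed
    have 1: "bform (M c x) y z = M c x $ iu $ iu * y $ iu * z $ iu - y $ iu * z $ iv - y $ iv * z $
        iu
        + (\<Sum>l\<in>T. M c x $ iu $ l * y $ iu * z $ l) + (\<Sum>k\<in>T. M c x $ iu $ k * y $ k * z $ iu)
        + (\<Sum>k\<in>T. \<Sum>l\<in>T. M c x $ k $ l * y $ k * z $ l)"
      using sum_split_two[OF ne, of "\<lambda>i. \<Sum>j\<in>UNIV. M c x $ i $ j * y $ i * z $ j"] iurow ivrow Trow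
      by (simp add: bform_def T_def)
    have sw: "(\<Sum>k\<in>T. \<Sum>l\<in>T. M c x $ k $ l * y $ l * z $ k) = (\<Sum>k\<in>T. \<Sum>l\<in>T. M c x $ k $ l * y $ k * z $
        l)"
      by (subst sum.swap) (simp add: M_sym[OF c x])
    have 2: "(\<Sum>k\<in>T. \<Sum>l\<in>T. M c x $ k $ l * sym_prod k l y z) = (\<Sum>k\<in>T. \<Sum>l\<in>T. M c x $ k $ l * y $ k * z
        $ l)"
    proof -
      have "(\<Sum>k\<in>T. \<Sum>l\<in>T. M c x $ k $ l * sym_prod k l y z) =
          ((\<Sum>k\<in>T. \<Sum>l\<in>T. M c x $ k $ l * y $ k * z $ l) + (\<Sum>k\<in>T. \<Sum>l\<in>T. M c x $ k $ l * y $ l * z $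
              k)) / 2"
        by (simp add: sym_prod_def distrib_left sum.distrib sum_divide_distrib add_divide_distrib
            mult.assoc)
      then show ?thesis unfolding sw by simp
    qed
    have 3: "(\<Sum>k\<in>T. 2 * M c x $ iu $ k * sym_prod iu k y z) =
        (\<Sum>l\<in>T. M c x $ iu $ l * y $ iu * z $ l) + (\<Sum>k\<in>T. M c x $ iu $ k * y $ k * z $ iu)"
      by (simp add: sym_prod_def distrib_left sum.distrib mult.assoc)
    show "a (pt c x) (tv D c x y) (tv D c x z) =
          - 2 * sym_prod iu iv y z + M c x $ iu $ iu * sym_prod iu iu y z
          + (\<Sum>k\<in>T. 2 * M c x $ iu $ k * sym_prod iu k y z)
          + (\<Sum>k\<in>T. \<Sum>l\<in>T. M c x $ k $ l * sym_prod k l y z)"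
      unfolding metric_tv[OF metric_a c x] 1 2 3 by (simp add: sym_prod_def algebra_simps)
  next
    fix x y assume x: "x \<in> img c"
    show "b (pt c x) (tv D c x y) = y $ iu" using one_form_tv[OF form_b c x] B[OF x] by simp
  qed
qed

text \<open>The level sets of a potential \<open>u\<close> of \<open>b\<close> are invariant
  under the flow of the dual vector field, since \<open>b\<close> is null. Take a hypersurface
  transversal to the field that is parametrized by \<open>u\<close> and further functions, and let
  the flow time of minus the dual field be \<open>v\<close>.\<close>

lemma null_flow_parametrization:
  fixes iu iv :: 'n
  assumes c: "c \<in> D" and x0: "x0 \<in> img c" and ne: "iu \<noteq> iv"
  obtains \<Phi> Z where "open Z" "0 \<in> Z" "smooth_on Z \<Phi>" "\<Phi> 0 = x0" "\<Phi> ` Z \<subseteq> img c"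
    "inj (frechet_derivative \<Phi> (at 0))"
    "\<And>z y. z \<in> Z \<Longrightarrow> B c (\<Phi> z) \<bullet> frechet_derivative \<Phi> (at z) y = y $ iu"
    "\<And>z. z \<in> Z \<Longrightarrow> frechet_derivative \<Phi> (at z) (axis iv 1) = - X c (\<Phi> z)"
proof -
  let ?e = "axis iv (1::real)"
  obtain R where R: "R > 0" "ball x0 R \<subseteq> img c" using open_img[OF c] x0 open_contains_ball by blast
  have sB: "smooth_on (ball x0 R) (B c)" by (rule smooth_on_subset[OF smooth_on_covec[OF form_b c]
      R(2)])
  have cl: "pd i (\<lambda>z. B c z $ j) x = pd j (\<lambda>z. B c z $ i) x" if "x \<in> ball x0 R" for x i j
    using closed c R(2) that by (auto simp: closed_form_def)
  obtain u where u: "smooth_on (ball x0 (R / 2)) u" "u x0 = 0"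
      "\<And>x v. x \<in> ball x0 (R / 2) \<Longrightarrow> frechet_derivative u (at x) v = B c x \<bullet> v"
    using closed_form_potential[OF R(1) sB cl] by blast
  let ?S = "ball x0 (R / 2)"
  have S: "?S \<subseteq> img c" "x0 \<in> ?S" using R by auto
  define Y where "Y x = - X c x" for x
  have sY: "smooth_on ?S Y"
    unfolding Y_def[abs_def] by (intro smooth_on_uminus open_ball smooth_on_subset[OF
        smooth_on_raised[OF metric_a form_b c] S(1)])
  have BY: "B c x \<bullet> Y x = 0" if "x \<in> ?S" for x using B_X[OF c, of x] S(1) that by (auto simp: Y_def)
  have Du: "(u has_derivative (\<lambda>v. B c x \<bullet> v)) (at x)" if "x \<in> ?S" for x
  proof -
    have "frechet_derivative u (at x) = (\<lambda>v. B c x \<bullet> v)" using u(3)[OF that] by (rule ext)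
    then show ?thesis using smooth_on_has_derivative[OF u(1) that] by simp
  qed
  obtain T r :: real and \<phi> where T: "T > 0" and r: "r > 0" "ball x0 r \<subseteq> ?S"
      and s\<phi>: "smooth_on ({-T<..<T} \<times> ball x0 r) \<phi>" and \<phi>S: "\<And>p. p \<in> {-T<..<T} \<times> ball x0 r \<Longrightarrow> \<phi> p \<in>
          ?S"
      and \<phi>0: "\<And>x. x \<in> ball x0 r \<Longrightarrow> \<phi> (0, x) = x"
      and ode: "\<And>p. p \<in> {-T<..<T} \<times> ball x0 r \<Longrightarrow> frechet_derivative \<phi> (at p) (1, 0) = Y (\<phi> p)"
    using smooth_local_flow[OF open_ball S(2) sY] by metis
  have x0r: "x0 \<in> ball x0 r" using r by simp
  have D\<phi>: "(\<phi> has_derivative frechet_derivative \<phi> (at p)) (at p)" if "p \<in> {-T<..<T} \<times> ball x0 r"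
      for p
    by (rule smooth_on_has_derivative[OF s\<phi> that])
  have u\<phi>: "u (\<phi> (t, y)) = u y" if t: "t \<in> {-T<..<T}" and y: "y \<in> ball x0 r" for t y
  proof -
    have "\<exists>k. \<forall>t\<in>{-T<..<T}. u (\<phi> (t, y)) = k"
    proof (rule has_derivative_zero_constant[of "{-T<..<T}"])
      fix s assume "s \<in> {-T<..<T}"
      then have p: "(s, y) \<in> {-T<..<T} \<times> ball x0 r" using y by simp
      have "((\<lambda>t. (t, y)) has_derivative (\<lambda>t. (t, 0))) (at s)"
        by (intro has_derivative_Pair has_derivative_const has_derivative_ident)
      from has_derivative_compose[OF has_derivative_compose[OF this D\<phi>[OF p]] Du[OF \<phi>S[OF p]]]
      have 1: "((\<lambda>t. u (\<phi> (t, y))) has_derivative (\<lambda>t. B c (\<phi> (s, y)) \<bullet> frechet_derivative \<phi> (at (s,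
          y)) (t, 0))) (at s)" .
      have 2: "B c (\<phi> (s, y)) \<bullet> frechet_derivative \<phi> (at (s, y)) (t, 0) = 0" for t
        using linear_cmul[OF has_derivative_linear[OF D\<phi>[OF p]], of t "(1, 0)"] ode[OF p] BY[OF
            \<phi>S[OF p]] by simp
      show "((\<lambda>t. u (\<phi> (t, y))) has_derivative (\<lambda>h. 0)) (at s within {-T<..<T})"
        by (rule has_derivative_at_withinI[OF 1[unfolded 2]])
    qed simp
    then have "u (\<phi> (t, y)) = u (\<phi> (0, y))" using t T by force
    then show ?thesis by (simp add: \<phi>0[OF y])
  qed
  have Y0: "Y x0 \<noteq> 0" using X_nonzero[OF c x0] by (simp add: Y_def)
  obtain Lf :: "real^'n \<Rightarrow> real^'n" where Lf: "linear Lf" "inj Lf" "\<And>y. Lf y $ iu = B c x0 \<bullet> y" "Lf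
      (Y x0) = ?e"
    using adapted_linear_frame[OF B_nonzero[OF c x0] Y0 BY[OF S(2)] ne] by blast
  \<comment> \<open>The linear frame, with its first component corrected to be \<open>u\<close>; the correction vanishes to
      first order.\<close>
  define \<theta> where "\<theta> x = Lf (x - x0) + (u x - B c x0 \<bullet> (x - x0)) *\<^sub>R axis iu 1" for x
  have s\<theta>: "smooth_on (ball x0 r) \<theta>"
  proof -
    have "smooth_on (ball x0 r) (\<lambda>x. Lf (x - x0))"
      by (rule smooth_on_compose[OF open_ball open_UNIV _ smooth_on_linear[OF Lf(1)]])
         (auto intro!: smooth_on_diff smooth_on_ident smooth_on_const)
    then show ?thesis
      unfolding \<theta>_def[abs_def]
      by (intro smooth_on_add smooth_on_scaleR smooth_on_diff smooth_on_inner_vec smooth_on_const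
          smooth_on_ident
          smooth_on_subset[OF u(1) r(2)] open_ball)
  qed
  have D\<theta>: "(\<theta> has_derivative Lf) (at x0)"
  proof -
    have "((\<lambda>x. Lf (x - x0)) has_derivative (\<lambda>v. Lf v)) (at x0)"
      by (rule has_derivative_compose[where f = "\<lambda>x. x - x0" and g = Lf,
            OF _ linear_imp_has_derivative[OF Lf(1)]]) (auto intro!: derivative_eq_intros)
    then have "(\<theta> has_derivative (\<lambda>v. Lf v + (B c x0 \<bullet> v - B c x0 \<bullet> v) *\<^sub>R axis iu 1)) (at x0)"
      unfolding \<theta>_def[abs_def]
      by (intro has_derivative_add has_derivative_scaleR_left has_derivative_diff Du[OF S(2)])
         (auto intro!: derivative_eq_intros)
    then show ?thesis by simp
  qed
  have \<theta>0: "\<theta> x0 = 0" using linear_0[OF Lf(1)] by (simp add: \<theta>_def u)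
  have \<theta>u: "\<theta> x $ iu = u x" for x using Lf(3) by (simp add: \<theta>_def)
  have "inj (frechet_derivative \<theta> (at x0))" using frechet_derivative_at[OF D\<theta>] Lf(2) by simp
  from smooth_inverse_function[OF open_ball x0r s\<theta> this]
  obtain U1 V1 \<sigma> where U1: "open U1" "U1 \<subseteq> ball x0 r" "x0 \<in> U1" and V1: "open V1"
      and hom: "homeomorphism U1 V1 \<theta> \<sigma>" and s\<sigma>: "smooth_on V1 \<sigma>" by metis
  have \<sigma>U: "\<sigma> w \<in> U1" "\<theta> (\<sigma> w) = w" if "w \<in> V1" for w using hom that by (auto simp:
      homeomorphism_def)
  have V10: "0 \<in> V1" and \<sigma>0: "\<sigma> 0 = x0" using hom U1(3) \<theta>0 by (force simp: homeomorphism_def)+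
  have D\<sigma>: "(\<sigma> has_derivative frechet_derivative \<sigma> (at w)) (at w)" if "w \<in> V1" for w
    by (rule smooth_on_has_derivative[OF s\<sigma> that])
  have LD\<sigma>: "Lf (frechet_derivative \<sigma> (at 0) v) = v" for v
  proof -
    have "((\<lambda>w. \<theta> (\<sigma> w)) has_derivative (\<lambda>v. Lf (frechet_derivative \<sigma> (at 0) v))) (at 0)"
      by (rule has_derivative_compose[OF D\<sigma>[OF V10]]) (use D\<theta> \<sigma>0 in simp)
    moreover have "((\<lambda>w. \<theta> (\<sigma> w)) has_derivative (\<lambda>v. v)) (at 0)"
      by (rule has_derivative_transform_within_open[OF has_derivative_ident V1 V10]) (simp add: \<sigma>U)
    ultimately have "(\<lambda>v. Lf (frechet_derivative \<sigma> (at 0) v)) = (\<lambda>v. v)" by (rule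
        has_derivative_unique)
    then show ?thesis by metis
  qed
  \<comment> \<open>Projection to the parameters of the hypersurface: its points have \<open>v = 0\<close>.\<close>
  define proj where "proj z = z - z $ iv *\<^sub>R ?e" for z :: "real^'n"
  have linear_proj: "linear proj" by (rule linearI) (simp_all add: proj_def algebra_simps)
  have proj_simps: "proj 0 = 0" "proj ?e = 0" "proj z $ iu = z $ iu" for z
    using ne by (simp_all add: proj_def axis_def vec_eq_iff)
  define Z where "Z = {z. proj z \<in> V1} \<inter> {z. z $ iv \<in> {-T<..<T}}"
  have oZ: "open Z"
  proof -
    have "open (proj -` V1)"
      by (rule open_vimage[OF V1 smooth_on_continuous_on[OF smooth_on_linear[OF linear_proj]]])
    moreover have "open ((\<lambda>z::real^'n. z $ iv) -` {-T<..<T})" by (intro open_vimage) (auto intro!: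
        continuous_intros)
    moreover have "Z = proj -` V1 \<inter> (\<lambda>z. z $ iv) -` {-T<..<T}" by (auto simp: Z_def)
    ultimately show ?thesis by auto
  qed
  have Z0: "0 \<in> Z" using V10 T by (simp add: Z_def proj_simps)
  define \<Phi> where "\<Phi> z = \<phi> (z $ iv, \<sigma> (proj z))" for z
  have inslab: "(z $ iv, \<sigma> (proj z)) \<in> {-T<..<T} \<times> ball x0 r" if "z \<in> Z" for z
  proof -
    have "\<sigma> (proj z) \<in> ball x0 r" using that \<sigma>U(1) U1(2) by (auto simp: Z_def simp del: mem_ball)
    then show ?thesis using that by (simp add: Z_def del: mem_ball)
  qed
  have s\<Phi>: "smooth_on Z \<Phi>"
    unfolding \<Phi>_def[abs_def]
  proof (rule smooth_on_compose[OF oZ _ _ s\<phi>])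
    have "smooth_on Z (\<lambda>z. \<sigma> (proj z))"
      by (rule smooth_on_compose[OF oZ V1 smooth_on_linear[OF linear_proj] s\<sigma>]) (auto simp: Z_def)
    then show "smooth_on Z (\<lambda>z. (z $ iv, \<sigma> (proj z)))"
      by (intro smooth_on_Pair oZ smooth_on_nth smooth_on_ident)
    show "(\<lambda>z. (z $ iv, \<sigma> (proj z))) ` Z \<subseteq> {-T<..<T} \<times> ball x0 r" using inslab by blast
  qed (auto intro: open_Times)
  have D\<Phi>: "(\<Phi> has_derivative (\<lambda>v. frechet_derivative \<phi> (at (z $ iv, \<sigma> (proj z))) (v $ iv,
      frechet_derivative \<sigma> (at (proj z)) (proj v)))) (at z)"
    if z: "z \<in> Z" for z
  proof -
    have w: "proj z \<in> V1" using z by (simp add: Z_def)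
    have "((\<lambda>z. \<sigma> (proj z)) has_derivative (\<lambda>v. frechet_derivative \<sigma> (at (proj z)) (proj v))) (at
        z)"
      by (rule has_derivative_compose[OF linear_imp_has_derivative[OF linear_proj] D\<sigma>[OF w]])
    then have "((\<lambda>z. (z $ iv, \<sigma> (proj z))) has_derivative (\<lambda>v. (v $ iv, frechet_derivative \<sigma> (at
        (proj z)) (proj v)))) (at z)"
      by (intro has_derivative_Pair bounded_linear_imp_has_derivative bounded_linear_vec_nth)
    from has_derivative_compose[OF this D\<phi>[OF inslab[OF z]]] show ?thesis unfolding \<Phi>_def[abs_def] .
  qed
  have FD\<Phi>: "frechet_derivative \<Phi> (at z) v = frechet_derivative \<phi> (at (z $ iv, \<sigma> (proj z))) (v $ iv,
      frechet_derivative \<sigma> (at (proj z)) (proj v))"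
    if "z \<in> Z" for z v
    using frechet_derivative_at[OF D\<Phi>[OF that], symmetric] by simp
  have \<Phi>S: "\<Phi> z \<in> ?S" if "z \<in> Z" for z unfolding \<Phi>_def by (rule \<phi>S[OF inslab[OF that]])
  have flow: "frechet_derivative \<Phi> (at z) ?e = Y (\<Phi> z)" if z: "z \<in> Z" for z
  proof -
    have "proj z \<in> V1" using z by (simp add: Z_def)
    then have "frechet_derivative \<sigma> (at (proj z)) 0 = 0" using linear_0[OF has_derivative_linear[OF
        D\<sigma>]] by blast
    then show ?thesis
      unfolding FD\<Phi>[OF z] proj_simps using ode[OF inslab[OF z]] by (simp add: \<Phi>_def)
  qed
  have u\<Phi>: "u (\<Phi> z) = z $ iu" if z: "z \<in> Z" for z
  proof -
    have "u (\<Phi> z) = u (\<sigma> (proj z))" unfolding \<Phi>_def using inslab[OF z] by (intro u\<phi>) auto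
    also have "\<dots> = proj z $ iu" using \<theta>u[of "\<sigma> (proj z)"] \<sigma>U(2)[of "proj z"] z by (simp add: Z_def)
    finally show ?thesis by (simp add: proj_simps)
  qed
  have frame: "B c (\<Phi> z) \<bullet> frechet_derivative \<Phi> (at z) y = y $ iu" if z: "z \<in> Z" for z y
  proof -
    have "((\<lambda>z. u (\<Phi> z)) has_derivative (\<lambda>y. B c (\<Phi> z) \<bullet> frechet_derivative \<Phi> (at z) y)) (at z)"
      by (rule has_derivative_compose[OF smooth_on_has_derivative[OF s\<Phi> z] Du[OF \<Phi>S[OF z]]])
    moreover have "((\<lambda>z. u (\<Phi> z)) has_derivative (\<lambda>y. y $ iu)) (at z)"
      by (rule has_derivative_transform_within_open[OF bounded_linear_imp_has_derivative[OF
          bounded_linear_vec_nth] oZ z])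
         (simp add: u\<Phi>)
    ultimately have "(\<lambda>y. B c (\<Phi> z) \<bullet> frechet_derivative \<Phi> (at z) y) = (\<lambda>y. y $ iu)" by (rule
        has_derivative_unique)
    then show ?thesis by metis
  qed
  have \<Phi>0: "\<Phi> 0 = x0" by (simp add: \<Phi>_def proj_simps \<sigma>0 \<phi>0[OF x0r])
  have "Lf (frechet_derivative \<Phi> (at 0) v) = v" for v
  proof -
    have p: "(0, x0) \<in> {-T<..<T} \<times> ball x0 r" using T x0r by simp
    note lin = has_derivative_linear[OF D\<phi>[OF p]]
    have "((\<lambda>x. (0::real, x)) has_derivative (\<lambda>w. (0, w))) (at x0)"
      by (intro has_derivative_Pair has_derivative_const has_derivative_ident)
    from has_derivative_compose[OF this D\<phi>[OF p]]
    have "((\<lambda>x. \<phi> (0, x)) has_derivative (\<lambda>w. frechet_derivative \<phi> (at (0, x0)) (0, w))) (at x0)" .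
    moreover have "((\<lambda>x. \<phi> (0, x)) has_derivative (\<lambda>w. w)) (at x0)"
      by (rule has_derivative_transform_within_open[OF has_derivative_ident open_ball x0r]) (simp
          add: \<phi>0)
    ultimately have "(\<lambda>w. frechet_derivative \<phi> (at (0, x0)) (0, w)) = (\<lambda>w. w)" by (rule
        has_derivative_unique)
    then have sp: "frechet_derivative \<phi> (at (0, x0)) (0, w) = w" for w by metis
    have "frechet_derivative \<phi> (at (0, x0)) (q, w) = q *\<^sub>R Y x0 + w" for q w
      using linear_add[OF lin, of "q *\<^sub>R (1, 0)" "(0, w)"] linear_cmul[OF lin, of q "(1, 0)"] ode[OF
          p] sp \<phi>0[OF x0r] by simp
    then have "frechet_derivative \<Phi> (at 0) v = v $ iv *\<^sub>R Y x0 + frechet_derivative \<sigma> (at 0) (proj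
        v)"
      unfolding FD\<Phi>[OF Z0] by (simp add: proj_simps \<sigma>0)
    then have "Lf (frechet_derivative \<Phi> (at 0) v) = v $ iv *\<^sub>R ?e + proj v"
      by (simp add: linear_add[OF Lf(1)] linear_cmul[OF Lf(1)] Lf(4) LD\<sigma>)
    then show ?thesis by (simp add: proj_def)
  qed
  then have "inj (frechet_derivative \<Phi> (at 0))" by (metis injI)
  moreover have "\<Phi> ` Z \<subseteq> img c" using \<Phi>S S(1) by blast
  ultimately show ?thesis using that[OF oZ Z0 s\<Phi> \<Phi>0] frame flow by (simp add: Y_def)
qed

lemma ex_null_frame:
  fixes iu iv :: 'n
  assumes ne: "iu \<noteq> iv"
  obtains c where "c \<in> D" "p \<in> dom_of c" "convex (img c)"
    "\<And>z y. z \<in> img c \<Longrightarrow> B c z \<bullet> y = y $ iu"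
    "\<And>z y. z \<in> img c \<Longrightarrow> bform (M c z) (axis iv 1) y = - y $ iu"
proof -
  obtain c where c: "c \<in> D" "p \<in> dom_of c" using ex_chart by blast
  define x0 where "x0 = coords c p"
  have x0: "x0 \<in> img c" "pt c x0 = p" using pt_coords[OF c] by (simp_all add: x0_def)
  obtain \<Phi> Z where Z: "open Z" "0 \<in> Z" and s\<Phi>: "smooth_on Z \<Phi>" and \<Phi>0: "\<Phi> 0 = x0" and \<Phi>Z: "\<Phi> ` Z \<subseteq>
      img c"
      and inj: "inj (frechet_derivative \<Phi> (at 0))"
      and frame: "\<And>z y. z \<in> Z \<Longrightarrow> B c (\<Phi> z) \<bullet> frechet_derivative \<Phi> (at z) y = y $ iu"
      and flow: "\<And>z. z \<in> Z \<Longrightarrow> frechet_derivative \<Phi> (at z) (axis iv 1) = - X c (\<Phi> z)"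
    using null_flow_parametrization[OF c(1) x0(1) ne] by metis
  obtain U2 V2 g where U2: "open U2" "U2 \<subseteq> Z" "0 \<in> U2" and V2: "open V2"
      and hom: "homeomorphism U2 V2 \<Phi> g" and sg: "smooth_on V2 g"
    using smooth_inverse_function[OF Z s\<Phi> inj] by metis
  obtain e where e: "e > 0" "ball 0 e \<subseteq> U2" using U2(1,3) open_contains_ball by blast
  let ?V = "ball (0::real^'n) e" and ?U = "\<Phi> ` ball 0 e"
  have VZ: "?V \<subseteq> Z" using e(2) U2(2) by blast
  have UV: "?U \<subseteq> V2" using hom e(2) by (auto simp: homeomorphism_def)
  have homV: "homeomorphism ?V ?U \<Phi> g" by (rule homeomorphism_of_subsets[OF hom e(2) UV refl])
  have oU: "open ?U"
  proof -
    have "?U = V2 \<inter> g -` ?V"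
    proof
      show "?U \<subseteq> V2 \<inter> g -` ?V" using UV homV by (auto simp: homeomorphism_def)
      show "V2 \<inter> g -` ?V \<subseteq> ?U"
      proof
        fix w assume "w \<in> V2 \<inter> g -` ?V"
        then have "g w \<in> ?V" "w = \<Phi> (g w)" using hom by (auto simp: homeomorphism_def)
        then show "w \<in> ?U" by blast
      qed
    qed
    then show ?thesis
      using continuous_open_preimage[OF smooth_on_continuous_on[OF sg] V2 open_ball] by simp
  qed
  have Uc: "?U \<subseteq> img c" using \<Phi>Z VZ by blast
  define c' where "c' = (pt c ` ?U, g \<circ> coords c)"
  note ch = chart_from_parametrization[OF c(1) homV open_ball oU Uc smooth_on_subset[OF s\<Phi> VZ]
      smooth_on_subset[OF sg UV], folded c'_def]
  have p': "p \<in> dom_of c'"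
  proof -
    have "\<Phi> 0 \<in> ?U" using e(1) by auto
    then show ?thesis using x0(2) \<Phi>0 unfolding c'_def by auto
  qed
  have ov: "z \<in> overlap c' c" if "z \<in> ?V" for z
    using that ch(2,3,4) by (auto simp: overlap_def)
  have tr: "transition c' c z = \<Phi> z" if "z \<in> ?V" for z
  proof -
    have "\<Phi> z \<in> img c" using Uc that by blast
    then show ?thesis using coords_pt(1)[OF c(1)] ch(3)[OF that] by (simp add: transition_def)
  qed
  have jac: "jacobian_map c' c z = frechet_derivative \<Phi> (at z)" if "z \<in> ?V" for z
    by (rule frechet_derivative_cong_open[OF open_ball that tr])
  have B': "B c' z \<bullet> y = y $ iu" if "z \<in> img c'" for z y
  proof -
    have z: "z \<in> ?V" using that ch(2) by simp
    have "B c' z \<bullet> y = B c (\<Phi> z) \<bullet> frechet_derivative \<Phi> (at z) y"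
      using covec_transition[OF form_b ch(1) c(1) ov[OF z], of y] by (simp add: tr[OF z] jac[OF z])
    then show ?thesis using frame[of z y] VZ z by auto
  qed
  moreover have "bform (M c' z) (axis iv 1) y = - y $ iu" if "z \<in> img c'" for z y
  proof -
    have z: "z \<in> ?V" using that ch(2) by simp
    then have zZ: "z \<in> Z" and \<Phi>z: "\<Phi> z \<in> img c" using VZ Uc by auto
    have "bform (M c' z) (axis iv 1) y = bform (M c (\<Phi> z)) (- X c (\<Phi> z)) (frechet_derivative \<Phi> (at
        z) y)"
      using metric_transition[OF metric_a ch(1) c(1) ov[OF z], of "axis iv 1" y] flow[OF zZ] by
          (simp add: tr[OF z] jac[OF z])
    also have "\<dots> = - (B c (\<Phi> z) \<bullet> frechet_derivative \<Phi> (at z) y)"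
      using bform_scaleR_left[of "M c (\<Phi> z)" "-1" "X c (\<Phi> z)"] bform_X[OF c(1) \<Phi>z] by simp
    finally show ?thesis using frame[OF zZ, of y] by simp
  qed
  moreover have "convex (img c')" using ch(2) by simp
  ultimately show ?thesis using that ch(1) p' by blast
qed

lemma berwald_iff_adapted_coords:
  assumes ne: "iu \<noteq> iv"
  shows "berwald D A F \<longleftrightarrow> (\<forall>p. \<exists>c H W h. p \<in> dom_of c \<and> adapted_coords D a b iu iv c H W h)"
proof
  assume ber: "berwald D A F"
  show "\<forall>p. \<exists>c H W h. p \<in> dom_of c \<and> adapted_coords D a b iu iv c H W h"
  proof
    fix p
    obtain c where c: "c \<in> D" "p \<in> dom_of c" "convex (img c)"
      and fr: "\<And>z y. z \<in> img c \<Longrightarrow> B c z \<bullet> y = y $ iu" "\<And>z y. z \<in> img c \<Longrightarrow> bform (M c z) (axis iv 1) y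
          = - y $ iu"
      using ex_null_frame[OF ne, of p] by metis
    have "adapted_coords D a b iu iv c (\<lambda>x. M c x $ iu $ iu) (\<lambda>k x. 2 * M c x $ iu $ k) (\<lambda>k l x. M c
        x $ k $ l)"
      by (rule adapted_coords_of_null_frame[OF c(1,3) ne fr]) (use ber berwald_iff_nabla_recurrent
          c(1) in blast)+
    then show "\<exists>c H W h. p \<in> dom_of c \<and> adapted_coords D a b iu iv c H W h" using c(2) by blast
  qed
next
  assume ad: "\<forall>p. \<exists>c H W h. p \<in> dom_of c \<and> adapted_coords D a b iu iv c H W h"
  show "berwald D A F"
    unfolding berwald_iff_nabla_recurrent
  proof (intro ballI)
    fix d x assume d: "d \<in> D" and x: "x \<in> img d"
    obtain c H W h where c: "pt d x \<in> dom_of c" and adc: "adapted_coords D a b iu iv c H W h" using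
        ad by blast
    have cD: "c \<in> D" using adc by (simp add: adapted_coords_def)
    have o: "x \<in> overlap d c" using x c by (simp add: overlap_def)
    from nabla_recurrent_transition[OF metric_a form_b d cD o nabla_in_adapted_coords[OF adc ne
        transition_in(3)[OF d cD o]]]
    show "\<exists>\<kappa>. \<forall>i j. nabla D d a b j i x = \<kappa> * (B d x $ i * B d x $ j)" by blast
  qed
qed

text \<open>The term with \<open>b^2\<close> vanishes, and \<open>(1 - m) c\<close> is the
  factor found in the adapted chart, which is a scalar and hence the same in every chart.\<close>

lemma berwald_condition_in_adapted_coords:
  assumes ne: "iu \<noteq> iv" and ad: "adapted_coords D a b iu iv c H W h"
  shows "berwald_condition D a b m (dom_of c) (\<lambda>q. - pd iv H (coords c q) / (2 * (1 - m)))"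
  unfolding berwald_condition_def Let_def
proof (intro ballI allI)
  fix d q i j assume d: "d \<in> D" and q: "q \<in> dom_of c \<inter> dom_of d"
  have c: "c \<in> D" using ad by (simp add: adapted_coords_def)
  let ?x = "coords d q"
  have x: "?x \<in> img d" "pt d ?x = q" using pt_coords[OF d] q by auto
  have o: "?x \<in> overlap d c" using x q by (simp add: overlap_def)
  have tr: "transition d c ?x = coords c q" using x by (simp add: transition_def)
  have "nabla D d a b j i ?x = (- pd iv H (coords c q) / 2) * (B d ?x $ i * B d ?x $ j)"
    using nabla_recurrent_transition[OF metric_a form_b d c o nabla_in_adapted_coords[OF ad ne
        transition_in(3)[OF d c o]]]
    unfolding tr .
  moreover have "norm_sq D d a b ?x = 0" using null d x(1) by (simp add: null_form_def)
  moreover have "1 - m \<noteq> 0" using m_not_1 by simp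
  ultimately show "nabla D d a b j i ?x = - pd iv H (coords c q) / (2 * (1 - m)) *
      (m * norm_sq D d a b ?x * M d ?x $ i $ j + (1 - m) * B d ?x $ i * B d ?x $ j)"
    by (simp add: field_simps)
qed

end

theorem lemma2:
  fixes D :: "('p::{t2_space, second_countable_topology}, 'n::finite) chart set"
    and a :: "'p \<Rightarrow> ('p, 'n) tvec \<Rightarrow> ('p, 'n) tvec \<Rightarrow> real"
    and b :: "'p \<Rightarrow> ('p, 'n) tvec \<Rightarrow> real"
    and A :: "('p \<times> ('p, 'n) tvec) set"
    and F :: "'p \<Rightarrow> ('p, 'n) tvec \<Rightarrow> real"
    and m :: real
    and iu iv :: 'n
  assumes "smooth_structure D"
    and "CARD('n) > 2"
    and "pseudo_riemannian D a"
    and "one_form D b"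
    and "nowhere_vanishing D b"
    and "closed_form D b"
    and "null_form D a b"
    and "m \<noteq> 0"
    and "kropina_space D A F a b m"
    and "iu \<noteq> iv"
  shows "(berwald D A F \<longleftrightarrow>
            (\<forall>p. \<exists>c H W h. p \<in> dom_of c \<and> adapted_coords D a b iu iv c H W h)) \<and>
         (berwald D A F \<longrightarrow>
            (\<forall>c H W h. adapted_coords D a b iu iv c H W h \<longrightarrow>
               berwald_condition D a b m (dom_of c)
                 (\<lambda>q. - pd iv H (coords c q) / (2 * (1 - m)))))"
proof -
  interpret null_kropina D a b A F m
    by unfold_locales (use assms in auto)
  show ?thesis
    using berwald_iff_adapted_coords[OF assms(10)] berwald_condition_in_adapted_coords[OF assms(10)]
        by blast
qed

end
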